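(* Let $\sigma_\ell,g_\ell$ ($\ell\in L$) satisfy the structural assumption stated in the context, and let $u_h,\{q_{h,\ell}\}_{\ell\in L}$ be the LDG approximation defined in the context, with maximal existence time $\tau_{\max}$. Then for any $K\in\mathcal{T}_h$ and $t\in[0,\tau_{\max})$, $$2\sum_{\ell\in L}\int_0^tb_K\bigl(u_h(s),q_{h,\ell}(s),u_h(s)\bigr)ds+\int_K\langle u_h(\cdot),u_h(\cdot)\rangle_t\,dx=\sum_{\ell\in L}\sum_{e\subset\partial K}\int_0^t\int_e(\sigma_\ell\cdot n_e)\Bigl(u_h\widetilde{\mathcal{F}}^e_{g_\ell'(u)q_\ell}+q_{h,\ell}\widetilde{\mathcal{F}}^e_{g_\ell(u)}-g_\ell(u_h)q_{h,\ell}\Bigr)d\mathcal{H}^{d-1}(x)\,ds,$$ where $\langle\cdot,\cdot\rangle_t$ is the quadratic covariation (pointwise in $x$), traces of $u_h,q_{h,\ell}$ on $e\subset\partial K$ outside the fluxes are taken from inside $K$, and $\widetilde{\mathcal{F}}^e$ denotes the flux without the factor $\sigma_\ell\cdot n_e$, i.e. $\mathcal{F}^e_{g_\ell'(u)q_\ell}=(\sigma_\ell\cdot n_e)\widetilde{\mathcal{F}}^e_{g_\ell'(u)q_\ell}$ and $\mathcal{F}^e_{g_\ell(u)}=(\sigma_\ell\cdot n_e)\widetilde{\mathcal{F}}^e_{g_\ell(u)}$.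
   Context: Setting. $T>0$, $d\ge1$, $L$ is a finite index set, $\{W^\ell\}_{\ell\in L}$ are independent real Wiener processes on a filtered probability space satisfying the usual conditions. $D\subset\mathbb{R}^d$ is a bounded polygonal (polyhedral) domain; $\bar u\in L^2(\mathbb{R}^d)$ is deterministic. Structural assumption. For each $\ell\in L$: $\sigma_\ell\in[L^2(\mathbb{R}^d)]^d$, $\operatorname{div}_x\sigma_\ell=0$, and the normal traces $\sigma_\ell\cdot n$ are well defined in $L^2$ on the mesh faces; $g_\ell\in C^2(\mathbb{R})$ and there are $C_\ell>0$, $r_\ell\in\mathbb{N}$ with $|g_\ell(u)|\le C_\ell(1+|u|^{r_\ell})$ for all $u\in\mathbb{R}$. Mesh. $\mathcal{T}_h$ is a conforming shape-regular partition of $D$ into polyhedra $K$, $\mathcal{V}^k=\{v\in L^2(D): v|_K\in\mathcal{P}^k(K)\ \forall K\in\mathcal{T}_h\}$, $k\ge0$. In sums over $e\subset\partial K$, $n_e$ is the unit normal outward to $K$. For an interior face with normal $n_e$, $\llbracket v\rrbracket$ is the trace of $v$ from the element into which $n_e$ points minus the trace from the other element, and $\{\!\{v\}\!\}$ is the mean of the two traces. LDG scheme. Find adapted continuous processes $u_h(t)\in\mathcal{V}^k$, $q_{h,\ell}(t)\in\mathcal{V}^k$ ($\ell\in L$), on $[0,\tau_{\max})$, such that for all $K\in\mathcal{T}_h$ and $\varphi,\psi_\ell\in\mathcal{V}^k$ $$d\int_K\varphi u_h\,dx=\sum_{\ell\in L}b_K(u_h,q_{h,\ell},\varphi)\,dt-\sum_{\ell\in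 L}\int_K\varphi q_{h,\ell}\,dx\,dW^\ell_t,$$ $$\int_K\psi_\ell q_{h,\ell}\,dx=-\int_K(\nabla\psi_\ell\cdot\sigma_\ell)g_\ell(u_h)\,dx+\sum_{e\subset\partial K}\int_e\psi_\ell\,\mathcal{F}^e_{g_\ell(u)}\,d\mathcal{H}^{d-1},$$ $$b_K(u_h,q_{h,\ell},\varphi)=-\tfrac12\int_K(\nabla\varphi\cdot\sigma_\ell)g_\ell'(u_h)q_{h,\ell}\,dx+\tfrac12\sum_{e\subset\partial K}\int_e\varphi\,\mathcal{F}^e_{g_\ell'(u)q_\ell}\,d\mathcal{H}^{d-1},$$ with traces of $\varphi,\psi_\ell$ from inside $K$, and $u_h(0)$ the $L^2$-projection of $\bar u$ onto $\mathcal{V}^k$. Numerical fluxes. On interior faces $$\mathcal{F}^e_{g_\ell'(u)q_\ell}=(\sigma_\ell\cdot n_e)\Bigl(\tfrac{\llbracket g_\ell(u_h)\rrbracket}{\llbracket u_h\rrbracket}\{\!\{q_{h,\ell}\}\!\}+\eta^e_{q,\ell}\,\mathrm{sgn}(\sigma_\ell\cdot n_e)\llbracket u_h\rrbracket\Bigr),\quad \mathcal{F}^e_{g_\ell(u)}=(\sigma_\ell\cdot n_e)\Bigl(\{\!\{g_\ell(u_h)\}\!\}+\eta^e_{u,\ell}\,\mathrm{sgn}(\sigma_\ell\cdot n_e)\llbracket q_{h,\ell}\rrbracket\Bigr),$$ with the quotient read as $g_\ell'(u_h)$ when $\llbracket u_h\rrbracket=0$ and constants $\eta^e_{u,\ell},\eta^e_{q,\ell}\ge0$.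 On faces $e=\partial K\cap\partial D$: $\mathcal{F}^e_{g_\ell'(u)q_\ell}=(\sigma_\ell\cdot n_e)g_\ell'(u_h|_K)q_{h,\ell}|_K$ and $\mathcal{F}^e_{g_\ell(u)}=(\sigma_\ell\cdot n_e)g_\ell(u_h|_K)$. *)

theory Defs
  imports "HOL-Probability.Probability"
begin

section \<open>Function classes on Euclidean space\<close>

text \<open>Functions with continuous partial derivatives of all orders up to \<open>m\<close>.\<close>

primrec C_k :: "nat \<Rightarrow> ('a::euclidean_space \<Rightarrow> real) \<Rightarrow> bool" where
  "C_k 0 f \<longleftrightarrow> continuous_on UNIV f"
| "C_k (Suc m) f \<longleftrightarrow> (\<forall>x. f differentiable (at x)) \<and>
     (\<forall>b\<in>Basis. C_k m (\<lambda>x. frechet_derivative f (at x) b))"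

definition test_function :: "('a::euclidean_space \<Rightarrow> real) \<Rightarrow> bool" where
  "test_function \<phi> \<longleftrightarrow> (\<forall>m. C_k m \<phi>) \<and> compact (closure {x. \<phi> x \<noteq> 0})"

definition grad :: "('a::euclidean_space \<Rightarrow> real) \<Rightarrow> 'a \<Rightarrow> 'a" where
  "grad f x = (\<Sum>b\<in>Basis. frechet_derivative f (at x) b *\<^sub>R b)"

definition square_integrable :: "('a::euclidean_space \<Rightarrow> 'b::euclidean_space) \<Rightarrow> bool" where
  "square_integrable f \<longleftrightarrow>
     f \<in> borel_measurable lebesgue \<and> integrable lebesgue (\<lambda>x. (norm (f x))\<^sup>2)"

text \<open>\<open>div \<sigma> = 0\<close> on the whole space, in the sense of distributions.\<close>

definition divergence_free :: "('a::euclidean_space \<Rightarrow> 'a) \<Rightarrow> bool" where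
  "divergence_free \<sigma> \<longleftrightarrow>
     (\<forall>\<phi>. test_function \<phi> \<longrightarrow> (LINT x|lebesgue. grad \<phi> x \<bullet> \<sigma> x) = 0)"

definition multi_indices :: "nat \<Rightarrow> ('a::euclidean_space \<Rightarrow> nat) set" where
  "multi_indices k = {\<alpha>. (\<forall>b. b \<notin> Basis \<longrightarrow> \<alpha> b = 0) \<and> (\<Sum>b\<in>Basis. \<alpha> b) \<le> k}"

text \<open>Polynomial functions of total degree at most \<open>k\<close>.\<close>

definition poly_space :: "nat \<Rightarrow> ('a::euclidean_space \<Rightarrow> real) set" where
  "poly_space k = {p. \<exists>c. p = (\<lambda>x. \<Sum>\<alpha>\<in>multi_indices k. c \<alpha> * (\<Prod>b\<in>Basis. (x \<bullet> b) ^ \<alpha> b))}"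


section \<open>Hausdorff measure\<close>

text \<open>Normalised by the volume of the Euclidean unit ball, so that the \<open>s\<close>-dimensional
  Hausdorff measure is the usual surface area on flat pieces of dimension \<open>s\<close>. The empty set
  is treated separately because \<open>0 ^ 0 = 1\<close>; for \<open>s = 0\<close> one gets counting measure.\<close>

definition hausdorff_content :: "nat \<Rightarrow> real \<Rightarrow> 'a::euclidean_space set \<Rightarrow> ennreal" where
  "hausdorff_content s \<delta> A =
     (INF U \<in> {U :: nat \<Rightarrow> 'a set. A \<subseteq> (\<Union>i. U i) \<and> (\<forall>i. bounded (U i) \<and> diameter (U i) \<le> \<delta>)}.
        \<Sum>i. if U i = {} then 0 else ennreal (unit_ball_vol (real s) * (diameter (U i) / 2) ^ s))"

definition hausdorff_outer :: "nat \<Rightarrow> 'a::euclidean_space set \<Rightarrow> ennreal" where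
  "hausdorff_outer s A = (SUP \<delta>\<in>{0<..}. hausdorff_content s \<delta> A)"

definition hausdorff_measure :: "nat \<Rightarrow> 'a::euclidean_space measure" where
  "hausdorff_measure s = measure_of UNIV (sets borel) (hausdorff_outer s)"

abbreviation surface_measure :: "'a::euclidean_space measure" where
  "surface_measure \<equiv> hausdorff_measure (DIM('a) - 1)"


section \<open>Meshes and broken polynomials\<close>

text \<open>A mesh records the domain, the (closed) elements, and for each element its flat
  boundary faces. For a convex element the faces would be its facets; keeping them as data
  allows nonconvex elements and coplanar faces.\<close>

record 'a dg_mesh =
  dom :: "'a set"
  elems :: "'a set set"
  faces :: "'a set \<Rightarrow> 'a set set"

definition polyhedral_region :: "'a::euclidean_space set \<Rightarrow> bool" where
  "polyhedral_region P \<longleftrightarrow> (\<exists>\<S>. finite \<S> \<and> (\<forall>S\<in>\<S>. polytope S) \<and> P = \<Union>\<S>)"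

definition polyhedral_domain :: "'a::euclidean_space set \<Rightarrow> bool" where
  "polyhedral_domain D \<longleftrightarrow>
     D \<noteq> {} \<and> connected D \<and> interior (closure D) = D \<and> polyhedral_region (closure D)"

definition is_outward_normal :: "'a::euclidean_space set \<Rightarrow> 'a set \<Rightarrow> 'a \<Rightarrow> bool" where
  "is_outward_normal K e n \<longleftrightarrow>
     norm n = 1 \<and> (\<exists>c. \<forall>x\<in>e. n \<bullet> x = c) \<and>
     (\<forall>x\<in>rel_interior e. \<exists>\<epsilon>>0. \<forall>s. 0 < s \<and> s < \<epsilon> \<longrightarrow>
        x + s *\<^sub>R n \<notin> K \<and> x - s *\<^sub>R n \<in> interior K)"

definition outward_normal :: "'a::euclidean_space set \<Rightarrow> 'a set \<Rightarrow> 'a" where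
  "outward_normal K e = (THE n. is_outward_normal K e n)"

definition polyhedral_element :: "'a::euclidean_space set \<Rightarrow> 'a set set \<Rightarrow> bool" where
  "polyhedral_element K E \<longleftrightarrow>
     polyhedral_region K \<and> interior K \<noteq> {} \<and> closure (interior K) = K \<and>
     finite E \<and> \<Union>E = frontier K \<and>
     (\<forall>e\<in>E. polyhedral_region e \<and> aff_dim e = int DIM('a) - 1 \<and> closure (rel_interior e) = e \<and>
        (\<exists>n. is_outward_normal K e n)) \<and>
     (\<forall>e\<in>E. \<forall>e'\<in>E. e \<noteq> e' \<longrightarrow> rel_interior e \<inter> rel_interior e' = {})"

text \<open>Conformity: a face lies on the boundary of the domain and belongs to one element only,
  or it is a full face of exactly one further element.\<close>

definition conforming_mesh :: "'a::euclidean_space dg_mesh \<Rightarrow> bool" where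
  "conforming_mesh m \<longleftrightarrow>
     finite (elems m) \<and> \<Union>(elems m) = closure (dom m) \<and>
     (\<forall>K\<in>elems m. polyhedral_element K (faces m K)) \<and>
     (\<forall>K\<in>elems m. \<forall>K'\<in>elems m. K \<noteq> K' \<longrightarrow> interior K \<inter> interior K' = {}) \<and>
     (\<forall>K\<in>elems m. \<forall>e\<in>faces m K.
        if e \<subseteq> frontier (dom m) then \<forall>K'\<in>elems m. e \<in> faces m K' \<longrightarrow> K' = K
        else \<exists>!K'. K' \<in> elems m \<and> K' \<noteq> K \<and> e \<in> faces m K')"

definition shape_regular :: "real \<Rightarrow> 'a::euclidean_space dg_mesh \<Rightarrow> bool" where
  "shape_regular \<kappa> m \<longleftrightarrow> \<kappa> > 0 \<and> (\<forall>K\<in>elems m. \<exists>x. ball x (\<kappa> * diameter K) \<subseteq> K)"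

definition neighbour :: "'a dg_mesh \<Rightarrow> 'a set \<Rightarrow> 'a set \<Rightarrow> 'a set" where
  "neighbour m K e = (THE K'. K' \<in> elems m \<and> K' \<noteq> K \<and> e \<in> faces m K')"

text \<open>Piecewise polynomials, as functions on the ambient space. Their values on element
  boundaries (a null set) and outside the domain are irrelevant; all boundary values below
  are taken as one-sided traces.\<close>

definition dg_space :: "'a::euclidean_space dg_mesh \<Rightarrow> nat \<Rightarrow> ('a \<Rightarrow> real) set" where
  "dg_space m k = {v. \<forall>K\<in>elems m. \<exists>p\<in>poly_space k. \<forall>x\<in>interior K. v x = p x}"

definition inner_trace :: "'a::euclidean_space set \<Rightarrow> ('a \<Rightarrow> real) \<Rightarrow> 'a \<Rightarrow> real" where
  "inner_trace K v x = Lim (at x within interior K) v"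

text \<open>Jump across \<open>e\<close>, oriented by the normal outward to \<open>K\<close>: outer minus inner trace.\<close>

definition jump :: "'a::euclidean_space dg_mesh \<Rightarrow> 'a set \<Rightarrow> 'a set \<Rightarrow> ('a \<Rightarrow> real) \<Rightarrow> 'a \<Rightarrow> real" where
  "jump m K e v x = inner_trace (neighbour m K e) v x - inner_trace K v x"

definition average :: "'a::euclidean_space dg_mesh \<Rightarrow> 'a set \<Rightarrow> 'a set \<Rightarrow> ('a \<Rightarrow> real) \<Rightarrow> 'a \<Rightarrow> real" where
  "average m K e v x = (inner_trace (neighbour m K e) v x + inner_trace K v x) / 2"


section \<open>Noise coefficients\<close>

text \<open>Data belonging to one driving Wiener process: the field \<open>\<sigma>\<close>, its normal trace
  (\<open>ntrace c n x\<close> stands for \<open>(\<sigma> \<cdot> n)(x)\<close> on a face with unit normal \<open>n\<close>), the nonlinearity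
  \<open>g\<close>, and the facewise penalty constants.\<close>

record 'a noise_coeff =
  field :: "'a \<Rightarrow> 'a"
  ntrace :: "'a \<Rightarrow> 'a \<Rightarrow> real"
  nonlin :: "real \<Rightarrow> real"
  eta_u :: "'a set \<Rightarrow> real"
  eta_q :: "'a set \<Rightarrow> real"

text \<open>The normal trace of an \<open>L\<^sup>2\<close> field with vanishing divergence has no pointwise meaning; it is
  the density of the functional \<open>\<phi> \<mapsto> \<integral>\<^sub>K \<nabla>\<phi> \<cdot> \<sigma>\<close> (Green's formula with \<open>div \<sigma> = 0\<close>), required
  here to be an \<open>L\<^sup>2\<close> function on every face.\<close>

definition has_normal_trace ::
    "'a::euclidean_space dg_mesh \<Rightarrow> ('a \<Rightarrow> 'a) \<Rightarrow> ('a \<Rightarrow> 'a \<Rightarrow> real) \<Rightarrow> bool" where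
  "has_normal_trace m \<sigma> s \<longleftrightarrow>
     (\<forall>n x. s (- n) x = - s n x) \<and>
     (\<forall>K\<in>elems m. \<forall>e\<in>faces m K.
        set_borel_measurable surface_measure e (s (outward_normal K e)) \<and>
        set_integrable surface_measure e (\<lambda>x. (s (outward_normal K e) x)\<^sup>2)) \<and>
     (\<forall>K\<in>elems m. \<forall>\<phi>. C_k 1 \<phi> \<longrightarrow>
        (LINT x:K|lebesgue. grad \<phi> x \<bullet> \<sigma> x) =
        (\<Sum>e\<in>faces m K. LINT x:e|surface_measure. \<phi> x * s (outward_normal K e) x))"

definition structural_assumption :: "'a::euclidean_space dg_mesh \<Rightarrow> 'a noise_coeff \<Rightarrow> bool" where
  "structural_assumption m c \<longleftrightarrow>
     square_integrable (field c) \<and> divergence_free (field c) \<and>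
     has_normal_trace m (field c) (ntrace c) \<and>
     C_k 2 (nonlin c) \<and>
     (\<exists>C>0. \<exists>r::nat. \<forall>u. \<bar>nonlin c u\<bar> \<le> C * (1 + \<bar>u\<bar> ^ r))"


section \<open>Numerical fluxes\<close>

text \<open>Both fluxes are given on a face \<open>e\<close> of \<open>K\<close> with the normal outward to \<open>K\<close>. The
  \<open>reduced\<close> versions omit the factor \<open>\<sigma> \<cdot> n\<close>.\<close>

definition difference_quotient ::
    "'a::euclidean_space dg_mesh \<Rightarrow> (real \<Rightarrow> real) \<Rightarrow> 'a set \<Rightarrow> 'a set \<Rightarrow> ('a \<Rightarrow> real) \<Rightarrow> 'a \<Rightarrow> real" where
  "difference_quotient m g K e u x =
     (if jump m K e u x = 0 then deriv g (inner_trace K u x)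
      else jump m K e (\<lambda>y. g (u y)) x / jump m K e u x)"

definition reduced_flux_dgq ::
    "'a::euclidean_space dg_mesh \<Rightarrow> 'a noise_coeff \<Rightarrow> 'a set \<Rightarrow> 'a set \<Rightarrow>
     ('a \<Rightarrow> real) \<Rightarrow> ('a \<Rightarrow> real) \<Rightarrow> 'a \<Rightarrow> real" where
  "reduced_flux_dgq m c K e u q x =
     (if e \<subseteq> frontier (dom m)
      then deriv (nonlin c) (inner_trace K u x) * inner_trace K q x
      else difference_quotient m (nonlin c) K e u x * average m K e q x +
           eta_q c e * sgn (ntrace c (outward_normal K e) x) * jump m K e u x)"

definition reduced_flux_g ::
    "'a::euclidean_space dg_mesh \<Rightarrow> 'a noise_coeff \<Rightarrow> 'a set \<Rightarrow> 'a set \<Rightarrow>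
     ('a \<Rightarrow> real) \<Rightarrow> ('a \<Rightarrow> real) \<Rightarrow> 'a \<Rightarrow> real" where
  "reduced_flux_g m c K e u q x =
     (if e \<subseteq> frontier (dom m)
      then nonlin c (inner_trace K u x)
      else average m K e (\<lambda>y. nonlin c (u y)) x +
           eta_u c e * sgn (ntrace c (outward_normal K e) x) * jump m K e q x)"

definition flux_dgq ::
    "'a::euclidean_space dg_mesh \<Rightarrow> 'a noise_coeff \<Rightarrow> 'a set \<Rightarrow> 'a set \<Rightarrow>
     ('a \<Rightarrow> real) \<Rightarrow> ('a \<Rightarrow> real) \<Rightarrow> 'a \<Rightarrow> real" where
  "flux_dgq m c K e u q x = ntrace c (outward_normal K e) x * reduced_flux_dgq m c K e u q x"

definition flux_g ::
    "'a::euclidean_space dg_mesh \<Rightarrow> 'a noise_coeff \<Rightarrow> 'a set \<Rightarrow> 'a set \<Rightarrow>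
     ('a \<Rightarrow> real) \<Rightarrow> ('a \<Rightarrow> real) \<Rightarrow> 'a \<Rightarrow> real" where
  "flux_g m c K e u q x = ntrace c (outward_normal K e) x * reduced_flux_g m c K e u q x"

definition b_form ::
    "'a::euclidean_space dg_mesh \<Rightarrow> 'a noise_coeff \<Rightarrow> 'a set \<Rightarrow>
     ('a \<Rightarrow> real) \<Rightarrow> ('a \<Rightarrow> real) \<Rightarrow> ('a \<Rightarrow> real) \<Rightarrow> real" where
  "b_form m c K u q \<phi> =
     - (1/2) * (LINT x:K|lebesgue. (grad \<phi> x \<bullet> field c x) * deriv (nonlin c) (u x) * q x) +
     (1/2) * (\<Sum>e\<in>faces m K. LINT x:e|surface_measure. inner_trace K \<phi> x * flux_dgq m c K e u q x)"


section \<open>Stochastic notions\<close>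

text \<open>All processes are indexed by real times, of which only those in \<open>{0..T}\<close> matter.\<close>

definition usual_filtration :: "'w measure \<Rightarrow> real \<Rightarrow> (real \<Rightarrow> 'w measure) \<Rightarrow> bool" where
  "usual_filtration M T F \<longleftrightarrow>
     complete_measure M \<and>
     (\<forall>t\<in>{0..T}. space (F t) = space M \<and> sets (F t) \<subseteq> sets M) \<and>
     (\<forall>s\<in>{0..T}. \<forall>t\<in>{s..T}. sets (F s) \<subseteq> sets (F t)) \<and>
     null_sets M \<subseteq> sets (F 0) \<and>
     (\<forall>t\<in>{0..<T}. sets (F t) = (\<Inter>s\<in>{t<..T}. sets (F s)))"

definition wiener_process ::
    "'w measure \<Rightarrow> real \<Rightarrow> (real \<Rightarrow> 'w measure) \<Rightarrow> (real \<Rightarrow> 'w \<Rightarrow> real) \<Rightarrow> bool" where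
  "wiener_process M T F W \<longleftrightarrow>
     (AE \<omega> in M. W 0 \<omega> = 0) \<and>
     (AE \<omega> in M. continuous_on {0..T} (\<lambda>t. W t \<omega>)) \<and>
     (\<forall>t\<in>{0..T}. W t \<in> borel_measurable (F t)) \<and>
     (\<forall>s t. 0 \<le> s \<and> s < t \<and> t \<le> T \<longrightarrow>
        distributed M lborel (\<lambda>\<omega>. W t \<omega> - W s \<omega>) (normal_density 0 (sqrt (t - s))) \<and>
        prob_space.indep_set M (sets (F s))
          {(\<lambda>\<omega>. W t \<omega> - W s \<omega>) -` B \<inter> space M | B. B \<in> sets borel})"

definition independent_processes ::
    "'w measure \<Rightarrow> real \<Rightarrow> 'l set \<Rightarrow> ('l \<Rightarrow> real \<Rightarrow> 'w \<Rightarrow> real) \<Rightarrow> bool" where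
  "independent_processes M T L W \<longleftrightarrow>
     prob_space.indep_vars M (\<lambda>_. Pi\<^sub>M {0..T} (\<lambda>_. borel)) (\<lambda>l \<omega>. \<lambda>t\<in>{0..T}. W l t \<omega>) L"

definition stopping_time_upto ::
    "'w measure \<Rightarrow> real \<Rightarrow> (real \<Rightarrow> 'w measure) \<Rightarrow> ('w \<Rightarrow> real) \<Rightarrow> bool" where
  "stopping_time_upto M T F \<tau> \<longleftrightarrow>
     (\<forall>\<omega>\<in>space M. 0 < \<tau> \<omega> \<and> \<tau> \<omega> \<le> T) \<and>
     (\<forall>t\<in>{0..T}. {\<omega>\<in>space M. \<tau> \<omega> \<le> t} \<in> sets (F t))"

text \<open>Adapted, almost surely continuous real processes on the random interval \<open>[0, \<tau>)\<close>.\<close>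

definition adapted_continuous ::
    "'w measure \<Rightarrow> real \<Rightarrow> (real \<Rightarrow> 'w measure) \<Rightarrow> ('w \<Rightarrow> real) \<Rightarrow> (real \<Rightarrow> 'w \<Rightarrow> real) \<Rightarrow> bool" where
  "adapted_continuous M T F \<tau> X \<longleftrightarrow>
     (\<forall>t\<in>{0..T}. (\<lambda>\<omega>. if t < \<tau> \<omega> then X t \<omega> else 0) \<in> borel_measurable (F t)) \<and>
     (AE \<omega> in M. continuous_on {0..<\<tau> \<omega>} (\<lambda>t. X t \<omega>))"

text \<open>Convergence in probability on the event \<open>A\<close>.\<close>

definition tendsto_in_prob_on ::
    "'w measure \<Rightarrow> 'w set \<Rightarrow> (nat \<Rightarrow> 'w \<Rightarrow> real) \<Rightarrow> ('w \<Rightarrow> real) \<Rightarrow> bool" where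
  "tendsto_in_prob_on M A X Y \<longleftrightarrow>
     (\<forall>\<epsilon>>0. (\<forall>j. {\<omega>\<in>A. \<epsilon> < \<bar>X j \<omega> - Y \<omega>\<bar>} \<in> sets M) \<and>
        (\<lambda>j. measure M {\<omega>\<in>A. \<epsilon> < \<bar>X j \<omega> - Y \<omega>\<bar>}) \<longlonglongrightarrow> 0)"

text \<open>Simple processes \<open>\<Sum>\<^bsub>i<N\<^esub> \<xi>\<^sub>i 1\<^bsub>(p i, p (i+1)]\<^esub>\<close> with bounded \<open>\<xi>\<^sub>i\<close> measurable at time \<open>p i\<close>.\<close>

definition simple_process ::
    "'w measure \<Rightarrow> real \<Rightarrow> (real \<Rightarrow> 'w measure) \<Rightarrow> nat \<Rightarrow> (nat \<Rightarrow> real) \<Rightarrow> (nat \<Rightarrow> 'w \<Rightarrow> real) \<Rightarrow> bool" where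
  "simple_process M T F N p \<xi> \<longleftrightarrow>
     (\<forall>i\<le>N. p i \<in> {0..T}) \<and> (\<forall>i<N. p i < p (Suc i)) \<and>
     (\<forall>i<N. \<xi> i \<in> borel_measurable (F (p i)) \<and> (\<exists>B. \<forall>\<omega>\<in>space M. \<bar>\<xi> i \<omega>\<bar> \<le> B))"

definition simple_value ::
    "nat \<Rightarrow> (nat \<Rightarrow> real) \<Rightarrow> (nat \<Rightarrow> 'w \<Rightarrow> real) \<Rightarrow> real \<Rightarrow> 'w \<Rightarrow> real" where
  "simple_value N p \<xi> t \<omega> = (\<Sum>i<N. \<xi> i \<omega> * indicator {p i<..p (Suc i)} t)"

definition simple_integral ::
    "(real \<Rightarrow> 'w \<Rightarrow> real) \<Rightarrow> nat \<Rightarrow> (nat \<Rightarrow> real) \<Rightarrow> (nat \<Rightarrow> 'w \<Rightarrow> real) \<Rightarrow> real \<Rightarrow> 'w \<Rightarrow> real" where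
  "simple_integral W N p \<xi> t \<omega> =
     (\<Sum>i<N. \<xi> i \<omega> * (W (min t (p (Suc i))) \<omega> - W (min t (p i)) \<omega>))"

text \<open>\<open>I\<close> is (a continuous version of) the Ito integral of \<open>H\<close> against \<open>W\<close> on \<open>[0, \<tau>)\<close>: the
  limit in probability of integrals of simple processes whose squared \<open>L\<^sup>2(0,t)\<close>-distance to
  \<open>H\<close> tends to zero in probability. The restriction to the events \<open>t < \<tau>\<close> is the localisation.
  Integrands are adapted and continuous, which makes all events below measurable.\<close>

definition ito_integral_on ::
    "'w measure \<Rightarrow> real \<Rightarrow> (real \<Rightarrow> 'w measure) \<Rightarrow> ('w \<Rightarrow> real) \<Rightarrow> (real \<Rightarrow> 'w \<Rightarrow> real) \<Rightarrow>
     (real \<Rightarrow> 'w \<Rightarrow> real) \<Rightarrow> (real \<Rightarrow> 'w \<Rightarrow> real) \<Rightarrow> bool" where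
  "ito_integral_on M T F \<tau> W H I \<longleftrightarrow>
     adapted_continuous M T F \<tau> H \<and> adapted_continuous M T F \<tau> I \<and>
     (\<exists>N p \<xi>. (\<forall>j. simple_process M T F (N j) (p j) (\<xi> j)) \<and>
        (\<forall>t\<in>{0..T}.
           tendsto_in_prob_on M {\<omega>\<in>space M. t < \<tau> \<omega>}
             (\<lambda>j \<omega>. LINT s:{0..t}|lborel. (simple_value (N j) (p j) (\<xi> j) s \<omega> - H s \<omega>)\<^sup>2) (\<lambda>_. 0) \<and>
           tendsto_in_prob_on M {\<omega>\<in>space M. t < \<tau> \<omega>}
             (\<lambda>j. simple_integral W (N j) (p j) (\<xi> j) t) (I t)))"

definition partition_sequence :: "real \<Rightarrow> (nat \<Rightarrow> nat) \<Rightarrow> (nat \<Rightarrow> nat \<Rightarrow> real) \<Rightarrow> bool" where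
  "partition_sequence t N p \<longleftrightarrow>
     (\<forall>j. p j 0 = 0 \<and> p j (N j) = t \<and> (\<forall>i<N j. p j i \<le> p j (Suc i))) \<and>
     (\<forall>\<delta>>0. \<forall>\<^sub>F j in sequentially. \<forall>i<N j. p j (Suc i) - p j i < \<delta>)"

text \<open>The quadratic covariation on \<open>[0, \<tau>)\<close> as the limit in probability, along arbitrary
  partitions of \<open>[0, t]\<close> with mesh tending to zero, of the sums of products of increments.\<close>

definition has_covariation ::
    "'w measure \<Rightarrow> real \<Rightarrow> ('w \<Rightarrow> real) \<Rightarrow> (real \<Rightarrow> 'w \<Rightarrow> real) \<Rightarrow> (real \<Rightarrow> 'w \<Rightarrow> real) \<Rightarrow>
     (real \<Rightarrow> 'w \<Rightarrow> real) \<Rightarrow> bool" where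
  "has_covariation M T \<tau> X Y A \<longleftrightarrow>
     (\<forall>t\<in>{0..T}. \<forall>N p. partition_sequence t N p \<longrightarrow>
        tendsto_in_prob_on M {\<omega>\<in>space M. t < \<tau> \<omega>}
          (\<lambda>j \<omega>. \<Sum>i<N j. (X (p j (Suc i)) \<omega> - X (p j i) \<omega>) * (Y (p j (Suc i)) \<omega> - Y (p j i) \<omega>))
          (A t))"

text \<open>A version of the pointwise covariation of two random fields on \<open>S\<close>. Since the
  covariation at each \<open>x\<close> is only determined up to a null set, integrating it over \<open>x\<close> requires
  a version that is jointly measurable and continuous in time.\<close>

definition covariation_field ::
    "'w measure \<Rightarrow> real \<Rightarrow> ('w \<Rightarrow> real) \<Rightarrow> 'a::euclidean_space set \<Rightarrow>
     (real \<Rightarrow> 'w \<Rightarrow> 'a \<Rightarrow> real) \<Rightarrow> (real \<Rightarrow> 'w \<Rightarrow> 'a \<Rightarrow> real) \<Rightarrow> (real \<Rightarrow> 'w \<Rightarrow> 'a \<Rightarrow> real) \<Rightarrow> bool" where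
  "covariation_field M T \<tau> S X Y A \<longleftrightarrow>
     (\<forall>t\<in>{0..T}. (\<lambda>(\<omega>, x). if t < \<tau> \<omega> then A t \<omega> x else 0)
        \<in> borel_measurable (M \<Otimes>\<^sub>M restrict_space lborel S)) \<and>
     (AE \<omega> in M. \<forall>x\<in>S. continuous_on {0..<\<tau> \<omega>} (\<lambda>t. A t \<omega> x)) \<and>
     (\<forall>x\<in>S. has_covariation M T \<tau> (\<lambda>t \<omega>. X t \<omega> x) (\<lambda>t \<omega>. Y t \<omega> x) (\<lambda>t \<omega>. A t \<omega> x))"


section \<open>The local discontinuous Galerkin scheme\<close>

text \<open>Adapted processes on \<open>[0, \<tau>)\<close> with values in the finite-dimensional subspace
  \<open>dg_space m k\<close> of \<open>L\<^sup>2(D)\<close>, almost surely continuous in the \<open>L\<^sup>2(D)\<close> norm.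
  Measurability into this space is tested by inner products.\<close>

definition dg_process ::
    "'w measure \<Rightarrow> real \<Rightarrow> (real \<Rightarrow> 'w measure) \<Rightarrow> ('w \<Rightarrow> real) \<Rightarrow>
     'a::euclidean_space dg_mesh \<Rightarrow> nat \<Rightarrow> (real \<Rightarrow> 'w \<Rightarrow> 'a \<Rightarrow> real) \<Rightarrow> bool" where
  "dg_process M T F \<tau> m k v \<longleftrightarrow>
     (\<forall>\<omega>\<in>space M. \<forall>t\<in>{0..<\<tau> \<omega>}. v t \<omega> \<in> dg_space m k) \<and>
     (\<forall>t\<in>{0..T}. \<forall>\<phi>\<in>dg_space m k.
        (\<lambda>\<omega>. if t < \<tau> \<omega> then LINT x:dom m|lebesgue. \<phi> x * v t \<omega> x else 0) \<in> borel_measurable (F t)) \<and>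
     (AE \<omega> in M. \<forall>s\<in>{0..<\<tau> \<omega>}.
        ((\<lambda>t. LINT x:dom m|lebesgue. (v t \<omega> x - v s \<omega> x)\<^sup>2) \<longlongrightarrow> 0) (at s within {0..<\<tau> \<omega>}))"

definition ldg_solution ::
    "'w measure \<Rightarrow> real \<Rightarrow> (real \<Rightarrow> 'w measure) \<Rightarrow> 'l set \<Rightarrow> ('l \<Rightarrow> real \<Rightarrow> 'w \<Rightarrow> real) \<Rightarrow>
     'a::euclidean_space dg_mesh \<Rightarrow> nat \<Rightarrow> ('l \<Rightarrow> 'a noise_coeff) \<Rightarrow> ('a \<Rightarrow> real) \<Rightarrow>
     ('w \<Rightarrow> real) \<Rightarrow> (real \<Rightarrow> 'w \<Rightarrow> 'a \<Rightarrow> real) \<Rightarrow> ('l \<Rightarrow> real \<Rightarrow> 'w \<Rightarrow> 'a \<Rightarrow> real) \<Rightarrow> bool" where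
  "ldg_solution M T F L W m k c ubar \<tau> u q \<longleftrightarrow>
     stopping_time_upto M T F \<tau> \<and>
     dg_process M T F \<tau> m k u \<and> (\<forall>l\<in>L. dg_process M T F \<tau> m k (q l)) \<and>
     (AE \<omega> in M. \<forall>\<phi>\<in>dg_space m k.
        (LINT x:dom m|lebesgue. \<phi> x * u 0 \<omega> x) = (LINT x:dom m|lebesgue. \<phi> x * ubar x)) \<and>
     (\<forall>K\<in>elems m. \<forall>\<phi>\<in>dg_space m k. \<exists>I.
        (\<forall>l\<in>L. ito_integral_on M T F \<tau> (W l) (\<lambda>s \<omega>. LINT x:K|lebesgue. \<phi> x * q l s \<omega> x) (I l)) \<and>
        (AE \<omega> in M. \<forall>t\<in>{0..<\<tau> \<omega>}.
           (LINT x:K|lebesgue. \<phi> x * u t \<omega> x) =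
           (LINT x:K|lebesgue. \<phi> x * u 0 \<omega> x) +
           (LINT s:{0..t}|lborel. (\<Sum>l\<in>L. b_form m (c l) K (u s \<omega>) (q l s \<omega>) \<phi>)) -
           (\<Sum>l\<in>L. I l t \<omega>))) \<and>
     (AE \<omega> in M. \<forall>t\<in>{0..<\<tau> \<omega>}. \<forall>K\<in>elems m. \<forall>l\<in>L. \<forall>\<psi>\<in>dg_space m k.
        (LINT x:K|lebesgue. \<psi> x * q l t \<omega> x) =
        - (LINT x:K|lebesgue. (grad \<psi> x \<bullet> field (c l) x) * nonlin (c l) (u t \<omega> x)) +
        (\<Sum>e\<in>faces m K. LINT x:e|surface_measure.
           inner_trace K \<psi> x * flux_g m (c l) K e (u t \<omega>) (q l t \<omega>) x))"

text \<open>\<open>\<tau>\<close> is the maximal existence time: the solution has no proper extension.\<close>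

definition maximal_ldg_solution ::
    "'w measure \<Rightarrow> real \<Rightarrow> (real \<Rightarrow> 'w measure) \<Rightarrow> 'l set \<Rightarrow> ('l \<Rightarrow> real \<Rightarrow> 'w \<Rightarrow> real) \<Rightarrow>
     'a::euclidean_space dg_mesh \<Rightarrow> nat \<Rightarrow> ('l \<Rightarrow> 'a noise_coeff) \<Rightarrow> ('a \<Rightarrow> real) \<Rightarrow>
     ('w \<Rightarrow> real) \<Rightarrow> (real \<Rightarrow> 'w \<Rightarrow> 'a \<Rightarrow> real) \<Rightarrow> ('l \<Rightarrow> real \<Rightarrow> 'w \<Rightarrow> 'a \<Rightarrow> real) \<Rightarrow> bool" where
  "maximal_ldg_solution M T F L W m k c ubar \<tau> u q \<longleftrightarrow>
     ldg_solution M T F L W m k c ubar \<tau> u q \<and>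
     (\<forall>\<tau>' u' q'. ldg_solution M T F L W m k c ubar \<tau>' u' q' \<and>
        (AE \<omega> in M. \<tau> \<omega> \<le> \<tau>' \<omega> \<and>
           (\<forall>t\<in>{0..<\<tau> \<omega>}. \<forall>K\<in>elems m. \<forall>x\<in>interior K.
              u' t \<omega> x = u t \<omega> x \<and> (\<forall>l\<in>L. q' l t \<omega> x = q l t \<omega> x))) \<longrightarrow>
        (AE \<omega> in M. \<tau>' \<omega> = \<tau> \<omega>))"

end

theory Submission
  imports Defs
begin

text \<open>For \<open>x\<close> in the interior of \<open>K\<close>, test the equation for \<open>u\<close> with the polynomial \<open>\<psi>\<^sub>x\<close> that
  represents evaluation at \<open>x\<close> in \<open>L\<^sup>2(K)\<close>. Then \<open>u(x)\<close> is a process with drift minus the stochastic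
  integrals of \<open>q\<^sub>l(x)\<close> against \<open>W\<^sup>l\<close>, so its quadratic variation is \<open>\<Sum>\<^sub>l \<integral> q\<^sub>l(s, x)\<^sup>2 ds\<close>, and
  integrating over \<open>K\<close> gives \<open>\<Sum>\<^sub>l \<integral> \<parallel>q\<^sub>l(s)\<parallel>\<^sup>2 ds\<close>. Testing the equation for \<open>q\<^sub>l\<close> with \<open>q\<^sub>l\<close> itself and
  adding \<open>2 b(u, q\<^sub>l, u)\<close>, the volume terms combine to \<open>- \<integral> \<sigma>\<^sub>l \<cdot> \<nabla> (g\<^sub>l(u) q\<^sub>l)\<close>, which Green's
  formula with \<open>div \<sigma>\<^sub>l = 0\<close> turns into a boundary term.

  The quadratic variation is computed from the definition of the stochastic integral as a limit in
  probability. Over a partition, the increments of \<open>\<integral> H dW\<close> may be replaced by \<open>H(p\<^sub>i)\<close> times the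
  increments of \<open>W\<close>, with an error controlled by a discrete Lenglart inequality; the mixed sums
  \<open>\<Sum> (\<Delta>W\<^sup>i \<Delta>W\<^sup>j - \<delta>\<^sub>i\<^sub>j \<Delta>t)\<close> over initial segments tend to \<open>0\<close> in \<open>L\<^sup>2\<close>, and along an almost surely
  convergent subsequence the weighted sums converge pathwise by uniform continuity of \<open>H\<close>.\<close>

text \<open>The covariation is pointwise in x, while the scheme is only tested against broken
  polynomials. The representing polynomial is the reproducing kernel of the polynomials in L2(K).
  Since it does not depend on time, the drift is a continuous function of time and contributes
  nothing to the quadratic variation. The stochastic integral supplies, for each fixed time, only
  simple processes unrelated to the partition whose increments are summed. Hence the common
  refinement, the limit over the simple processes with the partition held fixed, and only then the
  limit of vanishing mesh. The weights \<open>H\<close> are neither bounded nor piecewise constant;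
  freezing them on a rational grid leaves countably many unweighted sums, so one subsequence serves
  all of them. Processes are controlled only before \<open>\<tau>\<close>, so limits are taken on
  \<open>t < \<tau>\<close> and measurability is argued for versions set to zero afterwards. The
  fluxes contain the sign of the normal trace, which is merely measurable in x; multiplied by the
  normal trace it becomes an absolute value, an integrable weight independent of time.\<close>

section \<open>Orthogonality, complete filtrations and moments of Brownian increments\<close>

lemma expectation_square_sum_orthogonal:
  fixes x :: "'i \<Rightarrow> 'w \<Rightarrow> real"
  assumes fin: "finite S"
    and int: "\<And>i j. i \<in> S \<Longrightarrow> j \<in> S \<Longrightarrow> integrable M (\<lambda>\<omega>. x i \<omega> * x j \<omega>)"
    and orth: "\<And>i j. i \<in> S \<Longrightarrow> j \<in> S \<Longrightarrow> i \<noteq> j \<Longrightarrow> (LINT \<omega>|M. x i \<omega> * x j \<omega>) = 0"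
  shows "integrable M (\<lambda>\<omega>. (\<Sum>i\<in>S. x i \<omega>)\<^sup>2)"
    and "(LINT \<omega>|M. (\<Sum>i\<in>S. x i \<omega>)\<^sup>2) = (\<Sum>i\<in>S. LINT \<omega>|M. (x i \<omega>)\<^sup>2)"
proof -
  have eq: "(\<lambda>\<omega>. (\<Sum>i\<in>S. x i \<omega>)\<^sup>2) = (\<lambda>\<omega>. \<Sum>i\<in>S. \<Sum>j\<in>S. x i \<omega> * x j \<omega>)"
    by (simp add: power2_eq_square sum_product)
  show "integrable M (\<lambda>\<omega>. (\<Sum>i\<in>S. x i \<omega>)\<^sup>2)"
    unfolding eq using int by (intro Bochner_Integration.integrable_sum) auto
  have "(LINT \<omega>|M. (\<Sum>i\<in>S. x i \<omega>)\<^sup>2) = (\<Sum>i\<in>S. \<Sum>j\<in>S. LINT \<omega>|M. x i \<omega> * x j \<omega>)"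
    unfolding eq using int
    by (simp add: Bochner_Integration.integral_sum Bochner_Integration.integrable_sum)
  also have "\<dots> = (\<Sum>i\<in>S. \<Sum>j\<in>S. if i = j then LINT \<omega>|M. (x i \<omega>)\<^sup>2 else 0)"
    using orth by (intro sum.cong refl) (auto simp: power2_eq_square)
  also have "\<dots> = (\<Sum>i\<in>S. LINT \<omega>|M. (x i \<omega>)\<^sup>2)"
    using fin by simp
  finally show "(LINT \<omega>|M. (\<Sum>i\<in>S. x i \<omega>)\<^sup>2) = (\<Sum>i\<in>S. LINT \<omega>|M. (x i \<omega>)\<^sup>2)" .
qed

locale filtered_prob_space = prob_space M for M :: "'w measure" +
  fixes T :: real and F :: "real \<Rightarrow> 'w measure"
  assumes usual: "usual_filtration M T F"
begin

lemma complete_M: "complete_measure M"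
  using usual by (simp add: usual_filtration_def)

lemma space_F [simp]: "0 \<le> t \<Longrightarrow> t \<le> T \<Longrightarrow> space (F t) = space M"
  using usual by (auto simp: usual_filtration_def)

lemma sets_F: "0 \<le> t \<Longrightarrow> t \<le> T \<Longrightarrow> sets (F t) \<subseteq> sets M"
  using usual unfolding usual_filtration_def by (metis atLeastAtMost_iff)

lemma F_mono: "0 \<le> s \<Longrightarrow> s \<le> t \<Longrightarrow> t \<le> T \<Longrightarrow> sets (F s) \<subseteq> sets (F t)"
  using usual unfolding usual_filtration_def by (meson atLeastAtMost_iff order_trans)

lemma measurable_F_mono:
  "f \<in> measurable (F s) N \<Longrightarrow> 0 \<le> s \<Longrightarrow> s \<le> t \<Longrightarrow> t \<le> T \<Longrightarrow> f \<in> measurable (F t) N"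
  using F_mono[of s t] space_F[of s] space_F[of t] by (auto simp: measurable_def)

lemma measurable_F_M:
  "f \<in> measurable (F s) N \<Longrightarrow> 0 \<le> s \<Longrightarrow> s \<le> T \<Longrightarrow> f \<in> measurable M N"
  using sets_F[of s] space_F[of s] by (auto simp: measurable_def)

text \<open>Completeness makes every subset of a null set measurable, so the exceptional part of a
  preimage does no harm. This is needed because paths are continuous only almost surely: pathwise
  limits of measurable functions equal the quantities of interest only up to a null set.\<close>

lemma measurable_AE_eq:
  assumes f: "f \<in> measurable M N" and ae: "AE \<omega> in M. f \<omega> = g \<omega>"
    and g: "\<And>\<omega>. \<omega> \<in> space M \<Longrightarrow> g \<omega> \<in> space N"
  shows "g \<in> measurable M N"
proof -
  interpret complete_measure M by (rule complete_M)
  obtain Z where Z: "{\<omega>\<in>space M. f \<omega> \<noteq> g \<omega>} \<subseteq> Z" "Z \<in> null_sets M"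
    using ae by (auto elim!: AE_E intro: null_setsI)
  show ?thesis
  proof (rule measurableI)
    fix A assume A: "A \<in> sets N"
    have "g -` A \<inter> space M = ((f -` A \<inter> space M) - Z) \<union> (g -` A \<inter> space M \<inter> Z)"
      using Z(1) by auto
    moreover have "g -` A \<inter> space M \<inter> Z \<in> sets M"
      by (rule complete[OF _ Z(2)]) auto
    ultimately show "g -` A \<inter> space M \<in> sets M"
      using measurable_sets[OF f A] Z(2) by (metis null_setsD2 sets.Diff sets.Un)
  qed (use g in auto)
qed

lemma measurable_set_AE_eq:
  assumes "A \<in> sets M" "AE \<omega> in M. \<omega> \<in> A \<longleftrightarrow> \<omega> \<in> B" "B \<subseteq> space M"
  shows "B \<in> sets M"
proof -
  have "(\<lambda>\<omega>. \<omega> \<in> B) \<in> measurable M (count_space UNIV)"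
    by (rule measurable_AE_eq[of "\<lambda>\<omega>. \<omega> \<in> A"]) (use assms in auto)
  then have "{\<omega>\<in>space M. \<omega> \<in> B} \<in> sets M" by measurable
  moreover have "{\<omega>\<in>space M. \<omega> \<in> B} = B" using assms(3) by auto
  ultimately show ?thesis by simp
qed

end

locale wiener = filtered_prob_space +
  fixes W :: "real \<Rightarrow> 'a \<Rightarrow> real"
  assumes wiener: "wiener_process M T F W"
begin

lemma W_measurable: "0 \<le> t \<Longrightarrow> t \<le> T \<Longrightarrow> W t \<in> borel_measurable (F t)"
  using wiener by (auto simp: wiener_process_def)

lemma W_measurable_later: "0 \<le> s \<Longrightarrow> s \<le> t \<Longrightarrow> t \<le> T \<Longrightarrow> W s \<in> borel_measurable (F t)"
  using W_measurable measurable_F_mono by (meson order_trans)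

lemma W_measurable_M: "0 \<le> t \<Longrightarrow> t \<le> T \<Longrightarrow> W t \<in> borel_measurable M"
  using W_measurable measurable_F_M by blast

lemma increment_distributed:
  "0 \<le> s \<Longrightarrow> s < t \<Longrightarrow> t \<le> T \<Longrightarrow>
    distributed M lborel (\<lambda>\<omega>. W t \<omega> - W s \<omega>) (normal_density 0 (sqrt (t - s)))"
  using wiener by (auto simp: wiener_process_def)

lemma indep_increment:
  assumes st: "0 \<le> s" "s < t" "t \<le> T" and Y: "Y \<in> borel_measurable (F s)"
  shows "indep_var borel Y borel (\<lambda>\<omega>. W t \<omega> - W s \<omega>)"
proof -
  let ?G = "{(\<lambda>\<omega>. W t \<omega> - W s \<omega>) -` B \<inter> space M | B. B \<in> sets borel}"
  have ind: "indep_set (sets (F s)) ?G"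
    using wiener st by (auto simp: wiener_process_def)
  have YM: "Y \<in> borel_measurable M" using measurable_F_M[OF Y] st by auto
  have WM: "(\<lambda>\<omega>. W t \<omega> - W s \<omega>) \<in> borel_measurable M"
    using W_measurable_M st by (intro borel_measurable_diff) auto
  have 1: "sigma_sets (space M) {Y -` A \<inter> space M |A. A \<in> sets borel} \<subseteq> sets (F s)"
  proof -
    have "{Y -` A \<inter> space M |A. A \<in> sets borel} \<subseteq> sets (F s)"
      using measurable_sets[OF Y] space_F[of s] st by auto
    then show ?thesis
      using sets.sigma_sets_subset[of _ "F s"] space_F[of s] st by auto
  qed
  \<comment> \<open>Preimages of Borel sets under one function already form a sigma-algebra, so
    independence of the generating class is independence of the generated one.\<close>
  have 2: "sigma_sets (space M) ?G = ?G"
    using sets_vimage_algebra2[of "\<lambda>\<omega>. W t \<omega> - W s \<omega>" "space M" borel]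
    by (metis (no_types, lifting) Pi_I' UNIV_I sets.sigma_sets_eq space_borel space_vimage_algebra)
  show ?thesis
    unfolding indep_var_eq 2 using YM WM ind 1
    unfolding indep_sets2_eq by blast
qed

lemma increment_moments:
  assumes st: "0 \<le> s" "s < t" "t \<le> T"
  shows "integrable M (\<lambda>\<omega>. (W t \<omega> - W s \<omega>) ^ n)"
    and "expectation (\<lambda>\<omega>. W t \<omega> - W s \<omega>) = 0"
    and "expectation (\<lambda>\<omega>. (W t \<omega> - W s \<omega>)\<^sup>2) = t - s"
    and "expectation (\<lambda>\<omega>. (W t \<omega> - W s \<omega>) ^ 4) = 3 * (t - s)\<^sup>2"
proof -
  note D = increment_distributed[OF st]
  have \<sigma>: "0 < sqrt (t - s)" using st by simp
  show "integrable M (\<lambda>\<omega>. (W t \<omega> - W s \<omega>) ^ n)"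
    using distributed_integrable[OF D, of "\<lambda>x. x ^ n"] integrable_normal_moment[OF \<sigma>, of 0 n]
    by simp
  show "expectation (\<lambda>\<omega>. W t \<omega> - W s \<omega>) = 0"
    using normal_distributed_expectation[OF \<sigma> D] by simp
  show "expectation (\<lambda>\<omega>. (W t \<omega> - W s \<omega>)\<^sup>2) = t - s"
    using distributed_integral[OF D, of "\<lambda>x. x\<^sup>2"] integral_normal_moment_even[OF \<sigma>, of 0 1] st
    by (simp add: fact_numeral)
  show "expectation (\<lambda>\<omega>. (W t \<omega> - W s \<omega>) ^ 4) = 3 * (t - s)\<^sup>2"
    using distributed_integral[OF D, of "\<lambda>x. x ^ 4"] integral_normal_moment_even[OF \<sigma>, of 0 2] st
    by (simp add: fact_numeral power2_eq_square field_simps)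
qed

text \<open>Independence of the increment from the past factorises the expectation. With
  \<open>f\<close> the identity this is orthogonality to the past, with \<open>f\<close> the square
  it is the Ito isometry on one interval.\<close>

lemma expectation_mult_increment:
  fixes Y :: "'a \<Rightarrow> real" and f :: "real \<Rightarrow> real"
  assumes st: "0 \<le> s" "s < t" "t \<le> T" and Y: "Y \<in> borel_measurable (F s)" "integrable M Y"
    and f: "f \<in> borel_measurable borel" "integrable M (\<lambda>\<omega>. f (W t \<omega> - W s \<omega>))"
  shows "integrable M (\<lambda>\<omega>. Y \<omega> * f (W t \<omega> - W s \<omega>))"
    and "expectation (\<lambda>\<omega>. Y \<omega> * f (W t \<omega> - W s \<omega>)) = expectation Y * expectation (\<lambda>\<omega>. f (W t \<omega> - W s \<omega>))"
proof -
  have "indep_var borel ((\<lambda>x. x) \<circ> Y) borel (f \<circ> (\<lambda>\<omega>. W t \<omega> - W s \<omega>))"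
    by (rule indep_var_compose[OF indep_increment[OF st Y(1)]]) (use f in auto)
  then have ind: "indep_var borel Y borel (\<lambda>\<omega>. f (W t \<omega> - W s \<omega>))"
    by (simp add: comp_def)
  show "integrable M (\<lambda>\<omega>. Y \<omega> * f (W t \<omega> - W s \<omega>))"
    by (rule indep_var_integrable[OF ind Y(2) f(2)])
  show "expectation (\<lambda>\<omega>. Y \<omega> * f (W t \<omega> - W s \<omega>)) = expectation Y * expectation (\<lambda>\<omega>. f (W t \<omega> - W s \<omega>))"
    by (rule indep_var_lebesgue_integral[OF ind Y(2) f(2)])
qed

text \<open>A discrete Lenglart inequality: the weights are truncated at the stage where the
  accumulated variance exceeds \<open>\<delta>\<close>, after which the \<open>L\<^sup>2\<close> isometry and Markov apply.\<close>

lemma block_sums_in_prob: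
  fixes A :: "'i set" and s s' :: "'i \<Rightarrow> real" and \<zeta> :: "'i \<Rightarrow> 'a \<Rightarrow> real" and \<beta> :: "'i \<Rightarrow> 'j"
  assumes fin: "finite A" "finite B" and \<beta>: "\<And>a. a \<in> A \<Longrightarrow> \<beta> a \<in> B"
    and ss: "\<And>a. a \<in> A \<Longrightarrow> 0 \<le> s a \<and> s a < s' a \<and> s' a \<le> T"
    and disj: "\<And>a b. a \<in> A \<Longrightarrow> b \<in> A \<Longrightarrow> a \<noteq> b \<Longrightarrow> s' a \<le> s b \<or> s' b \<le> s a"
    and \<zeta>: "\<And>a. a \<in> A \<Longrightarrow> \<zeta> a \<in> borel_measurable (F (s a))"
    and E: "E \<in> events" and \<epsilon>: "\<epsilon> > 0" and \<delta>: "\<delta> \<ge> 0"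
  shows "prob {\<omega>\<in>E. \<epsilon> < (\<Sum>i\<in>B. (\<Sum>a\<in>{a\<in>A. \<beta> a = i}. \<zeta> a \<omega> * (W (s' a) \<omega> - W (s a) \<omega>))\<^sup>2)}
    \<le> \<delta> / \<epsilon> + prob {\<omega>\<in>E. \<delta> < (\<Sum>a\<in>A. (\<zeta> a \<omega>)\<^sup>2 * (s' a - s a))}"
proof -
  define D where "D a = s' a - s a" for a
  define dW where "dW a \<omega> = W (s' a) \<omega> - W (s a) \<omega>" for a \<omega>
  \<comment> \<open>Variance accumulated up to and including \<open>a\<close>. Only weights known at
    time \<open>s a\<close> enter, so the truncation below keeps the weights adapted.\<close>
  define V where "V a \<omega> = (\<Sum>b\<in>{b\<in>A. s b \<le> s a}. (\<zeta> b \<omega>)\<^sup>2 * D b)" for a \<omega>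
  define \<zeta>' where "\<zeta>' a \<omega> = (if V a \<omega> \<le> \<delta> then \<zeta> a \<omega> else 0)" for a \<omega>
  define x where "x a \<omega> = \<zeta>' a \<omega> * dW a \<omega>" for a \<omega>
  have Dpos: "D a > 0" if "a \<in> A" for a using ss[OF that] by (simp add: D_def)
  have Dnn: "D a \<ge> 0" if "a \<in> A" for a using Dpos[OF that] by simp
  have \<zeta>F: "\<zeta> b \<in> borel_measurable (F (s a))" if "a \<in> A" "b \<in> A" "s b \<le> s a" for a b
    by (rule measurable_F_mono[OF \<zeta>[OF that(2)]]) (use ss[OF that(1)] ss[OF that(2)] that in auto)
  have VF: "V a \<in> borel_measurable (F (s a))" if "a \<in> A" for a
    unfolding V_def[abs_def] using \<zeta>F that by (intro borel_measurable_sum) (auto intro!: borel_measurable_times borel_measurable_power)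
  have \<zeta>'F: "\<zeta>' a \<in> borel_measurable (F (s a))" if a: "a \<in> A" for a
    unfolding \<zeta>'_def[abs_def] using VF[OF a] \<zeta>[OF a] by measurable
  have VD: "(\<zeta> a \<omega>)\<^sup>2 * D a \<le> V a \<omega>" if a: "a \<in> A" for a \<omega>
    unfolding V_def using a fin Dnn
    by (intro member_le_sum[of a "{b\<in>A. s b \<le> s a}" "\<lambda>b. (\<zeta> b \<omega>)\<^sup>2 * D b"]) (auto intro!: mult_nonneg_nonneg)
  \<comment> \<open>A surviving weight satisfies
    \<open>\<zeta>\<^sup>2 * D \<le> V \<le> \<delta>\<close>. Truncation thus yields bounded
    weights, and with them all the integrability needed below.\<close>
  have bound: "\<bar>\<zeta>' a \<omega>\<bar> \<le> sqrt (\<delta> / D a)" if a: "a \<in> A" for a \<omega>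
  proof (cases "V a \<omega> \<le> \<delta>")
    case True
    then have "(\<zeta>' a \<omega>)\<^sup>2 * D a \<le> \<delta>" using VD[OF a, of \<omega>] by (simp add: \<zeta>'_def)
    then have "(\<zeta>' a \<omega>)\<^sup>2 \<le> \<delta> / D a" using Dpos[OF a] by (simp add: field_simps)
    then show ?thesis by (metis real_sqrt_abs real_sqrt_le_iff)
  qed (use \<delta> Dpos[OF a] in \<open>auto simp: \<zeta>'_def\<close>)
  have dWM: "dW a \<in> borel_measurable M" if "a \<in> A" for a
    unfolding dW_def[abs_def] using ss[OF that] by (intro borel_measurable_diff W_measurable_M) auto
  have \<zeta>'M: "\<zeta>' a \<in> borel_measurable M" if a: "a \<in> A" for a
    by (rule measurable_F_M[OF \<zeta>'F[OF a]]) (use ss[OF a] in auto)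
  have dWF: "dW a \<in> borel_measurable (F (s b))" if "a \<in> A" "b \<in> A" "s' a \<le> s b" for a b
    unfolding dW_def[abs_def] using ss[OF that(1)] ss[OF that(2)] that(3)
    by (intro borel_measurable_diff W_measurable_later) auto
  have dW2: "integrable M (\<lambda>\<omega>. (dW a \<omega>)\<^sup>2)" if "a \<in> A" for a
    unfolding dW_def using increment_moments(1)[of "s a" "s' a" 2] ss[OF that] by auto
  have dWint: "integrable M (dW a)" if "a \<in> A" for a
    unfolding dW_def[abs_def] using increment_moments(1)[of "s a" "s' a" 1] ss[OF that] by auto
  have int: "integrable M (\<lambda>\<omega>. x a \<omega> * x b \<omega>)" if a: "a \<in> A" and b: "b \<in> A" for a b
  proof (rule Bochner_Integration.integrable_bound)
    let ?C = "sqrt (\<delta> / D a) * sqrt (\<delta> / D b)"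
    show "integrable M (\<lambda>\<omega>. ?C * ((dW a \<omega>)\<^sup>2 + (dW b \<omega>)\<^sup>2))"
      using dW2 a b by auto
    show "(\<lambda>\<omega>. x a \<omega> * x b \<omega>) \<in> borel_measurable M"
      unfolding x_def using \<zeta>'M dWM a b by (intro borel_measurable_times) auto
    show "AE \<omega> in M. norm (x a \<omega> * x b \<omega>) \<le> norm (?C * ((dW a \<omega>)\<^sup>2 + (dW b \<omega>)\<^sup>2))"
    proof (rule AE_I2)
      fix \<omega>
      have 1: "\<bar>\<zeta>' a \<omega>\<bar> * \<bar>\<zeta>' b \<omega>\<bar> \<le> ?C"
        by (intro mult_mono bound a b) (use \<delta> Dnn[OF a] in auto)
      have 2: "\<bar>dW a \<omega>\<bar> * \<bar>dW b \<omega>\<bar> \<le> (dW a \<omega>)\<^sup>2 + (dW b \<omega>)\<^sup>2"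
      proof -
        have "2 * (\<bar>dW a \<omega>\<bar> * \<bar>dW b \<omega>\<bar>) \<le> (dW a \<omega>)\<^sup>2 + (dW b \<omega>)\<^sup>2"
          using sum_squares_bound[of "\<bar>dW a \<omega>\<bar>" "\<bar>dW b \<omega>\<bar>"] by (simp add: mult.assoc)
        moreover have "0 \<le> \<bar>dW a \<omega>\<bar> * \<bar>dW b \<omega>\<bar>" by simp
        ultimately show ?thesis by linarith
      qed
      have C0: "0 \<le> ?C" using \<delta> Dpos[OF a] Dpos[OF b] by simp
      have "norm (x a \<omega> * x b \<omega>) = (\<bar>\<zeta>' a \<omega>\<bar> * \<bar>\<zeta>' b \<omega>\<bar>) * (\<bar>dW a \<omega>\<bar> * \<bar>dW b \<omega>\<bar>)"
        by (simp add: x_def abs_mult)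
      also have "\<dots> \<le> ?C * ((dW a \<omega>)\<^sup>2 + (dW b \<omega>)\<^sup>2)"
        by (rule mult_mono[OF 1 2 C0]) auto
      finally show "norm (x a \<omega> * x b \<omega>) \<le> norm (?C * ((dW a \<omega>)\<^sup>2 + (dW b \<omega>)\<^sup>2))"
        by (simp only: real_norm_def)
    qed
  qed
  \<comment> \<open>Everything except the later increment is measurable at its starting time, so the
    product has expectation zero by independence.\<close>
  have orth1: "expectation (\<lambda>\<omega>. x a \<omega> * x b \<omega>) = 0"
    if a: "a \<in> A" and b: "b \<in> A" and le: "s' a \<le> s b" for a b
  proof -
    let ?Y = "\<lambda>\<omega>. \<zeta>' b \<omega> * (\<zeta>' a \<omega> * dW a \<omega>)"
    have le': "s a \<le> s b" using le ss[OF a] by auto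
    have YF: "?Y \<in> borel_measurable (F (s b))"
      using \<zeta>'F[OF b] dWF[OF a b le] measurable_F_mono[OF \<zeta>'F[OF a], of "s b"] ss[OF a] ss[OF b] le'
      by (intro borel_measurable_times) auto
    have Yint: "integrable M ?Y"
    proof (rule Bochner_Integration.integrable_bound)
      let ?C = "sqrt (\<delta> / D b) * sqrt (\<delta> / D a)"
      show "integrable M (\<lambda>\<omega>. ?C * dW a \<omega>)" using dWint[OF a] by auto
      show "?Y \<in> borel_measurable M" using \<zeta>'M dWM a b by (intro borel_measurable_times) auto
      show "AE \<omega> in M. norm (?Y \<omega>) \<le> norm (?C * dW a \<omega>)"
      proof (rule AE_I2)
        fix \<omega>
        have "\<bar>\<zeta>' b \<omega>\<bar> * \<bar>\<zeta>' a \<omega>\<bar> \<le> ?C"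
          using bound[OF a] bound[OF b] \<delta> Dpos[OF b] by (intro mult_mono) auto
        from mult_right_mono[OF this, of "\<bar>dW a \<omega>\<bar>"]
        have "norm (?Y \<omega>) \<le> ?C * \<bar>dW a \<omega>\<bar>" by (simp add: abs_mult mult.assoc)
        also have "\<dots> = norm (?C * dW a \<omega>)"
        proof -
          have "0 \<le> ?C" using \<delta> Dpos[OF a] Dpos[OF b] by simp
          then show ?thesis by (simp only: real_norm_def abs_mult[of ?C] abs_of_nonneg)
        qed
        finally show "norm (?Y \<omega>) \<le> norm (?C * dW a \<omega>)" .
      qed
    qed
    have dWb: "integrable M (\<lambda>\<omega>. (\<lambda>x. x) (W (s' b) \<omega> - W (s b) \<omega>))"
      using dWint[OF b] unfolding dW_def .
    have "expectation (\<lambda>\<omega>. ?Y \<omega> * (W (s' b) \<omega> - W (s b) \<omega>))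
        = expectation ?Y * expectation (\<lambda>\<omega>. W (s' b) \<omega> - W (s b) \<omega>)"
      by (rule expectation_mult_increment(2)[of "s b" "s' b" ?Y "\<lambda>x. x", OF _ _ _ YF Yint _ dWb])
        (use ss[OF b] in auto)
    also have "\<dots> = 0"
      using increment_moments(2)[of "s b" "s' b"] ss[OF b] by simp
    finally have "expectation (\<lambda>\<omega>. ?Y \<omega> * (W (s' b) \<omega> - W (s b) \<omega>)) = 0" .
    moreover have "x a \<omega> * x b \<omega> = ?Y \<omega> * (W (s' b) \<omega> - W (s b) \<omega>)" for \<omega>
      unfolding x_def dW_def by (simp only: mult_ac)
    ultimately show ?thesis by (simp only:)
  qed
  have orth: "expectation (\<lambda>\<omega>. x a \<omega> * x b \<omega>) = 0"
    if "a \<in> A" "b \<in> A" "a \<noteq> b" for a b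
    using disj[OF that] orth1[of a b] orth1[of b a] that by (auto simp: mult.commute)
  have \<zeta>'2: "integrable M (\<lambda>\<omega>. (\<zeta>' a \<omega>)\<^sup>2)" if a: "a \<in> A" for a
  proof (rule integrable_const_bound[where B = "\<delta> / D a"])
    show "AE \<omega> in M. norm ((\<zeta>' a \<omega>)\<^sup>2) \<le> \<delta> / D a"
    proof (rule AE_I2)
      fix \<omega> show "norm ((\<zeta>' a \<omega>)\<^sup>2) \<le> \<delta> / D a"
        using power_mono[OF bound[OF a, of \<omega>], of 2] \<delta> Dpos[OF a] by simp
    qed
  qed (use \<zeta>'M[OF a] in measurable)
  have diag: "expectation (\<lambda>\<omega>. (x a \<omega>)\<^sup>2) = expectation (\<lambda>\<omega>. (\<zeta>' a \<omega>)\<^sup>2 * D a)" if a: "a \<in> A" for a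
    using expectation_mult_increment(2)[of "s a" "s' a" "\<lambda>\<omega>. (\<zeta>' a \<omega>)\<^sup>2" "\<lambda>x. x\<^sup>2"] ss[OF a] \<zeta>'F[OF a]
      \<zeta>'2[OF a] dW2[OF a] increment_moments(3)[of "s a" "s' a"]
    by (simp add: x_def power_mult_distrib dW_def D_def)
  have trunc: "(\<Sum>a\<in>A. (\<zeta>' a \<omega>)\<^sup>2 * D a) \<le> \<delta>" for \<omega>
  proof (cases "\<exists>a\<in>A. V a \<omega> \<le> \<delta>")
    case True
    let ?G = "{a\<in>A. V a \<omega> \<le> \<delta>}"
    have G: "finite ?G" "?G \<noteq> {}" using fin True by auto
    \<comment> \<open>The survivor that starts last: every other survivor starts no later, so all
      surviving variances are summands of its \<open>V\<close>, which is at most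
      \<open>\<delta>\<close>.\<close>
    obtain a where a: "a \<in> ?G" and amax: "\<And>b. b \<in> ?G \<Longrightarrow> s b \<le> s a"
    proof -
      have "Max (s ` ?G) \<in> s ` ?G" using G by (intro Max_in) auto
      then obtain a where "a \<in> ?G" "s a = Max (s ` ?G)" by auto
      then show ?thesis using that G by (metis (no_types, lifting) Max_ge finite_imageI imageI)
    qed
    have "(\<Sum>a\<in>A. (\<zeta>' a \<omega>)\<^sup>2 * D a) = (\<Sum>a\<in>?G. (\<zeta> a \<omega>)\<^sup>2 * D a)"
      using fin by (intro sum.mono_neutral_cong_right) (auto simp: \<zeta>'_def)
    also have "\<dots> \<le> V a \<omega>"
      unfolding V_def[of a \<omega>] using fin amax Dnn
      by (intro sum_mono2) (auto intro!: mult_nonneg_nonneg)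
    also have "\<dots> \<le> \<delta>" using a by simp
    finally show ?thesis .
  next
    case False
    then show ?thesis using \<delta> by (simp add: \<zeta>'_def)
  qed
  \<comment> \<open>Orthogonality removes the cross terms inside each block, and the blocks
    partition \<open>A\<close>; the expected sum of squared block sums is therefore the total
    variance, whatever the grouping.\<close>
  let ?A = "\<lambda>i. {a\<in>A. \<beta> a = i}"
  define S' where "S' \<omega> = (\<Sum>i\<in>B. (\<Sum>a\<in>?A i. x a \<omega>)\<^sup>2)" for \<omega>
  have blk: "integrable M (\<lambda>\<omega>. (\<Sum>a\<in>?A i. x a \<omega>)\<^sup>2)"
    "expectation (\<lambda>\<omega>. (\<Sum>a\<in>?A i. x a \<omega>)\<^sup>2) = (\<Sum>a\<in>?A i. expectation (\<lambda>\<omega>. (x a \<omega>)\<^sup>2))" for i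
    using expectation_square_sum_orthogonal[of "?A i" M x] fin int orth by auto
  have S'int: "integrable M S'" unfolding S'_def[abs_def] using blk by auto
  have "expectation S' = (\<Sum>i\<in>B. \<Sum>a\<in>?A i. expectation (\<lambda>\<omega>. (x a \<omega>)\<^sup>2))"
    unfolding S'_def using blk by (simp add: Bochner_Integration.integral_sum)
  also have "\<dots> = (\<Sum>a\<in>A. expectation (\<lambda>\<omega>. (x a \<omega>)\<^sup>2))"
    using sum.group[OF fin, of \<beta>] \<beta> by auto
  also have "\<dots> = expectation (\<lambda>\<omega>. \<Sum>a\<in>A. (\<zeta>' a \<omega>)\<^sup>2 * D a)"
    using diag \<zeta>'2 by (simp add: Bochner_Integration.integral_sum)
  also have "\<dots> \<le> expectation (\<lambda>_. \<delta>)"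
    using trunc \<zeta>'2 by (intro integral_mono) auto
  also have "\<dots> = \<delta>" by (simp add: prob_space)
  finally have ES': "expectation S' \<le> \<delta>" .
  have S'nn: "S' \<omega> \<ge> 0" for \<omega> by (simp add: S'_def sum_nonneg)
  have "prob {\<omega>\<in>space M. \<epsilon> \<le> S' \<omega>} \<le> expectation S' / \<epsilon>"
    using integral_Markov_inequality_measure[OF S'int, of "{}" \<epsilon>] \<epsilon> S'nn by simp
  also have "\<dots> \<le> \<delta> / \<epsilon>" using ES' \<epsilon> by (simp add: divide_right_mono)
  finally have markov: "prob {\<omega>\<in>space M. \<epsilon> \<le> S' \<omega>} \<le> \<delta> / \<epsilon>" .
  have SM: "S' \<in> borel_measurable M" using S'int by auto
  have \<zeta>M: "\<zeta> a \<in> borel_measurable M" if "a \<in> A" for a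
    by (rule measurable_F_M[OF \<zeta>[OF that]]) (use ss[OF that] in auto)
  have sumM: "(\<lambda>\<omega>. \<Sum>a\<in>A. (\<zeta> a \<omega>)\<^sup>2 * D a) \<in> borel_measurable M"
    using \<zeta>M by (intro borel_measurable_sum) auto
  let ?R = "{\<omega>\<in>E. \<delta> < (\<Sum>a\<in>A. (\<zeta> a \<omega>)\<^sup>2 * D a)}"
  have Rev: "?R \<in> events"
  proof -
    have "?R = E \<inter> {\<omega>\<in>space M. \<delta> < (\<Sum>a\<in>A. (\<zeta> a \<omega>)\<^sup>2 * D a)}"
      using sets.sets_into_space[OF E] by auto
    then show ?thesis using E sumM by auto
  qed
  \<comment> \<open>Outside \<open>?R\<close> the total variance is at most \<open>\<delta>\<close>,
    hence so is every \<open>V\<close>, and no weight is truncated.\<close>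
  have sub: "{\<omega>\<in>E. \<epsilon> < (\<Sum>i\<in>B. (\<Sum>a\<in>?A i. \<zeta> a \<omega> * dW a \<omega>)\<^sup>2)} \<subseteq> {\<omega>\<in>space M. \<epsilon> \<le> S' \<omega>} \<union> ?R"
  proof
    fix \<omega> assume \<omega>: "\<omega> \<in> {\<omega>\<in>E. \<epsilon> < (\<Sum>i\<in>B. (\<Sum>a\<in>?A i. \<zeta> a \<omega> * dW a \<omega>)\<^sup>2)}"
    show "\<omega> \<in> {\<omega>\<in>space M. \<epsilon> \<le> S' \<omega>} \<union> ?R"
    proof (cases "\<delta> < (\<Sum>a\<in>A. (\<zeta> a \<omega>)\<^sup>2 * D a)")
      case False
      have "V a \<omega> \<le> (\<Sum>a\<in>A. (\<zeta> a \<omega>)\<^sup>2 * D a)" for a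
        unfolding V_def using fin Dnn by (intro sum_mono2) (auto intro!: mult_nonneg_nonneg)
      then have "V a \<omega> \<le> \<delta>" for a using False by (meson not_less order_trans)
      then have "S' \<omega> = (\<Sum>i\<in>B. (\<Sum>a\<in>?A i. \<zeta> a \<omega> * dW a \<omega>)\<^sup>2)"
        by (simp add: S'_def x_def \<zeta>'_def)
      then show ?thesis using \<omega> sets.sets_into_space[OF E] by auto
    qed (use \<omega> in auto)
  qed
  have "prob {\<omega>\<in>E. \<epsilon> < (\<Sum>i\<in>B. (\<Sum>a\<in>?A i. \<zeta> a \<omega> * dW a \<omega>)\<^sup>2)}
      \<le> prob ({\<omega>\<in>space M. \<epsilon> \<le> S' \<omega>} \<union> ?R)"
    using SM Rev by (intro finite_measure_mono[OF sub]) auto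
  also have "\<dots> \<le> prob {\<omega>\<in>space M. \<epsilon> \<le> S' \<omega>} + prob ?R"
    using SM Rev by (intro measure_Un_le) auto
  finally show ?thesis using markov by (simp add: dW_def D_def)
qed

end

section \<open>Riemann sums\<close>

lemma LINT_atLeastAtMost_eq_integral:
  fixes h :: "real \<Rightarrow> real"
  assumes "continuous_on {a..b} h"
  shows "(LINT s:{a..b}|lborel. h s) = integral {a..b} h"
  by (rule set_borel_integral_eq_integral(2)[OF borel_integrable_atLeastAtMost'[OF assms]])

lemma partition_monotone:
  fixes p :: "nat \<Rightarrow> real"
  assumes "\<And>i. i < N \<Longrightarrow> p i \<le> p (Suc i)" "i \<le> j" "j \<le> N"
  shows "p i \<le> p j"
  using assms(2,3)
proof (induction j rule: dec_induct)
  case (step j)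
  then show ?case using assms(1)[of j] by (meson Suc_leD Suc_le_lessD order_trans)
qed simp

lemma partition_sequenceD:
  assumes "partition_sequence t N p"
  shows "p j 0 = 0" "p j (N j) = t" "i < N j \<Longrightarrow> p j i \<le> p j (Suc i)"
    "i \<le> k \<Longrightarrow> k \<le> N j \<Longrightarrow> p j i \<le> p j k" "i \<le> N j \<Longrightarrow> p j i \<in> {0..t}"
    "(\<Sum>i<N j. p j (Suc i) - p j i) = t"
proof -
  show *: "p j 0 = 0" "p j (N j) = t" "i < N j \<Longrightarrow> p j i \<le> p j (Suc i)" for i
    using assms by (auto simp: partition_sequence_def)
  show **: "i \<le> k \<Longrightarrow> k \<le> N j \<Longrightarrow> p j i \<le> p j k" for i k
    using partition_monotone[of "N j" "p j"] *(3) by blast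
  show "i \<le> N j \<Longrightarrow> p j i \<in> {0..t}"
    using **[of 0 i] **[of i "N j"] * by auto
  show "(\<Sum>i<N j. p j (Suc i) - p j i) = t"
    using sum_lessThan_telescope[of "p j" "N j"] * by simp
qed

lemma partition_sequence_mesh:
  "partition_sequence t N p \<Longrightarrow> \<delta> > 0 \<Longrightarrow> \<forall>\<^sub>F j in sequentially. \<forall>i<N j. p j (Suc i) - p j i < \<delta>"
  by (auto simp: partition_sequence_def)

lemma partition_sequence_subseq:
  assumes "partition_sequence t N p" "strict_mono r"
  shows "partition_sequence t (N \<circ> r) (p \<circ> r)"
  unfolding partition_sequence_def comp_def
proof (intro conjI allI impI)
  fix \<delta> :: real assume "\<delta> > 0"
  from partition_sequence_mesh[OF assms(1) this]
  show "\<forall>\<^sub>F j in sequentially. \<forall>i<N (r j). p (r j) (Suc i) - p (r j) i < \<delta>"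
    using filterlim_subseq[OF assms(2)] by (auto simp: filterlim_iff)
qed (use assms in \<open>auto simp: partition_sequence_def\<close>)

text \<open>A witness that partition sequences exist. Uniqueness of the covariation would be vacuous
  without one, and time integrals are shown measurable as limits along this one.\<close>

lemma uniform_partition_sequence:
  assumes "t \<ge> 0"
  shows "partition_sequence t (\<lambda>j. Suc j) (\<lambda>j i. t * real i / real (Suc j))"
  unfolding partition_sequence_def
proof (intro conjI allI impI)
  fix \<delta> :: real assume \<delta>: "\<delta> > 0"
  have "(\<lambda>j. t / real (Suc j)) \<longlonglongrightarrow> 0"
    by (rule LIMSEQ_Suc) (rule lim_const_over_n)
  then have "\<forall>\<^sub>F j in sequentially. t / real (Suc j) < \<delta>"
    using \<delta> by (rule order_tendstoD)
  then show "\<forall>\<^sub>F j in sequentially. \<forall>i<Suc j.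
      t * real (Suc i) / real (Suc j) - t * real i / real (Suc j) < \<delta>"
    by eventually_elim (auto simp: field_simps simp flip: diff_divide_distrib)
next
  fix j i assume "i < Suc j"
  show "t * real i / real (Suc j) \<le> t * real (Suc i) / real (Suc j)"
    using assms by (intro divide_right_mono mult_left_mono) auto
qed auto

text \<open>Serves two purposes: with \<open>y\<close> the value at the left end it gives
  convergence of Riemann sums, with \<open>y = 0\<close> it bounds the increments of the drift by
  the length of the interval.\<close>

lemma continuous_integral_increment_bound:
  fixes h :: "real \<Rightarrow> real"
  assumes h: "continuous_on {0..t} h" and ab: "0 \<le> a" "a \<le> b" "b \<le> t"
    and C: "\<And>s. s \<in> {a..b} \<Longrightarrow> \<bar>h s - y\<bar> \<le> C"
  shows "\<bar>(LINT s:{0..b}|lborel. h s) - (LINT s:{0..a}|lborel. h s) - y * (b - a)\<bar> \<le> C * (b - a)"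
proof -
  have ca: "continuous_on {0..a} h" and cb: "continuous_on {0..b} h" and cab: "continuous_on {a..b} h"
    using ab by (auto intro: continuous_on_subset[OF h])
  have "integral {0..a} h + integral {a..b} h = integral {0..b} h"
    using ab cb by (intro Henstock_Kurzweil_Integration.integral_combine integrable_continuous_real) auto
  moreover have "integral {a..b} (\<lambda>s. h s - y) = integral {a..b} h - y * (b - a)"
    using ab cab by (subst integral_diff) (auto intro: integrable_continuous_real)
  moreover have "norm (integral {a..b} (\<lambda>s. h s - y)) \<le> C * (b - a)"
    using ab cab C by (intro integral_bound) (auto intro!: continuous_intros)
  ultimately show ?thesis
    using LINT_atLeastAtMost_eq_integral[OF ca] LINT_atLeastAtMost_eq_integral[OF cb] by simp
qed

lemma riemann_sums_tendsto:
  assumes P: "partition_sequence t N p" and h: "continuous_on {0..t} h"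
  shows "(\<lambda>j. \<Sum>i<N j. h (p j i) * (p j (Suc i) - p j i)) \<longlonglongrightarrow> (LINT s:{0..t}|lborel. h s)"
proof (rule LIMSEQ_I)
  fix \<epsilon> :: real assume \<epsilon>: "\<epsilon> > 0"
  note D = partition_sequenceD[OF P]
  have t0: "t \<ge> 0" using D(5)[of 0 0] by simp
  \<comment> \<open>The summand 1 keeps the denominator positive when \<open>t = 0\<close>.\<close>
  define e where "e = \<epsilon> / (t + 1)"
  have e: "e > 0" using \<epsilon> t0 by (simp add: e_def)
  have "uniformly_continuous_on {0..t} h" using h by (intro compact_uniformly_continuous) auto
  then obtain d where d: "d > 0" "\<And>x y. x \<in> {0..t} \<Longrightarrow> y \<in> {0..t} \<Longrightarrow> dist y x < d \<Longrightarrow> dist (h y) (h x) < e"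
    using e unfolding uniformly_continuous_on_def by metis
  let ?I = "\<lambda>b. LINT s:{0..b}|lborel. h s"
  have "\<forall>\<^sub>F j in sequentially. norm ((\<Sum>i<N j. h (p j i) * (p j (Suc i) - p j i)) - ?I t) < \<epsilon>"
    using partition_sequence_mesh[OF P d(1)]
  proof eventually_elim
    case (elim j)
    have step: "\<bar>?I (p j (Suc i)) - ?I (p j i) - h (p j i) * (p j (Suc i) - p j i)\<bar> \<le> e * (p j (Suc i) - p j i)"
      if i: "i < N j" for i
    proof (rule continuous_integral_increment_bound[OF h])
      show "0 \<le> p j i" "p j i \<le> p j (Suc i)" "p j (Suc i) \<le> t"
        using D(5)[of i j] D(5)[of "Suc i" j] D(3)[of i j] i by auto
      fix s assume "s \<in> {p j i..p j (Suc i)}"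
      then show "\<bar>h s - h (p j i)\<bar> \<le> e"
        using d(2)[of "p j i" s] elim[rule_format, OF i] D(5)[of i j] D(5)[of "Suc i" j] i
        by (auto simp: dist_real_def)
    qed
    have "?I t - (\<Sum>i<N j. h (p j i) * (p j (Suc i) - p j i))
        = (\<Sum>i<N j. ?I (p j (Suc i)) - ?I (p j i) - h (p j i) * (p j (Suc i) - p j i))"
    proof -
      have "?I 0 = 0" using LINT_atLeastAtMost_eq_integral[of 0 0 h] by simp
      then have "?I t = (\<Sum>i<N j. ?I (p j (Suc i)) - ?I (p j i))"
        using sum_lessThan_telescope[of "\<lambda>i. ?I (p j i)" "N j"] D(1)[of j] D(2)[of j] by simp
      then show ?thesis by (simp add: sum_subtractf)
    qed
    then have "\<bar>?I t - (\<Sum>i<N j. h (p j i) * (p j (Suc i) - p j i))\<bar> \<le> (\<Sum>i<N j. e * (p j (Suc i) - p j i))"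
      using step by (auto intro!: sum_abs[THEN order_trans] sum_mono)
    also have "\<dots> = e * t" using D(6)[of j] by (simp flip: sum_distrib_left)
    also have "\<dots> < \<epsilon>" using \<epsilon> t0 by (simp add: e_def field_simps)
    finally show ?case by (simp add: abs_minus_commute)
  qed
  then show "\<exists>no. \<forall>n\<ge>no. norm ((\<Sum>i<N n. h (p n i) * (p n (Suc i) - p n i)) - ?I t) < \<epsilon>"
    by (simp add: eventually_sequentially)
qed

text \<open>Replacing \<open>h\<close> by its values on a fine grid costs at most a small multiple
  of the bound \<open>C\<close> on the absolute sums. With frozen weights the sum is a finite
  combination of differences of initial-segment sums. A rational grid suffices, so countably many
  thresholds \<open>r\<close> are involved.\<close>

lemma weighted_sums_tendsto_0:
  fixes p z :: "nat \<Rightarrow> nat \<Rightarrow> real" and h :: "real \<Rightarrow> real"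
  assumes h: "continuous_on {0..t} h" and p: "\<And>j i. i < N j \<Longrightarrow> p j i \<in> {0..t}"
    and C: "\<And>j. (\<Sum>i<N j. \<bar>z j i\<bar>) \<le> C"
    and S: "\<And>r. r \<in> \<rat> \<Longrightarrow> (\<lambda>j. \<Sum>i\<in>{i. i < N j \<and> p j i < r}. z j i) \<longlonglongrightarrow> 0"
  shows "(\<lambda>j. \<Sum>i<N j. h (p j i) * z j i) \<longlonglongrightarrow> 0"
proof (rule LIMSEQ_I)
  fix \<epsilon> :: real assume \<epsilon>: "\<epsilon> > 0"
  have C0: "C \<ge> 0" using C[of 0] by (meson abs_ge_zero order_trans sum_nonneg)
  define e where "e = \<epsilon> / (2 * (C + 1))"
  have e: "e > 0" using \<epsilon> C0 by (simp add: e_def)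
  have "uniformly_continuous_on {0..t} h" using h by (intro compact_uniformly_continuous) auto
  then obtain d where d: "d > 0" "\<And>x y. x \<in> {0..t} \<Longrightarrow> y \<in> {0..t} \<Longrightarrow> dist y x < d \<Longrightarrow> dist (h y) (h x) < e"
    using e unfolding uniformly_continuous_on_def by metis
  obtain m where m: "1 / real (Suc m) < d" using d(1) by (rule nat_approx_posE)
  \<comment> \<open>\<open>k x\<close> numbers the grid cell containing \<open>x\<close>, and
    \<open>g\<close> gives the left end of a cell. The grid has spacing
    \<open>1 / real (Suc m)\<close> and hence rational points.\<close>
  define k where "k x = nat \<lfloor>x * real (Suc m)\<rfloor>" for x
  define g where "g a = real a / real (Suc m)" for a :: nat
  have k: "k x = a \<longleftrightarrow> g a \<le> x \<and> x < g (Suc a)" if "x \<ge> 0" for x a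
  proof -
    have "k x = a \<longleftrightarrow> \<lfloor>x * real (Suc m)\<rfloor> = int a" using that by (auto simp: k_def)
    also have "\<dots> \<longleftrightarrow> real a \<le> x * real (Suc m) \<and> x * real (Suc m) < real a + 1"
      by (auto simp: floor_eq_iff)
    also have "\<dots> \<longleftrightarrow> g a \<le> x \<and> x < g (Suc a)" by (auto simp: g_def field_simps)
    finally show ?thesis .
  qed
  have gk: "g (k x) \<in> {0..t}" "dist x (g (k x)) < d" if "x \<in> {0..t}" for x
  proof -
    have "g (k x) \<le> x \<and> x < g (Suc (k x))" using k[of x "k x"] that by simp
    moreover have "g (Suc (k x)) = g (k x) + 1 / real (Suc m)"
      by (simp add: g_def add_divide_distrib del: of_nat_Suc) (simp add: add_divide_distrib)
    moreover have "0 \<le> g (k x)" by (simp add: g_def)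
    moreover have "0 \<le> x" "x \<le> t" using that by auto
    ultimately show "g (k x) \<in> {0..t}" "dist x (g (k x)) < d"
      using m unfolding atLeastAtMost_iff dist_real_def by linarith+
  qed
  define n where "n = Suc (k t)"
  have kn: "k x < n" if "x \<in> {0..t}" for x
    using that by (auto simp: n_def k_def less_Suc_eq_le intro!: nat_mono floor_mono mult_right_mono)
  let ?S = "\<lambda>r j. \<Sum>i\<in>{i. i < N j \<and> p j i < r}. z j i"
  have gQ: "g a \<in> \<rat>" for a by (simp add: g_def Rats_divide)
  \<comment> \<open>A cell is half-open, so its indices are exactly those below its right end minus
    those below its left end; the strict inequality in the initial segments matches this.\<close>
  have blk: "(\<Sum>i\<in>{i. i < N j \<and> k (p j i) = a}. z j i) = ?S (g (Suc a)) j - ?S (g a) j" for a j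
  proof -
    have g: "g a \<le> g (Suc a)" by (simp add: g_def divide_right_mono)
    have "{i. i < N j \<and> k (p j i) = a} = {i. i < N j \<and> p j i < g (Suc a)} - {i. i < N j \<and> p j i < g a}"
    proof (rule set_eqI)
      fix i
      show "i \<in> {i. i < N j \<and> k (p j i) = a} \<longleftrightarrow>
          i \<in> {i. i < N j \<and> p j i < g (Suc a)} - {i. i < N j \<and> p j i < g a}"
        using k[of "p j i" a] p[of i j] by auto
    qed
    moreover have "{i. i < N j \<and> p j i < g a} \<subseteq> {i. i < N j \<and> p j i < g (Suc a)}"
      using g by auto
    ultimately show ?thesis by (simp add: sum_diff)
  qed
  have "(\<lambda>j. \<Sum>a<n. h (g a) * (?S (g (Suc a)) j - ?S (g a) j)) \<longlonglongrightarrow> (\<Sum>a<n. h (g a) * (0 - 0))"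
    by (intro tendsto_intros S gQ)
  then have "\<forall>\<^sub>F j in sequentially. \<bar>\<Sum>a<n. h (g a) * (?S (g (Suc a)) j - ?S (g a) j)\<bar> < \<epsilon> / 2"
    using order_tendstoD(2)[OF tendsto_rabs_zero, of _ _ "\<epsilon> / 2"] \<epsilon> by simp
  then have "\<forall>\<^sub>F j in sequentially. norm ((\<Sum>i<N j. h (p j i) * z j i) - 0) < \<epsilon>"
  proof eventually_elim
    case (elim j)
    have "(\<Sum>i<N j. h (g (k (p j i))) * z j i)
        = (\<Sum>a<n. \<Sum>i\<in>{i\<in>{..<N j}. k (p j i) = a}. h (g (k (p j i))) * z j i)"
      by (rule sum.group[symmetric]) (use kn p in auto)
    also have "\<dots> = (\<Sum>a<n. h (g a) * (?S (g (Suc a)) j - ?S (g a) j))"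
      unfolding blk[symmetric] sum_distrib_left by (intro sum.cong refl) auto
    finally have main: "\<bar>\<Sum>i<N j. h (g (k (p j i))) * z j i\<bar> < \<epsilon> / 2" using elim by simp
    have "\<bar>(\<Sum>i<N j. h (p j i) * z j i) - (\<Sum>i<N j. h (g (k (p j i))) * z j i)\<bar>
        \<le> (\<Sum>i<N j. \<bar>h (p j i) - h (g (k (p j i)))\<bar> * \<bar>z j i\<bar>)"
      by (simp add: sum_subtractf[symmetric] left_diff_distrib[symmetric] abs_mult[symmetric])
    also have "\<dots> \<le> (\<Sum>i<N j. e * \<bar>z j i\<bar>)"
    proof (rule sum_mono)
      fix i assume "i \<in> {..<N j}"
      then have "p j i \<in> {0..t}" using p by auto
      then have "\<bar>h (p j i) - h (g (k (p j i)))\<bar> \<le> e"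
        using d(2)[OF gk(1) _ gk(2), of "p j i"] by (auto simp: dist_real_def)
      then show "\<bar>h (p j i) - h (g (k (p j i)))\<bar> * \<bar>z j i\<bar> \<le> e * \<bar>z j i\<bar>"
        by (rule mult_right_mono) simp
    qed
    also have "\<dots> \<le> e * C" using C[of j] e by (simp flip: sum_distrib_left)
    also have "\<dots> < \<epsilon> / 2" using \<epsilon> C0 by (simp add: e_def field_simps)
    finally show ?case using main unfolding real_norm_def by linarith
  qed
  then show "\<exists>no. \<forall>n\<ge>no. norm ((\<Sum>i<N n. h (p n i) * z n i) - 0) < \<epsilon>"
    by (simp add: eventually_sequentially)
qed

section \<open>Convergence in probability\<close>

lemma strict_mono_choice:
  assumes "\<And>n. \<forall>\<^sub>F k in sequentially. P n k"
  shows "\<exists>r::nat \<Rightarrow> nat. strict_mono r \<and> (\<forall>n. P n (r n))"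
proof -
  have "\<exists>r. \<forall>n. P n (r n) \<and> r n < (r (Suc n) :: nat)"
  proof (rule dependent_nat_choice)
    show "\<exists>x. P 0 x" using assms[of 0] by (auto simp: eventually_sequentially)
    show "\<exists>y. P (Suc n) y \<and> x < y" for x n
      using eventually_conj[OF assms[of "Suc n"] eventually_gt_at_top[of x]]
      by (auto simp: eventually_sequentially)
  qed
  then show ?thesis by (auto simp: strict_mono_Suc_iff)
qed

context prob_space
begin

lemma prob_tendsto_0_AE:
  assumes A: "\<And>j. A j \<in> events" and ae: "AE \<omega> in M. \<forall>\<^sub>F j in sequentially. \<omega> \<notin> A j"
  shows "(\<lambda>j. prob (A j)) \<longlonglongrightarrow> 0"
proof -
  have "(\<lambda>j. expectation (indicator (A j) :: 'a \<Rightarrow> real)) \<longlonglongrightarrow> expectation (\<lambda>_. 0)"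
  proof (rule integral_dominated_convergence[where w = "\<lambda>_. 1"])
    show "AE \<omega> in M. (\<lambda>j. indicator (A j) \<omega> :: real) \<longlonglongrightarrow> 0"
      using ae
    proof eventually_elim
      case (elim \<omega>)
      then have "\<forall>\<^sub>F j in sequentially. indicator (A j) \<omega> = (0::real)" by eventually_elim auto
      then show ?case by (rule tendsto_eventually)
    qed
    show "AE \<omega> in M. norm (indicator (A j) \<omega> :: real) \<le> 1" for j
      by (rule AE_I2) (auto simp: indicator_def)
  qed (use A in auto)
  then show ?thesis using A by simp
qed

text \<open>A diagonal choice followed by Borel-Cantelli: at stage \<open>n\<close> the first
  \<open>n + 1\<close> sequences must all be within \<open>(1/2)^n\<close> of zero outside events of
  probability below \<open>(1/2)^n\<close>.\<close>

lemma tendsto_in_prob_common_subsequence: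
  fixes Z :: "'c \<Rightarrow> nat \<Rightarrow> 'a \<Rightarrow> real"
  assumes C: "countable C" and Z: "\<And>c. c \<in> C \<Longrightarrow> tendsto_in_prob_on M E (Z c) (\<lambda>_. 0)"
  shows "\<exists>r. strict_mono r \<and> (AE \<omega> in M. \<omega> \<in> E \<longrightarrow> (\<forall>c\<in>C. (\<lambda>j. Z c (r j) \<omega>) \<longlonglongrightarrow> 0))"
proof (cases "C = {}")
  case True
  then show ?thesis by (intro exI[of _ "\<lambda>n. n"]) (auto simp: strict_mono_def)
next
  case False
  define f where "f = from_nat_into C"
  have f: "f n \<in> C" for n using False by (simp add: f_def from_nat_into)
  define A where "A i n k = {\<omega>\<in>E. (1/2)^n < \<bar>Z (f i) k \<omega>\<bar>}" for i n k
  have Aev: "A i n k \<in> events" for i n k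
    using Z[OF f[of i]] by (auto simp: A_def tendsto_in_prob_on_def)
  have lim: "(\<lambda>k. prob (A i n k)) \<longlonglongrightarrow> 0" for i n
    using Z[OF f[of i]] by (auto simp: A_def tendsto_in_prob_on_def)
  have ev: "\<forall>\<^sub>F k in sequentially. \<forall>i\<in>{..n}. prob (A i n k) < (1/2)^n" for n
    by (intro eventually_ball_finite ballI order_tendstoD(2)[OF lim]) auto
  obtain r :: "nat \<Rightarrow> nat" where r: "strict_mono r"
    "\<And>n. \<forall>i\<in>{..n}. prob (A i n (r n)) < (1/2)^n"
    using strict_mono_choice[of "\<lambda>n k. \<forall>i\<in>{..n}. prob (A i n k) < (1/2)^n", OF ev] by auto
  have "AE \<omega> in M. \<omega> \<in> E \<longrightarrow> (\<lambda>n. Z (f i) (r n) \<omega>) \<longlonglongrightarrow> 0" for i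
  proof -
    have "summable (\<lambda>n. prob (A i n (r n)))"
    proof (rule summable_comparison_test)
      \<comment> \<open>The choice of \<open>r\<close> controls the sequence with number
        \<open>i\<close> only from stage \<open>i\<close> on, hence the witness
        \<open>i\<close>.\<close>
      show "\<exists>N. \<forall>n\<ge>N. norm (prob (A i n (r n))) \<le> (1/2::real)^n"
        using r(2) by (intro exI[of _ i]) (auto intro: less_imp_le)
    qed (simp add: summable_geometric)
    then have "AE \<omega> in M. \<forall>\<^sub>F n in sequentially. \<omega> \<in> space M - A i n (r n)"
      by (intro borel_cantelli_AE1) (auto simp: Aev emeasure_eq_measure)
    then show ?thesis
    proof eventually_elim
      case (elim \<omega>)
      show ?case
      proof
        assume "\<omega> \<in> E"
        with elim have "\<forall>\<^sub>F n in sequentially. norm (Z (f i) (r n) \<omega>) \<le> (1/2)^n"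
          by (auto elim!: eventually_mono simp: A_def)
        moreover have "(\<lambda>n. (1/2::real)^n) \<longlonglongrightarrow> 0" by (rule LIMSEQ_realpow_zero) auto
        ultimately show "(\<lambda>n. Z (f i) (r n) \<omega>) \<longlonglongrightarrow> 0"
          by (rule Lim_null_comparison)
      qed
    qed
  qed
  then have "AE \<omega> in M. \<forall>i. \<omega> \<in> E \<longrightarrow> (\<lambda>n. Z (f i) (r n) \<omega>) \<longlonglongrightarrow> 0"
    unfolding AE_all_countable by blast
  then have "AE \<omega> in M. \<omega> \<in> E \<longrightarrow> (\<forall>c\<in>C. (\<lambda>j. Z c (r j) \<omega>) \<longlonglongrightarrow> 0)"
  proof eventually_elim
    case (elim \<omega>)
    show ?case
    proof (intro impI ballI)
      fix c assume "\<omega> \<in> E" "c \<in> C"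
      moreover have "f (to_nat_on C c) = c"
        using from_nat_into_to_nat_on[OF C \<open>c \<in> C\<close>] by (simp add: f_def)
      ultimately show "(\<lambda>j. Z c (r j) \<omega>) \<longlonglongrightarrow> 0"
        using elim[rule_format, of "to_nat_on C c"] by simp
    qed
  qed
  then show ?thesis using r(1) by auto
qed

text \<open>If the probabilities stayed above some \<open>e\<close> along a subsequence, a further
  subsequence would converge almost surely, and dominated convergence of indicators would contradict
  this. Pathwise arguments along subsequences thus suffice for convergence in probability.\<close>

lemma tendsto_in_prob_subseqI:
  assumes meas: "\<And>\<epsilon> j. \<epsilon> > 0 \<Longrightarrow> {\<omega>\<in>E. \<epsilon> < \<bar>X j \<omega> - Y \<omega>\<bar>} \<in> events"
    and sub: "\<And>r::nat \<Rightarrow> nat. strict_mono r \<Longrightarrow> \<exists>r'. strict_mono r' \<and>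
      (AE \<omega> in M. \<omega> \<in> E \<longrightarrow> (\<lambda>j. X (r (r' j)) \<omega>) \<longlonglongrightarrow> Y \<omega>)"
  shows "tendsto_in_prob_on M E X Y"
  unfolding tendsto_in_prob_on_def
proof (intro allI impI conjI meas)
  fix \<epsilon> :: real assume \<epsilon>: "\<epsilon> > 0"
  let ?A = "\<lambda>j. {\<omega>\<in>E. \<epsilon> < \<bar>X j \<omega> - Y \<omega>\<bar>}"
  show "(\<lambda>j. prob (?A j)) \<longlonglongrightarrow> 0"
  proof (rule ccontr)
    assume "\<not> ?thesis"
    then obtain e where e: "e > 0" "\<not> (\<forall>\<^sub>F j in sequentially. prob (?A j) < e)"
      by (auto simp: tendsto_iff dist_real_def)
    then have "infinite {j. \<not> prob (?A j) < e}"
      by (simp add: not_eventually frequently_cofinite[symmetric] cofinite_eq_sequentially)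
    then obtain r :: "nat \<Rightarrow> nat" where r: "strict_mono r" "\<And>n. \<not> prob (?A (r n)) < e"
      by (auto dest!: infinite_enumerate)
    obtain r' where r': "strict_mono r'" "AE \<omega> in M. \<omega> \<in> E \<longrightarrow> (\<lambda>j. X (r (r' j)) \<omega>) \<longlonglongrightarrow> Y \<omega>"
      using sub[OF r(1)] by auto
    have "(\<lambda>j. prob (?A (r (r' j)))) \<longlonglongrightarrow> 0"
    proof (rule prob_tendsto_0_AE)
      show "AE \<omega> in M. \<forall>\<^sub>F j in sequentially. \<omega> \<notin> ?A (r (r' j))"
        using r'(2)
      proof eventually_elim
        case (elim \<omega>)
        show ?case
        proof (cases "\<omega> \<in> E")
          case True
          then have "\<forall>\<^sub>F j in sequentially. dist (X (r (r' j)) \<omega>) (Y \<omega>) < \<epsilon>"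
            using elim \<epsilon> by (auto simp: tendsto_iff)
          then show ?thesis by eventually_elim (auto simp: dist_real_def)
        qed auto
      qed
    qed (use meas \<epsilon> in auto)
    from order_tendstoD(2)[OF this e(1)] show False
      using r(2) by (auto simp: eventually_sequentially)
  qed
qed

text \<open>The differences to both limits are indexed by \<open>bool\<close>, which yields one
  subsequence along which both vanish almost surely.\<close>

lemma tendsto_in_prob_unique:
  assumes "tendsto_in_prob_on M E X Y" "tendsto_in_prob_on M E X Y'"
  shows "AE \<omega> in M. \<omega> \<in> E \<longrightarrow> Y \<omega> = Y' \<omega>"
proof -
  have *: "tendsto_in_prob_on M E (\<lambda>j \<omega>. X j \<omega> - Z \<omega>) (\<lambda>_. 0)" if "tendsto_in_prob_on M E X Z" for Z
    using that by (simp add: tendsto_in_prob_on_def)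
  have "tendsto_in_prob_on M E (\<lambda>j \<omega>. X j \<omega> - (if c then Y \<omega> else Y' \<omega>)) (\<lambda>_. 0)" for c
    using *[OF assms(1)] *[OF assms(2)] by (cases c) auto
  then obtain r where "strict_mono r" "AE \<omega> in M. \<omega> \<in> E \<longrightarrow>
      (\<forall>c\<in>(UNIV::bool set). (\<lambda>j. (\<lambda>j \<omega>. X j \<omega> - (if c then Y \<omega> else Y' \<omega>)) (r j) \<omega>) \<longlonglongrightarrow> 0)"
    using tendsto_in_prob_common_subsequence[of "UNIV :: bool set" E
        "\<lambda>c j \<omega>. X j \<omega> - (if c then Y \<omega> else Y' \<omega>)"] by auto
  from this(2) show ?thesis
  proof eventually_elim
    case (elim \<omega>)
    show ?case
    proof
      assume "\<omega> \<in> E"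
      then have "(\<lambda>j. X (r j) \<omega> - Y \<omega>) \<longlonglongrightarrow> 0" "(\<lambda>j. X (r j) \<omega> - Y' \<omega>) \<longlonglongrightarrow> 0"
        using elim by (auto simp: Ball_def all_bool_eq)
      then have "(\<lambda>j. X (r j) \<omega>) \<longlonglongrightarrow> Y \<omega>" "(\<lambda>j. X (r j) \<omega>) \<longlonglongrightarrow> Y' \<omega>"
        by (simp_all add: LIM_zero_iff)
      then show "Y \<omega> = Y' \<omega>" by (rule LIMSEQ_unique)
    qed
  qed
qed

end

section \<open>Increments of Wiener processes\<close>

context wiener
begin

text \<open>The normal density requires positive variance, while the points of a partition may
  coincide; the degenerate case is added here.\<close>

lemma increment_moments_le:
  assumes st: "0 \<le> s" "s \<le> t" "t \<le> T"
  shows "integrable M (\<lambda>\<omega>. (W t \<omega> - W s \<omega>) ^ n)"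
    and "expectation (\<lambda>\<omega>. W t \<omega> - W s \<omega>) = 0"
    and "expectation (\<lambda>\<omega>. (W t \<omega> - W s \<omega>)\<^sup>2) = t - s"
    and "expectation (\<lambda>\<omega>. (W t \<omega> - W s \<omega>) ^ 4) = 3 * (t - s)\<^sup>2"
proof -
  have "integrable M (\<lambda>\<omega>. (W t \<omega> - W s \<omega>) ^ n) \<and> expectation (\<lambda>\<omega>. W t \<omega> - W s \<omega>) = 0 \<and>
    expectation (\<lambda>\<omega>. (W t \<omega> - W s \<omega>)\<^sup>2) = t - s \<and>
    expectation (\<lambda>\<omega>. (W t \<omega> - W s \<omega>) ^ 4) = 3 * (t - s)\<^sup>2"
  proof (cases "s = t")
    case False
    then show ?thesis using increment_moments(1)[of s t n] increment_moments(2-4)[of s t] st by auto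
  qed auto
  then show "integrable M (\<lambda>\<omega>. (W t \<omega> - W s \<omega>) ^ n)"
    and "expectation (\<lambda>\<omega>. W t \<omega> - W s \<omega>) = 0"
    and "expectation (\<lambda>\<omega>. (W t \<omega> - W s \<omega>)\<^sup>2) = t - s"
    and "expectation (\<lambda>\<omega>. (W t \<omega> - W s \<omega>) ^ 4) = 3 * (t - s)\<^sup>2"
    by auto
qed

lemma disjoint_increments:
  fixes f g :: "real \<Rightarrow> real"
  assumes o: "0 \<le> a" "a \<le> b" "b \<le> c" "c \<le> d" "d \<le> T"
    and f: "f \<in> borel_measurable borel" "integrable M (\<lambda>\<omega>. f (W b \<omega> - W a \<omega>))"
    and g: "g \<in> borel_measurable borel" "integrable M (\<lambda>\<omega>. g (W d \<omega> - W c \<omega>))"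
    and E: "expectation (\<lambda>\<omega>. g (W d \<omega> - W c \<omega>)) = 0"
  shows "integrable M (\<lambda>\<omega>. f (W b \<omega> - W a \<omega>) * g (W d \<omega> - W c \<omega>))"
    and "expectation (\<lambda>\<omega>. f (W b \<omega> - W a \<omega>) * g (W d \<omega> - W c \<omega>)) = 0"
proof -
  have "integrable M (\<lambda>\<omega>. f (W b \<omega> - W a \<omega>) * g (W d \<omega> - W c \<omega>)) \<and>
    expectation (\<lambda>\<omega>. f (W b \<omega> - W a \<omega>) * g (W d \<omega> - W c \<omega>)) = 0"
  proof (cases "c = d")
    case True
    \<comment> \<open>The increment is constantly zero here, so the mean-zero hypothesis is a
      statement about \<open>g 0\<close> and makes the product vanish.\<close>
    then have "g 0 = 0" using E by (simp add: prob_space)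
    then show ?thesis using True by simp
  next
    case False
    then have cd: "c < d" "0 \<le> c" using o by auto
    have F: "(\<lambda>\<omega>. f (W b \<omega> - W a \<omega>)) \<in> borel_measurable (F c)"
      using o by (intro measurable_compose[OF _ f(1)] borel_measurable_diff W_measurable_later) auto
    show ?thesis
      using expectation_mult_increment[OF cd(2,1) o(5) F f(2) g] E by simp
  qed
  then show "integrable M (\<lambda>\<omega>. f (W b \<omega> - W a \<omega>) * g (W d \<omega> - W c \<omega>))"
    and "expectation (\<lambda>\<omega>. f (W b \<omega> - W a \<omega>) * g (W d \<omega> - W c \<omega>)) = 0" by auto
qed

context
  fixes N :: nat and p :: "nat \<Rightarrow> real"
  assumes p: "\<And>i. i \<le> N \<Longrightarrow> 0 \<le> p i \<and> p i \<le> T" "\<And>i. i < N \<Longrightarrow> p i \<le> p (Suc i)"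
begin

text \<open>The function applied to an increment may depend on its index because a squared increment
  is centred by the length of its own interval.\<close>

lemma partition_increments:
  fixes f :: "nat \<Rightarrow> real \<Rightarrow> real"
  assumes ij: "i < N" "j < N" "i \<noteq> j"
    and f: "\<And>i. i < N \<Longrightarrow> f i \<in> borel_measurable borel"
      "\<And>i. i < N \<Longrightarrow> integrable M (\<lambda>\<omega>. f i (W (p (Suc i)) \<omega> - W (p i) \<omega>))"
      "\<And>i. i < N \<Longrightarrow> expectation (\<lambda>\<omega>. f i (W (p (Suc i)) \<omega> - W (p i) \<omega>)) = 0"
  shows "integrable M (\<lambda>\<omega>. f i (W (p (Suc i)) \<omega> - W (p i) \<omega>) * f j (W (p (Suc j)) \<omega> - W (p j) \<omega>))"
    and "expectation (\<lambda>\<omega>. f i (W (p (Suc i)) \<omega> - W (p i) \<omega>) * f j (W (p (Suc j)) \<omega> - W (p j) \<omega>)) = 0"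
proof -
  have *: "integrable M (\<lambda>\<omega>. f i (W (p (Suc i)) \<omega> - W (p i) \<omega>) * f j (W (p (Suc j)) \<omega> - W (p j) \<omega>)) \<and>
      expectation (\<lambda>\<omega>. f i (W (p (Suc i)) \<omega> - W (p i) \<omega>) * f j (W (p (Suc j)) \<omega> - W (p j) \<omega>)) = 0"
    if ij: "i < j" "j < N" for i j
  proof -
    have "p (Suc i) \<le> p j"
      using partition_monotone[of N p "Suc i" j] p(2) ij by auto
    then show ?thesis
      using p f ij by (intro conjI disjoint_increments) auto
  qed
  then show "integrable M (\<lambda>\<omega>. f i (W (p (Suc i)) \<omega> - W (p i) \<omega>) * f j (W (p (Suc j)) \<omega> - W (p j) \<omega>))"
    and "expectation (\<lambda>\<omega>. f i (W (p (Suc i)) \<omega> - W (p i) \<omega>) * f j (W (p (Suc j)) \<omega> - W (p j) \<omega>)) = 0"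
    using *[of i j] *[of j i] ij by (cases "i < j"; simp add: mult.commute)+
qed

lemma increments_product:
  assumes ij: "i < N" "j < N"
  shows "integrable M (\<lambda>\<omega>. (W (p (Suc i)) \<omega> - W (p i) \<omega>) * (W (p (Suc j)) \<omega> - W (p j) \<omega>))"
    and "expectation (\<lambda>\<omega>. (W (p (Suc i)) \<omega> - W (p i) \<omega>) * (W (p (Suc j)) \<omega> - W (p j) \<omega>)) =
      (if i = j then p (Suc i) - p i else 0)"
proof -
  have P: "0 \<le> p i" "p i \<le> p (Suc i)" "p (Suc i) \<le> T" if "i < N" for i using p that by auto
  have int: "integrable M (\<lambda>\<omega>. W (p (Suc i)) \<omega> - W (p i) \<omega>)" if "i < N" for i
    using increment_moments_le(1)[OF P[OF that], of 1] by simp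
  have "integrable M (\<lambda>\<omega>. (W (p (Suc i)) \<omega> - W (p i) \<omega>) * (W (p (Suc j)) \<omega> - W (p j) \<omega>)) \<and>
    expectation (\<lambda>\<omega>. (W (p (Suc i)) \<omega> - W (p i) \<omega>) * (W (p (Suc j)) \<omega> - W (p j) \<omega>)) =
      (if i = j then p (Suc i) - p i else 0)"
  proof (cases "i = j")
    case True
    then show ?thesis
      using increment_moments_le(1)[OF P[OF ij(1)], of 2] increment_moments_le(3)[OF P[OF ij(1)]]
      by (simp add: power2_eq_square)
  next
    case False
    then show ?thesis
      using partition_increments[OF ij False, of "\<lambda>_ x. x"] int increment_moments_le(2)[OF P] by simp
  qed
  then show "integrable M (\<lambda>\<omega>. (W (p (Suc i)) \<omega> - W (p i) \<omega>) * (W (p (Suc j)) \<omega> - W (p j) \<omega>))"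
    and "expectation (\<lambda>\<omega>. (W (p (Suc i)) \<omega> - W (p i) \<omega>) * (W (p (Suc j)) \<omega> - W (p j) \<omega>)) =
      (if i = j then p (Suc i) - p i else 0)" by auto
qed

text \<open>Centred squares of disjoint increments are orthogonal. In the diagonal terms the
  Gaussian fourth moment contributes 3 and centring subtracts 2 and adds 1, which leaves the factor
  2.\<close>

lemma square_increments_L2:
  assumes S: "S \<subseteq> {..<N}"
  shows "integrable M (\<lambda>\<omega>. (\<Sum>i\<in>S. (W (p (Suc i)) \<omega> - W (p i) \<omega>)\<^sup>2 - (p (Suc i) - p i))\<^sup>2)"
    and "expectation (\<lambda>\<omega>. (\<Sum>i\<in>S. (W (p (Suc i)) \<omega> - W (p i) \<omega>)\<^sup>2 - (p (Suc i) - p i))\<^sup>2)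
      = (\<Sum>i\<in>S. 2 * (p (Suc i) - p i)\<^sup>2)"
proof -
  define f where "f i y = y\<^sup>2 - (p (Suc i) - p i)" for i :: nat and y :: real
  define dW where "dW i \<omega> = W (p (Suc i)) \<omega> - W (p i) \<omega>" for i \<omega>
  have P: "0 \<le> p i" "p i \<le> p (Suc i)" "p (Suc i) \<le> T" if "i < N" for i using p that by auto
  have pw: "integrable M (\<lambda>\<omega>. dW i \<omega> ^ n)" if "i < N" for i n
    unfolding dW_def by (rule increment_moments_le(1)[OF P[OF that]])
  have f1: "f i \<in> borel_measurable borel" for i unfolding f_def[abs_def] by measurable
  have f2: "integrable M (\<lambda>\<omega>. f i (dW i \<omega>))" if "i < N" for i
    unfolding f_def using pw[OF that, of 2] by auto
  have f3: "expectation (\<lambda>\<omega>. f i (dW i \<omega>)) = 0" if "i < N" for i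
    unfolding f_def using pw[OF that, of 2] increment_moments_le(3)[OF P[OF that]]
    by (simp add: dW_def prob_space)
  have sq: "(\<lambda>\<omega>. (f i (dW i \<omega>))\<^sup>2) =
      (\<lambda>\<omega>. dW i \<omega> ^ 4 - 2 * (p (Suc i) - p i) * (dW i \<omega>)\<^sup>2 + (p (Suc i) - p i)\<^sup>2)" for i
    by (simp add: f_def power2_eq_square power4_eq_xxxx algebra_simps)
  have diag: "integrable M (\<lambda>\<omega>. (f i (dW i \<omega>))\<^sup>2)"
    "expectation (\<lambda>\<omega>. (f i (dW i \<omega>))\<^sup>2) = 2 * (p (Suc i) - p i)\<^sup>2" if "i < N" for i
  proof -
    show "integrable M (\<lambda>\<omega>. (f i (dW i \<omega>))\<^sup>2)"
      unfolding sq using pw[OF that, of 2] pw[OF that, of 4] by auto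
    have lin: "expectation (\<lambda>\<omega>. dW i \<omega> ^ 4 - c * (dW i \<omega>)\<^sup>2 + d) =
        expectation (\<lambda>\<omega>. dW i \<omega> ^ 4) - c * expectation (\<lambda>\<omega>. (dW i \<omega>)\<^sup>2) + d" for c d
      using pw[OF that, of 2] pw[OF that, of 4] by (simp add: prob_space)
    have ev: "expectation (\<lambda>\<omega>. (dW i \<omega>)\<^sup>2) = p (Suc i) - p i"
      "expectation (\<lambda>\<omega>. dW i \<omega> ^ 4) = 3 * (p (Suc i) - p i)\<^sup>2"
      unfolding dW_def by (rule increment_moments_le[OF P[OF that]])+
    show "expectation (\<lambda>\<omega>. (f i (dW i \<omega>))\<^sup>2) = 2 * (p (Suc i) - p i)\<^sup>2"
      unfolding sq lin ev by (simp add: power2_eq_square algebra_simps)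
  qed
  have off: "integrable M (\<lambda>\<omega>. f i (dW i \<omega>) * f j (dW j \<omega>))"
    "expectation (\<lambda>\<omega>. f i (dW i \<omega>) * f j (dW j \<omega>)) = 0" if "i < N" "j < N" "i \<noteq> j" for i j
    using partition_increments[OF that, of f] f1 f2 f3 by (simp_all add: dW_def)
  have int: "integrable M (\<lambda>\<omega>. f i (dW i \<omega>) * f j (dW j \<omega>))" if "i < N" "j < N" for i j
    using off(1)[OF that] diag(1)[OF that(1)] by (cases "i = j") (auto simp: power2_eq_square)
  have fin: "finite S" using S finite_subset by blast
  have 1: "integrable M (\<lambda>\<omega>. (\<Sum>i\<in>S. f i (dW i \<omega>))\<^sup>2)"
    by (rule expectation_square_sum_orthogonal(1)[OF fin]) (use S int off in blast)+
  have "expectation (\<lambda>\<omega>. (\<Sum>i\<in>S. f i (dW i \<omega>))\<^sup>2) = (\<Sum>i\<in>S. expectation (\<lambda>\<omega>. (f i (dW i \<omega>))\<^sup>2))"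
    by (rule expectation_square_sum_orthogonal(2)[OF fin]) (use S int off in blast)+
  also have "\<dots> = (\<Sum>i\<in>S. 2 * (p (Suc i) - p i)\<^sup>2)"
    using S diag by (intro sum.cong) auto
  finally show "expectation (\<lambda>\<omega>. (\<Sum>i\<in>S. (W (p (Suc i)) \<omega> - W (p i) \<omega>)\<^sup>2 - (p (Suc i) - p i))\<^sup>2)
      = (\<Sum>i\<in>S. 2 * (p (Suc i) - p i)\<^sup>2)" by (simp add: f_def dW_def)
  show "integrable M (\<lambda>\<omega>. (\<Sum>i\<in>S. (W (p (Suc i)) \<omega> - W (p i) \<omega>)\<^sup>2 - (p (Suc i) - p i))\<^sup>2)"
    using 1 by (simp add: f_def dW_def)
qed

end

end

section \<open>Covariation of independent Wiener processes\<close>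

context filtered_prob_space
begin

text \<open>The cross terms of a squared sum contain four increments, two from each process. Grouped
  by process rather than by interval, they factorise by independence, and each factor is the known
  product moment of one Wiener process.\<close>

lemma independent_increments_product:
  fixes W :: "'l \<Rightarrow> real \<Rightarrow> 'w \<Rightarrow> real"
  assumes W: "\<And>l. l \<in> L \<Longrightarrow> wiener_process M T F (W l)" and ind: "independent_processes M T L W"
    and l: "l \<in> L" "l' \<in> L" "l \<noteq> l'"
    and p: "\<And>i. i \<le> N \<Longrightarrow> 0 \<le> p i \<and> p i \<le> T" "\<And>i. i < N \<Longrightarrow> p i \<le> p (Suc i)"
    and ij: "i < N" "j < N"
  defines "X \<equiv> \<lambda>l \<omega>. (W l (p (Suc i)) \<omega> - W l (p i) \<omega>) * (W l (p (Suc j)) \<omega> - W l (p j) \<omega>)"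
  shows "integrable M (\<lambda>\<omega>. X l \<omega> * X l' \<omega>)"
    and "expectation (\<lambda>\<omega>. X l \<omega> * X l' \<omega>) = (if i = j then (p (Suc i) - p i)\<^sup>2 else 0)"
proof -
  \<comment> \<open>A measurable functional of the path, so that independence of the whole paths
    transfers to the products of increments.\<close>
  define G where "G f = (f (p (Suc i)) - f (p i)) * (f (p (Suc j)) - f (p j))" for f :: "real \<Rightarrow> real"
  have pT: "p i \<in> {0..T}" "p (Suc i) \<in> {0..T}" "p j \<in> {0..T}" "p (Suc j) \<in> {0..T}"
    using p(1) ij by auto
  have "indep_vars (\<lambda>_. Pi\<^sub>M {0..T} (\<lambda>_. borel)) (\<lambda>l \<omega>. \<lambda>t\<in>{0..T}. W l t \<omega>) {l, l'}"
    by (rule indep_vars_subset[OF ind[unfolded independent_processes_def]]) (simp add: l)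
  moreover have "G \<in> borel_measurable (Pi\<^sub>M {0..T} (\<lambda>_. borel))"
    unfolding G_def[abs_def]
    by (intro borel_measurable_times borel_measurable_diff measurable_component_singleton pT)
  ultimately have "indep_vars (\<lambda>_. borel) (\<lambda>l \<omega>. G (\<lambda>t\<in>{0..T}. W l t \<omega>)) {l, l'}"
    using indep_vars_compose2[of "\<lambda>_. Pi\<^sub>M {0..T} (\<lambda>_. borel)" _ "{l, l'}" "\<lambda>_. G" "\<lambda>_. borel"] by blast
  then have indX: "indep_vars (\<lambda>_. borel) X {l, l'}"
    using pT by (simp add: G_def X_def)
  have Xl: "integrable M (X l)" "expectation (X l) = (if i = j then p (Suc i) - p i else 0)" if "l \<in> L" for l
  proof -
    interpret wiener M T F "W l" by standard (rule W[OF that])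
    show "integrable M (X l)" "expectation (X l) = (if i = j then p (Suc i) - p i else 0)"
      unfolding X_def using increments_product[of N p i j] p ij by simp_all
  qed
  have int: "\<And>i. i \<in> {l, l'} \<Longrightarrow> integrable M (X i)" using Xl l by auto
  show "integrable M (\<lambda>\<omega>. X l \<omega> * X l' \<omega>)"
    using indep_vars_integrable[OF _ indX int] l by simp
  show "expectation (\<lambda>\<omega>. X l \<omega> * X l' \<omega>) = (if i = j then (p (Suc i) - p i)\<^sup>2 else 0)"
    using indep_vars_lebesgue_integral[OF _ indX int] l Xl by (simp add: power2_eq_square)
qed

text \<open>One bound for both cases: the diagonal case attains the factor 2, while for distinct
  processes the expectation is the sum with factor 1.\<close>

lemma covariation_increments_L2:
  fixes W :: "'l \<Rightarrow> real \<Rightarrow> 'w \<Rightarrow> real"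
  assumes W: "\<And>l. l \<in> L \<Longrightarrow> wiener_process M T F (W l)" and ind: "independent_processes M T L W"
    and l: "l \<in> L" "l' \<in> L"
    and p: "\<And>i. i \<le> N \<Longrightarrow> 0 \<le> p i \<and> p i \<le> T" "\<And>i. i < N \<Longrightarrow> p i \<le> p (Suc i)"
    and S: "S \<subseteq> {..<N}"
  defines "Y \<equiv> \<lambda>\<omega>. \<Sum>i\<in>S. (W l (p (Suc i)) \<omega> - W l (p i) \<omega>) * (W l' (p (Suc i)) \<omega> - W l' (p i) \<omega>)
      - (if l = l' then p (Suc i) - p i else 0)"
  shows "integrable M (\<lambda>\<omega>. (Y \<omega>)\<^sup>2)" and "expectation (\<lambda>\<omega>. (Y \<omega>)\<^sup>2) \<le> (\<Sum>i\<in>S. 2 * (p (Suc i) - p i)\<^sup>2)"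
proof -
  have "integrable M (\<lambda>\<omega>. (Y \<omega>)\<^sup>2) \<and> expectation (\<lambda>\<omega>. (Y \<omega>)\<^sup>2) \<le> (\<Sum>i\<in>S. 2 * (p (Suc i) - p i)\<^sup>2)"
  proof (cases "l = l'")
    case True
    interpret wiener M T F "W l" by standard (rule W[OF l(1)])
    show ?thesis
      using square_increments_L2[of N p S] p S True by (simp add: Y_def power2_eq_square)
  next
    case False
    define x where "x i \<omega> = (W l (p (Suc i)) \<omega> - W l (p i) \<omega>) * (W l' (p (Suc i)) \<omega> - W l' (p i) \<omega>)" for i \<omega>
    have Y: "Y = (\<lambda>\<omega>. \<Sum>i\<in>S. x i \<omega>)" using False by (simp add: Y_def x_def)
    have xx: "x i \<omega> * x j \<omega> =
        ((W l (p (Suc i)) \<omega> - W l (p i) \<omega>) * (W l (p (Suc j)) \<omega> - W l (p j) \<omega>)) *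
        ((W l' (p (Suc i)) \<omega> - W l' (p i) \<omega>) * (W l' (p (Suc j)) \<omega> - W l' (p j) \<omega>))" for i j \<omega>
      by (simp only: x_def mult_ac)
    have int: "integrable M (\<lambda>\<omega>. x i \<omega> * x j \<omega>)"
      and ex: "expectation (\<lambda>\<omega>. x i \<omega> * x j \<omega>) = (if i = j then (p (Suc i) - p i)\<^sup>2 else 0)"
      if "i < N" "j < N" for i j
      unfolding xx using independent_increments_product[of L W l l' N p, OF W ind l False p that] by simp_all
    have fin: "finite S" using S finite_subset by blast
    have SN: "i < N" if "i \<in> S" for i using S that by auto
    have "integrable M (\<lambda>\<omega>. (\<Sum>i\<in>S. x i \<omega>)\<^sup>2)"
      by (rule expectation_square_sum_orthogonal(1)[OF fin]) (use SN int ex in auto)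
    moreover have "expectation (\<lambda>\<omega>. (\<Sum>i\<in>S. x i \<omega>)\<^sup>2) = (\<Sum>i\<in>S. expectation (\<lambda>\<omega>. (x i \<omega>)\<^sup>2))"
      by (rule expectation_square_sum_orthogonal(2)[OF fin]) (use SN int ex in auto)
    moreover have "(\<Sum>i\<in>S. expectation (\<lambda>\<omega>. (x i \<omega>)\<^sup>2)) \<le> (\<Sum>i\<in>S. 2 * (p (Suc i) - p i)\<^sup>2)"
    proof (rule sum_mono)
      fix i assume "i \<in> S"
      then have "expectation (\<lambda>\<omega>. (x i \<omega>)\<^sup>2) = (p (Suc i) - p i)\<^sup>2"
        using ex[of i i] S by (auto simp: power2_eq_square)
      then show "expectation (\<lambda>\<omega>. (x i \<omega>)\<^sup>2) \<le> 2 * (p (Suc i) - p i)\<^sup>2" by simp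
    qed
    ultimately show ?thesis unfolding Y by simp
  qed
  then show "integrable M (\<lambda>\<omega>. (Y \<omega>)\<^sup>2)"
    and "expectation (\<lambda>\<omega>. (Y \<omega>)\<^sup>2) \<le> (\<Sum>i\<in>S. 2 * (p (Suc i) - p i)\<^sup>2)" by auto
qed

text \<open>Chebyshev: the second moment is at most twice the mesh times \<open>t\<close>.
  Restricting to an initial segment only drops nonnegative terms from this bound.\<close>

lemma covariation_increments_in_prob:
  fixes W :: "'l \<Rightarrow> real \<Rightarrow> 'w \<Rightarrow> real"
  assumes W: "\<And>l. l \<in> L \<Longrightarrow> wiener_process M T F (W l)" and ind: "independent_processes M T L W"
    and l: "l \<in> L" "l' \<in> L" and P: "partition_sequence t N p" and t: "t \<le> T" and E: "E \<in> events"
  shows "tendsto_in_prob_on M E (\<lambda>j \<omega>. \<Sum>i\<in>{i. i < N j \<and> p j i < r}.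
      (W l (p j (Suc i)) \<omega> - W l (p j i) \<omega>) * (W l' (p j (Suc i)) \<omega> - W l' (p j i) \<omega>)
      - (if l = l' then p j (Suc i) - p j i else 0)) (\<lambda>_. 0)"
  unfolding tendsto_in_prob_on_def
proof (intro allI impI conjI)
  fix \<epsilon> :: real assume \<epsilon>: "\<epsilon> > 0"
  note D = partition_sequenceD[OF P]
  let ?S = "\<lambda>j. {i. i < N j \<and> p j i < r}"
  define Y where "Y j \<omega> = (\<Sum>i\<in>?S j.
      (W l (p j (Suc i)) \<omega> - W l (p j i) \<omega>) * (W l' (p j (Suc i)) \<omega> - W l' (p j i) \<omega>)
      - (if l = l' then p j (Suc i) - p j i else 0))" for j \<omega>
  have pT: "0 \<le> p j i \<and> p j i \<le> T" if "i \<le> N j" for i j using D(5)[OF that] t by auto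
  interpret l: wiener M T F "W l" by standard (rule W[OF l(1)])
  interpret l': wiener M T F "W l'" by standard (rule W[OF l(2)])
  have YM: "Y j \<in> borel_measurable M" for j
    unfolding Y_def[abs_def] using pT
    by (intro borel_measurable_sum borel_measurable_diff borel_measurable_times
        borel_measurable_const l.W_measurable_M l'.W_measurable_M) auto
  have YL2: "integrable M (\<lambda>\<omega>. (Y j \<omega>)\<^sup>2)"
    "expectation (\<lambda>\<omega>. (Y j \<omega>)\<^sup>2) \<le> (\<Sum>i\<in>?S j. 2 * (p j (Suc i) - p j i)\<^sup>2)" for j
    unfolding Y_def by (rule covariation_increments_L2[of L W l l' "N j", OF W ind l]; use D pT in auto)+
  show "{\<omega> \<in> E. \<epsilon> < \<bar>Y j \<omega> - 0\<bar>} \<in> events" for j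
  proof -
    have "{\<omega> \<in> E. \<epsilon> < \<bar>Y j \<omega> - 0\<bar>} = E \<inter> {\<omega>\<in>space M. \<epsilon> < \<bar>Y j \<omega>\<bar>}"
      using sets.sets_into_space[OF E] by auto
    moreover have "{\<omega>\<in>space M. \<epsilon> < \<bar>Y j \<omega>\<bar>} \<in> events" using YM[of j] by measurable
    ultimately show ?thesis using E by auto
  qed
  have bound: "prob {\<omega> \<in> E. \<epsilon> < \<bar>Y j \<omega> - 0\<bar>} \<le> (\<Sum>i\<in>?S j. 2 * (p j (Suc i) - p j i)\<^sup>2) / \<epsilon>\<^sup>2" for j
  proof -
    have ev: "{\<omega>\<in>space M. \<epsilon>\<^sup>2 \<le> (Y j \<omega>)\<^sup>2} \<in> events" using YM[of j] by measurable
    have "{\<omega> \<in> E. \<epsilon> < \<bar>Y j \<omega> - 0\<bar>} \<subseteq> {\<omega>\<in>space M. \<epsilon>\<^sup>2 \<le> (Y j \<omega>)\<^sup>2}"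
      using sets.sets_into_space[OF E] \<epsilon> by (auto simp: power2_le_iff_abs_le abs_le_square_iff[symmetric])
    then have "prob {\<omega> \<in> E. \<epsilon> < \<bar>Y j \<omega> - 0\<bar>} \<le> prob {\<omega>\<in>space M. \<epsilon>\<^sup>2 \<le> (Y j \<omega>)\<^sup>2}"
      using ev by (rule finite_measure_mono)
    also have "\<dots> \<le> expectation (\<lambda>\<omega>. (Y j \<omega>)\<^sup>2) / \<epsilon>\<^sup>2"
      using integral_Markov_inequality_measure[OF YL2(1)[of j], of "{}" "\<epsilon>\<^sup>2"] \<epsilon> by simp
    also have "\<dots> \<le> (\<Sum>i\<in>?S j. 2 * (p j (Suc i) - p j i)\<^sup>2) / \<epsilon>\<^sup>2"
      using YL2(2) by (simp add: divide_right_mono)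
    finally show ?thesis .
  qed
  show "(\<lambda>j. prob {\<omega> \<in> E. \<epsilon> < \<bar>Y j \<omega> - 0\<bar>}) \<longlonglongrightarrow> 0"
  proof (rule LIMSEQ_I)
    fix e :: real assume e: "e > 0"
    have t0: "t \<ge> 0" using D(5)[of 0 0] by simp
    \<comment> \<open>With mesh below \<open>d\<close> the bound becomes
      \<open>2 * d * t / \<epsilon>\<^sup>2\<close>, which is below \<open>e\<close>.\<close>
    define d where "d = e * \<epsilon>\<^sup>2 / (2 * (t + 1))"
    have d: "d > 0" using e \<epsilon> t0 by (simp add: d_def)
    have "\<forall>\<^sub>F j in sequentially. norm (prob {\<omega> \<in> E. \<epsilon> < \<bar>Y j \<omega> - 0\<bar>} - 0) < e"
      using partition_sequence_mesh[OF P d]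
    proof eventually_elim
      case (elim j)
      have "(\<Sum>i\<in>?S j. 2 * (p j (Suc i) - p j i)\<^sup>2) \<le> (\<Sum>i<N j. 2 * (p j (Suc i) - p j i)\<^sup>2)"
        by (rule sum_mono2) auto
      also have "\<dots> \<le> (\<Sum>i<N j. 2 * d * (p j (Suc i) - p j i))"
        unfolding power2_eq_square mult.assoc using elim D(3)
        by (intro sum_mono mult_left_mono mult_right_mono) (auto intro: less_imp_le)
      also have "\<dots> = 2 * d * t" using D(6)[of j] by (simp flip: sum_distrib_left)
      also have "\<dots> < e * \<epsilon>\<^sup>2" using e \<epsilon> t0 by (simp add: d_def field_simps)
      finally have "(\<Sum>i\<in>?S j. 2 * (p j (Suc i) - p j i)\<^sup>2) / \<epsilon>\<^sup>2 < e"
        using \<epsilon> by (simp add: divide_less_eq)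
      then show ?case using bound[of j] by simp
    qed
    then show "\<exists>no. \<forall>n\<ge>no. norm (prob {\<omega> \<in> E. \<epsilon> < \<bar>Y n \<omega> - 0\<bar>} - 0) < e"
      by (simp add: eventually_sequentially)
  qed
qed

end

section \<open>Increments of stochastic integrals\<close>

text \<open>The cells \<open>(cell_left, cell_right]\<close> form the common refinement of the partitions \<open>p\<close> and
  \<open>Q\<close>; the index \<open>(i, k)\<close> stands for the part of \<open>(Q k, Q (k+1)]\<close> inside \<open>(p i, p (i+1)]\<close>.\<close>

definition cell_left :: "(nat \<Rightarrow> real) \<Rightarrow> (nat \<Rightarrow> real) \<Rightarrow> nat \<times> nat \<Rightarrow> real" where
  "cell_left p Q a = max (p (fst a)) (min (p (Suc (fst a))) (Q (snd a)))"

definition cell_right :: "(nat \<Rightarrow> real) \<Rightarrow> (nat \<Rightarrow> real) \<Rightarrow> nat \<times> nat \<Rightarrow> real" where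
  "cell_right p Q a = max (p (fst a)) (min (p (Suc (fst a))) (Q (Suc (snd a))))"

text \<open>Degenerate cells are left out: the estimate of block sums asks for intervals of positive
  length, and a point of such a cell is certain to lie in an interval of each partition.\<close>

definition cells :: "nat \<Rightarrow> nat \<Rightarrow> (nat \<Rightarrow> real) \<Rightarrow> (nat \<Rightarrow> real) \<Rightarrow> (nat \<times> nat) set" where
  "cells N n p Q = {a \<in> {..<N} \<times> {..<n}. cell_left p Q a < cell_right p Q a}"

lemma finite_cells [simp]: "finite (cells N n p Q)"
  by (simp add: cells_def)

lemma cell_boundsD:
  assumes "a \<in> cells N n p Q" "cell_left p Q a < x" "x \<le> cell_right p Q a"
  shows "p (fst a) < x" "x \<le> p (Suc (fst a))" "Q (snd a) < x" "x \<le> Q (Suc (snd a))"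
  using assms by (auto simp: cells_def cell_left_def cell_right_def max_def min_def split: if_splits)

text \<open>The lexicographic order of the index pairs is the order of the cells in time.\<close>

lemma cells_disjoint:
  assumes p: "\<And>i. i < N \<Longrightarrow> p i \<le> p (Suc i)" and Q: "\<And>k. k < n \<Longrightarrow> Q k \<le> Q (Suc k)"
    and ab: "a \<in> cells N n p Q" "b \<in> cells N n p Q" "a \<noteq> b"
  shows "cell_right p Q a \<le> cell_left p Q b \<or> cell_right p Q b \<le> cell_left p Q a"
proof -
  have *: "cell_right p Q a \<le> cell_left p Q b"
    if ab: "a \<in> cells N n p Q" "b \<in> cells N n p Q"
      and lt: "fst a < fst b \<or> fst a = fst b \<and> snd a < snd b" for a b
    using lt
  proof
    assume "fst a < fst b"
    then have "p (Suc (fst a)) \<le> p (fst b)"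
      using partition_monotone[of N p "Suc (fst a)" "fst b"] p ab by (auto simp: cells_def)
    moreover have "p (fst a) \<le> p (Suc (fst a))" using p ab by (auto simp: cells_def)
    ultimately show ?thesis by (auto simp: cell_left_def cell_right_def)
  next
    assume *: "fst a = fst b \<and> snd a < snd b"
    then have "Q (Suc (snd a)) \<le> Q (snd b)"
      using partition_monotone[of n Q "Suc (snd a)" "snd b"] Q ab by (auto simp: cells_def)
    then show ?thesis using * by (auto simp: cell_left_def cell_right_def max_def min_def)
  qed
  show ?thesis
    using *[of a b] *[of b a] ab by (metis nat_neq_iff prod.expand)
qed

lemma integrable_indicator_Icc: "integrable lborel (indicator {a..b::real} :: real \<Rightarrow> real)"
  by (rule integrable_real_indicator) (auto simp: emeasure_lborel_Icc_eq)

lemma integrable_indicator_Ioc: "integrable lborel (indicator {a<..b::real} :: real \<Rightarrow> real)"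
  by (cases "a \<le> b") (auto intro!: integrable_real_indicator)

lemma square_add_le: "(a + b)\<^sup>2 \<le> 2 * a\<^sup>2 + 2 * b\<^sup>2" for a b :: real
  using zero_le_power2[of "a - b"] by (simp add: power2_eq_square algebra_simps)

text \<open>On a cell the step function \<open>v\<close> has the constant value
  \<open>\<Xi>\<close>, and \<open>h\<close> stays within \<open>\<eta>\<close> of its value at the
  partition point. So the squared weight is at most
  \<open>2 * (v - h)\<^sup>2 + 2 * \<eta>\<^sup>2\<close> there, and integration over the disjoint
  cells gives the claim.\<close>

lemma cells_variance_le:
  fixes Q \<Xi> p :: "nat \<Rightarrow> real" and v h :: "real \<Rightarrow> real"
  assumes p: "\<And>i. i < N \<Longrightarrow> p i \<le> p (Suc i)" "p 0 = 0" "p N = t"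
    and Q: "\<And>k. k < n \<Longrightarrow> Q k \<le> Q (Suc k)"
    and v: "\<And>k x. k < n \<Longrightarrow> Q k < x \<Longrightarrow> x \<le> Q (Suc k) \<Longrightarrow> v x = \<Xi> k"
    and h: "\<And>i s. i < N \<Longrightarrow> s \<in> {p i..p (Suc i)} \<Longrightarrow> \<bar>h s - h (p i)\<bar> \<le> \<eta>"
    and int: "set_integrable lborel {0..t} (\<lambda>s. (v s - h s)\<^sup>2)"
  shows "(\<Sum>a\<in>cells N n p Q. (\<Xi> (snd a) - h (p (fst a)))\<^sup>2 * (cell_right p Q a - cell_left p Q a))
    \<le> 2 * (LINT s:{0..t}|lborel. (v s - h s)\<^sup>2) + 2 * \<eta>\<^sup>2 * t"
proof -
  let ?A = "cells N n p Q"
  define J where "J a = {cell_left p Q a<..cell_right p Q a}" for a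
  have pt: "p i \<in> {0..t}" if "i \<le> N" for i
    using partition_monotone[of N p 0 i] partition_monotone[of N p i N] p that by auto
  have t0: "t \<ge> 0" using pt[of 0] by simp
  have Jp: "x \<in> {p (fst a)..p (Suc (fst a))}" "x \<in> {0..t}" "v x = \<Xi> (snd a)" "fst a < N"
    if "a \<in> ?A" "x \<in> J a" for a x
  proof -
    have a: "fst a < N" "snd a < n" using that(1) by (auto simp: cells_def)
    note b = cell_boundsD[OF that(1), of x]
    show "x \<in> {p (fst a)..p (Suc (fst a))}" "fst a < N" using b that a by (auto simp: J_def)
    then show "x \<in> {0..t}" using pt[of "fst a"] pt[of "Suc (fst a)"] a by auto
    show "v x = \<Xi> (snd a)" using v[OF a(2)] b that by (auto simp: J_def)
  qed
  define g where "g x = 2 * (indicator {0..t} x * (v x - h x)\<^sup>2) + 2 * \<eta>\<^sup>2 * indicator {0..t} x" for x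
  have int': "integrable lborel (\<lambda>x. indicator {0..t} x * (v x - h x)\<^sup>2)"
    using int by (simp add: set_integrable_def)
  note ind = integrable_indicator_Icc[of 0 t]
  have gint: "integrable lborel g"
    unfolding g_def[abs_def]
    by (intro Bochner_Integration.integrable_add integrable_mult_right int' ind)
  have "(\<Sum>a\<in>?A. (\<Xi> (snd a) - h (p (fst a)))\<^sup>2 * (cell_right p Q a - cell_left p Q a))
      = (\<Sum>a\<in>?A. LINT x|lborel. (\<Xi> (snd a) - h (p (fst a)))\<^sup>2 * indicator (J a) x)"
    by (intro sum.cong refl) (auto simp: J_def cells_def)
  also have "\<dots> = (LINT x|lborel. (\<Sum>a\<in>?A. (\<Xi> (snd a) - h (p (fst a)))\<^sup>2 * indicator (J a) x))"
    by (intro Bochner_Integration.integral_sum[symmetric] integrable_mult_right)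
      (simp add: J_def integrable_indicator_Ioc)
  also have "\<dots> \<le> (LINT x|lborel. g x)"
  proof (intro integral_mono gint Bochner_Integration.integrable_sum integrable_mult_right)
    fix x
    show "(\<Sum>a\<in>?A. (\<Xi> (snd a) - h (p (fst a)))\<^sup>2 * indicator (J a) x) \<le> g x"
    proof (cases "\<exists>a\<in>?A. x \<in> J a")
      case True
      then obtain a where a: "a \<in> ?A" "x \<in> J a" by auto
      have "x \<notin> J b" if "b \<in> ?A" "b \<noteq> a" for b
        using cells_disjoint[OF p(1) Q a(1) that(1)] that(2) a(2) by (auto simp: J_def)
      then have "(\<Sum>a\<in>?A. (\<Xi> (snd a) - h (p (fst a)))\<^sup>2 * indicator (J a) x)
          = (\<Sum>b\<in>?A. if b = a then (\<Xi> (snd a) - h (p (fst a)))\<^sup>2 else 0)"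
        using a(2) by (intro sum.cong refl) (auto simp: indicator_def)
      also have "\<dots> = (\<Xi> (snd a) - h (p (fst a)))\<^sup>2" using a(1) by simp
      also have "\<dots> = ((v x - h x) + (h x - h (p (fst a))))\<^sup>2" using Jp(3)[OF a] by simp
      also have "\<dots> \<le> 2 * (v x - h x)\<^sup>2 + 2 * (h x - h (p (fst a)))\<^sup>2"
        by (rule square_add_le)
      also have "\<dots> \<le> 2 * (v x - h x)\<^sup>2 + 2 * \<eta>\<^sup>2"
        using h[OF Jp(4)[OF a] Jp(1)[OF a]] by (simp add: abs_le_square_iff[symmetric])
      also have "\<dots> = g x" using Jp(2)[OF a] by (simp add: g_def)
      finally show ?thesis .
    next
      case False
      then have "(\<Sum>a\<in>?A. (\<Xi> (snd a) - h (p (fst a)))\<^sup>2 * indicator (J a) x) = 0"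
        by (intro sum.neutral) auto
      then show ?thesis by (simp add: g_def indicator_def)
    qed
  qed (simp add: J_def integrable_indicator_Ioc)
  also have "\<dots> = 2 * (LINT s:{0..t}|lborel. (v s - h s)\<^sup>2) + 2 * \<eta>\<^sup>2 * t"
    unfolding g_def set_lebesgue_integral_def using int' ind t0
    by (subst Bochner_Integration.integral_add) auto
  finally show ?thesis .
qed

text \<open>Stopping at \<open>a\<close> and \<open>b\<close> is turned into clamping to
  \<open>[a, b]\<close>, the form in which the ends of cells are defined.\<close>

lemma simple_integral_increment:
  assumes "a \<le> b"
  shows "simple_integral W K q \<xi> b \<omega> - simple_integral W K q \<xi> a \<omega> =
    (\<Sum>k<K. \<xi> k \<omega> * (W (max a (min b (q (Suc k)))) \<omega> - W (max a (min b (q k))) \<omega>))"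
proof -
  have key: "W (min b y) \<omega> - W (min a y) \<omega> = W (max a (min b y)) \<omega> - W a \<omega>" for y
    using assms by (auto simp: max_def min_def)
  have "W (min b y) \<omega> - W (min b x) \<omega> - (W (min a y) \<omega> - W (min a x) \<omega>)
      = W (max a (min b y)) \<omega> - W (max a (min b x)) \<omega>" for x y
    using key[of x] key[of y] by simp
  then show ?thesis
    unfolding simple_integral_def sum_subtractf[symmetric] right_diff_distrib[symmetric] by simp
qed

text \<open>A simple process need not start at \<open>0\<close> nor end at \<open>T\<close>; it is extended by \<open>0\<close> to all of
  \<open>[0, T]\<close>, so that its intervals cover every partition of \<open>[0, t]\<close>.\<close>

definition extended_points :: "real \<Rightarrow> nat \<Rightarrow> (nat \<Rightarrow> real) \<Rightarrow> nat \<Rightarrow> real" where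
  "extended_points T K q k = (if k = 0 then 0 else if k \<le> Suc K then q (k - 1) else T)"

definition extended_values :: "nat \<Rightarrow> (nat \<Rightarrow> 'w \<Rightarrow> real) \<Rightarrow> nat \<Rightarrow> 'w \<Rightarrow> real" where
  "extended_values K \<xi> k \<omega> = (if 0 < k \<and> k \<le> K then \<xi> (k - 1) \<omega> else 0)"

lemma extended_points_mono:
  assumes "\<And>i. i \<le> K \<Longrightarrow> q i \<in> {0..T}" "\<And>i. i < K \<Longrightarrow> q i < q (Suc i)" "k < K + 2"
  shows "extended_points T K q k \<le> extended_points T K q (Suc k)"
proof -
  consider "k = 0" | j where "k = Suc j" "j < K" | "k = Suc K"
    using assms(3) by (metis Suc_lessI add_2_eq_Suc' less_Suc_eq not0_implies_Suc not_less_eq)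
  then show ?thesis
    by cases (use assms(1)[of 0] assms(1)[of K] assms(2) in \<open>auto simp: extended_points_def intro: less_imp_le\<close>)
qed

text \<open>Indices are shifted by one: interval \<open>Suc j\<close> of the extension is interval
  \<open>j\<close> of the process. On the two added intervals, numbers \<open>0\<close> and
  \<open>Suc K\<close>, all indicators vanish.\<close>

lemma simple_value_extended:
  assumes q: "\<And>i. i < K \<Longrightarrow> q i < q (Suc i)" and k: "k < K + 2"
    and x: "extended_points T K q k < x" "x \<le> extended_points T K q (Suc k)"
  shows "simple_value K q \<xi> x \<omega> = extended_values K \<xi> k \<omega>"
proof -
  have mono: "q i \<le> q j" if "i \<le> j" "j \<le> K" for i j
    using partition_monotone[of K q i j] q that by (auto intro: less_imp_le)
  consider "k = 0" | j where "k = Suc j" "j < K" | "k = Suc K"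
    using k by (metis Suc_lessI add_2_eq_Suc' less_Suc_eq not0_implies_Suc not_less_eq)
  then show ?thesis
  proof cases
    case 1
    then have "x \<le> q i" if "i < K" for i using x mono[of 0 i] that by (auto simp: extended_points_def)
    then show ?thesis using 1 by (force simp: simple_value_def extended_values_def intro!: sum.neutral)
  next
    case (2 j)
    then have xj: "q j < x" "x \<le> q (Suc j)" using x by (auto simp: extended_points_def)
    have "\<xi> i \<omega> * indicator {q i<..q (Suc i)} x = (if i = j then \<xi> j \<omega> else 0)" if "i < K" for i
    proof (cases i j rule: linorder_cases)
      case less
      then show ?thesis using mono[of "Suc i" j] xj 2 by auto
    next
      case greater
      then show ?thesis using mono[of "Suc j" i] xj that by auto
    qed (use xj in auto)
    then have "simple_value K q \<xi> x \<omega> = (\<Sum>i<K. if i = j then \<xi> j \<omega> else 0)"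
      unfolding simple_value_def by (intro sum.cong) auto
    then show ?thesis using 2 by (simp add: extended_values_def)
  next
    case 3
    then have "q (Suc i) < x" if "i < K" for i
      using x mono[of "Suc i" K] that by (auto simp: extended_points_def)
    then show ?thesis using 3 by (force simp: simple_value_def extended_values_def intro!: sum.neutral)
  qed
qed

lemma simple_value_square_integrable:
  fixes h :: "real \<Rightarrow> real"
  assumes h: "continuous_on {0..t} h"
  shows "set_integrable lborel {0..t} (\<lambda>s. (simple_value K q \<xi> s \<omega> - h s)\<^sup>2)"
proof -
  obtain B where "\<forall>y\<in>h ` {0..t}. norm y \<le> B"
    using compact_imp_bounded[OF compact_continuous_image[OF h]] unfolding bounded_iff by auto
  then have B: "\<And>s. s \<in> {0..t} \<Longrightarrow> \<bar>h s\<bar> \<le> B" by simp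
  define C where "C = (\<Sum>i<K. \<bar>\<xi> i \<omega>\<bar>)"
  have sv: "\<bar>simple_value K q \<xi> s \<omega>\<bar> \<le> C" for s
    unfolding simple_value_def C_def
    by (intro sum_abs[THEN order_trans] sum_mono) (auto simp: abs_mult indicator_def)
  have eq: "(\<lambda>s. indicator {0..t} s *\<^sub>R (simple_value K q \<xi> s \<omega> - h s)\<^sup>2) =
      (\<lambda>s. (indicator {0..t} s * simple_value K q \<xi> s \<omega> - indicator {0..t} s *\<^sub>R h s)\<^sup>2)"
    by (auto simp: indicator_def)
  show ?thesis
    unfolding set_integrable_def
  proof (rule Bochner_Integration.integrable_bound)
    show "integrable lborel (\<lambda>s. (C + B)\<^sup>2 * indicator {0..t} s)"
      by (intro integrable_mult_right integrable_indicator_Icc)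
    have "(\<lambda>s. indicator {0..t} s *\<^sub>R h s) \<in> borel_measurable lborel"
      using borel_measurable_continuous_on_indicator[OF _ h] by auto
    moreover have "(\<lambda>s. indicator {0..t} s * simple_value K q \<xi> s \<omega>) \<in> borel_measurable lborel"
      unfolding simple_value_def
      by (intro borel_measurable_times borel_measurable_sum borel_measurable_indicator borel_measurable_const) auto
    ultimately show "(\<lambda>s. indicator {0..t} s *\<^sub>R (simple_value K q \<xi> s \<omega> - h s)\<^sup>2) \<in> borel_measurable lborel"
      unfolding eq by auto
    show "AE s in lborel. norm (indicator {0..t} s *\<^sub>R (simple_value K q \<xi> s \<omega> - h s)\<^sup>2)
        \<le> norm ((C + B)\<^sup>2 * indicator {0..t} s)"
    proof (rule AE_I2)
      fix s
      show "norm (indicator {0..t} s *\<^sub>R (simple_value K q \<xi> s \<omega> - h s)\<^sup>2) \<le> norm ((C + B)\<^sup>2 * indicator {0..t} s)"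
      proof (cases "s \<in> {0..t}")
        case True
        have "\<bar>simple_value K q \<xi> s \<omega> - h s\<bar> \<le> C + B" using sv[of s] B[OF True] by linarith
        then have "(simple_value K q \<xi> s \<omega> - h s)\<^sup>2 \<le> (C + B)\<^sup>2"
          by (metis abs_ge_zero power2_abs power_mono)
        then show ?thesis using True by simp
      qed simp
    qed
  qed
qed

section \<open>Comparing a simple integral with its Riemann increments\<close>

context wiener
begin

text \<open>Cells of the refinement are grouped by the partition interval that contains them; each
  block sum is then the error on that interval. The total variance can exceed
  \<open>\<delta>\<close> only where the simple process is far from \<open>H\<close> in L2, which is
  \<open>G\<close>, or where \<open>H\<close> oscillates by more than \<open>\<eta>\<close>, which
  is \<open>B\<close>.\<close>

lemma simple_integral_block_estimate:
  fixes h :: "nat \<Rightarrow> 'a \<Rightarrow> real" and H :: "real \<Rightarrow> 'a \<Rightarrow> real"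
  assumes sp: "simple_process M T F K q \<xi>"
    and p: "\<And>i. i < N \<Longrightarrow> p i \<le> p (Suc i)" "p 0 = 0" "p N = t" and t: "t \<le> T"
    and h: "\<And>i. i < N \<Longrightarrow> h i \<in> borel_measurable (F (p i))"
    and E: "E \<in> events" and pos: "\<epsilon> > 0" "\<delta> > 0" and \<eta>: "2 * \<eta>\<^sup>2 * t \<le> \<delta> / 2"
    and H: "AE \<omega> in M. \<omega> \<in> E \<longrightarrow> continuous_on {0..t} (\<lambda>s. H s \<omega>) \<and> (\<forall>i<N. h i \<omega> = H (p i) \<omega>)"
    and B: "B \<in> events" "AE \<omega> in M. \<omega> \<in> E \<longrightarrow> \<omega> \<notin> B \<longrightarrow>
      (\<forall>i<N. \<forall>s\<in>{p i..p (Suc i)}. \<bar>H s \<omega> - H (p i) \<omega>\<bar> \<le> \<eta>)"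
  defines "G \<equiv> {\<omega>\<in>E. \<delta> / 4 < \<bar>(LINT s:{0..t}|lborel. (simple_value K q \<xi> s \<omega> - H s \<omega>)\<^sup>2) - 0\<bar>}"
  assumes G: "G \<in> events"
  shows "prob {\<omega>\<in>E. \<epsilon> < (\<Sum>i<N. (simple_integral W K q \<xi> (p (Suc i)) \<omega> - simple_integral W K q \<xi> (p i) \<omega>
      - h i \<omega> * (W (p (Suc i)) \<omega> - W (p i) \<omega>))\<^sup>2)} \<le> \<delta> / \<epsilon> + prob G + prob B"
proof -
  have q: "\<And>i. i \<le> K \<Longrightarrow> q i \<in> {0..T}" "\<And>i. i < K \<Longrightarrow> q i < q (Suc i)"
    and \<xi>: "\<And>i. i < K \<Longrightarrow> \<xi> i \<in> borel_measurable (F (q i))"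
    using sp by (auto simp: simple_process_def)
  define Q where "Q = extended_points T K q"
  define \<Xi> where "\<Xi> = extended_values K \<xi>"
  let ?n = "K + 2" and ?A = "cells N (K + 2) p Q"
  have Qmono: "Q k \<le> Q (Suc k)" if "k < ?n" for k
    unfolding Q_def using extended_points_mono q that by blast
  have Q0: "Q 0 = 0" and Qn: "Q ?n = T" "Q (Suc (Suc K)) = T" by (auto simp: Q_def extended_points_def)
  have QT: "0 \<le> Q k \<and> Q k \<le> T" if "k \<le> ?n" for k
    using partition_monotone[of ?n Q 0 k] partition_monotone[of ?n Q k ?n] Qmono that Q0 Qn by auto
  have pt: "0 \<le> p i \<and> p i \<le> t" if "i \<le> N" for i
    using partition_monotone[of N p 0 i] partition_monotone[of N p i N] p that by auto
  have \<Xi>F: "\<Xi> k \<in> borel_measurable (F (Q k))" if "k < ?n" for k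
  proof (cases "0 < k \<and> k \<le> K")
    case True
    then have "\<Xi> k = \<xi> (k - 1)" "Q k = q (k - 1)"
      by (auto simp: \<Xi>_def Q_def extended_values_def[abs_def] extended_points_def)
    then show ?thesis using \<xi>[of "k - 1"] True by auto
  next
    case False
    then have "\<Xi> k = (\<lambda>_. 0)" by (auto simp: \<Xi>_def extended_values_def[abs_def])
    then show ?thesis by simp
  qed
  define \<zeta> where "\<zeta> a \<omega> = \<Xi> (snd a) \<omega> - h (fst a) \<omega>" for a \<omega>
  have cell: "0 \<le> cell_left p Q a \<and> cell_left p Q a < cell_right p Q a \<and> cell_right p Q a \<le> T"
    if "a \<in> ?A" for a
    using that pt[of "fst a"] pt[of "Suc (fst a)"] t
    by (auto simp: cells_def cell_left_def cell_right_def)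
  \<comment> \<open>A nondegenerate cell starts no earlier than either of the two intervals it lies
    in, so both values in the weight are known at its left end.\<close>
  have \<zeta>F: "\<zeta> a \<in> borel_measurable (F (cell_left p Q a))" if a: "a \<in> ?A" for a
  proof -
    have a': "fst a < N" "snd a < ?n" using a by (auto simp: cells_def)
    have "p (fst a) \<le> cell_left p Q a" by (simp add: cell_left_def)
    moreover have "Q (snd a) \<le> cell_left p Q a"
      using a p(1)[OF a'(1)] by (auto simp: cells_def cell_left_def cell_right_def max_def min_def split: if_splits)
    ultimately show ?thesis
      unfolding \<zeta>_def[abs_def] using cell[OF a] QT[of "snd a"] pt[of "fst a"] a'
      by (intro borel_measurable_diff measurable_F_mono[OF \<Xi>F] measurable_F_mono[OF h]) auto
  qed
  \<comment> \<open>Because the extended points run from \<open>0\<close> to \<open>T\<close>, the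
    clamped increments telescope to the whole increment over the partition interval; the added
    intervals carry the value zero and drop out of the other sum.\<close>
  have blk: "(\<Sum>a\<in>{a\<in>?A. fst a = i}. \<zeta> a \<omega> * (W (cell_right p Q a) \<omega> - W (cell_left p Q a) \<omega>))
      = simple_integral W K q \<xi> (p (Suc i)) \<omega> - simple_integral W K q \<xi> (p i) \<omega> - h i \<omega> * (W (p (Suc i)) \<omega> - W (p i) \<omega>)"
    if i: "i < N" for i \<omega>
  proof -
    define w where "w k = W (max (p i) (min (p (Suc i)) (Q k))) \<omega>" for k
    have le: "p i \<le> p (Suc i)" by (rule p(1)[OF i])
    have "(\<Sum>a\<in>{a\<in>?A. fst a = i}. \<zeta> a \<omega> * (W (cell_right p Q a) \<omega> - W (cell_left p Q a) \<omega>))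
        = (\<Sum>a\<in>{i} \<times> {..<?n}. \<zeta> a \<omega> * (W (cell_right p Q a) \<omega> - W (cell_left p Q a) \<omega>))"
    proof (rule sum.mono_neutral_left)
      show "\<forall>a\<in>{i} \<times> {..<?n} - {a \<in> ?A. fst a = i}. \<zeta> a \<omega> * (W (cell_right p Q a) \<omega> - W (cell_left p Q a) \<omega>) = 0"
      proof
        fix a assume a: "a \<in> {i} \<times> {..<?n} - {a \<in> ?A. fst a = i}"
        then have "Q (snd a) \<le> Q (Suc (snd a))" by (intro Qmono) auto
        then have "cell_left p Q a \<le> cell_right p Q a" by (auto simp: cell_left_def cell_right_def)
        then have "cell_left p Q a = cell_right p Q a" using a i by (auto simp: cells_def)
        then show "\<zeta> a \<omega> * (W (cell_right p Q a) \<omega> - W (cell_left p Q a) \<omega>) = 0" by simp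
      qed
    qed (use i in \<open>auto simp: cells_def\<close>)
    also have "\<dots> = (\<Sum>k<?n. (\<Xi> k \<omega> - h i \<omega>) * (w (Suc k) - w k))"
      by (rule sum.reindex_cong[of "\<lambda>k. (i, k)"])
        (auto simp: inj_on_def \<zeta>_def w_def cell_left_def cell_right_def)
    also have "\<dots> = (\<Sum>k<?n. \<Xi> k \<omega> * (w (Suc k) - w k)) - h i \<omega> * (\<Sum>k<?n. w (Suc k) - w k)"
      unfolding left_diff_distrib sum_distrib_left by (rule sum_subtractf)
    also have "(\<Sum>k<?n. w (Suc k) - w k) = w ?n - w 0" by (rule sum_lessThan_telescope)
    also have "w ?n - w 0 = W (p (Suc i)) \<omega> - W (p i) \<omega>"
      using pt[of i] pt[of "Suc i"] i t le by (simp add: w_def Q0 Qn)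
    also have "(\<Sum>k<?n. \<Xi> k \<omega> * (w (Suc k) - w k)) = (\<Sum>k\<in>Suc ` {..<K}. \<Xi> k \<omega> * (w (Suc k) - w k))"
    proof (rule sum.mono_neutral_right)
      show "\<forall>k\<in>{..<?n} - Suc ` {..<K}. \<Xi> k \<omega> * (w (Suc k) - w k) = 0"
      proof
        fix k assume k: "k \<in> {..<?n} - Suc ` {..<K}"
        have "\<not> (0 < k \<and> k \<le> K)"
        proof
          assume "0 < k \<and> k \<le> K"
          then have "k = Suc (k - 1)" "k - 1 < K" by auto
          then show False using k by (metis DiffD2 image_eqI lessThan_iff)
        qed
        then show "\<Xi> k \<omega> * (w (Suc k) - w k) = 0" by (auto simp: \<Xi>_def extended_values_def)
      qed
    qed auto
    also have "\<dots> = (\<Sum>k<K. \<xi> k \<omega> * (W (max (p i) (min (p (Suc i)) (q (Suc k)))) \<omega> - W (max (p i) (min (p (Suc i)) (q k))) \<omega>))"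
      by (subst sum.reindex) (auto simp: \<Xi>_def extended_values_def w_def Q_def extended_points_def intro!: sum.cong)
    also have "\<dots> = simple_integral W K q \<xi> (p (Suc i)) \<omega> - simple_integral W K q \<xi> (p i) \<omega>"
      by (rule simple_integral_increment[OF le, symmetric])
    finally show ?thesis .
  qed
  let ?V = "\<lambda>\<omega>. \<Sum>a\<in>?A. (\<zeta> a \<omega>)\<^sup>2 * (cell_right p Q a - cell_left p Q a)"
  have "prob {\<omega>\<in>E. \<epsilon> < (\<Sum>i<N. (simple_integral W K q \<xi> (p (Suc i)) \<omega> - simple_integral W K q \<xi> (p i) \<omega>
      - h i \<omega> * (W (p (Suc i)) \<omega> - W (p i) \<omega>))\<^sup>2)} \<le> \<delta> / \<epsilon> + prob {\<omega>\<in>E. \<delta> < ?V \<omega>}"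
  proof -
    have "prob {\<omega>\<in>E. \<epsilon> < (\<Sum>i<N. (\<Sum>a\<in>{a\<in>?A. fst a = i}. \<zeta> a \<omega> * (W (cell_right p Q a) \<omega> - W (cell_left p Q a) \<omega>))\<^sup>2)}
       \<le> \<delta> / \<epsilon> + prob {\<omega>\<in>E. \<delta> < ?V \<omega>}"
    proof (rule block_sums_in_prob)
      show "cell_right p Q a \<le> cell_left p Q b \<or> cell_right p Q b \<le> cell_left p Q a"
        if "a \<in> ?A" "b \<in> ?A" "a \<noteq> b" for a b
        using cells_disjoint[OF p(1) Qmono that] by simp
      show "fst a \<in> {..<N}" if "a \<in> ?A" for a using that by (auto simp: cells_def)
      show "0 \<le> \<delta>" using pos by simp
    qed (simp_all only: finite_cells finite_lessThan cell \<zeta>F E pos)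
    then show ?thesis using blk by simp
  qed
  also have "prob {\<omega>\<in>E. \<delta> < ?V \<omega>} \<le> prob (G \<union> B)"
  proof (rule finite_measure_mono_AE)
    show "AE \<omega> in M. \<omega> \<in> {\<omega>\<in>E. \<delta> < ?V \<omega>} \<longrightarrow> \<omega> \<in> G \<union> B"
      using H B(2)
    proof eventually_elim
      case (elim \<omega>)
      show ?case
      proof (intro impI, rule ccontr)
        assume \<omega>: "\<omega> \<in> {\<omega>\<in>E. \<delta> < ?V \<omega>}" and nG: "\<omega> \<notin> G \<union> B"
        have Hc: "continuous_on {0..t} (\<lambda>s. H s \<omega>)" and hH: "\<forall>i<N. h i \<omega> = H (p i) \<omega>"
          and HB: "\<And>i s. i < N \<Longrightarrow> s \<in> {p i..p (Suc i)} \<Longrightarrow> \<bar>H s \<omega> - H (p i) \<omega>\<bar> \<le> \<eta>"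
          using elim \<omega> nG by auto
        have "?V \<omega> = (\<Sum>a\<in>?A. (\<Xi> (snd a) \<omega> - H (p (fst a)) \<omega>)\<^sup>2 * (cell_right p Q a - cell_left p Q a))"
          using hH by (intro sum.cong refl) (auto simp: \<zeta>_def cells_def)
        also have "\<dots> \<le> 2 * (LINT s:{0..t}|lborel. (simple_value K q \<xi> s \<omega> - H s \<omega>)\<^sup>2) + 2 * \<eta>\<^sup>2 * t"
        proof (rule cells_variance_le[where v = "\<lambda>s. simple_value K q \<xi> s \<omega>" and \<Xi> = "\<lambda>k. \<Xi> k \<omega>" and h = "\<lambda>s. H s \<omega>"])
          show "simple_value K q \<xi> x \<omega> = \<Xi> k \<omega>" if "k < ?n" "Q k < x" "x \<le> Q (Suc k)" for k x
            unfolding \<Xi>_def using simple_value_extended[of K q k T x \<xi> \<omega>] q(2) that by (auto simp: Q_def)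
        qed (simp_all only: p Qmono HB simple_value_square_integrable[OF Hc])
        \<comment> \<open>Outside \<open>G\<close> the integral is at most
          \<open>\<delta> / 4\<close>, so its double uses up half of \<open>\<delta>\<close>; the
          choice of \<open>\<eta>\<close> provides the other half.\<close>
        also have "\<dots> \<le> \<delta>" using nG \<omega> \<eta> by (auto simp: G_def)
        finally show False using \<omega> by simp
      qed
    qed
  qed (use G B in auto)
  also have "prob (G \<union> B) \<le> prob G + prob B" by (rule measure_Un_le[OF G B(1)])
  finally show ?thesis by simp
qed

end

section \<open>Measurability through rational times and Riemann sums\<close>

lemma closure_rationals_Ioo:
  fixes a b :: real
  assumes "a < b"
  shows "closure ({a<..<b} \<inter> \<rat>) = {a..b}"
proof -
  have "{a<..<b} \<subseteq> closure ({a<..<b} \<inter> \<rat>)"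
    using open_Int_closure_subset[of "{a<..<b}" \<rat>] by (simp add: Rats_closure_real)
  then have "closure {a<..<b} \<subseteq> closure ({a<..<b} \<inter> \<rat>)" by (simp add: closure_minimal)
  moreover have "closure ({a<..<b} \<inter> \<rat>) \<subseteq> closure {a<..<b}" by (intro closure_mono) auto
  ultimately show ?thesis
    using assms by (simp add: closure_greaterThanLessThan)
qed

text \<open>Density of the rationals reduces an oscillation bound to countably many times, which is
  what makes the oscillation event measurable. Nonnegativity of \<open>c\<close> covers an interval
  shrunk to a point, which may contain no rational.\<close>

lemma continuous_bound_from_rationals:
  fixes f :: "real \<Rightarrow> real"
  assumes f: "continuous_on {a..b} f" and c: "c \<ge> 0"
    and le: "\<And>s. s \<in> \<rat> \<inter> {a..b} \<Longrightarrow> \<bar>f s - f a\<bar> \<le> c" and s: "s \<in> {a..b}"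
  shows "\<bar>f s - f a\<bar> \<le> c"
proof (cases "a < b")
  case True
  note cl = closure_rationals_Ioo[OF True]
  show ?thesis
  proof (rule continuous_le_on_closure[where f = "\<lambda>s. \<bar>f s - f a\<bar>" and S = "{a<..<b} \<inter> \<rat>"])
    show "continuous_on (closure ({a<..<b} \<inter> \<rat>)) (\<lambda>s. \<bar>f s - f a\<bar>)"
      unfolding cl by (intro continuous_intros f)
  qed (use cl s le in auto)
next
  case False
  then have "s = a" using s by auto
  then show ?thesis using c by simp
qed

context filtered_prob_space
begin

lemma stopping_time_less_event:
  assumes "stopping_time_upto M T F \<tau>" "t \<in> {0..T}"
  shows "{\<omega>\<in>space M. t < \<tau> \<omega>} \<in> events"
proof -
  have "{\<omega>\<in>space M. \<tau> \<omega> \<le> t} \<in> sets (F t)" using assms by (auto simp: stopping_time_upto_def)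
  then have "{\<omega>\<in>space M. \<tau> \<omega> \<le> t} \<in> events" using sets_F[of t] assms by auto
  moreover have "{\<omega>\<in>space M. t < \<tau> \<omega>} = space M - {\<omega>\<in>space M. \<tau> \<omega> \<le> t}" by auto
  ultimately show ?thesis by auto
qed

text \<open>The integral is the almost sure limit of Riemann sums of the process set to zero from
  \<open>\<tau>\<close> on. Completeness turns this into measurability.\<close>

lemma measurable_time_integral:
  fixes f :: "real \<Rightarrow> 'w \<Rightarrow> real"
  assumes \<tau>: "stopping_time_upto M T F \<tau>" and t: "t \<in> {0..T}"
    and f: "\<And>s. s \<in> {0..T} \<Longrightarrow> (\<lambda>\<omega>. if s < \<tau> \<omega> then f s \<omega> else 0) \<in> borel_measurable M"
    and c: "AE \<omega> in M. continuous_on {0..<\<tau> \<omega>} (\<lambda>s. f s \<omega>)"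
  shows "(\<lambda>\<omega>. if t < \<tau> \<omega> then LINT s:{0..t}|lborel. f s \<omega> else 0) \<in> borel_measurable M"
proof -
  define p where "p j i = t * real i / real (Suc j)" for j i
  have P: "partition_sequence t (\<lambda>j. Suc j) p"
    unfolding p_def by (rule uniform_partition_sequence) (use t in auto)
  note D = partition_sequenceD[OF P]
  define f' where "f' s \<omega> = (if s < \<tau> \<omega> then f s \<omega> else 0)" for s \<omega>
  define g where "g j \<omega> = indicator {\<omega>\<in>space M. t < \<tau> \<omega>} \<omega> * (\<Sum>i<Suc j. f' (p j i) \<omega> * (p j (Suc i) - p j i))" for j \<omega>
  have gM: "g j \<in> borel_measurable M" for j
  proof -
    have "f' (p j i) \<in> borel_measurable M" if "i < Suc j" for i
      unfolding f'_def using f[of "p j i"] D(5)[of i j] that t by auto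
    then show ?thesis
      unfolding g_def[abs_def] using stopping_time_less_event[OF \<tau> t]
      by (intro borel_measurable_times borel_measurable_indicator borel_measurable_sum borel_measurable_const) auto
  qed
  show ?thesis
  proof (rule measurable_AE_eq[OF borel_measurable_lim_metric[of g M]])
    show "AE \<omega> in M. lim (\<lambda>j. g j \<omega>) = (if t < \<tau> \<omega> then LINT s:{0..t}|lborel. f s \<omega> else 0)"
      using c AE_space
    proof eventually_elim
      case (elim \<omega>)
      show ?case
      proof (cases "t < \<tau> \<omega>")
        case True
        have "continuous_on {0..t} (\<lambda>s. f s \<omega>)" by (rule continuous_on_subset[OF elim(1)]) (use True in auto)
        from riemann_sums_tendsto[OF P this]
        have "(\<lambda>j. \<Sum>i<Suc j. f (p j i) \<omega> * (p j (Suc i) - p j i)) \<longlonglongrightarrow> (LINT s:{0..t}|lborel. f s \<omega>)" .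
        moreover have "g j \<omega> = (\<Sum>i<Suc j. f (p j i) \<omega> * (p j (Suc i) - p j i))" for j
        proof -
          have "f' (p j i) \<omega> = f (p j i) \<omega>" if "i < Suc j" for i
            using D(5)[of i j] that True by (auto simp: f'_def)
          then show ?thesis using True elim(2) by (simp add: g_def)
        qed
        ultimately show ?thesis using True by (simp add: limI)
      next
        case False
        then show ?thesis by (simp add: g_def limI)
      qed
    qed
  qed (use gM in auto)
qed

end

context wiener
begin

text \<open>Two limits in a fixed order. For a given partition only finitely many values of
  \<open>I\<close> occur, so the simple integrals may be substituted for them as \<open>n\<close>
  tends to infinity. What remains is the probability that \<open>H\<close> oscillates over the mesh,
  and this vanishes as the partition is refined.\<close>

lemma ito_increments_in_prob:
  assumes ito: "ito_integral_on M T F \<tau> W H I" and \<tau>: "stopping_time_upto M T F \<tau>"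
    and P: "partition_sequence t N p" and t: "t \<in> {0..T}"
  shows "tendsto_in_prob_on M {\<omega>\<in>space M. t < \<tau> \<omega>} (\<lambda>j \<omega>. \<Sum>i<N j. (I (p j (Suc i)) \<omega> - I (p j i) \<omega>
      - H (p j i) \<omega> * (W (p j (Suc i)) \<omega> - W (p j i) \<omega>))\<^sup>2) (\<lambda>_. 0)"
proof -
  note D = partition_sequenceD[OF P]
  define E where "E = {\<omega>\<in>space M. t < \<tau> \<omega>}"
  have E: "E \<in> events" unfolding E_def by (rule stopping_time_less_event[OF \<tau> t])
  have pT: "p j i \<in> {0..T}" "p j i \<le> t" "0 \<le> p j i" if "i \<le> N j" for i j using D(5)[OF that] t by auto
  obtain K q \<xi> where sp: "\<And>n. simple_process M T F (K n) (q n) (\<xi> n)"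
    and L2: "\<And>s. s \<in> {0..T} \<Longrightarrow> tendsto_in_prob_on M {\<omega>\<in>space M. s < \<tau> \<omega>}
      (\<lambda>n \<omega>. LINT r:{0..s}|lborel. (simple_value (K n) (q n) (\<xi> n) r \<omega> - H r \<omega>)\<^sup>2) (\<lambda>_. 0)"
    and conv: "\<And>s. s \<in> {0..T} \<Longrightarrow> tendsto_in_prob_on M {\<omega>\<in>space M. s < \<tau> \<omega>}
      (\<lambda>n. simple_integral W (K n) (q n) (\<xi> n) s) (I s)"
    using ito unfolding ito_integral_on_def by blast
  have acH: "adapted_continuous M T F \<tau> H" and acI: "adapted_continuous M T F \<tau> I"
    using ito by (auto simp: ito_integral_on_def)
  \<comment> \<open>Adaptedness is granted only for the versions set to zero from
    \<open>\<tau>\<close> on; on \<open>E\<close> they agree with the originals up to time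
    \<open>t\<close>.\<close>
  define H' where "H' s \<omega> = (if s < \<tau> \<omega> then H s \<omega> else 0)" for s \<omega>
  define I' where "I' s \<omega> = (if s < \<tau> \<omega> then I s \<omega> else 0)" for s \<omega>
  have H'F: "H' s \<in> borel_measurable (F s)" and I'F: "I' s \<in> borel_measurable (F s)" if "s \<in> {0..T}" for s
    using acH acI that by (auto simp: adapted_continuous_def H'_def[abs_def] I'_def[abs_def])
  have H'M: "H' s \<in> borel_measurable M" and I'M: "I' s \<in> borel_measurable M" if "s \<in> {0..T}" for s
    using measurable_F_M[OF H'F[OF that]] measurable_F_M[OF I'F[OF that]] that by auto
  have HE: "H' s \<omega> = H s \<omega>" "I' s \<omega> = I s \<omega>" if "\<omega> \<in> E" "s \<le> t" for s \<omega>
    using that by (auto simp: E_def H'_def I'_def)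
  have WM: "W s \<in> borel_measurable M" if "s \<in> {0..T}" for s using W_measurable_M that by auto
  define R where "R j \<omega> = (\<Sum>i<N j. (I (p j (Suc i)) \<omega> - I (p j i) \<omega>
      - H (p j i) \<omega> * (W (p j (Suc i)) \<omega> - W (p j i) \<omega>))\<^sup>2)" for j \<omega>
  define R' where "R' j \<omega> = (\<Sum>i<N j. (I' (p j (Suc i)) \<omega> - I' (p j i) \<omega>
      - H' (p j i) \<omega> * (W (p j (Suc i)) \<omega> - W (p j i) \<omega>))\<^sup>2)" for j \<omega>
  have R'M: "R' j \<in> borel_measurable M" for j
    unfolding R'_def[abs_def] using pT
    by (intro borel_measurable_sum borel_measurable_power borel_measurable_diff borel_measurable_times
        H'M I'M WM) auto
  have RR': "R j \<omega> = R' j \<omega>" if "\<omega> \<in> E" for j \<omega>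
    unfolding R_def R'_def using HE[OF that] pT(2) by (intro sum.cong refl) auto
  have Rnn: "R j \<omega> \<ge> 0" for j \<omega> by (simp add: R_def sum_nonneg)
  have Rev: "{\<omega>\<in>E. \<epsilon> < R j \<omega>} \<in> events" for \<epsilon> j
  proof -
    have "{\<omega>\<in>E. \<epsilon> < R j \<omega>} = E \<inter> {\<omega>\<in>space M. \<epsilon> < R' j \<omega>}"
      using RR' sets.sets_into_space[OF E] by auto
    moreover have "{\<omega>\<in>space M. \<epsilon> < R' j \<omega>} \<in> events" using R'M by measurable
    ultimately show ?thesis using E by auto
  qed
  \<comment> \<open>Oscillation is tested at rational times only, so the event is a countable union;
    path continuity recovers all times.\<close>
  define B where "B \<eta> j = {\<omega>\<in>E. \<exists>i<N j. \<exists>s\<in>\<rat> \<inter> {p j i..p j (Suc i)}. \<eta> < \<bar>H s \<omega> - H (p j i) \<omega>\<bar>}" for \<eta> j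
  have Bev: "B \<eta> j \<in> events" for \<eta> j
  proof -
    have "B \<eta> j = E \<inter> (\<Union>i\<in>{..<N j}. \<Union>s\<in>\<rat> \<inter> {p j i..p j (Suc i)}. {\<omega>\<in>space M. \<eta> < \<bar>H' s \<omega> - H' (p j i) \<omega>\<bar>})"
    proof (rule set_eqI)
      fix \<omega>
      show "\<omega> \<in> B \<eta> j \<longleftrightarrow> \<omega> \<in> E \<inter> (\<Union>i\<in>{..<N j}. \<Union>s\<in>\<rat> \<inter> {p j i..p j (Suc i)}.
          {\<omega>\<in>space M. \<eta> < \<bar>H' s \<omega> - H' (p j i) \<omega>\<bar>})"
      proof (cases "\<omega> \<in> E")
        case True
        then have sp: "\<omega> \<in> space M" using sets.sets_into_space[OF E] by blast
        have eq: "\<bar>H s \<omega> - H (p j i) \<omega>\<bar> = \<bar>H' s \<omega> - H' (p j i) \<omega>\<bar>"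
          if "i \<in> {..<N j}" "s \<in> \<rat> \<inter> {p j i..p j (Suc i)}" for i s
          using HE[OF True] that pT(2)[of i j] pT(2)[of "Suc i" j] by auto
        have "(\<exists>i\<in>{..<N j}. \<exists>s\<in>\<rat> \<inter> {p j i..p j (Suc i)}. \<eta> < \<bar>H s \<omega> - H (p j i) \<omega>\<bar>) \<longleftrightarrow>
          (\<exists>i\<in>{..<N j}. \<exists>s\<in>\<rat> \<inter> {p j i..p j (Suc i)}. \<eta> < \<bar>H' s \<omega> - H' (p j i) \<omega>\<bar>)"
          by (intro bex_cong refl) (simp only: eq)
        then show ?thesis using True sp by (simp add: B_def Bex_def)
      qed (simp add: B_def)
    qed
    moreover have "{\<omega>\<in>space M. \<eta> < \<bar>H' s \<omega> - H' (p j i) \<omega>\<bar>} \<in> events"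
      if "i < N j" "s \<in> {p j i..p j (Suc i)}" for i s
    proof -
      have "s \<in> {0..T}" "p j i \<in> {0..T}"
        using pT[of i j] pT[of "Suc i" j] that by auto
      from H'M[OF this(1)] H'M[OF this(2)] show ?thesis by measurable
    qed
    moreover have "countable (\<rat> \<inter> {p j i..p j (Suc i)})" for i
      using countable_rat by (rule countable_subset[rotated]) auto
    ultimately show ?thesis
      using E by (auto intro!: sets.Int sets.finite_UN sets.countable_UN'')
  qed
  have Hc: "AE \<omega> in M. \<omega> \<in> E \<longrightarrow> continuous_on {0..t} (\<lambda>s. H s \<omega>)"
  proof -
    have "AE \<omega> in M. continuous_on {0..<\<tau> \<omega>} (\<lambda>s. H s \<omega>)"
      using acH by (simp add: adapted_continuous_def)
    then show ?thesis
      by eventually_elim (auto simp: E_def elim!: continuous_on_subset)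
  qed
  have HB: "AE \<omega> in M. \<omega> \<in> E \<longrightarrow> \<omega> \<notin> B \<eta> j \<longrightarrow>
      (\<forall>i<N j. \<forall>s\<in>{p j i..p j (Suc i)}. \<bar>H s \<omega> - H (p j i) \<omega>\<bar> \<le> \<eta>)" if \<eta>: "\<eta> \<ge> 0" for \<eta> j
    using Hc
  proof eventually_elim
    case (elim \<omega>)
    show ?case
    proof (intro impI allI ballI)
      fix i s assume *: "\<omega> \<in> E" "\<omega> \<notin> B \<eta> j" "i < N j" "s \<in> {p j i..p j (Suc i)}"
      show "\<bar>H s \<omega> - H (p j i) \<omega>\<bar> \<le> \<eta>"
      proof (rule continuous_bound_from_rationals[where a = "p j i" and b = "p j (Suc i)"])
        show "continuous_on {p j i..p j (Suc i)} (\<lambda>s. H s \<omega>)"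
          using elim * pT[of i j] pT[of "Suc i" j] by (auto elim!: continuous_on_subset)
        show "\<bar>H s \<omega> - H (p j i) \<omega>\<bar> \<le> \<eta>" if "s \<in> \<rat> \<inter> {p j i..p j (Suc i)}" for s
        proof (rule ccontr)
          assume "\<not> ?thesis"
          then have "\<omega> \<in> B \<eta> j"
            unfolding B_def using * that by (intro CollectI conjI exI[of _ i] bexI[of _ s]) (simp_all add: not_le)
          then show False using *(2) by simp
        qed
      qed (use \<eta> * in auto)
    qed
  qed
  have Blim: "(\<lambda>j. prob (B \<eta> j)) \<longlonglongrightarrow> 0" if \<eta>: "\<eta> > 0" for \<eta>
  proof (rule prob_tendsto_0_AE[OF Bev])
    show "AE \<omega> in M. \<forall>\<^sub>F j in sequentially. \<omega> \<notin> B \<eta> j"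
      using Hc
    proof eventually_elim
      case (elim \<omega>)
      show ?case
      proof (cases "\<omega> \<in> E")
        case True
        then have "uniformly_continuous_on {0..t} (\<lambda>s. H s \<omega>)"
          using elim by (intro compact_uniformly_continuous) auto
        then obtain d where d: "d > 0" "\<And>x y. x \<in> {0..t} \<Longrightarrow> y \<in> {0..t} \<Longrightarrow> dist y x < d \<Longrightarrow> dist (H y \<omega>) (H x \<omega>) < \<eta>"
          using \<eta> unfolding uniformly_continuous_on_def by metis
        from partition_sequence_mesh[OF P d(1)] show ?thesis
        proof eventually_elim
          case (elim j)
          have "\<bar>H s \<omega> - H (p j i) \<omega>\<bar> < \<eta>" if "i < N j" "s \<in> {p j i..p j (Suc i)}" for i s
            using d(2)[of "p j i" s] elim[rule_format, OF that(1)] that D(5)[of i j] D(5)[of "Suc i" j]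
            by (auto simp: dist_real_def)
          then show ?case by (force simp: B_def)
        qed
      qed (simp add: B_def)
    qed
  qed
  \<comment> \<open>The factor 4 pays for splitting the square of a sum: twice the error of
    replacing \<open>I\<close> plus twice the error of the simple integral, each at most
    \<open>2 * \<epsilon>\<close>.\<close>
  have est: "prob {\<omega>\<in>E. 4 * \<epsilon> < R j \<omega>} \<le> \<delta> / \<epsilon> + prob (B \<eta> j)"
    if pos: "\<epsilon> > 0" "\<delta> > 0" "\<eta> \<ge> 0" and \<eta>: "2 * \<eta>\<^sup>2 * t \<le> \<delta> / 2" for \<epsilon> \<delta> \<eta> j
  proof -
    let ?S = "\<lambda>n. simple_integral W (K n) (q n) (\<xi> n)"
    define G where "G n = {\<omega>\<in>E. \<delta> / 4 < \<bar>(LINT s:{0..t}|lborel. (simple_value (K n) (q n) (\<xi> n) s \<omega> - H s \<omega>)\<^sup>2) - 0\<bar>}" for n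
    have Gev: "G n \<in> events" and Glim: "(\<lambda>n. prob (G n)) \<longlonglongrightarrow> 0" for n
      using L2[OF t, unfolded tendsto_in_prob_on_def, rule_format, of "\<delta> / 4"] pos
      unfolding G_def E_def by auto
    \<comment> \<open>An error of \<open>\<theta>\<close> at both ends of an interval costs at most
      \<open>(2 * \<theta>)\<^sup>2\<close>; summed over the \<open>N j\<close> intervals this stays
      below \<open>\<epsilon>\<close>.\<close>
    define \<theta> where "\<theta> = sqrt (\<epsilon> / (4 * (real (N j) + 1)))"
    have \<theta>: "\<theta> > 0" using pos by (simp add: \<theta>_def)
    have \<theta>2: "real (N j) * (4 * \<theta>\<^sup>2) \<le> \<epsilon>"
      using pos by (simp add: \<theta>_def field_simps)
    \<comment> \<open>Convergence at \<open>p j i\<close> is known on \<open>p j i < \<tau>\<close>,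
      a larger event than \<open>E\<close>, so the exceptional event is defined there.\<close>
    define D' where "D' n i = {\<omega>\<in>{\<omega>\<in>space M. p j i < \<tau> \<omega>}. \<theta> < \<bar>?S n (p j i) \<omega> - I (p j i) \<omega>\<bar>}" for n i
    have D'ev: "D' n i \<in> events" and D'lim: "(\<lambda>n. prob (D' n i)) \<longlonglongrightarrow> 0" if "i \<le> N j" for n i
      using conv[OF pT(1)[OF that]] \<theta> unfolding tendsto_in_prob_on_def D'_def by blast+
    define Rn where "Rn n \<omega> = (\<Sum>i<N j. (?S n (p j (Suc i)) \<omega> - ?S n (p j i) \<omega>
      - H' (p j i) \<omega> * (W (p j (Suc i)) \<omega> - W (p j i) \<omega>))\<^sup>2)" for n \<omega>
    have SM: "?S n s \<in> borel_measurable M" if "s \<in> {0..T}" for n s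
    proof -
      have "\<xi> n k \<in> borel_measurable M" if "k < K n" for k
        using sp[of n] that measurable_F_M[of "\<xi> n k" "q n k" borel] by (auto simp: simple_process_def)
      moreover have "min s (q n k) \<in> {0..T}" if "k \<le> K n" for k
        using sp[of n] that \<open>s \<in> {0..T}\<close> by (auto simp: simple_process_def)
      ultimately show ?thesis
        unfolding simple_integral_def
        by (intro borel_measurable_sum borel_measurable_times borel_measurable_diff WM) auto
    qed
    have RnM: "Rn n \<in> borel_measurable M" for n
      unfolding Rn_def[abs_def] using pT
      by (intro borel_measurable_sum borel_measurable_power borel_measurable_diff borel_measurable_times
        H'M SM WM) auto
    have bound: "prob {\<omega>\<in>E. 4 * \<epsilon> < R j \<omega>} \<le> (\<delta> / \<epsilon> + prob (G n) + prob (B \<eta> j)) + (\<Sum>i\<le>N j. prob (D' n i))" for n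
    proof -
      have sub: "{\<omega>\<in>E. 4 * \<epsilon> < R j \<omega>} \<subseteq> {\<omega>\<in>E. \<epsilon> < Rn n \<omega>} \<union> (\<Union>i\<in>{..N j}. D' n i)"
      proof (rule subsetI, rule ccontr)
        fix \<omega> assume \<omega>: "\<omega> \<in> {\<omega>\<in>E. 4 * \<epsilon> < R j \<omega>}"
          and n: "\<omega> \<notin> {\<omega>\<in>E. \<epsilon> < Rn n \<omega>} \<union> (\<Union>i\<in>{..N j}. D' n i)"
        have \<omega>E: "\<omega> \<in> E" using \<omega> by simp
        have cl: "\<bar>?S n (p j i) \<omega> - I (p j i) \<omega>\<bar> \<le> \<theta>" if "i \<le> N j" for i
        proof -
          have "\<omega> \<in> space M" "p j i < \<tau> \<omega>" using \<omega>E pT(2)[OF that] by (auto simp: E_def)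
          moreover have "\<omega> \<notin> D' n i" using n that by blast
          ultimately show ?thesis by (simp add: D'_def not_less)
        qed
        have "R j \<omega> \<le> (\<Sum>i<N j. 2 * (4 * \<theta>\<^sup>2) + 2 * (?S n (p j (Suc i)) \<omega> - ?S n (p j i) \<omega>
            - H' (p j i) \<omega> * (W (p j (Suc i)) \<omega> - W (p j i) \<omega>))\<^sup>2)"
          unfolding R_def
        proof (rule sum_mono)
          fix i assume i: "i \<in> {..<N j}"
          let ?a = "(I (p j (Suc i)) \<omega> - ?S n (p j (Suc i)) \<omega>) - (I (p j i) \<omega> - ?S n (p j i) \<omega>)"
          let ?b = "?S n (p j (Suc i)) \<omega> - ?S n (p j i) \<omega> - H' (p j i) \<omega> * (W (p j (Suc i)) \<omega> - W (p j i) \<omega>)"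
          have "\<bar>?a\<bar> \<le> 2 * \<theta>" using cl[of i] cl[of "Suc i"] i by auto
          then have "?a\<^sup>2 \<le> (2 * \<theta>)\<^sup>2" by (metis abs_ge_zero power2_abs power_mono)
          then have a: "?a\<^sup>2 \<le> 4 * \<theta>\<^sup>2" by (simp add: power_mult_distrib)
          have "H' (p j i) \<omega> = H (p j i) \<omega>" using HE(1)[OF \<omega>E] pT(2)[of i j] i by auto
          then have "(I (p j (Suc i)) \<omega> - I (p j i) \<omega> - H (p j i) \<omega> * (W (p j (Suc i)) \<omega> - W (p j i) \<omega>))\<^sup>2
              = (?a + ?b)\<^sup>2" by (simp add: algebra_simps)
          also have "\<dots> \<le> 2 * ?a\<^sup>2 + 2 * ?b\<^sup>2" by (rule square_add_le)
          finally show "(I (p j (Suc i)) \<omega> - I (p j i) \<omega> - H (p j i) \<omega> * (W (p j (Suc i)) \<omega> - W (p j i) \<omega>))\<^sup>2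
              \<le> 2 * (4 * \<theta>\<^sup>2) + 2 * ?b\<^sup>2" using a by linarith
        qed
        also have "\<dots> = 2 * (real (N j) * (4 * \<theta>\<^sup>2)) + 2 * Rn n \<omega>"
          by (simp add: sum.distrib Rn_def sum_distrib_left)
        also have "\<dots> \<le> 2 * \<epsilon> + 2 * \<epsilon>" using \<theta>2 n \<omega>E by (intro add_mono mult_left_mono) auto
        finally show False using \<omega> by simp
      qed
      have ev: "{\<omega>\<in>E. \<epsilon> < Rn n \<omega>} \<in> events"
      proof -
        have "{\<omega>\<in>E. \<epsilon> < Rn n \<omega>} = E \<inter> {\<omega>\<in>space M. \<epsilon> < Rn n \<omega>}"
          using sets.sets_into_space[OF E] by auto
        moreover have "{\<omega>\<in>space M. \<epsilon> < Rn n \<omega>} \<in> events" using RnM by measurable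
        ultimately show ?thesis using E by auto
      qed
      have ev2: "(\<Union>i\<in>{..N j}. D' n i) \<in> events" using D'ev by (intro sets.finite_UN) auto
      have "prob {\<omega>\<in>E. 4 * \<epsilon> < R j \<omega>} \<le> prob ({\<omega>\<in>E. \<epsilon> < Rn n \<omega>} \<union> (\<Union>i\<in>{..N j}. D' n i))"
        using ev ev2 by (intro finite_measure_mono[OF sub]) auto
      also have "\<dots> \<le> prob {\<omega>\<in>E. \<epsilon> < Rn n \<omega>} + prob (\<Union>i\<in>{..N j}. D' n i)"
        by (rule measure_Un_le[OF ev ev2])
      also have "prob (\<Union>i\<in>{..N j}. D' n i) \<le> (\<Sum>i\<le>N j. prob (D' n i))"
        using D'ev by (intro measure_UNION_le) auto
      also have "prob {\<omega>\<in>E. \<epsilon> < Rn n \<omega>} \<le> \<delta> / \<epsilon> + prob (G n) + prob (B \<eta> j)"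
        unfolding Rn_def G_def
      proof (rule simple_integral_block_estimate[OF sp, where \<eta> = \<eta> and t = t])
        show "H' (p j i) \<in> borel_measurable (F (p j i))" if "i < N j" for i
          using H'F pT(1)[of i j] that by auto
        show "AE \<omega> in M. \<omega> \<in> E \<longrightarrow> continuous_on {0..t} (\<lambda>s. H s \<omega>) \<and> (\<forall>i<N j. H' (p j i) \<omega> = H (p j i) \<omega>)"
          using Hc by eventually_elim (auto simp: HE pT(2))
        show "{\<omega>\<in>E. \<delta> / 4 < \<bar>(LINT s:{0..t}|lborel. (simple_value (K n) (q n) (\<xi> n) s \<omega> - H s \<omega>)\<^sup>2) - 0\<bar>} \<in> events"
          using Gev[of n] by (simp add: G_def)
        show "AE \<omega> in M. \<omega> \<in> E \<longrightarrow> \<omega> \<notin> B \<eta> j \<longrightarrow>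
          (\<forall>i<N j. \<forall>s\<in>{p j i..p j (Suc i)}. \<bar>H s \<omega> - H (p j i) \<omega>\<bar> \<le> \<eta>)"
          by (rule HB[OF pos(3)])
      qed (use D t E pos \<eta> Bev in \<open>simp_all\<close>)
      finally show ?thesis by simp
    qed
    \<comment> \<open>The left-hand side to be bounded does not involve \<open>n\<close>, so the
      terms belonging to the approximation disappear in the limit.\<close>
    have "(\<lambda>n. (\<delta> / \<epsilon> + prob (G n) + prob (B \<eta> j)) + (\<Sum>i\<le>N j. prob (D' n i)))
        \<longlonglongrightarrow> (\<delta> / \<epsilon> + 0 + prob (B \<eta> j)) + (\<Sum>i\<le>N j. 0)"
      by (intro tendsto_intros Glim D'lim) auto
    from LIMSEQ_le_const[OF this, of "prob {\<omega>\<in>E. 4 * \<epsilon> < R j \<omega>}"] bound show ?thesis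
      by simp
  qed
  have lim: "(\<lambda>j. prob {\<omega>\<in>E. 4 * \<epsilon> < R j \<omega>}) \<longlonglongrightarrow> 0" if \<epsilon>: "\<epsilon> > 0" for \<epsilon>
  proof (rule LIMSEQ_I)
    fix e :: real assume e: "e > 0"
    \<comment> \<open>Makes \<open>\<delta> / \<epsilon>\<close> equal to \<open>e / 2\<close>; the
      other half of \<open>e\<close> is left for the oscillation event.\<close>
    define \<delta> where "\<delta> = \<epsilon> * e / 2"
    define \<eta> where "\<eta> = sqrt (\<delta> / (4 * (t + 1)))"
    have \<delta>: "\<delta> > 0" using \<epsilon> e by (simp add: \<delta>_def)
    have t0: "t \<ge> 0" using t by simp
    have \<eta>: "\<eta> > 0" using \<delta> t0 by (simp add: \<eta>_def)
    have \<eta>2: "2 * \<eta>\<^sup>2 * t \<le> \<delta> / 2"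
      using \<delta> t0 by (simp add: \<eta>_def field_simps)
    have "\<forall>\<^sub>F j in sequentially. prob (B \<eta> j) < e / 2"
      using order_tendstoD(2)[OF Blim[OF \<eta>], of "e / 2"] e by simp
    then have "\<forall>\<^sub>F j in sequentially. norm (prob {\<omega>\<in>E. 4 * \<epsilon> < R j \<omega>} - 0) < e"
    proof eventually_elim
      case (elim j)
      have "\<delta> / \<epsilon> = e / 2" using \<epsilon> by (simp add: \<delta>_def)
      then show ?case using est[OF \<epsilon> \<delta> less_imp_le[OF \<eta>] \<eta>2, of j] elim by simp
    qed
    then show "\<exists>no. \<forall>n\<ge>no. norm (prob {\<omega>\<in>E. 4 * \<epsilon> < R n \<omega>} - 0) < e"
      by (simp add: eventually_sequentially)
  qed
  have "tendsto_in_prob_on M E R (\<lambda>_. 0)"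
    unfolding tendsto_in_prob_on_def
  proof (intro allI impI conjI)
    fix \<epsilon> :: real assume \<epsilon>: "\<epsilon> > 0"
    have eq: "{\<omega>\<in>E. \<epsilon> < \<bar>R j \<omega> - 0\<bar>} = {\<omega>\<in>E. \<epsilon> < R j \<omega>}" for j using Rnn by simp
    show "{\<omega>\<in>E. \<epsilon> < \<bar>R j \<omega> - 0\<bar>} \<in> events" for j unfolding eq by (rule Rev)
    show "(\<lambda>j. prob {\<omega>\<in>E. \<epsilon> < \<bar>R j \<omega> - 0\<bar>}) \<longlonglongrightarrow> 0"
      unfolding eq using lim[of "\<epsilon> / 4"] \<epsilon> by simp
  qed
  then show ?thesis by (simp only: E_def R_def[abs_def])
qed

end

section \<open>Quadratic variation\<close>

text \<open>On \<open>[0, t]\<close> the integrand is bounded by some \<open>C\<close>, so an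
  increment is at most \<open>C\<close> times the length of its interval, and the squares sum to at
  most \<open>C\<^sup>2\<close> times mesh times \<open>t\<close>.\<close>

lemma drift_increments_tendsto_0:
  fixes b :: "real \<Rightarrow> real"
  assumes P: "partition_sequence t N p" and b: "continuous_on {0..t} b"
  shows "(\<lambda>j. \<Sum>i<N j. ((LINT s:{0..p j (Suc i)}|lborel. b s) - (LINT s:{0..p j i}|lborel. b s))\<^sup>2) \<longlonglongrightarrow> 0"
proof (rule LIMSEQ_I)
  fix \<epsilon> :: real assume \<epsilon>: "\<epsilon> > 0"
  note D = partition_sequenceD[OF P]
  have t0: "t \<ge> 0" using D(5)[of 0 0] by simp
  obtain C0 where "\<forall>y\<in>b ` {0..t}. norm y \<le> C0"
    using compact_imp_bounded[OF compact_continuous_image[OF b]] unfolding bounded_iff by auto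
  then have C0: "\<And>s. s \<in> {0..t} \<Longrightarrow> \<bar>b s\<bar> \<le> C0" by simp
  define C where "C = \<bar>C0\<bar> + 1"
  have C: "C > 0" "\<And>s. s \<in> {0..t} \<Longrightarrow> \<bar>b s - 0\<bar> \<le> C" using C0 by (force simp: C_def)+
  define d where "d = \<epsilon> / (C\<^sup>2 * (t + 1))"
  have d: "d > 0" using \<epsilon> C t0 by (simp add: d_def)
  let ?I = "\<lambda>s. LINT s:{0..s}|lborel. b s"
  have "\<forall>\<^sub>F j in sequentially. norm ((\<Sum>i<N j. (?I (p j (Suc i)) - ?I (p j i))\<^sup>2) - 0) < \<epsilon>"
    using partition_sequence_mesh[OF P d]
  proof eventually_elim
    case (elim j)
    have "(\<Sum>i<N j. (?I (p j (Suc i)) - ?I (p j i))\<^sup>2) \<le> (\<Sum>i<N j. C\<^sup>2 * d * (p j (Suc i) - p j i))"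
    proof (rule sum_mono)
      fix i assume "i \<in> {..<N j}"
      then have i: "i < N j" by simp
      have "\<bar>?I (p j (Suc i)) - ?I (p j i) - 0 * (p j (Suc i) - p j i)\<bar> \<le> C * (p j (Suc i) - p j i)"
      proof (rule continuous_integral_increment_bound[OF b])
        show "\<bar>b s - 0\<bar> \<le> C" if "s \<in> {p j i..p j (Suc i)}" for s
          using that D(5)[of i j] D(5)[of "Suc i" j] i by (intro C(2)) auto
      qed (use D(5)[of i j] D(5)[of "Suc i" j] D(3)[of i j] i in auto)
      then have "\<bar>?I (p j (Suc i)) - ?I (p j i)\<bar> \<le> C * (p j (Suc i) - p j i)" by simp
      then have "(?I (p j (Suc i)) - ?I (p j i))\<^sup>2 \<le> (C * (p j (Suc i) - p j i))\<^sup>2"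
        by (metis abs_ge_zero power2_abs power_mono)
      also have "\<dots> = C\<^sup>2 * ((p j (Suc i) - p j i) * (p j (Suc i) - p j i))"
        by (simp add: power2_eq_square)
      also have "\<dots> \<le> C\<^sup>2 * (d * (p j (Suc i) - p j i))"
        using elim i D(3)[OF i] by (intro mult_left_mono mult_right_mono) (auto intro: less_imp_le)
      finally show "(?I (p j (Suc i)) - ?I (p j i))\<^sup>2 \<le> C\<^sup>2 * d * (p j (Suc i) - p j i)"
        by (simp add: mult.assoc)
    qed
    also have "\<dots> = C\<^sup>2 * d * t" using D(6)[of j] by (simp flip: sum_distrib_left)
    also have "\<dots> < \<epsilon>"
    proof -
      have e: "C\<^sup>2 * d = \<epsilon> / (t + 1)" using C(1) by (simp add: d_def)
      show ?thesis unfolding e using \<epsilon> t0 by (simp add: field_simps)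
    qed
    finally show ?case by (simp add: sum_nonneg)
  qed
  then show "\<exists>no. \<forall>n\<ge>no. norm ((\<Sum>i<N n. (?I (p n (Suc i)) - ?I (p n i))\<^sup>2) - 0) < \<epsilon>"
    by (simp add: eventually_sequentially)
qed

text \<open>Cauchy-Schwarz bounds the mixed sum by the geometric mean of a null sequence and a
  convergent one.\<close>

lemma sums_of_squares_perturbation:
  fixes y z :: "nat \<Rightarrow> nat \<Rightarrow> real"
  assumes y: "(\<lambda>j. \<Sum>i<N j. (y j i)\<^sup>2) \<longlonglongrightarrow> 0" and z: "(\<lambda>j. \<Sum>i<N j. (z j i)\<^sup>2) \<longlonglongrightarrow> A"
  shows "(\<lambda>j. \<Sum>i<N j. (y j i - z j i)\<^sup>2) \<longlonglongrightarrow> A"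
proof -
  let ?Y = "\<lambda>j. \<Sum>i<N j. (y j i)\<^sup>2" and ?Z = "\<lambda>j. \<Sum>i<N j. (z j i)\<^sup>2"
  have "(\<lambda>j. \<Sum>i<N j. y j i * z j i) \<longlonglongrightarrow> 0"
  proof (rule Lim_null_comparison)
    show "\<forall>\<^sub>F j in sequentially. norm (\<Sum>i<N j. y j i * z j i) \<le> sqrt (?Y j * ?Z j)"
      using Cauchy_Schwarz_ineq_sum[where a = "y _" and b = "z _"]
      by (intro always_eventually allI) (auto intro: real_le_rsqrt)
    have "(\<lambda>j. sqrt (?Y j * ?Z j)) \<longlonglongrightarrow> sqrt (0 * A)" by (intro tendsto_intros y z)
    then show "(\<lambda>j. sqrt (?Y j * ?Z j)) \<longlonglongrightarrow> 0" by simp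
  qed
  from tendsto_add[OF tendsto_diff[OF y tendsto_mult_left[OF this, of 2]] z]
  show ?thesis
    by (simp add: power2_diff sum.distrib sum_subtractf sum_distrib_left algebra_simps)
qed

text \<open>Purely deterministic: one path, one partition sequence, and the two kinds of limit that
  hold almost surely along a subsequence. Expanding the square of the martingale part leaves
  weighted sums of products of increments; the compensator is present only on the diagonal, where it
  gives Riemann sums of \<open>(h l)\<^sup>2\<close>.\<close>

lemma quadratic_variation_pathwise:
  fixes w i h :: "'l \<Rightarrow> real \<Rightarrow> real" and b x :: "real \<Rightarrow> real"
  assumes L: "finite L" and P: "partition_sequence t N p"
    and h: "\<And>l. l \<in> L \<Longrightarrow> continuous_on {0..t} (h l)" and b: "continuous_on {0..t} b"
    and x: "\<And>s. s \<in> {0..t} \<Longrightarrow> x s = x0 + (LINT r:{0..s}|lborel. b r) - (\<Sum>l\<in>L. i l s)"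
    and R: "\<And>l. l \<in> L \<Longrightarrow> (\<lambda>j. \<Sum>k<N j. (i l (p j (Suc k)) - i l (p j k)
        - h l (p j k) * (w l (p j (Suc k)) - w l (p j k)))\<^sup>2) \<longlonglongrightarrow> 0"
    and C: "\<And>l l' r. l \<in> L \<Longrightarrow> l' \<in> L \<Longrightarrow> r \<in> \<rat> \<Longrightarrow> (\<lambda>j. \<Sum>k\<in>{k. k < N j \<and> p j k < r}.
        (w l (p j (Suc k)) - w l (p j k)) * (w l' (p j (Suc k)) - w l' (p j k))
        - (if l = l' then p j (Suc k) - p j k else 0)) \<longlonglongrightarrow> 0"
  shows "(\<lambda>j. \<Sum>k<N j. (x (p j (Suc k)) - x (p j k))\<^sup>2) \<longlonglongrightarrow> (\<Sum>l\<in>L. LINT s:{0..t}|lborel. (h l s)\<^sup>2)"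
proof -
  note D = partition_sequenceD[OF P]
  define dw where "dw l j k = w l (p j (Suc k)) - w l (p j k)" for l j k
  define \<delta> where "\<delta> j k = p j (Suc k) - p j k" for j k
  define c where "c l l' j k = dw l j k * dw l' j k - (if l = l' then \<delta> j k else 0)" for l l' j k
  have \<delta>0: "\<delta> j k \<ge> 0" if "k < N j" for j k using D(3)[OF that] by (simp add: \<delta>_def)
  have Cr: "(\<lambda>j. \<Sum>k\<in>{k. k < N j \<and> p j k < r}. c l l' j k) \<longlonglongrightarrow> 0" if "l \<in> L" "l' \<in> L" "r \<in> \<rat>" for l l' r
    using C[OF that] unfolding c_def dw_def \<delta>_def .
  have sq: "(\<lambda>j. \<Sum>k<N j. (dw l j k)\<^sup>2) \<longlonglongrightarrow> t" if l: "l \<in> L" for l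
  proof -
    obtain r where r: "r \<in> \<rat>" "t < r" using Rats_dense_in_real[of t "t + 1"] by auto
    have "p j k < r" if "k < N j" for j k using D(5)[of k j] r that by auto
    then have "{k. k < N j \<and> p j k < r} = {..<N j}" for j by auto
    then have "(\<lambda>j. \<Sum>k<N j. (dw l j k)\<^sup>2 - \<delta> j k) \<longlonglongrightarrow> 0"
      using Cr[OF l l r(1)] by (simp add: c_def power2_eq_square)
    then have "(\<lambda>j. (\<Sum>k<N j. (dw l j k)\<^sup>2) - t) \<longlonglongrightarrow> 0"
      using D(6) by (simp add: sum_subtractf \<delta>_def)
    then show ?thesis by (simp add: LIM_zero_iff)
  qed
  \<comment> \<open>The sums of squared increments converge and hence are bounded; mixed sums are
    controlled by them. This is the uniform bound that freezing the weights requires.\<close>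
  have bnd: "\<exists>B. \<forall>j. (\<Sum>k<N j. \<bar>c l l' j k\<bar>) \<le> B" if l: "l \<in> L" "l' \<in> L" for l l'
  proof -
    obtain B1 where B1: "\<And>j. norm (\<Sum>k<N j. (dw l j k)\<^sup>2) \<le> B1"
      using convergent_imp_Bseq[OF convergentI[OF sq[OF l(1)]]] by (auto simp: Bseq_def)
    obtain B2 where B2: "\<And>j. norm (\<Sum>k<N j. (dw l' j k)\<^sup>2) \<le> B2"
      using convergent_imp_Bseq[OF convergentI[OF sq[OF l(2)]]] by (auto simp: Bseq_def)
    have "(\<Sum>k<N j. \<bar>c l l' j k\<bar>) \<le> B1 + B2 + t" for j
    proof -
      have "(\<Sum>k<N j. \<bar>c l l' j k\<bar>) \<le> (\<Sum>k<N j. (dw l j k)\<^sup>2 + (dw l' j k)\<^sup>2 + \<delta> j k)"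
      proof (rule sum_mono)
        fix k assume "k \<in> {..<N j}"
        then have "\<delta> j k \<ge> 0" using \<delta>0 by simp
        moreover have "\<bar>dw l j k * dw l' j k\<bar> \<le> (dw l j k)\<^sup>2 + (dw l' j k)\<^sup>2"
        proof -
          have "2 * (\<bar>dw l j k\<bar> * \<bar>dw l' j k\<bar>) \<le> (dw l j k)\<^sup>2 + (dw l' j k)\<^sup>2"
            using sum_squares_bound[of "\<bar>dw l j k\<bar>" "\<bar>dw l' j k\<bar>"] by (simp add: mult.assoc)
          moreover have "0 \<le> \<bar>dw l j k\<bar> * \<bar>dw l' j k\<bar>" by simp
          ultimately show ?thesis unfolding abs_mult by linarith
        qed
        ultimately show "\<bar>c l l' j k\<bar> \<le> (dw l j k)\<^sup>2 + (dw l' j k)\<^sup>2 + \<delta> j k"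
          unfolding c_def using abs_triangle_ineq4[of "dw l j k * dw l' j k" "if l = l' then \<delta> j k else 0"]
          by (auto split: if_splits)
      qed
      also have "\<dots> = (\<Sum>k<N j. (dw l j k)\<^sup>2) + (\<Sum>k<N j. (dw l' j k)\<^sup>2) + t"
        using D(6)[of j] by (simp add: sum.distrib \<delta>_def)
      finally show ?thesis using B1[of j] B2[of j] by simp
    qed
    then show ?thesis by blast
  qed
  define A where "A l = (LINT s:{0..t}|lborel. (h l s)\<^sup>2)" for l
  have hh: "(\<lambda>j. \<Sum>k<N j. (h l (p j k) * h l' (p j k)) * (dw l j k * dw l' j k)) \<longlonglongrightarrow> (if l = l' then A l else 0)"
    if l: "l \<in> L" "l' \<in> L" for l l'
  proof -
    obtain B where B: "\<And>j. (\<Sum>k<N j. \<bar>c l l' j k\<bar>) \<le> B" using bnd[OF l] by auto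
    have "(\<lambda>j. \<Sum>k<N j. (h l (p j k) * h l' (p j k)) * c l l' j k) \<longlonglongrightarrow> 0"
    proof (rule weighted_sums_tendsto_0[where h = "\<lambda>s. h l s * h l' s" and t = t and C = B])
      show "continuous_on {0..t} (\<lambda>s. h l s * h l' s)" by (intro continuous_intros h l)
      show "p j i \<in> {0..t}" if "i < N j" for i j using D(5)[of i j] that by auto
    qed (use B Cr[OF l] in auto)
    moreover have "(\<lambda>j. \<Sum>k<N j. (h l (p j k) * h l' (p j k)) * (if l = l' then \<delta> j k else 0))
        \<longlonglongrightarrow> (if l = l' then A l else 0)"
    proof (cases "l = l'")
      case True
      have "continuous_on {0..t} (\<lambda>s. (h l s)\<^sup>2)" by (intro continuous_intros h l)
      from riemann_sums_tendsto[OF P this] show ?thesis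
        using True by (simp add: A_def \<delta>_def power2_eq_square)
    qed simp
    ultimately have "(\<lambda>j. (\<Sum>k<N j. (h l (p j k) * h l' (p j k)) * c l l' j k) +
        (\<Sum>k<N j. (h l (p j k) * h l' (p j k)) * (if l = l' then \<delta> j k else 0))) \<longlonglongrightarrow> 0 + (if l = l' then A l else 0)"
      by (rule tendsto_add)
    then show ?thesis
      unfolding sum.distrib[symmetric] distrib_left[symmetric] by (simp add: c_def)
  qed
  define z where "z j k = (\<Sum>l\<in>L. h l (p j k) * dw l j k)" for j k
  have zlim: "(\<lambda>j. \<Sum>k<N j. (z j k)\<^sup>2) \<longlonglongrightarrow> (\<Sum>l\<in>L. A l)"
  proof -
    have "(\<lambda>j. \<Sum>l\<in>L. \<Sum>l'\<in>L. \<Sum>k<N j. (h l (p j k) * h l' (p j k)) * (dw l j k * dw l' j k))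
        \<longlonglongrightarrow> (\<Sum>l\<in>L. \<Sum>l'\<in>L. if l = l' then A l else 0)"
      by (intro tendsto_sum hh)
    moreover have "(\<Sum>k<N j. (z j k)\<^sup>2) = (\<Sum>l\<in>L. \<Sum>l'\<in>L. \<Sum>k<N j. (h l (p j k) * h l' (p j k)) * (dw l j k * dw l' j k))" for j
    proof -
      have "(z j k)\<^sup>2 = (\<Sum>l\<in>L. \<Sum>l'\<in>L. (h l (p j k) * h l' (p j k)) * (dw l j k * dw l' j k))" for k
        unfolding z_def power2_eq_square sum_product by (intro sum.cong refl) (simp only: mult_ac)
      then have "(\<Sum>k<N j. (z j k)\<^sup>2) = (\<Sum>k<N j. \<Sum>l\<in>L. \<Sum>l'\<in>L. (h l (p j k) * h l' (p j k)) * (dw l j k * dw l' j k))"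
        by simp
      also have "\<dots> = (\<Sum>l\<in>L. \<Sum>k<N j. \<Sum>l'\<in>L. (h l (p j k) * h l' (p j k)) * (dw l j k * dw l' j k))"
        by (rule sum.swap)
      also have "\<dots> = (\<Sum>l\<in>L. \<Sum>l'\<in>L. \<Sum>k<N j. (h l (p j k) * h l' (p j k)) * (dw l j k * dw l' j k))"
        by (intro sum.cong refl sum.swap)
      finally show ?thesis .
    qed
    ultimately show ?thesis using L by simp
  qed
  define I where "I s = (LINT r:{0..s}|lborel. b r)" for s
  define e where "e l j k = i l (p j (Suc k)) - i l (p j k) - h l (p j k) * dw l j k" for l j k
  \<comment> \<open>An increment of \<open>x\<close> is \<open>y - z\<close>: \<open>y\<close>
    gathers the drift and the errors of replacing increments of \<open>i\<close> by \<open>h\<close>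
    times increments of \<open>w\<close>.\<close>
  define y where "y j k = (I (p j (Suc k)) - I (p j k)) - (\<Sum>l\<in>L. e l j k)" for j k
  have ylim: "(\<lambda>j. \<Sum>k<N j. (y j k)\<^sup>2) \<longlonglongrightarrow> 0"
  proof (rule tendsto_sandwich[OF _ _ tendsto_const])
    let ?U = "\<lambda>j. 2 * (\<Sum>k<N j. (I (p j (Suc k)) - I (p j k))\<^sup>2) + 2 * (\<Sum>l\<in>L. \<Sum>k<N j. (e l j k)\<^sup>2) * card L"
    show "\<forall>\<^sub>F j in sequentially. 0 \<le> (\<Sum>k<N j. (y j k)\<^sup>2)"
      by (intro always_eventually allI sum_nonneg) simp
    show "\<forall>\<^sub>F j in sequentially. (\<Sum>k<N j. (y j k)\<^sup>2) \<le> ?U j"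
    proof (intro always_eventually allI)
      fix j
      have "(\<Sum>k<N j. (y j k)\<^sup>2) \<le> (\<Sum>k<N j. 2 * (I (p j (Suc k)) - I (p j k))\<^sup>2 + 2 * ((\<Sum>l\<in>L. (e l j k)\<^sup>2) * card L))"
      proof (rule sum_mono)
        fix k
        have "(y j k)\<^sup>2 \<le> 2 * (I (p j (Suc k)) - I (p j k))\<^sup>2 + 2 * (\<Sum>l\<in>L. e l j k)\<^sup>2"
          unfolding y_def using square_add_le[of "I (p j (Suc k)) - I (p j k)" "- (\<Sum>l\<in>L. e l j k)"] by simp
        then show "(y j k)\<^sup>2 \<le> 2 * (I (p j (Suc k)) - I (p j k))\<^sup>2 + 2 * ((\<Sum>l\<in>L. (e l j k)\<^sup>2) * card L)"
          using sum_squared_le_sum_of_squares[of "\<lambda>l. e l j k" L] by linarith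
      qed
      also have "\<dots> = ?U j"
        by (simp add: sum.distrib sum_distrib_left sum_distrib_right sum.swap[of _ L] mult.assoc)
      finally show "(\<Sum>k<N j. (y j k)\<^sup>2) \<le> ?U j" .
    qed
    have "?U \<longlonglongrightarrow> 2 * (0::real) + 2 * (\<Sum>l\<in>L. 0) * real (card L)"
      unfolding I_def e_def dw_def by (intro tendsto_intros drift_increments_tendsto_0[OF P b] R)
    then show "?U \<longlonglongrightarrow> 0" by simp
  qed
  have dx: "x (p j (Suc k)) - x (p j k) = y j k - z j k" if "k < N j" for j k
  proof -
    have "p j k \<in> {0..t}" "p j (Suc k) \<in> {0..t}" using D(5)[of k j] D(5)[of "Suc k" j] that by auto
    then show ?thesis
      by (simp add: x y_def z_def e_def I_def sum_subtractf)
  qed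
  have "(\<lambda>j. \<Sum>k<N j. (y j k - z j k)\<^sup>2) \<longlonglongrightarrow> (\<Sum>l\<in>L. A l)"
    by (rule sums_of_squares_perturbation[OF ylim zlim])
  then show ?thesis by (simp add: dx A_def)
qed

context filtered_prob_space
begin

text \<open>The subsequence criterion reduces the claim to paths. Any subsequence of the partitions
  is again a partition sequence, so the limits in probability are available along it.\<close>

lemma semimartingale_quadratic_variation:
  fixes W H I :: "'l \<Rightarrow> real \<Rightarrow> 'w \<Rightarrow> real" and X b :: "real \<Rightarrow> 'w \<Rightarrow> real"
  assumes L: "finite L" and W: "\<And>l. l \<in> L \<Longrightarrow> wiener_process M T F (W l)"
    and ind: "independent_processes M T L W" and \<tau>: "stopping_time_upto M T F \<tau>"
    and ito: "\<And>l. l \<in> L \<Longrightarrow> ito_integral_on M T F \<tau> (W l) (H l) (I l)"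
    and X: "\<And>t. t \<in> {0..T} \<Longrightarrow> (\<lambda>\<omega>. if t < \<tau> \<omega> then X t \<omega> else 0) \<in> borel_measurable M"
    and dec: "AE \<omega> in M. continuous_on {0..<\<tau> \<omega>} (\<lambda>s. b s \<omega>) \<and>
      (\<forall>t\<in>{0..<\<tau> \<omega>}. X t \<omega> = X 0 \<omega> + (LINT s:{0..t}|lborel. b s \<omega>) - (\<Sum>l\<in>L. I l t \<omega>))"
  shows "has_covariation M T \<tau> X X (\<lambda>t \<omega>. \<Sum>l\<in>L. LINT s:{0..t}|lborel. (H l s \<omega>)\<^sup>2)"
  unfolding has_covariation_def
proof (intro ballI allI impI)
  fix t N p assume t: "t \<in> {0..T}" and P: "partition_sequence t N p"
  define E where "E = {\<omega>\<in>space M. t < \<tau> \<omega>}"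
  have E: "E \<in> events" unfolding E_def by (rule stopping_time_less_event[OF \<tau> t])
  let ?A = "\<lambda>\<omega>. \<Sum>l\<in>L. LINT s:{0..t}|lborel. (H l s \<omega>)\<^sup>2"
  let ?V = "\<lambda>j \<omega>. \<Sum>i<N j. (X (p j (Suc i)) \<omega> - X (p j i) \<omega>) * (X (p j (Suc i)) \<omega> - X (p j i) \<omega>)"
  have acH: "adapted_continuous M T F \<tau> (H l)" if "l \<in> L" for l
    using ito[OF that] by (simp add: ito_integral_on_def)
  have Hc: "AE \<omega> in M. \<forall>l\<in>L. continuous_on {0..<\<tau> \<omega>} (\<lambda>s. H l s \<omega>)"
    using acH by (intro AE_finite_allI L) (auto simp: adapted_continuous_def)
  have "tendsto_in_prob_on M E ?V ?A"
  proof (rule tendsto_in_prob_subseqI)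
    fix \<epsilon> :: real and j assume \<epsilon>: "\<epsilon> > 0"
    note D = partition_sequenceD[OF P]
    have A1: "(\<lambda>\<omega>. if t < \<tau> \<omega> then LINT s:{0..t}|lborel. (H l s \<omega>)\<^sup>2 else 0) \<in> borel_measurable M" if l: "l \<in> L" for l
    proof (rule measurable_time_integral[OF \<tau> t])
      fix s assume s: "s \<in> {0..T}"
      have "(\<lambda>\<omega>. if s < \<tau> \<omega> then H l s \<omega> else 0) \<in> borel_measurable (F s)"
        using acH[OF l] s by (simp add: adapted_continuous_def)
      then have "(\<lambda>\<omega>. if s < \<tau> \<omega> then H l s \<omega> else 0) \<in> borel_measurable M"
        by (rule measurable_F_M) (use s in auto)
      then have "(\<lambda>\<omega>. (if s < \<tau> \<omega> then H l s \<omega> else 0)\<^sup>2) \<in> borel_measurable M" by measurable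
      then show "(\<lambda>\<omega>. if s < \<tau> \<omega> then (H l s \<omega>)\<^sup>2 else 0) \<in> borel_measurable M"
        by (rule measurable_cong[THEN iffD1, rotated]) auto
    next
      show "AE \<omega> in M. continuous_on {0..<\<tau> \<omega>} (\<lambda>s. (H l s \<omega>)\<^sup>2)"
        using Hc by eventually_elim (use l in \<open>auto intro!: continuous_intros\<close>)
    qed
    \<comment> \<open>On \<open>E\<close> every partition point lies before \<open>\<tau>\<close>,
      so this measurable expression equals the error that defines the event.\<close>
    define Y where "Y \<omega> = (\<Sum>i<N j. ((if p j (Suc i) < \<tau> \<omega> then X (p j (Suc i)) \<omega> else 0) - (if p j i < \<tau> \<omega> then X (p j i) \<omega> else 0)) *
        ((if p j (Suc i) < \<tau> \<omega> then X (p j (Suc i)) \<omega> else 0) - (if p j i < \<tau> \<omega> then X (p j i) \<omega> else 0)))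
      - (\<Sum>l\<in>L. if t < \<tau> \<omega> then LINT s:{0..t}|lborel. (H l s \<omega>)\<^sup>2 else 0)" for \<omega>
    have pT: "p j i \<in> {0..T}" "p j i \<le> t" if "i \<le> N j" for i using D(5)[OF that] t by auto
    have YM: "Y \<in> borel_measurable M"
      unfolding Y_def[abs_def] using pT
      by (intro borel_measurable_diff borel_measurable_sum borel_measurable_times X A1) auto
    have "Y \<omega> = ?V j \<omega> - ?A \<omega>" if "\<omega> \<in> E" for \<omega>
    proof -
      have "p j i < \<tau> \<omega>" if "i \<le> N j" for i using pT(2)[OF that] \<open>\<omega> \<in> E\<close> by (simp add: E_def)
      then show ?thesis using that by (simp add: Y_def E_def)
    qed
    then have "{\<omega>\<in>E. \<epsilon> < \<bar>?V j \<omega> - ?A \<omega>\<bar>} = E \<inter> {\<omega>\<in>space M. \<epsilon> < \<bar>Y \<omega>\<bar>}"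
      using sets.sets_into_space[OF E] by auto
    moreover have "{\<omega>\<in>space M. \<epsilon> < \<bar>Y \<omega>\<bar>} \<in> events" using YM by measurable
    ultimately show "{\<omega>\<in>E. \<epsilon> < \<bar>?V j \<omega> - ?A \<omega>\<bar>} \<in> events" using E by auto
  next
    fix r :: "nat \<Rightarrow> nat" assume r: "strict_mono r"
    note P1 = partition_sequence_subseq[OF P r]
    \<comment> \<open>All required null sequences under one countable index: replacement errors for
      each \<open>l\<close>, and covariation errors for each pair and rational threshold. A single
      subsequence then handles them together.\<close>
    define Z where "Z c = (case c of
        Inl l \<Rightarrow> (\<lambda>j \<omega>. \<Sum>i<(N \<circ> r) j. (I l ((p \<circ> r) j (Suc i)) \<omega> - I l ((p \<circ> r) j i) \<omega>
          - H l ((p \<circ> r) j i) \<omega> * (W l ((p \<circ> r) j (Suc i)) \<omega> - W l ((p \<circ> r) j i) \<omega>))\<^sup>2)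
      | Inr (l, l', q) \<Rightarrow> (\<lambda>j \<omega>. \<Sum>i\<in>{i. i < (N \<circ> r) j \<and> (p \<circ> r) j i < q}.
          (W l ((p \<circ> r) j (Suc i)) \<omega> - W l ((p \<circ> r) j i) \<omega>) * (W l' ((p \<circ> r) j (Suc i)) \<omega> - W l' ((p \<circ> r) j i) \<omega>)
          - (if l = l' then (p \<circ> r) j (Suc i) - (p \<circ> r) j i else 0)))" for c :: "'l + 'l \<times> 'l \<times> real"
    define C :: "('l + 'l \<times> 'l \<times> real) set" where "C = Inl ` L \<union> Inr ` (L \<times> L \<times> \<rat>)"
    have "countable C"
      unfolding C_def using countable_finite[OF L] countable_rat by (intro countable_Un countable_image countable_SIGMA) auto
    moreover have "tendsto_in_prob_on M E (Z c) (\<lambda>_. 0)" if c: "c \<in> C" for c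
    proof (cases c)
      case (Inl l)
      then have l: "l \<in> L" using c by (auto simp: C_def)
      interpret wiener M T F "W l" by standard (rule W[OF l])
      show ?thesis
        unfolding Z_def Inl sum.case E_def by (rule ito_increments_in_prob[OF ito[OF l] \<tau> P1 t])
    next
      case (Inr d)
      then obtain l l' q where d: "d = (l, l', q)" "l \<in> L" "l' \<in> L" using c by (cases d) (auto simp: C_def Inr)
      show ?thesis
        unfolding Z_def Inr d sum.case prod.case
        by (rule covariation_increments_in_prob[OF W ind d(2,3) P1 _ E]) (use t in auto)
    qed
    ultimately obtain r' where r': "strict_mono r'"
      and Z0: "AE \<omega> in M. \<omega> \<in> E \<longrightarrow> (\<forall>c\<in>C. (\<lambda>j. Z c (r' j) \<omega>) \<longlonglongrightarrow> 0)"
      using tendsto_in_prob_common_subsequence[of C E Z] by blast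
    note P2 = partition_sequence_subseq[OF P1 r']
    have "AE \<omega> in M. \<omega> \<in> E \<longrightarrow> (\<lambda>j. ?V (r (r' j)) \<omega>) \<longlonglongrightarrow> ?A \<omega>"
      using Z0 Hc dec
    proof eventually_elim
      case (elim \<omega>)
      show ?case
      proof
        assume \<omega>: "\<omega> \<in> E"
        then have sub: "{0..t} \<subseteq> {0..<\<tau> \<omega>}" by (auto simp: E_def)
        have "(\<lambda>j. \<Sum>k<(N \<circ> r \<circ> r') j. (X ((p \<circ> r \<circ> r') j (Suc k)) \<omega> - X ((p \<circ> r \<circ> r') j k) \<omega>)\<^sup>2) \<longlonglongrightarrow> ?A \<omega>"
        proof (rule quadratic_variation_pathwise[OF L P2, where h = "\<lambda>l s. H l s \<omega>" and b = "\<lambda>s. b s \<omega>"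
              and x = "\<lambda>s. X s \<omega>" and i = "\<lambda>l s. I l s \<omega>" and w = "\<lambda>l s. W l s \<omega>" and ?x0.0 = "X 0 \<omega>"])
          show "continuous_on {0..t} (\<lambda>s. H l s \<omega>)" if "l \<in> L" for l
            using elim(2) that sub by (blast intro: continuous_on_subset)
          show "continuous_on {0..t} (\<lambda>s. b s \<omega>)" using elim(3) sub by (blast intro: continuous_on_subset)
          show "X s \<omega> = X 0 \<omega> + (LINT r:{0..s}|lborel. b r \<omega>) - (\<Sum>l\<in>L. I l s \<omega>)" if "s \<in> {0..t}" for s
            using elim(3) sub that by blast
          have Zc: "(\<lambda>j. Z c (r' j) \<omega>) \<longlonglongrightarrow> 0" if "c \<in> C" for c using elim(1) \<omega> that by blast
          show "(\<lambda>j. \<Sum>k<(N \<circ> r \<circ> r') j. (I l ((p \<circ> r \<circ> r') j (Suc k)) \<omega> - I l ((p \<circ> r \<circ> r') j k) \<omega> -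
              H l ((p \<circ> r \<circ> r') j k) \<omega> * (W l ((p \<circ> r \<circ> r') j (Suc k)) \<omega> - W l ((p \<circ> r \<circ> r') j k) \<omega>))\<^sup>2) \<longlonglongrightarrow> 0"
            if "l \<in> L" for l
            using Zc[of "Inl l"] that by (simp add: Z_def C_def)
          show "(\<lambda>j. \<Sum>k\<in>{k. k < (N \<circ> r \<circ> r') j \<and> (p \<circ> r \<circ> r') j k < q}.
              (W l ((p \<circ> r \<circ> r') j (Suc k)) \<omega> - W l ((p \<circ> r \<circ> r') j k) \<omega>) *
              (W l' ((p \<circ> r \<circ> r') j (Suc k)) \<omega> - W l' ((p \<circ> r \<circ> r') j k) \<omega>) -
              (if l = l' then (p \<circ> r \<circ> r') j (Suc k) - (p \<circ> r \<circ> r') j k else 0)) \<longlonglongrightarrow> 0"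
            if "l \<in> L" "l' \<in> L" "q \<in> \<rat>" for l l' q
            using Zc[of "Inr (l, l', q)"] that by (simp add: Z_def C_def cong: if_cong)
        qed
        then show "(\<lambda>j. ?V (r (r' j)) \<omega>) \<longlonglongrightarrow> ?A \<omega>" by (simp add: power2_eq_square)
      qed
    qed
    then show "\<exists>r'. strict_mono r' \<and> (AE \<omega> in M. \<omega> \<in> E \<longrightarrow> (\<lambda>j. ?V (r (r' j)) \<omega>) \<longlonglongrightarrow> ?A \<omega>)"
      using r' by blast
  qed
  then show "tendsto_in_prob_on M {\<omega>\<in>space M. t < \<tau> \<omega>} ?V ?A" by (simp add: E_def)
qed

end

section \<open>Surface measure of flat pieces\<close>

text \<open>A bounded piece of a hyperplane is a Lipschitz graph over the coordinates other than
  some \<open>b\<close> not orthogonal to \<open>n\<close>. Cubes of side \<open>h\<close> in those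
  coordinates cut it into order \<open>h\<close> to the power \<open>- s\<close> pieces of diameter
  of order \<open>h\<close>, so the contents are bounded uniformly in the mesh size.\<close>

lemma hausdorff_outer_hyperplane_finite:
  fixes e :: "'a::euclidean_space set"
  assumes bnd: "bounded e" and n: "n \<noteq> 0" and hyp: "\<And>x. x \<in> e \<Longrightarrow> n \<bullet> x = c"
  shows "hausdorff_outer (DIM('a) - 1) e < \<infinity>"
proof -
  obtain b where b: "b \<in> Basis" "n \<bullet> b \<noteq> 0" using n by (auto simp: euclidean_eq_iff[of n 0])
  define B where "B = Basis - {b}"
  have finB: "finite B" and cardB: "card B = DIM('a) - 1" using b by (auto simp: B_def)
  obtain R where R: "R > 0" "\<And>x. x \<in> e \<Longrightarrow> norm x \<le> R" using bnd by (auto simp: bounded_pos)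
  \<comment> \<open>Lipschitz constant of the coordinate along \<open>b\<close>, with respect to the
    largest difference of the other coordinates.\<close>
  define \<Lambda> where "\<Lambda> = (\<Sum>b'\<in>B. \<bar>n \<bullet> b'\<bar>) / \<bar>n \<bullet> b\<bar>"
  have \<Lambda>: "\<Lambda> \<ge> 0" unfolding \<Lambda>_def by (intro divide_nonneg_nonneg sum_nonneg) auto
  define C where "C = \<Lambda> + real (card B) + 1"
  have C: "C > 0" using \<Lambda> by (simp add: C_def)
  have diam: "norm (x - y) \<le> C * h"
    if x: "x \<in> e" and y: "y \<in> e" and h: "h \<ge> 0" and B: "\<And>b'. b' \<in> B \<Longrightarrow> \<bar>(x - y) \<bullet> b'\<bar> \<le> h" for x y h
  proof -
    have Bas: "(Basis :: 'a set) = insert b B" "b \<notin> B" using b by (auto simp: B_def)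
    have "0 = n \<bullet> (x - y)" using hyp[OF x] hyp[OF y] by (simp add: inner_diff_right)
    also have "\<dots> = (\<Sum>b'\<in>Basis. (n \<bullet> b') * ((x - y) \<bullet> b'))" by (rule euclidean_inner)
    also have "\<dots> = (n \<bullet> b) * ((x - y) \<bullet> b) + (\<Sum>b'\<in>B. (n \<bullet> b') * ((x - y) \<bullet> b'))"
      unfolding Bas(1) using Bas(2) finB by simp
    finally have "\<bar>n \<bullet> b\<bar> * \<bar>(x - y) \<bullet> b\<bar> = \<bar>\<Sum>b'\<in>B. (n \<bullet> b') * ((x - y) \<bullet> b')\<bar>"
      by (simp add: abs_mult[symmetric])
    also have "\<dots> \<le> (\<Sum>b'\<in>B. \<bar>n \<bullet> b'\<bar> * h)"
      by (intro sum_abs[THEN order_trans] sum_mono) (auto simp: abs_mult intro!: mult_left_mono B)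
    finally have xb: "\<bar>(x - y) \<bullet> b\<bar> \<le> \<Lambda> * h"
      using b(2) by (simp add: \<Lambda>_def field_simps sum_distrib_left)
    have "norm (x - y) \<le> (\<Sum>b'\<in>Basis. \<bar>(x - y) \<bullet> b'\<bar>)" by (rule norm_le_l1)
    also have "\<dots> = \<bar>(x - y) \<bullet> b\<bar> + (\<Sum>b'\<in>B. \<bar>(x - y) \<bullet> b'\<bar>)"
      unfolding Bas(1) using Bas(2) finB by simp
    also have "\<dots> \<le> \<Lambda> * h + (\<Sum>b'\<in>B. h)" by (intro add_mono xb sum_mono B)
    also have "\<dots> \<le> C * h" using h by (simp add: C_def algebra_simps)
    finally show ?thesis .
  qed
  define s where "s = DIM('a) - 1"
  \<comment> \<open>Comes from \<open>(R / h + 2) * (C * h) = C * R + 2 * (C * h)\<close> together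
    with \<open>C * h \<le> 1\<close>; it does not depend on \<open>\<delta>\<close>.\<close>
  define V where "V = unit_ball_vol (real s) * (C * R + 2) ^ s"
  have "hausdorff_content s \<delta> e \<le> ennreal V" if \<delta>: "\<delta> > 0" for \<delta>
  proof -
    define h where "h = min \<delta> 1 / C"
    have h: "h > 0" "C * h \<le> \<delta>" "C * h \<le> 1" using \<delta> C by (auto simp: h_def)
    define N where "N = nat \<lceil>R / h\<rceil>"
    have N: "R / h \<le> real N" "real N \<le> R / h + 1"
      using R(1) h(1) by (auto simp: N_def of_nat_ceiling intro: of_int_ceiling_le_add_one)
    \<comment> \<open>There are \<open>2 * N + 2\<close> values per axis, and this factor 2 cancels
      against the halved diameter in the Hausdorff content.\<close>
    define J where "J = Pi\<^sub>E B (\<lambda>_. {- (int N) - 1..int N})"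
    define f where "f i = {x\<in>e. \<forall>b'\<in>B. \<lfloor>(x \<bullet> b') / h\<rfloor> = i b'}" for i :: "'a \<Rightarrow> int"
    have finJ: "finite J" unfolding J_def using finB by (intro finite_PiE) auto
    have cardJ: "card J = (2 * N + 2) ^ s"
    proof -
      have "nat (2 + 2 * int N) = Suc (Suc (2 * N))" by linarith
      then show ?thesis unfolding J_def using finB by (simp add: card_PiE cardB s_def)
    qed
    obtain g where g: "bij_betw g {..<card J} J"
      using ex_bij_betw_nat_finite[OF finJ] by (auto simp: atLeast0LessThan)
    define U where "U k = (if k < card J then f (g k) else {})" for k
    have fd: "norm (x - y) \<le> C * h" if "x \<in> f i" "y \<in> f i" for x y i
    proof (rule diam)
      fix b' assume "b' \<in> B"
      then have "\<lfloor>(x \<bullet> b') / h\<rfloor> = \<lfloor>(y \<bullet> b') / h\<rfloor>" using that by (auto simp: f_def)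
      then have "\<bar>(x \<bullet> b') / h - (y \<bullet> b') / h\<bar> < 1" by linarith
      then have "\<bar>(x \<bullet> b' - y \<bullet> b') / h\<bar> < 1" by (simp add: diff_divide_distrib)
      then show "\<bar>(x - y) \<bullet> b'\<bar> \<le> h" using h by (simp add: inner_diff_left abs_divide)
    qed (use that h in \<open>auto simp: f_def\<close>)
    have Ch: "0 \<le> C * h" using C h by simp
    have dU: "diameter (U k) \<le> C * h" for k
      using fd Ch by (intro diameter_le) (auto simp: U_def split: if_splits)
    have bU: "bounded (U k)" for k
      by (rule bounded_subset[OF bnd]) (auto simp: U_def f_def)
    have cover: "e \<subseteq> (\<Union>k. U k)"
    proof
      fix x assume x: "x \<in> e"
      define i where "i = (\<lambda>b'\<in>B. \<lfloor>(x \<bullet> b') / h\<rfloor>)"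
      have "\<lfloor>(x \<bullet> b') / h\<rfloor> \<in> {- (int N) - 1..int N}" if "b' \<in> B" for b'
      proof -
        have "\<bar>x \<bullet> b'\<bar> \<le> R" using Basis_le_norm[of b' x] R(2)[OF x] that by (auto simp: B_def)
        then have "\<bar>(x \<bullet> b') / h\<bar> \<le> R / h" using h by (simp add: abs_divide divide_right_mono)
        then have "\<bar>(x \<bullet> b') / h\<bar> \<le> real N" using N by linarith
        then have "- real N \<le> (x \<bullet> b') / h" "(x \<bullet> b') / h \<le> real N" by linarith+
        then show ?thesis unfolding atLeastAtMost_iff le_floor_iff floor_le_iff by simp
      qed
      then have "i \<in> J" by (auto simp: i_def J_def)
      then have "i \<in> g ` {..<card J}" using g by (simp add: bij_betw_def)
      then obtain k where k: "k < card J" "g k = i" by auto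
      have "x \<in> U k" using x k by (auto simp: U_def f_def i_def)
      then show "x \<in> (\<Union>k. U k)" by blast
    qed
    have term_le: "(if U k = {} then 0 else ennreal (unit_ball_vol (real s) * (diameter (U k) / 2) ^ s))
        \<le> ennreal (unit_ball_vol (real s) * (C * h / 2) ^ s)" for k
      using dU[of k] diameter_ge_0[OF bU]
      by (auto intro!: ennreal_leI mult_left_mono power_mono divide_right_mono)
    have "hausdorff_content s \<delta> e \<le> (\<Sum>k. if U k = {} then 0 else ennreal (unit_ball_vol (real s) * (diameter (U k) / 2) ^ s))"
      unfolding hausdorff_content_def
      by (rule INF_lower) (use cover bU dU h(2) in \<open>auto intro: order_trans\<close>)
    also have "\<dots> = (\<Sum>k<card J. if U k = {} then 0 else ennreal (unit_ball_vol (real s) * (diameter (U k) / 2) ^ s))"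
      by (rule suminf_finite) (auto simp: U_def)
    also have "\<dots> \<le> (\<Sum>k<card J. ennreal (unit_ball_vol (real s) * (C * h / 2) ^ s))"
      by (intro sum_mono term_le)
    also have "\<dots> = ennreal (real (card J) * (unit_ball_vol (real s) * (C * h / 2) ^ s))"
      using Ch by (simp add: ennreal_mult ennreal_of_nat_eq_real_of_nat)
    also have "\<dots> \<le> ennreal V"
    proof (rule ennreal_leI)
      have "(real N + 1) * (C * h) \<le> (R / h + 2) * (C * h)"
        using N Ch by (intro mult_right_mono) auto
      also have "\<dots> = C * R + 2 * (C * h)" using h by (simp add: field_simps)
      also have "\<dots> \<le> C * R + 2" using h by simp
      finally have "((real N + 1) * (C * h)) ^ s \<le> (C * R + 2) ^ s"
        using Ch by (intro power_mono) auto
      moreover have "real (card J) * (C * h / 2) ^ s = ((real N + 1) * (C * h)) ^ s"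
      proof -
        have "real (2 * N + 2) * (C * h / 2) = (real N + 1) * (C * h)" by (simp add: field_simps)
        then show ?thesis unfolding cardJ of_nat_power power_mult_distrib[symmetric] by (simp only:)
      qed
      ultimately show "real (card J) * (unit_ball_vol (real s) * (C * h / 2) ^ s) \<le> V"
        unfolding V_def by (metis mult.left_commute mult_left_mono of_nat_0_le_iff unit_ball_vol_nonneg)
    qed
    finally show ?thesis .
  qed
  then have "hausdorff_outer s e \<le> ennreal V"
    unfolding hausdorff_outer_def by (intro SUP_least) auto
  then show ?thesis unfolding s_def by (rule order_le_less_trans) simp
qed

lemma sets_hausdorff_measure [simp]: "sets (hausdorff_measure s) = sets borel"
  unfolding hausdorff_measure_def
  by (metis sets.sigma_sets_eq sets_measure_of sets.space_closed space_borel)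

lemma space_hausdorff_measure [simp]: "space (hausdorff_measure s) = UNIV"
  unfolding hausdorff_measure_def by (simp add: space_measure_of_conv)

text \<open>By the conventions of \<open>measure_of\<close> the value is that of the outer measure
  or the default 0, and it is finite in both cases.\<close>

lemma emeasure_surface_measure_hyperplane_finite:
  fixes e :: "'a::euclidean_space set"
  assumes "bounded e" "n \<noteq> 0" "\<And>x. x \<in> e \<Longrightarrow> n \<bullet> x = c"
  shows "emeasure surface_measure e < \<infinity>"
  using hausdorff_outer_hyperplane_finite[OF assms]
  unfolding hausdorff_measure_def emeasure_measure_of_conv by auto

section \<open>Integrals with a fixed integrable weight\<close>

text \<open>Rests on \<open>\<bar>w\<bar> \<le> 1 + w\<^sup>2\<close>. The normal trace is given in
  L2 of a face, but it serves as a weight against continuous functions, for which L1 is the right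
  class.\<close>

lemma set_integrable_if_square_integrable:
  fixes w :: "'a \<Rightarrow> real"
  assumes e: "e \<in> sets M" "emeasure M e < \<infinity>"
    and w: "set_borel_measurable M e w" "set_integrable M e (\<lambda>x. (w x)\<^sup>2)"
  shows "set_integrable M e w"
  unfolding set_integrable_def
proof (rule Bochner_Integration.integrable_bound)
  show "integrable M (\<lambda>x. indicator e x + indicator e x *\<^sub>R (w x)\<^sup>2)"
    using w(2) e unfolding set_integrable_def
    by (intro Bochner_Integration.integrable_add integrable_real_indicator) auto
  show "(\<lambda>x. indicator e x *\<^sub>R w x) \<in> borel_measurable M"
    using w(1) by (simp add: set_borel_measurable_def)
  show "AE x in M. norm (indicator e x *\<^sub>R w x) \<le> norm (indicator e x + indicator e x *\<^sub>R (w x)\<^sup>2)"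
  proof (rule AE_I2)
    fix x
    have "\<bar>w x\<bar> \<le> 1 + (w x)\<^sup>2"
      using sum_squares_bound[of "\<bar>w x\<bar>" 1] by simp
    then show "norm (indicator e x *\<^sub>R w x) \<le> norm (indicator e x + indicator e x *\<^sub>R (w x)\<^sup>2)"
      by (simp add: indicator_def)
  qed
qed

text \<open>Along a convergent sequence of times, \<open>h\<close> is bounded on the compact product
  of the sequence with its limit and \<open>e\<close>, so a multiple of \<open>\<bar>w\<bar>\<close>
  dominates. The measure is kept general to cover faces with surface measure and elements with
  Lebesgue measure.\<close>

lemma weighted_integral_continuous:
  fixes w :: "'a::euclidean_space \<Rightarrow> real" and h :: "real \<Rightarrow> 'a \<Rightarrow> real"
  assumes M: "sets borel \<subseteq> sets M" "space M = UNIV" and e: "compact e"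
    and w: "set_integrable M e w" and h: "continuous_on (I \<times> e) (\<lambda>(s, x). h s x)"
  shows "\<And>s. s \<in> I \<Longrightarrow> set_integrable M e (\<lambda>x. w x * h s x)"
    and "continuous_on I (\<lambda>s. LINT x:e|M. w x * h s x)"
proof -
  have bor: "f \<in> borel_measurable M" if "f \<in> borel_measurable borel" for f :: "'a \<Rightarrow> real"
    using that M by (auto simp: measurable_def)
  have hs: "continuous_on e (h s)" if "s \<in> I" for s
  proof -
    have "continuous_on e (\<lambda>x. (s, x))"
      by (intro continuous_on_Pair continuous_on_const continuous_on_id)
    from continuous_on_compose2[OF h this] show ?thesis using that by auto
  qed
  have meas: "(\<lambda>x. indicator e x *\<^sub>R (w x * h s x)) \<in> borel_measurable M" if "s \<in> I" for s
  proof -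
    have "(\<lambda>x. indicator e x *\<^sub>R h s x) \<in> borel_measurable M"
      by (rule bor) (use borel_measurable_continuous_on_indicator[OF _ hs[OF that]] compact_imp_closed[OF e] in auto)
    moreover have "(\<lambda>x. indicator e x *\<^sub>R w x) \<in> borel_measurable M"
      using w by (auto simp: set_integrable_def)
    moreover have "(\<lambda>x. indicator e x *\<^sub>R (w x * h s x)) = (\<lambda>x. (indicator e x *\<^sub>R w x) * (indicator e x *\<^sub>R h s x))"
      by (auto simp: indicator_def)
    ultimately show ?thesis by simp
  qed
  have bound: "\<exists>B. \<forall>s\<in>K. \<forall>x\<in>e. \<bar>h s x\<bar> \<le> B" if "compact K" "K \<subseteq> I" for K
  proof -
    have "compact ((\<lambda>(s, x). h s x) ` (K \<times> e))"
      by (intro compact_continuous_image compact_Times that e continuous_on_subset[OF h]) (use that in auto)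
    from compact_imp_bounded[OF this]
    obtain B where "\<forall>y\<in>(\<lambda>(s, x). h s x) ` (K \<times> e). norm y \<le> B"
      by (auto simp only: bounded_iff)
    then have "\<forall>s\<in>K. \<forall>x\<in>e. \<bar>h s x\<bar> \<le> B" by auto
    then show ?thesis by blast
  qed
  have dom: "norm (indicator e x *\<^sub>R (w x * h s x)) \<le> \<bar>B\<bar> * norm (indicator e x *\<^sub>R w x)"
    if "\<forall>s\<in>K. \<forall>x\<in>e. \<bar>h s x\<bar> \<le> B" "s \<in> K" for K B s x
  proof (cases "x \<in> e")
    case True
    then have "\<bar>h s x\<bar> \<le> B" using that by blast
    then have "\<bar>h s x\<bar> \<le> \<bar>B\<bar>" by linarith
    then have "\<bar>w x\<bar> * \<bar>h s x\<bar> \<le> \<bar>w x\<bar> * \<bar>B\<bar>" by (rule mult_left_mono) simp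
    then show ?thesis using True by (simp add: abs_mult mult.commute)
  qed simp
  have wB: "integrable M (\<lambda>x. \<bar>B\<bar> * norm (indicator e x *\<^sub>R w x))" for B
    using w unfolding set_integrable_def by (intro integrable_mult_right integrable_norm)
  show "set_integrable M e (\<lambda>x. w x * h s x)" if s: "s \<in> I" for s
  proof -
    obtain B where B: "\<forall>s\<in>{s}. \<forall>x\<in>e. \<bar>h s x\<bar> \<le> B" using bound[of "{s}"] s by auto
    show ?thesis
      unfolding set_integrable_def
      by (rule Bochner_Integration.integrable_bound[OF wB[of B] meas[OF s]])
        (intro AE_I2 order_trans[OF dom[OF B]], auto)
  qed
  show "continuous_on I (\<lambda>s. LINT x:e|M. w x * h s x)"
    unfolding continuous_on_sequentially
  proof (intro allI ballI impI)
    fix r s assume s: "s \<in> I" and r: "(\<forall>n. r n \<in> I) \<and> r \<longlonglongrightarrow> s"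
    have "compact (insert s (range r))" using r by (intro compact_sequence_with_limit) auto
    then obtain B where B: "\<forall>s\<in>insert s (range r). \<forall>x\<in>e. \<bar>h s x\<bar> \<le> B"
      using bound[of "insert s (range r)"] s r by auto
    show "((\<lambda>s. LINT x:e|M. w x * h s x) \<circ> r) \<longlonglongrightarrow> (LINT x:e|M. w x * h s x)"
      unfolding comp_def set_lebesgue_integral_def
    proof (rule integral_dominated_convergence[OF meas[OF s] meas wB[of B]])
      show "AE x in M. (\<lambda>n. indicator e x *\<^sub>R (w x * h (r n) x)) \<longlonglongrightarrow> indicator e x *\<^sub>R (w x * h s x)"
      proof (intro AE_I2)
        fix x
        show "(\<lambda>n. indicator e x *\<^sub>R (w x * h (r n) x)) \<longlonglongrightarrow> indicator e x *\<^sub>R (w x * h s x)"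
        proof (cases "x \<in> e")
          case True
          have "continuous_on I (\<lambda>s. h s x)"
          proof -
            have "continuous_on I (\<lambda>s. (s, x))"
              by (intro continuous_on_Pair continuous_on_const continuous_on_id)
            from continuous_on_compose2[OF h this] show ?thesis using True by auto
          qed
          then have "(\<lambda>n. h (r n) x) \<longlonglongrightarrow> h s x"
            using r s by (auto simp: continuous_on_sequentially comp_def)
          then show ?thesis by (intro tendsto_intros)
        qed simp
      qed
      show "AE x in M. norm (indicator e x *\<^sub>R (w x * h (r n) x)) \<le> \<bar>B\<bar> * norm (indicator e x *\<^sub>R w x)" for n
        by (intro AE_I2 dom[OF B]) auto
    qed (use r in auto)
  qed
qed

section \<open>Continuously differentiable functions\<close>

lemma C_k_1I:
  assumes f': "\<And>x. (f has_derivative f' x) (at x)"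
    and c: "\<And>b. b \<in> Basis \<Longrightarrow> continuous_on UNIV (\<lambda>x. f' x b)"
  shows "C_k 1 f"
proof -
  have "frechet_derivative f (at x) = f' x" for x
    using frechet_derivative_at[OF f'[of x]] by simp
  then show ?thesis using f' c by (auto simp: differentiable_def)
qed

lemma C_k_1D:
  assumes "C_k 1 f"
  shows "(f has_derivative frechet_derivative f (at x)) (at x)"
    and "b \<in> Basis \<Longrightarrow> continuous_on UNIV (\<lambda>x. frechet_derivative f (at x) b)"
    and "continuous_on UNIV f"
proof -
  have d: "f differentiable (at x)" for x using assms by simp
  then show "(f has_derivative frechet_derivative f (at x)) (at x)"
    by (simp add: frechet_derivative_works)
  show "b \<in> Basis \<Longrightarrow> continuous_on UNIV (\<lambda>x. frechet_derivative f (at x) b)"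
    using assms by simp
  show "continuous_on UNIV f"
    using d by (intro continuous_at_imp_continuous_on) (auto intro: differentiable_imp_continuous_within)
qed

lemma C_k_1_const: "C_k 1 (\<lambda>x. c)"
  by (rule C_k_1I[where f' = "\<lambda>_ _. 0"]) (auto intro!: derivative_eq_intros)

lemma C_k_1_inner: "C_k 1 (\<lambda>x. x \<bullet> b)"
  by (rule C_k_1I[where f' = "\<lambda>_ h. h \<bullet> b"]) (auto intro!: derivative_eq_intros)

lemma C_k_1_add:
  assumes f: "C_k 1 f" and g: "C_k 1 g"
  shows "C_k 1 (\<lambda>x. f x + g x)"
proof (rule C_k_1I)
  show "((\<lambda>x. f x + g x) has_derivative (\<lambda>h. frechet_derivative f (at x) h + frechet_derivative g (at x) h)) (at x)" for x
    by (intro has_derivative_add C_k_1D f g)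
qed (intro continuous_intros C_k_1D f g)

lemma C_k_1_mult_has_derivative:
  assumes f: "C_k 1 f" and g: "C_k 1 g"
  shows "((\<lambda>x. f x * g x) has_derivative
    (\<lambda>h. f x * frechet_derivative g (at x) h + frechet_derivative f (at x) h * g x)) (at x)"
  by (intro has_derivative_mult C_k_1D f g)

lemma C_k_1_mult:
  assumes f: "C_k 1 f" and g: "C_k 1 g"
  shows "C_k 1 (\<lambda>x. f x * g x)"
  by (rule C_k_1I[OF C_k_1_mult_has_derivative[OF f g]]) (intro continuous_intros C_k_1D f g)

lemma C_k_1_sum: "(\<And>i. i \<in> A \<Longrightarrow> C_k 1 (f i)) \<Longrightarrow> C_k 1 (\<lambda>x. \<Sum>i\<in>A. f i x)"
  by (induction A rule: infinite_finite_induct) (auto simp del: C_k.simps One_nat_def intro: C_k_1_const C_k_1_add)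

lemma C_k_1_prod: "(\<And>i. i \<in> A \<Longrightarrow> C_k 1 (f i)) \<Longrightarrow> C_k 1 (\<lambda>x. \<Prod>i\<in>A. f i x)"
  by (induction A rule: infinite_finite_induct) (auto simp del: C_k.simps One_nat_def intro: C_k_1_const C_k_1_mult)

lemma C_k_1_power: "C_k 1 f \<Longrightarrow> C_k 1 (\<lambda>x. f x ^ n)"
  by (induction n) (auto simp del: C_k.simps One_nat_def intro: C_k_1_const C_k_1_mult)

lemma C_k_2_real:
  fixes g :: "real \<Rightarrow> real"
  assumes "C_k 2 g"
  shows "(g has_real_derivative deriv g y) (at y)" and "continuous_on UNIV (deriv g)"
    and "continuous_on UNIV g"
proof -
  have C: "\<forall>x. g differentiable (at x)" "C_k 1 (\<lambda>x. frechet_derivative g (at x) 1)"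
    using assms by (simp_all add: numeral_2_eq_2)
  then show d: "(g has_real_derivative deriv g y) (at y)" for y
    by (simp add: DERIV_deriv_iff_real_differentiable)
  have "frechet_derivative g (at y) 1 = deriv g y" for y
    using frechet_derivative_at[OF d[of y, unfolded has_field_derivative_def]] by (metis mult.right_neutral)
  then show "continuous_on UNIV (deriv g)" using C_k_1D(3)[OF C(2)] by simp
  show "continuous_on UNIV g"
    using d by (intro DERIV_continuous_on) (auto intro: has_field_derivative_at_within)
qed

lemma C_k_1_compose_has_derivative:
  fixes g :: "real \<Rightarrow> real"
  assumes g: "C_k 2 g" and f: "C_k 1 f"
  shows "((\<lambda>x. g (f x)) has_derivative (\<lambda>h. deriv g (f x) * frechet_derivative f (at x) h)) (at x)"
  using has_derivative_compose[OF C_k_1D(1)[OF f] C_k_2_real(1)[OF g, unfolded has_field_derivative_def]]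
  by simp

lemma C_k_1_compose:
  fixes g :: "real \<Rightarrow> real"
  assumes g: "C_k 2 g" and f: "C_k 1 f"
  shows "C_k 1 (\<lambda>x. g (f x))"
proof (rule C_k_1I[OF C_k_1_compose_has_derivative[OF g f]])
  have "continuous_on UNIV (\<lambda>x. deriv g (f x))"
    using continuous_on_compose2[OF C_k_2_real(2)[OF g] C_k_1D(3)[OF f]] by simp
  then show "continuous_on UNIV (\<lambda>x. deriv g (f x) * frechet_derivative f (at x) b)" if "b \<in> Basis" for b
    by (intro continuous_on_mult C_k_1D(2)[OF f that])
qed

text \<open>The two summands are the volume integrands of the form \<open>b\<close> and of the
  equation for \<open>q\<close>; this is why their sum is a full gradient.\<close>

lemma grad_compose_mult:
  fixes g :: "real \<Rightarrow> real"
  assumes g: "C_k 2 g" and f: "C_k 1 f" and q: "C_k 1 q"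
  shows "grad (\<lambda>x. g (f x) * q x) x = (deriv g (f x) * q x) *\<^sub>R grad f x + g (f x) *\<^sub>R grad q x"
proof -
  have gf: "frechet_derivative (\<lambda>x. g (f x)) (at x) = (\<lambda>h. deriv g (f x) * frechet_derivative f (at x) h)"
    using frechet_derivative_at[OF C_k_1_compose_has_derivative[OF g f]] by simp
  have "frechet_derivative (\<lambda>x. g (f x) * q x) (at x) =
      (\<lambda>h. g (f x) * frechet_derivative q (at x) h + deriv g (f x) * frechet_derivative f (at x) h * q x)"
    unfolding frechet_derivative_at[OF C_k_1_mult_has_derivative[OF C_k_1_compose[OF g f] q], symmetric]
    by (simp only: gf)
  then show ?thesis
    by (simp add: grad_def scaleR_sum_right sum.distrib[symmetric] scaleR_add_left ac_simps)
qed

text \<open>A broken polynomial is pinned down only on the interiors of elements; its gradient may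
  still be exchanged for that of the polynomial there.\<close>

lemma grad_cong_open:
  assumes "open S" "x \<in> S" "\<And>y. y \<in> S \<Longrightarrow> f y = g y"
  shows "grad f x = grad g x"
proof -
  have "(f has_derivative D) (at x) \<longleftrightarrow> (g has_derivative D) (at x)" for D
    using has_derivative_transform_within_open[of f D x UNIV S g]
      has_derivative_transform_within_open[of g D x UNIV S f] assms by auto
  then have "frechet_derivative f (at x) = frechet_derivative g (at x)"
    by (simp add: frechet_derivative_def)
  then show ?thesis by (simp add: grad_def)
qed

lemma continuous_grad:
  assumes "C_k 1 f"
  shows "continuous_on UNIV (grad f)"
  unfolding grad_def[abs_def] by (intro continuous_intros C_k_1D assms)

section \<open>The difference quotient of the flux as a continuous function of two traces\<close>

definition divided_difference :: "(real \<Rightarrow> real) \<Rightarrow> real \<Rightarrow> real \<Rightarrow> real" where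
  "divided_difference g a b = (if b - a = 0 then deriv g a else (g b - g a) / (b - a))"

lemma divided_difference_mvt:
  assumes g: "\<And>y. (g has_real_derivative deriv g y) (at y)"
  shows "\<exists>z. \<bar>z - a\<bar> \<le> \<bar>b - a\<bar> \<and> divided_difference g a b = deriv g z"
proof (cases a b rule: linorder_cases)
  case less
  then obtain z where "a < z" "z < b" "g b - g a = (b - a) * deriv g z"
    using MVT2[of a b g "deriv g"] g by auto
  then show ?thesis using less by (intro exI[of _ z]) (auto simp: divided_difference_def)
next
  case equal
  then show ?thesis by (auto simp: divided_difference_def)
next
  case greater
  then obtain z where z: "b < z" "z < a" "g a - g b = (a - b) * deriv g z"
    using MVT2[of b a g "deriv g"] g by auto
  have "g b - g a = (b - a) * deriv g z" using z(3) by (simp add: algebra_simps)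
  then have "divided_difference g a b = deriv g z" using greater by (simp add: divided_difference_def)
  then show ?thesis using z by (intro exI[of _ z]) auto
qed

text \<open>Away from the diagonal it is a quotient of continuous functions. Near the diagonal the
  mean value theorem makes it a value of \<open>deriv g\<close> at a nearby point, so continuity of
  \<open>deriv g\<close> decides.\<close>

lemma continuous_divided_difference:
  assumes g: "C_k 2 g"
  shows "continuous_on UNIV (\<lambda>(a, b). divided_difference g a b)"
proof (rule continuous_at_imp_continuous_on, intro ballI)
  fix p :: "real \<times> real"
  obtain a b where p: "p = (a, b)" by force
  note g' = C_k_2_real[OF g]
  show "isCont (\<lambda>(a, b). divided_difference g a b) p"
  proof (cases "a = b")
    case False
    define S where "S = {p :: real \<times> real. fst p \<noteq> snd p}"
    have S: "open S" unfolding S_def by (intro open_Collect_neq continuous_intros)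
    have "isCont (\<lambda>p. (g (snd p) - g (fst p)) / (snd p - fst p)) p"
      using False p g'(3) by (intro continuous_intros continuous_at_compose[unfolded comp_def, of _ snd g]
          continuous_at_compose[unfolded comp_def, of _ fst g]) (auto simp: continuous_on_eq_continuous_at)
    moreover have "\<forall>\<^sub>F q in nhds p. (\<lambda>(a, b). divided_difference g a b) q = (g (snd q) - g (fst q)) / (snd q - fst q)"
      unfolding eventually_nhds
      by (rule exI[of _ S]) (use S False p in \<open>auto simp: S_def divided_difference_def\<close>)
    ultimately show ?thesis by (subst isCont_cong) auto
  next
    case True
    show ?thesis
      unfolding continuous_at_eps_delta
    proof (intro allI impI)
      fix \<epsilon> :: real assume \<epsilon>: "\<epsilon> > 0"
      have "isCont (deriv g) a" using g'(2) by (simp add: continuous_on_eq_continuous_at)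
      then obtain d where d: "d > 0" "\<And>z. dist z a < d \<Longrightarrow> dist (deriv g z) (deriv g a) < \<epsilon>"
        using \<epsilon> unfolding continuous_at_eps_delta by blast
      \<comment> \<open>With both coordinates within \<open>d / 3\<close> of \<open>a\<close>, the
        intermediate point is at most \<open>2 * d / 3\<close> away from \<open>x\<close>, hence
        less than \<open>d\<close> from \<open>a\<close>.\<close>
      have "dist ((\<lambda>(a, b). divided_difference g a b) q) ((\<lambda>(a, b). divided_difference g a b) p) < \<epsilon>"
        if q: "dist q p < d / 3" for q
      proof -
        obtain x y where xy: "q = (x, y)" by force
        have "\<bar>x - a\<bar> < d / 3" "\<bar>y - a\<bar> < d / 3"
          using dist_fst_le[of q p] dist_snd_le[of q p] q xy p True by (auto simp: dist_real_def)
        moreover obtain z where z: "\<bar>z - x\<bar> \<le> \<bar>y - x\<bar>" "divided_difference g x y = deriv g z"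
          using divided_difference_mvt[OF g'(1)] by blast
        ultimately have "dist z a < d" unfolding dist_real_def by linarith
        then show ?thesis using d(2)[of z] z xy p True by (simp add: divided_difference_def)
      qed
      then show "\<exists>d>0. \<forall>q. dist q p < d \<longrightarrow>
          dist ((\<lambda>(a, b). divided_difference g a b) q) ((\<lambda>(a, b). divided_difference g a b) p) < \<epsilon>"
        using d(1) by (intro exI[of _ "d / 3"]) auto
    qed
  qed
qed

section \<open>Polynomials\<close>

lemma finite_multi_indices: "finite (multi_indices k :: ('a::euclidean_space \<Rightarrow> nat) set)"
proof (rule finite_subset)
  show "multi_indices k \<subseteq> {\<alpha> :: 'a \<Rightarrow> nat. \<forall>b. (b \<in> Basis \<longrightarrow> \<alpha> b \<in> {..k}) \<and> (b \<notin> Basis \<longrightarrow> \<alpha> b = 0)}"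
  proof (intro subsetI CollectI allI conjI impI)
    fix \<alpha> :: "'a \<Rightarrow> nat" and b :: 'a assume \<alpha>: "\<alpha> \<in> multi_indices k"
    show "\<alpha> b \<in> {..k}" if "b \<in> Basis"
      using member_le_sum[of b Basis \<alpha>] that \<alpha> by (auto simp: multi_indices_def)
    show "\<alpha> b = 0" if "b \<notin> Basis" using \<alpha> that by (auto simp: multi_indices_def)
  qed
  show "finite {\<alpha> :: 'a \<Rightarrow> nat. \<forall>b. (b \<in> Basis \<longrightarrow> \<alpha> b \<in> {..k}) \<and> (b \<notin> Basis \<longrightarrow> \<alpha> b = 0)}"
    by (rule finite_set_of_finite_funs) auto
qed

definition monomial :: "('a::euclidean_space \<Rightarrow> nat) \<Rightarrow> 'a \<Rightarrow> real" where
  "monomial \<alpha> x = (\<Prod>b\<in>Basis. (x \<bullet> b) ^ \<alpha> b)"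

lemma poly_space_eq: "poly_space k = {p. \<exists>c. p = (\<lambda>x. \<Sum>\<alpha>\<in>multi_indices k. c \<alpha> * monomial \<alpha> x)}"
  by (simp add: poly_space_def monomial_def)

lemma C_k_1_poly_space: "p \<in> poly_space k \<Longrightarrow> C_k 1 p"
  unfolding poly_space_eq monomial_def
  by (auto simp del: C_k.simps One_nat_def
      intro!: C_k_1_sum C_k_1_mult C_k_1_const C_k_1_prod C_k_1_power C_k_1_inner)

lemma monomial_poly_space:
  assumes "\<alpha> \<in> multi_indices k"
  shows "monomial \<alpha> \<in> poly_space k"
proof -
  have "monomial \<alpha> x = (\<Sum>\<beta>\<in>multi_indices k. (if \<beta> = \<alpha> then 1 else 0) * monomial \<beta> x)" for x :: 'a
    using assms finite_multi_indices[of k, where 'a = 'a] by (simp add: if_distrib[of "\<lambda>c. c * _"] cong: if_cong)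
  then have "monomial \<alpha> = (\<lambda>x. \<Sum>\<beta>\<in>multi_indices k. (if \<beta> = \<alpha> then 1 else 0) * monomial \<beta> x)"
    by (rule ext)
  then show ?thesis unfolding poly_space_eq by (intro CollectI exI)
qed

lemma poly_space_lincomb:
  assumes "p \<in> poly_space k" "q \<in> poly_space k"
  shows "(\<lambda>x. a * p x + b * q x) \<in> poly_space k"
proof -
  obtain c d where "p = (\<lambda>x. \<Sum>\<alpha>\<in>multi_indices k. c \<alpha> * monomial \<alpha> x)"
    "q = (\<lambda>x. \<Sum>\<alpha>\<in>multi_indices k. d \<alpha> * monomial \<alpha> x)"
    using assms by (auto simp: poly_space_eq)
  then have "(\<lambda>x. a * p x + b * q x) = (\<lambda>x. \<Sum>\<alpha>\<in>multi_indices k. (a * c \<alpha> + b * d \<alpha>) * monomial \<alpha> x)"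
    by (simp add: sum_distrib_left sum.distrib distrib_right mult.assoc)
  then show ?thesis unfolding poly_space_eq by (intro CollectI exI[of _ "\<lambda>\<alpha>. a * c \<alpha> + b * d \<alpha>"]) simp
qed

lemma poly_space_0: "(\<lambda>x. 0) \<in> poly_space k"
  unfolding poly_space_eq by (intro CollectI exI[of _ "\<lambda>_. 0"]) simp

lemma poly_space_sum:
  assumes "finite A" "\<And>i. i \<in> A \<Longrightarrow> e i \<in> poly_space k"
  shows "(\<lambda>x. \<Sum>i\<in>A. c i * e i x) \<in> poly_space k"
  using assms
proof (induction A rule: finite_induct)
  case (insert i A)
  then show ?case using poly_space_lincomb[of "e i" k "\<lambda>x. \<Sum>i\<in>A. c i * e i x" "c i" 1] by simp
qed (simp add: poly_space_0)

section \<open>Orthonormal polynomial bases\<close>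

definition L2_inner :: "'a::euclidean_space set \<Rightarrow> ('a \<Rightarrow> real) \<Rightarrow> ('a \<Rightarrow> real) \<Rightarrow> real" where
  "L2_inner K p q = (LINT x:K|lebesgue. p x * q x)"

text \<open>No measurability is assumed: the Lebesgue measure is complete, so both functions are
  measurable or neither is, and in the latter case both integrals take the default value 0.\<close>

lemma LINT_lebesgue_cong_AE:
  fixes f g :: "'a::euclidean_space \<Rightarrow> real"
  assumes "AE x in lebesgue. f x = g x"
  shows "integral\<^sup>L lebesgue f = integral\<^sup>L lebesgue g"
proof (cases "f \<in> borel_measurable lebesgue")
  case True
  then show ?thesis using borel_measurable_AE[OF True assms] assms by (intro integral_cong_AE)
next
  case False
  then have "g \<notin> borel_measurable lebesgue"
    using borel_measurable_AE[of g f] assms by (auto simp: eq_commute)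
  then show ?thesis using False by (metis borel_measurable_integrable not_integrable_integral_eq)
qed

text \<open>Broken polynomials are arbitrary on the boundaries of elements; since frontiers are null
  sets, integrals over \<open>K\<close> do not see this.\<close>

lemma LINT_cong_interior:
  fixes f g :: "'a::euclidean_space \<Rightarrow> real"
  assumes K: "negligible (frontier K)" and eq: "\<And>x. x \<in> interior K \<Longrightarrow> f x = g x"
  shows "(LINT x:K|lebesgue. f x) = (LINT x:K|lebesgue. g x)"
  unfolding set_lebesgue_integral_def
proof (rule LINT_lebesgue_cong_AE)
  have "frontier K \<in> null_sets lebesgue" using K by (simp add: negligible_iff_null_sets)
  then have "AE x in lebesgue. x \<notin> frontier K" by (rule AE_not_in)
  then show "AE x in lebesgue. indicator K x *\<^sub>R f x = indicator K x *\<^sub>R g x"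
  proof eventually_elim
    case (elim x)
    then have "x \<notin> K \<or> x \<in> interior K" using closure_subset by (auto simp: frontier_def)
    then show ?case using eq by auto
  qed
qed

lemma set_integrable_lebesgue_continuous:
  fixes p :: "'a::euclidean_space \<Rightarrow> real"
  assumes K: "compact K" and p: "continuous_on UNIV p"
  shows "set_integrable lebesgue K p"
proof -
  have "integrable lborel (\<lambda>x. indicator K x *\<^sub>R p x)"
    by (rule borel_integrable_compact[OF K continuous_on_subset[OF p]]) auto
  then show ?thesis
    unfolding set_integrable_def using integrable_completion[OF borel_measurable_integrable] by blast
qed

lemma L2_inner_commute: "L2_inner K p q = L2_inner K q p"
  by (simp add: L2_inner_def mult.commute)

lemma L2_inner_sum_right:
  assumes K: "compact K" and e: "\<And>i. i \<in> A \<Longrightarrow> continuous_on UNIV (e i)" and p: "continuous_on UNIV p"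
  shows "L2_inner K p (\<lambda>x. \<Sum>i\<in>A. c i * e i x) = (\<Sum>i\<in>A. c i * L2_inner K p (e i))"
proof -
  have int: "integrable lebesgue (\<lambda>x. indicator K x *\<^sub>R (p x * e i x))" if "i \<in> A" for i
    using set_integrable_lebesgue_continuous[OF K, of "\<lambda>x. p x * e i x"] e[OF that] p
    unfolding set_integrable_def by (auto intro!: continuous_intros)
  have "L2_inner K p (\<lambda>x. \<Sum>i\<in>A. c i * e i x) = (LINT x|lebesgue. (\<Sum>i\<in>A. c i * (indicator K x *\<^sub>R (p x * e i x))))"
    unfolding L2_inner_def set_lebesgue_integral_def
    by (intro Bochner_Integration.integral_cong refl) (simp add: sum_distrib_left mult_ac)
  also have "\<dots> = (\<Sum>i\<in>A. LINT x|lebesgue. c i * (indicator K x *\<^sub>R (p x * e i x)))"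
    using int by (intro Bochner_Integration.integral_sum integrable_mult_right)
  also have "\<dots> = (\<Sum>i\<in>A. c i * L2_inner K p (e i))"
    unfolding L2_inner_def set_lebesgue_integral_def using int by simp
  finally show ?thesis .
qed

lemma L2_inner_add_scale_right:
  assumes K: "compact K" and "continuous_on UNIV p" "continuous_on UNIV q" "continuous_on UNIV r"
  shows "L2_inner K p (\<lambda>x. a * q x + b * r x) = a * L2_inner K p q + b * L2_inner K p r"
  using L2_inner_sum_right[OF K, of "UNIV :: bool set" "\<lambda>i. if i then q else r" p "\<lambda>i. if i then a else b"] assms
  by (simp add: UNIV_bool add.commute)

text \<open>The set in the interior where \<open>p\<close> differs from zero is open and null, hence
  empty. As \<open>K\<close> is the closure of its interior, continuity carries the zero to the
  boundary.\<close>

lemma L2_inner_self_eq_0: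
  assumes K: "compact K" "closure (interior K) = K" and p: "continuous_on UNIV p"
    and 0: "L2_inner K p p = 0" and x: "x \<in> K"
  shows "p x = 0"
proof -
  let ?f = "\<lambda>x. indicator K x *\<^sub>R (p x * p x)"
  have int: "integrable lebesgue ?f"
    using set_integrable_lebesgue_continuous[OF K(1), of "\<lambda>x. p x * p x"] p
    unfolding set_integrable_def by (auto intro!: continuous_intros)
  have ae: "AE x in lebesgue. ?f x = 0"
    using 0 integral_nonneg_eq_0_iff_AE[OF int] by (simp add: L2_inner_def set_lebesgue_integral_def)
  have "{x \<in> space lebesgue. \<not> ?f x = 0} \<in> sets lebesgue"
  proof -
    have "?f -` (- {0}) \<inter> space lebesgue \<in> sets lebesgue"
      by (rule measurable_sets[OF borel_measurable_integrable[OF int]]) auto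
    moreover have "{x \<in> space lebesgue. \<not> ?f x = 0} = ?f -` (- {0}) \<inter> space lebesgue" by blast
    ultimately show ?thesis by (simp only:)
  qed
  from AE_iff_null[OF this] ae have neg: "negligible {x. ?f x \<noteq> 0}"
    unfolding negligible_iff_null_sets by simp
  define S where "S = {x \<in> interior K. p x \<noteq> 0}"
  have "S = interior K \<inter> {x. p x \<noteq> 0}" by (auto simp: S_def)
  moreover have "open {x. p x \<noteq> 0}" using p by (intro open_Collect_neq continuous_on_const)
  ultimately have "open S" by (simp add: open_Int)
  moreover have "negligible S"
    by (rule negligible_subset[OF neg]) (use interior_subset[of K] in \<open>auto simp: S_def\<close>)
  ultimately have "S = {}" using open_not_negligible by blast
  then have "interior K \<subseteq> {x. p x = 0}" by (auto simp: S_def)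
  moreover have "closed {x. p x = 0}" using p by (intro closed_Collect_eq continuous_on_const)
  ultimately have "closure (interior K) \<subseteq> {x. p x = 0}" by (rule closure_minimal)
  then show ?thesis using x K(2) by auto
qed

definition orthonormal_basis_on :: "'a::euclidean_space set \<Rightarrow> nat \<Rightarrow> nat \<Rightarrow> (nat \<Rightarrow> 'a \<Rightarrow> real) \<Rightarrow> bool" where
  "orthonormal_basis_on K k n e \<longleftrightarrow> (\<forall>i<n. e i \<in> poly_space k) \<and>
     (\<forall>i<n. \<forall>j<n. L2_inner K (e i) (e j) = (if i = j then 1 else 0)) \<and>
     (\<forall>p\<in>poly_space k. \<forall>x\<in>K. p x = (\<Sum>i<n. L2_inner K (e i) p * e i x))"

lemma continuous_poly_space: "p \<in> poly_space k \<Longrightarrow> continuous_on UNIV p"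
  using C_k_1D(3)[OF C_k_1_poly_space] .

text \<open>A residual of norm zero vanishes on \<open>K\<close>, so \<open>f\<close> is already
  represented and nothing is appended. Linear independence of the input is thus irrelevant, and the
  number of basis functions comes out as a result.\<close>

lemma gram_schmidt:
  assumes K: "compact K" "closure (interior K) = K" and B: "finite B" "B \<subseteq> poly_space k"
  shows "\<exists>(n::nat) e. (\<forall>i<n. e i \<in> poly_space k) \<and>
     (\<forall>i<n. \<forall>j<n. L2_inner K (e i) (e j) = (if i = j then 1 else 0)) \<and>
     (\<forall>f\<in>B. \<exists>c. \<forall>x\<in>K. f x = (\<Sum>i<n. c i * e i x))"
  using B
proof (induction B rule: finite_induct)
  case empty
  show ?case by (rule exI[of _ 0]) auto
next
  case (insert f B)
  have "B \<subseteq> poly_space k" using insert.prems by simp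
  from insert.IH[OF this] obtain n :: nat and e where on: "(\<forall>i<n. e i \<in> poly_space k) \<and>
     (\<forall>i<n. \<forall>j<n. L2_inner K (e i) (e j) = (if i = j then 1 else 0)) \<and>
     (\<forall>f\<in>B. \<exists>c. \<forall>x\<in>K. f x = (\<Sum>i<n. c i * e i x))"
    by (elim exE)
  then have e: "\<And>i. i < n \<Longrightarrow> e i \<in> poly_space k"
    "\<And>i j. i < n \<Longrightarrow> j < n \<Longrightarrow> L2_inner K (e i) (e j) = (if i = j then 1 else 0)"
    and rep: "\<And>g. g \<in> B \<Longrightarrow> \<exists>c. \<forall>x\<in>K. g x = (\<Sum>i<n. c i * e i x)"
    by auto
  have fV: "f \<in> poly_space k" using insert by simp
  define P where "P x = (\<Sum>i<n. L2_inner K (e i) f * e i x)" for x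
  have PV: "P \<in> poly_space k" unfolding P_def[abs_def] using e by (intro poly_space_sum) auto
  \<comment> \<open>Spelled as a linear combination with explicit coefficients to fit
    \<open>poly_space_lincomb\<close>; the same is done for \<open>d\<close> below.\<close>
  define r where "r x = 1 * f x + (- 1) * P x" for x
  have rV: "r \<in> poly_space k" unfolding r_def[abs_def] by (rule poly_space_lincomb[OF fV PV])
  note cont = continuous_poly_space
  have eP: "L2_inner K (e j) P = L2_inner K (e j) f" if j: "j < n" for j
  proof -
    have "L2_inner K (e j) P = (\<Sum>i<n. L2_inner K (e i) f * L2_inner K (e j) (e i))"
      unfolding P_def[abs_def] using e j by (intro L2_inner_sum_right K cont) auto
    also have "\<dots> = (\<Sum>i<n. if i = j then L2_inner K (e i) f else 0)"
      using e(2) j by (intro sum.cong) auto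
    finally show ?thesis using j by simp
  qed
  have er: "L2_inner K (e j) r = 0" if j: "j < n" for j
    unfolding r_def[abs_def] using L2_inner_add_scale_right[OF K(1) cont cont cont, OF e(1)[OF j] fV PV, of 1 "- 1"] eP[OF j]
    by simp
  have fr: "f x = r x + P x" for x by (simp add: r_def)
  show ?case
  proof (cases "L2_inner K r r = 0")
    case True
    then have "\<forall>x\<in>K. f x = (\<Sum>i<n. L2_inner K (e i) f * e i x)"
      using L2_inner_self_eq_0[OF K cont[OF rV]] fr by (simp add: P_def)
    then show ?thesis using e rep by (intro exI[of _ n] exI[of _ e]) auto
  next
    case False
    moreover have "L2_inner K r r \<ge> 0"
      unfolding L2_inner_def set_lebesgue_integral_def by (rule Bochner_Integration.integral_nonneg) simp
    ultimately have pos: "L2_inner K r r > 0" by simp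
    define \<rho> where "\<rho> = sqrt (L2_inner K r r)"
    have \<rho>: "\<rho> > 0" "\<rho> * \<rho> = L2_inner K r r" using pos by (auto simp: \<rho>_def)
    define d where "d x = (1 / \<rho>) * r x + 0 * r x" for x
    have dV: "d \<in> poly_space k" unfolding d_def[abs_def] by (rule poly_space_lincomb[OF rV rV])
    have dsc: "L2_inner K p d = L2_inner K p r / \<rho>" if "p \<in> poly_space k" for p
      unfolding d_def[abs_def] using L2_inner_add_scale_right[OF K(1) cont cont cont, OF that rV rV, of "1 / \<rho>" 0] by simp
    have ed: "L2_inner K (e j) d = 0" if "j < n" for j using dsc[OF e(1)[OF that]] er[OF that] by simp
    have de: "L2_inner K d (e j) = 0" if "j < n" for j
      using ed[OF that] L2_inner_commute[of K d "e j"] by simp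
    have dd: "L2_inner K d d = 1"
      using dsc[OF dV] dsc[OF rV] \<rho> pos by (simp add: L2_inner_commute[of K d r])
    define e' where "e' = e(n := d)"
    have e'_lt: "e' i = e i" if "i < n" for i using that by (simp add: e'_def)
    have e'n: "e' n = d" by (simp add: e'_def)
    have V': "e' i \<in> poly_space k" if "i < Suc n" for i
      using that e(1) dV e'_lt e'n by (cases "i = n") auto
    have on': "L2_inner K (e' i) (e' j) = (if i = j then 1 else 0)" if "i < Suc n" "j < Suc n" for i j
      using that e(2) ed de dd e'_lt e'n by (cases "i = n"; cases "j = n") auto
    have rep': "\<exists>c. \<forall>x\<in>K. g x = (\<Sum>i<Suc n. c i * e' i x)" if g: "g \<in> insert f B" for g
    proof (cases "g = f")
      case True
      have "f x = (\<Sum>i<Suc n. (if i = n then \<rho> else L2_inner K (e i) f) * e' i x)" for x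
        using fr[of x] \<rho> e'_lt by (simp add: P_def e'n d_def)
      then have "\<forall>x\<in>K. g x = (\<Sum>i<Suc n. (\<lambda>i. if i = n then \<rho> else L2_inner K (e i) f) i * e' i x)"
        unfolding True by blast
      then show ?thesis by (rule exI[of _ "\<lambda>i. if i = n then \<rho> else L2_inner K (e i) f"])
    next
      case False
      then obtain c where c: "\<forall>x\<in>K. g x = (\<Sum>i<n. c i * e i x)" using rep g by blast
      have "\<forall>x\<in>K. g x = (\<Sum>i<Suc n. (\<lambda>i. if i = n then 0 else c i) i * e' i x)"
        using c e'_lt by simp
      then show ?thesis by (rule exI[of _ "\<lambda>i. if i = n then 0 else c i"])
    qed
    show ?thesis using V' on' rep' by blast
  qed
qed

lemma orthonormal_basis_exists:
  assumes K: "compact K" "closure (interior K) = K"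
  shows "\<exists>n e. orthonormal_basis_on K k n e"
proof -
  have fin: "finite (monomial ` multi_indices k :: ('a \<Rightarrow> real) set)" using finite_multi_indices by blast
  have sub: "monomial ` multi_indices k \<subseteq> (poly_space k :: ('a \<Rightarrow> real) set)"
    using monomial_poly_space by blast
  from gram_schmidt[OF K fin sub] obtain n :: nat and e where on: "(\<forall>i<n. e i \<in> poly_space k) \<and>
     (\<forall>i<n. \<forall>j<n. L2_inner K (e i) (e j) = (if i = j then 1 else 0)) \<and>
     (\<forall>f\<in>monomial ` multi_indices k. \<exists>c. \<forall>x\<in>K. f x = (\<Sum>i<n. c i * e i x))"
    by (elim exE)
  then have e: "\<And>i. i < n \<Longrightarrow> e i \<in> poly_space k"
    "\<And>i j. i < n \<Longrightarrow> j < n \<Longrightarrow> L2_inner K (e i) (e j) = (if i = j then 1 else 0)"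
    and rep: "\<And>\<alpha>. \<alpha> \<in> multi_indices k \<Longrightarrow> \<exists>c. \<forall>x\<in>K. monomial \<alpha> x = (\<Sum>i<n. c i * e i x)"
    by auto
  obtain c where c: "\<And>\<alpha> x. \<alpha> \<in> multi_indices k \<Longrightarrow> x \<in> K \<Longrightarrow> monomial \<alpha> x = (\<Sum>i<n. c \<alpha> i * e i x)"
    using rep by metis
  have "p x = (\<Sum>i<n. L2_inner K (e i) p * e i x)" if p: "p \<in> poly_space k" and x: "x \<in> K" for p x
  proof -
    obtain a where a: "p = (\<lambda>x. \<Sum>\<alpha>\<in>multi_indices k. a \<alpha> * monomial \<alpha> x)" using p by (auto simp: poly_space_eq)
    define d where "d i = (\<Sum>\<alpha>\<in>multi_indices k. a \<alpha> * c \<alpha> i)" for i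
    have pd: "p y = (\<Sum>i<n. d i * e i y)" if "y \<in> K" for y
    proof -
      have "p y = (\<Sum>\<alpha>\<in>multi_indices k. \<Sum>i<n. a \<alpha> * c \<alpha> i * e i y)"
        using c that unfolding a by (intro sum.cong refl) (simp add: sum_distrib_left mult.assoc)
      also have "\<dots> = (\<Sum>i<n. \<Sum>\<alpha>\<in>multi_indices k. a \<alpha> * c \<alpha> i * e i y)" by (rule sum.swap)
      finally show ?thesis by (simp add: d_def sum_distrib_right)
    qed
    have "L2_inner K (e j) p = d j" if j: "j < n" for j
    proof -
      have "L2_inner K (e j) p = L2_inner K (e j) (\<lambda>y. \<Sum>i<n. d i * e i y)"
        unfolding L2_inner_def by (rule set_lebesgue_integral_cong) (use pd compact_imp_closed[OF K(1)] in auto)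
      also have "\<dots> = (\<Sum>i<n. d i * L2_inner K (e j) (e i))"
        using e j by (intro L2_inner_sum_right K continuous_poly_space) auto
      also have "\<dots> = (\<Sum>i<n. if i = j then d i else 0)" using e(2) j by (intro sum.cong) auto
      finally show ?thesis using j by simp
    qed
    then show ?thesis using pd[OF x] by simp
  qed
  then show ?thesis using e unfolding orthonormal_basis_on_def by blast
qed

definition basis_size :: "'a::euclidean_space set \<Rightarrow> nat \<Rightarrow> nat" where
  "basis_size K k = (SOME n. \<exists>e. orthonormal_basis_on K k n e)"

definition basis_fun :: "'a::euclidean_space set \<Rightarrow> nat \<Rightarrow> nat \<Rightarrow> 'a \<Rightarrow> real" where
  "basis_fun K k = (SOME e. orthonormal_basis_on K k (basis_size K k) e)"

definition coord :: "'a::euclidean_space set \<Rightarrow> nat \<Rightarrow> nat \<Rightarrow> ('a \<Rightarrow> real) \<Rightarrow> real" where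
  "coord K k i v = L2_inner K (basis_fun K k i) v"

text \<open>The polynomial that agrees with \<open>v\<close> on the interior of \<open>K\<close>, for \<open>v\<close> in the broken
  polynomial space.\<close>

definition local_poly :: "'a::euclidean_space set \<Rightarrow> nat \<Rightarrow> ('a \<Rightarrow> real) \<Rightarrow> 'a \<Rightarrow> real" where
  "local_poly K k v x = (\<Sum>i<basis_size K k. coord K k i v * basis_fun K k i x)"

section \<open>Elements of a mesh\<close>

lemma polyhedral_region_compact: "polyhedral_region P \<Longrightarrow> compact P"
  by (auto simp: polyhedral_region_def intro: polytope_imp_compact intro!: compact_Union)

lemma polyhedral_faceD:
  assumes "polyhedral_element K E" "e \<in> E"
  shows "compact e" "e \<subseteq> K" "emeasure surface_measure e < \<infinity>" "negligible e"
proof -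
  have P: "polyhedral_region e" "polyhedral_region K" "\<Union>E = frontier K"
    using assms by (auto simp: polyhedral_element_def)
  show "compact e" using P by (simp add: polyhedral_region_compact)
  have "closed K" using P(2) polyhedral_region_compact compact_imp_closed by blast
  then show "e \<subseteq> K" using assms(2) P(3) frontier_subset_closed by blast
  have "\<exists>n. is_outward_normal K e n" using assms by (simp add: polyhedral_element_def)
  then obtain n where "is_outward_normal K e n" ..
  then obtain c where n: "norm n = 1" "\<And>x. x \<in> e \<Longrightarrow> n \<bullet> x = c" by (auto simp: is_outward_normal_def)
  then have n0: "n \<noteq> 0" by auto
  show "emeasure surface_measure e < \<infinity>"
    using emeasure_surface_measure_hyperplane_finite[OF compact_imp_bounded[OF \<open>compact e\<close>] n0 n(2)] by simp
  show "negligible e"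
    by (rule negligible_subset[OF negligible_hyperplane[of n c]]) (use n n0 in auto)
qed

locale dg_element =
  fixes m :: "'a::euclidean_space dg_mesh" and K :: "'a set" and k :: nat
  assumes mesh: "conforming_mesh m" and K: "K \<in> elems m"
begin

lemma polyhedral: "polyhedral_element K (faces m K)"
  using mesh K by (auto simp: conforming_mesh_def)

lemma compact_K: "compact K"
  using polyhedral polyhedral_region_compact by (auto simp: polyhedral_element_def)

lemma closure_interior_K: "closure (interior K) = K"
  using polyhedral by (auto simp: polyhedral_element_def)

lemma finite_faces: "finite (faces m K)"
  using polyhedral by (auto simp: polyhedral_element_def)

lemma negligible_frontier_K: "negligible (frontier K)"
proof -
  have "frontier K = \<Union>(faces m K)" using polyhedral by (auto simp: polyhedral_element_def)
  then show ?thesis using polyhedral_faceD(4)[OF polyhedral] finite_faces by (auto intro: negligible_Union)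
qed

lemma face: "e \<in> faces m K \<Longrightarrow> compact e" "e \<in> faces m K \<Longrightarrow> e \<subseteq> K"
  "e \<in> faces m K \<Longrightarrow> emeasure surface_measure e < \<infinity>"
  using polyhedral_faceD[OF polyhedral] by auto

lemma neighbour_element:
  assumes e: "e \<in> faces m K" "\<not> e \<subseteq> frontier (dom m)"
  shows "neighbour m K e \<in> elems m" "e \<in> faces m (neighbour m K e)"
proof -
  from mesh have "\<forall>K\<in>elems m. \<forall>e\<in>faces m K.
      if e \<subseteq> frontier (dom m) then \<forall>K'\<in>elems m. e \<in> faces m K' \<longrightarrow> K' = K
      else \<exists>!K'. K' \<in> elems m \<and> K' \<noteq> K \<and> e \<in> faces m K'"
    unfolding conforming_mesh_def by (elim conjE)
  from bspec[OF bspec[OF this K] e(1)] e(2)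
  have "\<exists>!K'. K' \<in> elems m \<and> K' \<noteq> K \<and> e \<in> faces m K'" by simp
  from theI'[OF this] show "neighbour m K e \<in> elems m" "e \<in> faces m (neighbour m K e)"
    by (auto simp: neighbour_def)
qed

lemma basis: "orthonormal_basis_on K k (basis_size K k) (basis_fun K k)"
proof -
  have "\<exists>e. orthonormal_basis_on K k (basis_size K k) e"
    unfolding basis_size_def by (rule someI_ex[OF orthonormal_basis_exists[OF compact_K closure_interior_K]])
  then show ?thesis unfolding basis_fun_def by (rule someI_ex)
qed

lemma basis_fun: "i < basis_size K k \<Longrightarrow> basis_fun K k i \<in> poly_space k"
  using basis by (auto simp: orthonormal_basis_on_def)

lemma basis_orthonormal: "i < basis_size K k \<Longrightarrow> j < basis_size K k \<Longrightarrow>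
    L2_inner K (basis_fun K k i) (basis_fun K k j) = (if i = j then 1 else 0)"
  using basis by (auto simp: orthonormal_basis_on_def)

lemma basis_expansion:
  assumes "p \<in> poly_space k" "x \<in> K"
  shows "p x = (\<Sum>i<basis_size K k. coord K k i p * basis_fun K k i x)"
proof -
  from basis have "\<forall>p\<in>poly_space k. \<forall>x\<in>K. p x = (\<Sum>i<basis_size K k. L2_inner K (basis_fun K k i) p * basis_fun K k i x)"
    unfolding orthonormal_basis_on_def by (elim conjE)
  from bspec[OF bspec[OF this assms(1)] assms(2)] show ?thesis unfolding coord_def .
qed

lemma local_poly: "local_poly K k v \<in> poly_space k"
  unfolding local_poly_def[abs_def] using basis_fun by (intro poly_space_sum) auto

lemma continuous_basis_fun: "i < basis_size K k \<Longrightarrow> continuous_on UNIV (basis_fun K k i)"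
  by (rule continuous_poly_space[OF basis_fun])

lemma continuous_local_poly: "continuous_on UNIV (local_poly K k v)"
  by (rule continuous_poly_space[OF local_poly])

lemma coord_cong:
  assumes "\<And>x. x \<in> interior K \<Longrightarrow> v x = w x"
  shows "coord K k i v = coord K k i w"
  unfolding coord_def L2_inner_def
  by (rule LINT_cong_interior[OF negligible_frontier_K]) (simp add: assms)

lemma local_poly_interior:
  assumes v: "v \<in> dg_space m k" and x: "x \<in> interior K"
  shows "v x = local_poly K k v x"
proof -
  obtain p where p: "p \<in> poly_space k" "\<And>x. x \<in> interior K \<Longrightarrow> v x = p x"
    using v K by (auto simp: dg_space_def)
  have "p x = (\<Sum>i<basis_size K k. coord K k i p * basis_fun K k i x)"
    by (rule basis_expansion[OF p(1)]) (use x interior_subset in blast)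
  then show ?thesis using p(2)[OF x] coord_cong[of v p] p(2) by (simp add: local_poly_def)
qed

text \<open>Every point of \<open>K\<close> is a limit point of the interior, because
  \<open>K\<close> is its closure. So the filter is nontrivial and \<open>Lim\<close> denotes the
  genuine limit.\<close>

lemma inner_trace_continuous:
  assumes x: "x \<in> K" and w: "\<And>y. y \<in> interior K \<Longrightarrow> w y = p y" and p: "continuous_on UNIV p"
  shows "inner_trace K w x = p x"
proof -
  have "x islimpt interior K"
  proof (cases "x \<in> interior K")
    case True
    then show ?thesis using open_imp_islimpt[OF open_interior] by blast
  next
    case False
    then show ?thesis using x closure_interior_K by (metis closure_def UnE mem_Collect_eq)
  qed
  then have nt: "at x within interior K \<noteq> bot" by (simp add: trivial_limit_within)
  have "(p \<longlongrightarrow> p x) (at x within interior K)"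
    using p by (auto simp: continuous_on_eq_continuous_at continuous_at intro: tendsto_within_subset)
  moreover have "\<forall>\<^sub>F y in at x within interior K. w y = p y"
    unfolding eventually_at_filter using w by (intro always_eventually) auto
  ultimately have "(w \<longlongrightarrow> p x) (at x within interior K)"
    by (simp add: tendsto_cong)
  then show ?thesis unfolding inner_trace_def by (rule tendsto_Lim[OF nt])
qed

lemma inner_trace_compose:
  assumes v: "v \<in> dg_space m k" and x: "x \<in> K" and g: "continuous_on UNIV g"
  shows "inner_trace K (\<lambda>y. g (v y)) x = g (local_poly K k v x)"
proof (rule inner_trace_continuous[OF x])
  show "continuous_on UNIV (\<lambda>y. g (local_poly K k v y))"
    using continuous_on_compose2[OF g continuous_poly_space[OF local_poly]] by simp
qed (simp add: local_poly_interior[OF v])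

lemma inner_trace_local_poly:
  "v \<in> dg_space m k \<Longrightarrow> x \<in> K \<Longrightarrow> inner_trace K v x = local_poly K k v x"
  using inner_trace_compose[of v x "\<lambda>y. y"] by simp

lemma poly_space_dg_space: "p \<in> poly_space k \<Longrightarrow> p \<in> dg_space m k"
  by (auto simp: dg_space_def)

text \<open>Parseval's identity on one element.\<close>

lemma L2_inner_dg:
  assumes v: "v \<in> dg_space m k" and w: "w \<in> dg_space m k"
  shows "L2_inner K v w = (\<Sum>i<basis_size K k. coord K k i v * coord K k i w)"
proof -
  have "L2_inner K v w = L2_inner K v (local_poly K k w)"
    unfolding L2_inner_def by (rule LINT_cong_interior[OF negligible_frontier_K]) (simp add: local_poly_interior[OF w])
  also have "\<dots> = L2_inner K (local_poly K k v) (local_poly K k w)"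
    unfolding L2_inner_def by (rule LINT_cong_interior[OF negligible_frontier_K]) (simp add: local_poly_interior[OF v])
  also have "\<dots> = (\<Sum>i<basis_size K k. coord K k i w * L2_inner K (local_poly K k v) (basis_fun K k i))"
    unfolding local_poly_def[of K k w, abs_def]
    by (intro L2_inner_sum_right compact_K continuous_basis_fun continuous_local_poly) auto
  also have "\<dots> = (\<Sum>i<basis_size K k. coord K k i v * coord K k i w)"
  proof (rule sum.cong[OF refl])
    fix i assume "i \<in> {..<basis_size K k}"
    have "L2_inner K (local_poly K k v) (basis_fun K k i) = coord K k i (local_poly K k v)"
      by (simp add: coord_def L2_inner_commute)
    also have "\<dots> = coord K k i v" by (rule coord_cong[symmetric]) (simp add: local_poly_interior[OF v])
    finally show "coord K k i w * L2_inner K (local_poly K k v) (basis_fun K k i) = coord K k i v * coord K k i w"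
      by simp
  qed
  finally show ?thesis .
qed

text \<open>The reproducing kernel of the polynomials in L2(K), expanded in the orthonormal
  basis.\<close>

definition evaluation_poly :: "'a \<Rightarrow> 'a \<Rightarrow> real" where
  "evaluation_poly x y = (\<Sum>i<basis_size K k. basis_fun K k i x * basis_fun K k i y)"

lemma evaluation_poly: "evaluation_poly x \<in> poly_space k"
  unfolding evaluation_poly_def[abs_def] using basis_fun by (intro poly_space_sum) auto

lemma L2_inner_evaluation_poly:
  assumes v: "v \<in> dg_space m k" and x: "x \<in> interior K"
  shows "(LINT y:K|lebesgue. evaluation_poly x y * v y) = v x"
proof -
  have "coord K k j (evaluation_poly x) = basis_fun K k j x" if j: "j < basis_size K k" for j
  proof -
    have "coord K k j (evaluation_poly x) =
        (\<Sum>i<basis_size K k. basis_fun K k i x * L2_inner K (basis_fun K k j) (basis_fun K k i))"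
      unfolding coord_def evaluation_poly_def[abs_def] using j
      by (intro L2_inner_sum_right compact_K continuous_basis_fun) auto
    also have "\<dots> = (\<Sum>i<basis_size K k. if i = j then basis_fun K k i x else 0)"
      using basis_orthonormal j by (intro sum.cong) auto
    finally show ?thesis using j by simp
  qed
  then have "L2_inner K (evaluation_poly x) v = local_poly K k v x"
    using L2_inner_dg[OF poly_space_dg_space[OF evaluation_poly] v] by (simp add: local_poly_def mult.commute)
  then show ?thesis using local_poly_interior[OF v x] by (simp add: L2_inner_def)
qed

end

section \<open>Fluxes of time-dependent broken polynomials\<close>

text \<open>Continuity in time is expressed by finitely many real coordinates. It is a property of a
  single path, so everything up to the energy identity is deterministic.\<close>

definition elementwise_continuous ::
    "'a::euclidean_space dg_mesh \<Rightarrow> nat \<Rightarrow> real set \<Rightarrow> (real \<Rightarrow> 'a \<Rightarrow> real) \<Rightarrow> bool" where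
  "elementwise_continuous m k I v \<longleftrightarrow> (\<forall>s\<in>I. v s \<in> dg_space m k) \<and>
     (\<forall>K\<in>elems m. \<forall>i<basis_size K k. continuous_on I (\<lambda>s. coord K k i (v s)))"

lemma elementwise_continuousD:
  assumes "elementwise_continuous m k I v"
  shows "s \<in> I \<Longrightarrow> v s \<in> dg_space m k"
    and "K \<in> elems m \<Longrightarrow> i < basis_size K k \<Longrightarrow> continuous_on I (\<lambda>s. coord K k i (v s))"
  using assms by (auto simp: elementwise_continuous_def)

text \<open>Joint continuity in time and space holds because coordinates depend on time only and
  basis functions on space only.\<close>

lemma continuous_on_local_poly:
  assumes mesh: "conforming_mesh m" and v: "elementwise_continuous m k I v" and K: "K \<in> elems m"
  shows "continuous_on (I \<times> S) (\<lambda>p. local_poly K k (v (fst p)) (snd p))"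
proof -
  interpret dg_element m K k by standard (rule mesh, rule K)
  show ?thesis
    unfolding local_poly_def
  proof (intro continuous_on_sum continuous_on_mult)
    fix i assume i: "i \<in> {..<basis_size K k}"
    show "continuous_on (I \<times> S) (\<lambda>p. coord K k i (v (fst p)))"
      using continuous_on_compose2[OF elementwise_continuousD(2)[OF v K] continuous_on_fst[OF continuous_on_id], of i "I \<times> S"] i
      by auto
    show "continuous_on (I \<times> S) (\<lambda>p. basis_fun K k i (snd p))"
      using continuous_on_compose2[OF continuous_basis_fun continuous_on_snd[OF continuous_on_id], of i "I \<times> S"] i
      by auto
  qed
qed

lemma continuous_on_compose_UNIV:
  "continuous_on UNIV g \<Longrightarrow> continuous_on S f \<Longrightarrow> continuous_on S (\<lambda>x. g (f x))"
  using continuous_on_compose2[of UNIV g S f] by simp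

lemma set_integrable_abs_weight:
  fixes w :: "'a \<Rightarrow> real"
  assumes "set_integrable M e w"
  shows "set_integrable M e (\<lambda>x. \<bar>w x\<bar>)"
  using integrable_abs[OF assms[unfolded set_integrable_def]]
  unfolding set_integrable_def by (simp add: abs_mult)

section \<open>Central and penalty parts of the fluxes\<close>

context dg_element
begin

text \<open>The part of the reduced flux without the sign of the normal trace, written in the
  polynomials on both sides of the face. It is jointly continuous in time and space, which the full
  flux need not be.\<close>

definition central_dgq :: "'a noise_coeff \<Rightarrow> 'a set \<Rightarrow> ('a \<Rightarrow> real) \<Rightarrow> ('a \<Rightarrow> real) \<Rightarrow> 'a \<Rightarrow> real" where
  "central_dgq c e u q x =
    (if e \<subseteq> frontier (dom m) then deriv (nonlin c) (local_poly K k u x) * local_poly K k q x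
     else divided_difference (nonlin c) (local_poly K k u x) (local_poly (neighbour m K e) k u x) *
       ((local_poly (neighbour m K e) k q x + local_poly K k q x) / 2))"

definition penalty_dgq :: "'a noise_coeff \<Rightarrow> 'a set \<Rightarrow> ('a \<Rightarrow> real) \<Rightarrow> 'a \<Rightarrow> real" where
  "penalty_dgq c e u x =
    (if e \<subseteq> frontier (dom m) then 0 else eta_q c e * (local_poly (neighbour m K e) k u x - local_poly K k u x))"

definition central_g :: "'a noise_coeff \<Rightarrow> 'a set \<Rightarrow> ('a \<Rightarrow> real) \<Rightarrow> 'a \<Rightarrow> real" where
  "central_g c e u x =
    (if e \<subseteq> frontier (dom m) then nonlin c (local_poly K k u x)
     else (nonlin c (local_poly (neighbour m K e) k u x) + nonlin c (local_poly K k u x)) / 2)"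

definition penalty_g :: "'a noise_coeff \<Rightarrow> 'a set \<Rightarrow> ('a \<Rightarrow> real) \<Rightarrow> 'a \<Rightarrow> real" where
  "penalty_g c e q x =
    (if e \<subseteq> frontier (dom m) then 0 else eta_u c e * (local_poly (neighbour m K e) k q x - local_poly K k q x))"

text \<open>Traces of broken polynomials are values of the local polynomials, and by continuity of
  \<open>g\<close> the trace of \<open>g(u)\<close> is \<open>g\<close> of the trace; conformity
  provides the neighbour on interior faces.\<close>

lemma reduced_flux_split:
  assumes g: "continuous_on UNIV (nonlin c)" and u: "u \<in> dg_space m k" and q: "q \<in> dg_space m k"
    and e: "e \<in> faces m K" and x: "x \<in> e"
  shows "reduced_flux_dgq m c K e u q x =
      central_dgq c e u q x + sgn (ntrace c (outward_normal K e) x) * penalty_dgq c e u x"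
    and "reduced_flux_g m c K e u q x =
      central_g c e u x + sgn (ntrace c (outward_normal K e) x) * penalty_g c e q x"
proof -
  have xK: "x \<in> K" using face(2)[OF e] x by auto
  have "reduced_flux_dgq m c K e u q x =
      central_dgq c e u q x + sgn (ntrace c (outward_normal K e) x) * penalty_dgq c e u x \<and>
    reduced_flux_g m c K e u q x =
      central_g c e u x + sgn (ntrace c (outward_normal K e) x) * penalty_g c e q x"
  proof (cases "e \<subseteq> frontier (dom m)")
    case True
    then show ?thesis
      using inner_trace_local_poly[OF u xK] inner_trace_local_poly[OF q xK]
      by (simp add: reduced_flux_dgq_def reduced_flux_g_def central_dgq_def central_g_def penalty_dgq_def penalty_g_def)
  next
    case False
    interpret N: dg_element m "neighbour m K e" k
      by standard (rule mesh, rule neighbour_element[OF e False])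
    have xN: "x \<in> neighbour m K e"
      using N.face(2)[OF neighbour_element(2)[OF e False]] x by auto
    show ?thesis
      using False inner_trace_local_poly[OF u xK] inner_trace_local_poly[OF q xK]
        N.inner_trace_local_poly[OF u xN] N.inner_trace_local_poly[OF q xN]
        inner_trace_compose[OF u xK g] N.inner_trace_compose[OF u xN g]
      by (simp add: reduced_flux_dgq_def reduced_flux_g_def central_dgq_def central_g_def penalty_dgq_def
          penalty_g_def difference_quotient_def divided_difference_def jump_def average_def)
  qed
  then show "reduced_flux_dgq m c K e u q x =
      central_dgq c e u q x + sgn (ntrace c (outward_normal K e) x) * penalty_dgq c e u x"
    and "reduced_flux_g m c K e u q x =
      central_g c e u x + sgn (ntrace c (outward_normal K e) x) * penalty_g c e q x" by auto
qed

context
  fixes c :: "'a noise_coeff" and I :: "real set" and u q :: "real \<Rightarrow> 'a \<Rightarrow> real"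
  assumes c: "structural_assumption m c"
    and u: "elementwise_continuous m k I u" and q: "elementwise_continuous m k I q"
begin

lemma nonlin_C2: "C_k 2 (nonlin c)"
  using c by (simp add: structural_assumption_def)

lemmas nonlin_continuous = C_k_2_real(3)[OF nonlin_C2]
lemmas deriv_nonlin_continuous = C_k_2_real(2)[OF nonlin_C2]

lemma uq_dg: "s \<in> I \<Longrightarrow> u s \<in> dg_space m k" "s \<in> I \<Longrightarrow> q s \<in> dg_space m k"
  using elementwise_continuousD(1)[OF u] elementwise_continuousD(1)[OF q] by auto

lemma ntrace_integrable:
  assumes e: "e \<in> faces m K"
  shows "set_integrable surface_measure e (ntrace c (outward_normal K e))"
proof (rule set_integrable_if_square_integrable)
  have "has_normal_trace m (field c) (ntrace c)" using c by (simp add: structural_assumption_def)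
  then show "set_borel_measurable surface_measure e (ntrace c (outward_normal K e))"
    "set_integrable surface_measure e (\<lambda>x. (ntrace c (outward_normal K e) x)\<^sup>2)"
    using K e by (auto simp: has_normal_trace_def)
  show "e \<in> sets surface_measure" using compact_imp_closed[OF face(1)[OF e]] by auto
qed (rule face(3)[OF e])

text \<open>All spatial roughness sits in two time-independent integrable weights, the normal trace
  and its absolute value; the other factors are jointly continuous.\<close>

lemma face_integral:
  assumes e: "e \<in> faces m K" and h: "continuous_on (I \<times> e) (\<lambda>p. h (fst p) (snd p))"
    and h': "continuous_on (I \<times> e) (\<lambda>p. h' (fst p) (snd p))"
    and f: "\<And>s x. s \<in> I \<Longrightarrow> x \<in> e \<Longrightarrow> f s x = ntrace c (outward_normal K e) x * h s x +
      \<bar>ntrace c (outward_normal K e) x\<bar> * h' s x"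
  shows "s \<in> I \<Longrightarrow> set_integrable surface_measure e (f s)"
    and "continuous_on I (\<lambda>s. LINT x:e|surface_measure. f s x)"
proof -
  let ?w = "ntrace c (outward_normal K e)"
  have eM: "e \<in> sets surface_measure" using compact_imp_closed[OF face(1)[OF e]] by auto
  have h1: "continuous_on (I \<times> e) (\<lambda>(s, x). h s x)" and h2: "continuous_on (I \<times> e) (\<lambda>(s, x). h' s x)"
    using h h' by (simp_all add: case_prod_beta)
  have M: "sets borel \<subseteq> sets (surface_measure :: 'a measure)" "space (surface_measure :: 'a measure) = UNIV" by auto
  note a = weighted_integral_continuous[OF M face(1)[OF e] ntrace_integrable[OF e] h1]
  note b = weighted_integral_continuous[OF M face(1)[OF e] set_integrable_abs_weight[OF ntrace_integrable[OF e]] h2]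
  have int: "set_integrable surface_measure e (\<lambda>x. ?w x * h s x + \<bar>?w x\<bar> * h' s x)" if "s \<in> I" for s
    using a(1)[OF that] b(1)[OF that] by (rule set_integral_add(1))
  show "set_integrable surface_measure e (f s)" if "s \<in> I" for s
    using int[OF that] f[OF that] by (subst set_integrable_cong[OF refl refl]) auto
  have "(LINT x:e|surface_measure. f s x) =
      (LINT x:e|surface_measure. ?w x * h s x) + (LINT x:e|surface_measure. \<bar>?w x\<bar> * h' s x)" if "s \<in> I" for s
  proof -
    have "(LINT x:e|surface_measure. f s x) = (LINT x:e|surface_measure. ?w x * h s x + \<bar>?w x\<bar> * h' s x)"
      by (rule set_lebesgue_integral_cong[OF eM]) (use f[OF that] in auto)
    then show ?thesis using set_integral_add(2)[OF a(1)[OF that] b(1)[OF that]] by simp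
  qed
  then show "continuous_on I (\<lambda>s. LINT x:e|surface_measure. f s x)"
    using continuous_on_add[OF a(2) b(2)] by (simp cong: continuous_on_cong)
qed

lemma local_poly_continuous:
  assumes "K' \<in> elems m"
  shows "continuous_on (I \<times> S) (\<lambda>p. local_poly K' k (u (fst p)) (snd p))"
    and "continuous_on (I \<times> S) (\<lambda>p. local_poly K' k (q (fst p)) (snd p))"
  using continuous_on_local_poly[OF mesh u assms] continuous_on_local_poly[OF mesh q assms] by auto

lemma flux_parts_continuous:
  assumes e: "e \<in> faces m K"
  shows "continuous_on (I \<times> e) (\<lambda>p. central_dgq c e (u (fst p)) (q (fst p)) (snd p))"
    and "continuous_on (I \<times> e) (\<lambda>p. penalty_dgq c e (u (fst p)) (snd p))"
    and "continuous_on (I \<times> e) (\<lambda>p. central_g c e (u (fst p)) (snd p))"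
    and "continuous_on (I \<times> e) (\<lambda>p. penalty_g c e (q (fst p)) (snd p))"
proof -
  note P = local_poly_continuous[OF K, of e]
  have "continuous_on (I \<times> e) (\<lambda>p. central_dgq c e (u (fst p)) (q (fst p)) (snd p)) \<and>
    continuous_on (I \<times> e) (\<lambda>p. penalty_dgq c e (u (fst p)) (snd p)) \<and>
    continuous_on (I \<times> e) (\<lambda>p. central_g c e (u (fst p)) (snd p)) \<and>
    continuous_on (I \<times> e) (\<lambda>p. penalty_g c e (q (fst p)) (snd p))"
  proof (cases "e \<subseteq> frontier (dom m)")
    case True
    then show ?thesis
      by (auto simp: central_dgq_def penalty_dgq_def central_g_def penalty_g_def
          intro!: continuous_on_mult P continuous_on_compose_UNIV[OF nonlin_continuous]
            continuous_on_compose_UNIV[OF deriv_nonlin_continuous])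
  next
    case False
    note N = local_poly_continuous[OF neighbour_element(1)[OF e False], of e]
    have dd: "continuous_on (I \<times> e) (\<lambda>p. divided_difference (nonlin c)
        (local_poly K k (u (fst p)) (snd p)) (local_poly (neighbour m K e) k (u (fst p)) (snd p)))"
      using continuous_on_compose_UNIV[OF continuous_divided_difference[OF nonlin_C2] continuous_on_Pair[OF P(1) N(1)]]
      by simp
    show ?thesis
      using False by (auto simp: central_dgq_def penalty_dgq_def central_g_def penalty_g_def
          intro!: continuous_on_mult continuous_on_add continuous_on_diff continuous_on_divide continuous_on_const
            dd P N continuous_on_compose_UNIV[OF nonlin_continuous])
  qed
  then show "continuous_on (I \<times> e) (\<lambda>p. central_dgq c e (u (fst p)) (q (fst p)) (snd p))"
    and "continuous_on (I \<times> e) (\<lambda>p. penalty_dgq c e (u (fst p)) (snd p))"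
    and "continuous_on (I \<times> e) (\<lambda>p. central_g c e (u (fst p)) (snd p))"
    and "continuous_on (I \<times> e) (\<lambda>p. penalty_g c e (q (fst p)) (snd p))" by auto
qed

lemma face_flux_integral:
  assumes e: "e \<in> faces m K" and \<rho>: "continuous_on (I \<times> e) (\<lambda>p. \<rho> (fst p) (snd p))"
  shows "s \<in> I \<Longrightarrow> set_integrable surface_measure e (\<lambda>x. \<rho> s x * flux_dgq m c K e (u s) (q s) x)"
    and "continuous_on I (\<lambda>s. LINT x:e|surface_measure. \<rho> s x * flux_dgq m c K e (u s) (q s) x)"
    and "s \<in> I \<Longrightarrow> set_integrable surface_measure e (\<lambda>x. \<rho> s x * flux_g m c K e (u s) (q s) x)"
    and "continuous_on I (\<lambda>s. LINT x:e|surface_measure. \<rho> s x * flux_g m c K e (u s) (q s) x)"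
    and "s \<in> I \<Longrightarrow> set_integrable surface_measure e (\<lambda>x. \<rho> s x * ntrace c (outward_normal K e) x)"
    and "continuous_on I (\<lambda>s. LINT x:e|surface_measure. \<rho> s x * ntrace c (outward_normal K e) x)"
proof -
  \<comment> \<open>Absorbs the sign in the penalty term into the weight.\<close>
  have sg: "y * sgn y = \<bar>y\<bar>" for y :: real by (simp add: mult_sgn_abs abs_sgn mult.commute)
  have alg: "r * (y * (a + sgn y * b)) = y * (r * a) + \<bar>y\<bar> * (r * b)" for r y a b :: real
    unfolding sg[symmetric] by (simp add: algebra_simps)
  note cont = flux_parts_continuous[OF e]
  have 1: "\<rho> s x * flux_dgq m c K e (u s) (q s) x =
      ntrace c (outward_normal K e) x * (\<rho> s x * central_dgq c e (u s) (q s) x) +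
      \<bar>ntrace c (outward_normal K e) x\<bar> * (\<rho> s x * penalty_dgq c e (u s) x)" if "s \<in> I" "x \<in> e" for s x
    unfolding flux_dgq_def reduced_flux_split(1)[OF nonlin_continuous uq_dg[OF that(1)] e that(2)] by (rule alg)
  have 2: "\<rho> s x * flux_g m c K e (u s) (q s) x =
      ntrace c (outward_normal K e) x * (\<rho> s x * central_g c e (u s) x) +
      \<bar>ntrace c (outward_normal K e) x\<bar> * (\<rho> s x * penalty_g c e (q s) x)" if "s \<in> I" "x \<in> e" for s x
    unfolding flux_g_def reduced_flux_split(2)[OF nonlin_continuous uq_dg[OF that(1)] e that(2)] by (rule alg)
  note F1 = face_integral[where h = "\<lambda>s x. \<rho> s x * central_dgq c e (u s) (q s) x"
      and h' = "\<lambda>s x. \<rho> s x * penalty_dgq c e (u s) x", OF e continuous_on_mult[OF \<rho> cont(1)]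
      continuous_on_mult[OF \<rho> cont(2)] 1]
  note F2 = face_integral[where h = "\<lambda>s x. \<rho> s x * central_g c e (u s) x"
      and h' = "\<lambda>s x. \<rho> s x * penalty_g c e (q s) x", OF e continuous_on_mult[OF \<rho> cont(3)]
      continuous_on_mult[OF \<rho> cont(4)] 2]
  have 3: "\<rho> s x * ntrace c (outward_normal K e) x =
      ntrace c (outward_normal K e) x * \<rho> s x + \<bar>ntrace c (outward_normal K e) x\<bar> * 0" for s x by simp
  note F3 = face_integral[where h = \<rho> and h' = "\<lambda>_ _. 0", OF e \<rho> continuous_on_const 3]
  show "s \<in> I \<Longrightarrow> set_integrable surface_measure e (\<lambda>x. \<rho> s x * flux_dgq m c K e (u s) (q s) x)"
    and "continuous_on I (\<lambda>s. LINT x:e|surface_measure. \<rho> s x * flux_dgq m c K e (u s) (q s) x)"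
    and "s \<in> I \<Longrightarrow> set_integrable surface_measure e (\<lambda>x. \<rho> s x * flux_g m c K e (u s) (q s) x)"
    and "continuous_on I (\<lambda>s. LINT x:e|surface_measure. \<rho> s x * flux_g m c K e (u s) (q s) x)"
    and "s \<in> I \<Longrightarrow> set_integrable surface_measure e (\<lambda>x. \<rho> s x * ntrace c (outward_normal K e) x)"
    and "continuous_on I (\<lambda>s. LINT x:e|surface_measure. \<rho> s x * ntrace c (outward_normal K e) x)"
    using F1 F2 F3 by blast+
qed

text \<open>The gradient is bounded on the compact \<open>K\<close>, so the pairing inherits square
  integrability from the field; finite measure of \<open>K\<close> then gives integrability.\<close>

lemma field_weight_integrable:
  assumes \<phi>: "C_k 1 \<phi>"
  shows "set_integrable lebesgue K (\<lambda>x. grad \<phi> x \<bullet> field c x)"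
proof (rule set_integrable_if_square_integrable)
  have f: "field c \<in> borel_measurable lebesgue" "integrable lebesgue (\<lambda>x. (norm (field c x))\<^sup>2)"
    using c by (auto simp: structural_assumption_def square_integrable_def)
  have g: "grad \<phi> \<in> borel_measurable lebesgue"
    using borel_measurable_continuous_onI[OF continuous_grad[OF \<phi>]] by (simp add: measurable_completion)
  have Kb: "K \<in> sets borel" using compact_imp_closed[OF compact_K] by auto
  show "K \<in> sets lebesgue" using Kb by auto
  have w: "(\<lambda>x. indicator K x *\<^sub>R (grad \<phi> x \<bullet> field c x)) \<in> borel_measurable lebesgue"
    using f(1) g \<open>K \<in> sets lebesgue\<close> by (intro borel_measurable_scaleR borel_measurable_indicator borel_measurable_inner)
  then show "set_borel_measurable lebesgue K (\<lambda>x. grad \<phi> x \<bullet> field c x)"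
    by (simp add: set_borel_measurable_def)
  show "emeasure lebesgue K < \<infinity>"
    using emeasure_compact_finite[OF compact_K] Kb by simp
  have "compact (grad \<phi> ` K)"
    by (rule compact_continuous_image[OF continuous_on_subset[OF continuous_grad[OF \<phi>]] compact_K]) simp
  from compact_imp_bounded[OF this] obtain B where B: "\<And>x. x \<in> K \<Longrightarrow> norm (grad \<phi> x) \<le> B"
    by (auto simp: bounded_iff)
  show "set_integrable lebesgue K (\<lambda>x. (grad \<phi> x \<bullet> field c x)\<^sup>2)"
    unfolding set_integrable_def
  proof (rule Bochner_Integration.integrable_bound)
    show "integrable lebesgue (\<lambda>x. B\<^sup>2 * (norm (field c x))\<^sup>2)" using f(2) by simp
    have "(\<lambda>x. (indicator K x *\<^sub>R (grad \<phi> x \<bullet> field c x))\<^sup>2) \<in> borel_measurable lebesgue"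
      using w by (rule borel_measurable_power)
    moreover have "(\<lambda>x. (indicator K x *\<^sub>R (grad \<phi> x \<bullet> field c x))\<^sup>2) =
        (\<lambda>x. indicator K x *\<^sub>R (grad \<phi> x \<bullet> field c x)\<^sup>2)" by (auto simp: indicator_def)
    ultimately show "(\<lambda>x. indicator K x *\<^sub>R (grad \<phi> x \<bullet> field c x)\<^sup>2) \<in> borel_measurable lebesgue" by simp
    show "AE x in lebesgue. norm (indicator K x *\<^sub>R (grad \<phi> x \<bullet> field c x)\<^sup>2) \<le> norm (B\<^sup>2 * (norm (field c x))\<^sup>2)"
    proof (rule AE_I2)
      fix x
      show "norm (indicator K x *\<^sub>R (grad \<phi> x \<bullet> field c x)\<^sup>2) \<le> norm (B\<^sup>2 * (norm (field c x))\<^sup>2)"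
      proof (cases "x \<in> K")
        case True
        have "\<bar>grad \<phi> x \<bullet> field c x\<bar> \<le> norm (grad \<phi> x) * norm (field c x)" by (rule Cauchy_Schwarz_ineq2)
        also have "\<dots> \<le> B * norm (field c x)" using B[OF True] by (rule mult_right_mono) simp
        finally have "(grad \<phi> x \<bullet> field c x)\<^sup>2 \<le> (B * norm (field c x))\<^sup>2"
          by (metis abs_ge_zero power2_abs power_mono)
        then show ?thesis using True by (simp add: power_mult_distrib)
      qed simp
    qed
  qed
qed

lemma face_sets: "e \<in> faces m K \<Longrightarrow> e \<in> sets surface_measure"
  using compact_imp_closed[OF face(1)] by simp

lemma volume_integral:
  assumes \<phi>: "C_k 1 \<phi>" and h: "continuous_on (I \<times> K) (\<lambda>p. h (fst p) (snd p))"
  shows "s \<in> I \<Longrightarrow> set_integrable lebesgue K (\<lambda>x. (grad \<phi> x \<bullet> field c x) * h s x)"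
    and "continuous_on I (\<lambda>s. LINT x:K|lebesgue. (grad \<phi> x \<bullet> field c x) * h s x)"
proof -
  have "sets borel \<subseteq> sets (lebesgue :: 'a measure)" using sets_completionI_sets[of _ lborel] by auto
  moreover have "continuous_on (I \<times> K) (\<lambda>(s, x). h s x)" using h by (simp add: case_prod_beta)
  ultimately show "s \<in> I \<Longrightarrow> set_integrable lebesgue K (\<lambda>x. (grad \<phi> x \<bullet> field c x) * h s x)"
    and "continuous_on I (\<lambda>s. LINT x:K|lebesgue. (grad \<phi> x \<bullet> field c x) * h s x)"
    using weighted_integral_continuous[OF _ _ compact_K field_weight_integrable[OF \<phi>]] by auto
qed

lemma deriv_nonlin_local_poly_continuous:
  "continuous_on (I \<times> K) (\<lambda>p. deriv (nonlin c) (local_poly K k (u (fst p)) (snd p)) * local_poly K k (q (fst p)) (snd p))"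
  by (intro continuous_on_mult local_poly_continuous[OF K] continuous_on_compose_UNIV[OF deriv_nonlin_continuous])

lemma nonlin_local_poly_continuous:
  "continuous_on (I \<times> S) (\<lambda>p. nonlin c (local_poly K k (u (fst p)) (snd p)))"
  by (intro local_poly_continuous[OF K] continuous_on_compose_UNIV[OF nonlin_continuous])

text \<open>The test function is fixed in time here. Applied to the reproducing kernel, this is the
  continuity of the drift.\<close>

lemma b_form_continuous:
  assumes \<phi>: "\<phi> \<in> poly_space k"
  shows "continuous_on I (\<lambda>s. b_form m c K (u s) (q s) \<phi>)"
proof -
  have vol: "(LINT x:K|lebesgue. (grad \<phi> x \<bullet> field c x) * deriv (nonlin c) (u s x) * q s x) =
      (LINT x:K|lebesgue. (grad \<phi> x \<bullet> field c x) * (deriv (nonlin c) (local_poly K k (u s) x) * local_poly K k (q s) x))"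
    if "s \<in> I" for s
    by (rule LINT_cong_interior[OF negligible_frontier_K])
      (simp add: local_poly_interior[OF uq_dg(1)[OF that]] local_poly_interior[OF uq_dg(2)[OF that]])
  have trace: "(LINT x:e|surface_measure. inner_trace K \<phi> x * flux_dgq m c K e (u s) (q s) x) =
      (LINT x:e|surface_measure. \<phi> x * flux_dgq m c K e (u s) (q s) x)" if e: "e \<in> faces m K" for e s
  proof (rule set_lebesgue_integral_cong)
    show "e \<in> sets surface_measure" using compact_imp_closed[OF face(1)[OF e]] by auto
    have "inner_trace K \<phi> x = \<phi> x" if "x \<in> e" for x
      using inner_trace_continuous[of x \<phi> \<phi>] face(2)[OF e] that continuous_poly_space[OF \<phi>] by auto
    then show "\<forall>x. x \<in> e \<longrightarrow> inner_trace K \<phi> x * flux_dgq m c K e (u s) (q s) x =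
        \<phi> x * flux_dgq m c K e (u s) (q s) x" by simp
  qed
  have \<rho>: "continuous_on (I \<times> e) (\<lambda>p. (\<lambda>s x. \<phi> x) (fst p) (snd p))" for e
    by (intro continuous_on_compose_UNIV[OF continuous_poly_space[OF \<phi>]] continuous_intros)
  have "continuous_on I (\<lambda>s. - (1/2) * (LINT x:K|lebesgue. (grad \<phi> x \<bullet> field c x) *
      (deriv (nonlin c) (local_poly K k (u s) x) * local_poly K k (q s) x)) +
     (1/2) * (\<Sum>e\<in>faces m K. LINT x:e|surface_measure. \<phi> x * flux_dgq m c K e (u s) (q s) x))"
    using face_flux_integral(2)[OF _ \<rho>]
    by (intro continuous_on_add continuous_on_mult continuous_on_const continuous_on_sum
        volume_integral(2)[OF C_k_1_poly_space[OF \<phi>] deriv_nonlin_local_poly_continuous]) auto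
  then show ?thesis
    by (rule continuous_on_cong[THEN iffD1, rotated 2]) (simp_all add: b_form_def vol trace del: One_nat_def)
qed

lemma face_term:
  assumes e: "e \<in> faces m K"
  defines "R \<equiv> \<lambda>s x. ntrace c (outward_normal K e) x *
     (inner_trace K (u s) x * reduced_flux_dgq m c K e (u s) (q s) x +
      inner_trace K (q s) x * reduced_flux_g m c K e (u s) (q s) x -
      nonlin c (inner_trace K (u s) x) * inner_trace K (q s) x)"
  shows "s \<in> I \<Longrightarrow> (LINT x:e|surface_measure. R s x) =
      (LINT x:e|surface_measure. local_poly K k (u s) x * flux_dgq m c K e (u s) (q s) x) +
      (LINT x:e|surface_measure. local_poly K k (q s) x * flux_g m c K e (u s) (q s) x) -
      (LINT x:e|surface_measure. (nonlin c (local_poly K k (u s) x) * local_poly K k (q s) x) * ntrace c (outward_normal K e) x)"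
    and "continuous_on I (\<lambda>s. LINT x:e|surface_measure. R s x)"
proof -
  note P = local_poly_continuous[OF K, of e]
  note F1 = face_flux_integral(1,2)[OF e P(1)]
  note F2 = face_flux_integral(3,4)[OF e P(2)]
  note F3 = face_flux_integral(5,6)[where \<rho> = "\<lambda>s x. nonlin c (local_poly K k (u s) x) * local_poly K k (q s) x",
      OF e continuous_on_mult[OF nonlin_local_poly_continuous P(2)]]
  have eq: "(LINT x:e|surface_measure. R s x) =
      (LINT x:e|surface_measure. local_poly K k (u s) x * flux_dgq m c K e (u s) (q s) x) +
      (LINT x:e|surface_measure. local_poly K k (q s) x * flux_g m c K e (u s) (q s) x) -
      (LINT x:e|surface_measure. (nonlin c (local_poly K k (u s) x) * local_poly K k (q s) x) * ntrace c (outward_normal K e) x)"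
    if s: "s \<in> I" for s
  proof -
    have "(LINT x:e|surface_measure. R s x) = (LINT x:e|surface_measure.
        local_poly K k (u s) x * flux_dgq m c K e (u s) (q s) x + local_poly K k (q s) x * flux_g m c K e (u s) (q s) x -
        (nonlin c (local_poly K k (u s) x) * local_poly K k (q s) x) * ntrace c (outward_normal K e) x)"
    proof (rule set_lebesgue_integral_cong)
      show "e \<in> sets surface_measure" using compact_imp_closed[OF face(1)[OF e]] by auto
      have "R s x = local_poly K k (u s) x * flux_dgq m c K e (u s) (q s) x + local_poly K k (q s) x * flux_g m c K e (u s) (q s) x -
        (nonlin c (local_poly K k (u s) x) * local_poly K k (q s) x) * ntrace c (outward_normal K e) x" if "x \<in> e" for x
      proof -
        have "x \<in> K" using face(2)[OF e] that by auto
        then show ?thesis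
          by (simp add: R_def flux_dgq_def flux_g_def inner_trace_local_poly[OF uq_dg(1)[OF s]]
              inner_trace_local_poly[OF uq_dg(2)[OF s]] algebra_simps)
      qed
      then show "\<forall>x. x \<in> e \<longrightarrow> R s x = local_poly K k (u s) x * flux_dgq m c K e (u s) (q s) x + local_poly K k (q s) x * flux_g m c K e (u s) (q s) x -
        (nonlin c (local_poly K k (u s) x) * local_poly K k (q s) x) * ntrace c (outward_normal K e) x" by blast
    qed
    then show ?thesis
      using set_integral_diff(2)[OF set_integral_add(1)[OF F1(1)[OF s] F2(1)[OF s]] F3(1)[OF s]]
        set_integral_add(2)[OF F1(1)[OF s] F2(1)[OF s]] by simp
  qed
  show "s \<in> I \<Longrightarrow> (LINT x:e|surface_measure. R s x) =
      (LINT x:e|surface_measure. local_poly K k (u s) x * flux_dgq m c K e (u s) (q s) x) +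
      (LINT x:e|surface_measure. local_poly K k (q s) x * flux_g m c K e (u s) (q s) x) -
      (LINT x:e|surface_measure. (nonlin c (local_poly K k (u s) x) * local_poly K k (q s) x) * ntrace c (outward_normal K e) x)"
    by (rule eq)
  have "continuous_on I (\<lambda>s. (LINT x:e|surface_measure. local_poly K k (u s) x * flux_dgq m c K e (u s) (q s) x) +
      (LINT x:e|surface_measure. local_poly K k (q s) x * flux_g m c K e (u s) (q s) x) -
      (LINT x:e|surface_measure. (nonlin c (local_poly K k (u s) x) * local_poly K k (q s) x) * ntrace c (outward_normal K e) x))"
    by (intro continuous_on_add continuous_on_diff F1 F2 F3)
  then show "continuous_on I (\<lambda>s. LINT x:e|surface_measure. R s x)"
    by (rule continuous_on_cong[THEN iffD1, rotated 2]) (simp_all only: eq)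
qed

text \<open>Testing the equation for \<open>q\<close> with \<open>q\<close> itself turns \<open>2 b\<close> plus the energy of \<open>q\<close> into
  boundary terms, because Green's formula applies to \<open>g u * q\<close> and \<open>div \<sigma> = 0\<close>.\<close>

lemma energy_identity:
  assumes s: "s \<in> I"
    and scheme: "\<And>\<psi>. \<psi> \<in> dg_space m k \<Longrightarrow> (LINT x:K|lebesgue. \<psi> x * q s x) =
        - (LINT x:K|lebesgue. (grad \<psi> x \<bullet> field c x) * nonlin c (u s x)) +
        (\<Sum>e\<in>faces m K. LINT x:e|surface_measure. inner_trace K \<psi> x * flux_g m c K e (u s) (q s) x)"
  shows "2 * b_form m c K (u s) (q s) (u s) + L2_inner K (q s) (q s) =
    (\<Sum>e\<in>faces m K. LINT x:e|surface_measure. ntrace c (outward_normal K e) x *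
       (inner_trace K (u s) x * reduced_flux_dgq m c K e (u s) (q s) x +
        inner_trace K (q s) x * reduced_flux_g m c K e (u s) (q s) x -
        nonlin c (inner_trace K (u s) x) * inner_trace K (q s) x))"
proof -
  define P where "P = local_poly K k (u s)"
  define Q where "Q = local_poly K k (q s)"
  note ud = uq_dg(1)[OF s] and qd = uq_dg(2)[OF s]
  have PI: "u s x = P x" and QI: "q s x = Q x" if "x \<in> interior K" for x
    using local_poly_interior[OF ud that] local_poly_interior[OF qd that] by (auto simp: P_def Q_def)
  have PC: "C_k 1 P" and QC: "C_k 1 Q" and QV: "Q \<in> poly_space k"
    unfolding P_def Q_def by (rule C_k_1_poly_space[OF local_poly] local_poly)+
  have gradP: "grad (u s) x = grad P x" if "x \<in> interior K" for x
    by (rule grad_cong_open[OF open_interior that PI])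
  \<comment> \<open>\<open>V1\<close> stems from the form \<open>b\<close> and \<open>V2\<close>
    from the equation for \<open>q\<close>; by the product rule they add up to the integral of the
    gradient of \<open>g(P) * Q\<close> against the field.\<close>
  define V1 where "V1 = (LINT x:K|lebesgue. (grad P x \<bullet> field c x) * (deriv (nonlin c) (P x) * Q x))"
  define V2 where "V2 = (LINT x:K|lebesgue. (grad Q x \<bullet> field c x) * nonlin c (P x))"
  have V1': "(LINT x:K|lebesgue. (grad (u s) x \<bullet> field c x) * deriv (nonlin c) (u s x) * q s x) = V1"
    unfolding V1_def by (rule LINT_cong_interior[OF negligible_frontier_K]) (simp add: PI QI gradP)
  have V2': "(LINT x:K|lebesgue. (grad Q x \<bullet> field c x) * nonlin c (u s x)) = V2"
    unfolding V2_def by (rule LINT_cong_interior[OF negligible_frontier_K]) (simp add: PI)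
  have Vint: "set_integrable lebesgue K (\<lambda>x. (grad P x \<bullet> field c x) * (deriv (nonlin c) (P x) * Q x))"
    "set_integrable lebesgue K (\<lambda>x. (grad Q x \<bullet> field c x) * nonlin c (P x))"
    using volume_integral(1)[OF PC deriv_nonlin_local_poly_continuous s]
      volume_integral(1)[OF QC nonlin_local_poly_continuous s] by (simp_all add: P_def Q_def)
  define F1 where "F1 e = (LINT x:e|surface_measure. P x * flux_dgq m c K e (u s) (q s) x)" for e
  define F2 where "F2 e = (LINT x:e|surface_measure. Q x * flux_g m c K e (u s) (q s) x)" for e
  define F3 where "F3 e = (LINT x:e|surface_measure. (nonlin c (P x) * Q x) * ntrace c (outward_normal K e) x)" for e
  have "C_k 1 (\<lambda>x. nonlin c (P x) * Q x)" by (rule C_k_1_mult[OF C_k_1_compose[OF nonlin_C2 PC] QC])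
  then have "(LINT x:K|lebesgue. grad (\<lambda>x. nonlin c (P x) * Q x) x \<bullet> field c x) = (\<Sum>e\<in>faces m K. F3 e)"
    using c K unfolding structural_assumption_def has_normal_trace_def F3_def by blast
  moreover have "(LINT x:K|lebesgue. grad (\<lambda>x. nonlin c (P x) * Q x) x \<bullet> field c x) = V1 + V2"
  proof -
    have "grad (\<lambda>x. nonlin c (P x) * Q x) x \<bullet> field c x =
        (grad P x \<bullet> field c x) * (deriv (nonlin c) (P x) * Q x) + (grad Q x \<bullet> field c x) * nonlin c (P x)" for x
      unfolding grad_compose_mult[OF nonlin_C2 PC QC] by (simp add: inner_add_left algebra_simps)
    then show ?thesis unfolding V1_def V2_def using set_integral_add(2)[OF Vint] by simp
  qed
  ultimately have green: "V1 + V2 = (\<Sum>e\<in>faces m K. F3 e)" by simp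
  have tr: "(LINT x:e|surface_measure. inner_trace K w x * f x) = (LINT x:e|surface_measure. p x * f x)"
    if e: "e \<in> faces m K" and w: "\<And>x. x \<in> K \<Longrightarrow> inner_trace K w x = p x" for e w p f
    by (rule set_lebesgue_integral_cong) (use face(2)[OF e] face_sets[OF e] w in \<open>auto simp del: One_nat_def\<close>)
  have traceQ: "inner_trace K Q x = Q x" if "x \<in> K" for x
    by (rule inner_trace_continuous[OF that]) (auto simp: Q_def continuous_local_poly)
  have b: "2 * b_form m c K (u s) (q s) (u s) = - V1 + (\<Sum>e\<in>faces m K. F1 e)"
    unfolding b_form_def V1' F1_def P_def
    using tr[OF _ inner_trace_local_poly[OF ud]] by simp
  \<comment> \<open>The scheme is tested with the polynomial \<open>Q\<close>, which agrees with
    \<open>q s\<close> inside \<open>K\<close>; elsewhere its values do not enter the equation on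
    \<open>K\<close>.\<close>
  have "(LINT x:K|lebesgue. Q x * q s x) = - V2 + (\<Sum>e\<in>faces m K. F2 e)"
    unfolding scheme[OF poly_space_dg_space[OF QV]] V2' F2_def using tr[OF _ traceQ] by simp
  moreover have "(LINT x:K|lebesgue. Q x * q s x) = L2_inner K (q s) (q s)"
    unfolding L2_inner_def by (rule LINT_cong_interior[OF negligible_frontier_K]) (simp add: QI)
  ultimately have qq: "L2_inner K (q s) (q s) = - V2 + (\<Sum>e\<in>faces m K. F2 e)" by simp
  have "2 * b_form m c K (u s) (q s) (u s) + L2_inner K (q s) (q s) = (\<Sum>e\<in>faces m K. F1 e + F2 e - F3 e)"
    unfolding b qq using green by (simp add: sum.distrib sum_subtractf)
  also have "\<dots> = (\<Sum>e\<in>faces m K. LINT x:e|surface_measure. ntrace c (outward_normal K e) x *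
       (inner_trace K (u s) x * reduced_flux_dgq m c K e (u s) (q s) x +
        inner_trace K (q s) x * reduced_flux_g m c K e (u s) (q s) x -
        nonlin c (inner_trace K (u s) x) * inner_trace K (q s) x))"
    unfolding F1_def F2_def F3_def P_def Q_def using face_term(1)[OF _ s] by (intro sum.cong) simp_all
  finally show ?thesis .
qed

end

end

section \<open>Broken polynomial processes\<close>

lemma LINT_Icc_sum:
  fixes f :: "'i \<Rightarrow> real \<Rightarrow> real"
  assumes "finite A" and f: "\<And>i. i \<in> A \<Longrightarrow> continuous_on {a..b} (f i)"
  shows "(LINT s:{a..b}|lborel. (\<Sum>i\<in>A. c i * f i s)) = (\<Sum>i\<in>A. c i * (LINT s:{a..b}|lborel. f i s))"
proof -
  have "continuous_on {a..b} (\<lambda>s. \<Sum>i\<in>A. c i * f i s)" by (intro continuous_intros f)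
  from LINT_atLeastAtMost_eq_integral[OF this]
  have "(LINT s:{a..b}|lborel. (\<Sum>i\<in>A. c i * f i s)) = integral {a..b} (\<lambda>s. \<Sum>i\<in>A. c i * f i s)" .
  also have "\<dots> = (\<Sum>i\<in>A. integral {a..b} (\<lambda>s. c i * f i s))"
    using assms by (intro integral_sum integrable_continuous_real continuous_intros) auto
  also have "\<dots> = (\<Sum>i\<in>A. c i * integral {a..b} (f i))" by simp
  also have "\<dots> = (\<Sum>i\<in>A. c i * (LINT s:{a..b}|lborel. f i s))"
    using LINT_atLeastAtMost_eq_integral[OF f] by simp
  finally show ?thesis .
qed

lemma indefinite_LINT_continuous:
  fixes f :: "real \<Rightarrow> real"
  assumes f: "continuous_on {0..<\<tau>} f"
  shows "continuous_on {0..<\<tau>} (\<lambda>t. LINT s:{0..t}|lborel. f s)"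
  unfolding continuous_on_def
proof
  fix t assume t: "t \<in> {0..<\<tau>}"
  \<comment> \<open>A compact interval reaching beyond \<open>t\<close> but staying below
    \<open>\<tau>\<close>, so that continuity of indefinite integrals on compact intervals applies
    near \<open>t\<close>.\<close>
  then obtain t1 where t1: "t < t1" "t1 < \<tau>" using dense[of t \<tau>] by auto
  have f1: "continuous_on {0..t1} f" by (rule continuous_on_subset[OF f]) (use t1 in auto)
  have c1: "continuous_on {0..t1} (\<lambda>t. integral {0..t} f)"
    by (rule indefinite_integral_continuous_1[OF integrable_continuous_real[OF f1]])
  have eq: "integral {0..r} f = (LINT s:{0..r}|lborel. f s)" if "r \<in> {0..t1}" for r
    by (rule LINT_atLeastAtMost_eq_integral[OF continuous_on_subset[OF f1], symmetric]) (use that in auto)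
  have "continuous_on {0..t1} (\<lambda>t. LINT s:{0..t}|lborel. f s)"
    by (rule continuous_on_eq[OF c1 eq])
  then have "((\<lambda>t. LINT s:{0..t}|lborel. f s) \<longlongrightarrow> (LINT s:{0..t}|lborel. f s)) (at t within {0..t1})"
    using t t1 by (auto simp: continuous_on_def)
  moreover have "at t within {0..<\<tau>} = at t within {0..t1}"
    by (rule at_within_nhd[of t "{..<t1}"]) (use t1 in auto)
  ultimately show "((\<lambda>t. LINT s:{0..t}|lborel. f s) \<longlongrightarrow> (LINT s:{0..t}|lborel. f s)) (at t within {0..<\<tau>})"
    by simp
qed

lemma dg_space_diff:
  assumes "v \<in> dg_space m k" "w \<in> dg_space m k"
  shows "(\<lambda>x. v x - w x) \<in> dg_space m k"
  unfolding dg_space_def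
proof (intro CollectI ballI)
  fix K assume "K \<in> elems m"
  then obtain p r where "p \<in> poly_space k" "\<forall>x\<in>interior K. v x = p x"
    "r \<in> poly_space k" "\<forall>x\<in>interior K. w x = r x"
    using assms unfolding dg_space_def by blast
  then show "\<exists>p\<in>poly_space k. \<forall>x\<in>interior K. v x - w x = p x"
    using poly_space_lincomb[of p k r 1 "- 1"] by (intro bexI[of _ "\<lambda>x. 1 * p x + - 1 * r x"]) auto
qed

context dg_element
begin

lemma coord_diff:
  assumes v: "v \<in> dg_space m k" and w: "w \<in> dg_space m k" and i: "i < basis_size K k"
  shows "coord K k i (\<lambda>x. v x - w x) = coord K k i v - coord K k i w"
proof -
  have "coord K k i (\<lambda>x. v x - w x) = coord K k i (\<lambda>x. 1 * local_poly K k v x + - 1 * local_poly K k w x)"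
    by (rule coord_cong) (simp add: local_poly_interior[OF v] local_poly_interior[OF w])
  also have "\<dots> = coord K k i (local_poly K k v) - coord K k i (local_poly K k w)"
    unfolding coord_def
    using L2_inner_add_scale_right[OF compact_K continuous_basis_fun[OF i] continuous_local_poly continuous_local_poly, of 1 v "- 1" w]
    by simp
  also have "coord K k i (local_poly K k v) = coord K k i v"
    by (rule coord_cong[symmetric]) (simp add: local_poly_interior[OF v])
  also have "coord K k i (local_poly K k w) = coord K k i w"
    by (rule coord_cong[symmetric]) (simp add: local_poly_interior[OF w])
  finally show ?thesis .
qed

lemma AE_not_frontier: "AE x in lebesgue. x \<notin> frontier K"
  by (rule AE_not_in) (use negligible_frontier_K in \<open>simp add: negligible_iff_null_sets\<close>)

lemma square_integrable_on_element:
  assumes w: "w \<in> dg_space m k"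
  shows "set_integrable lebesgue K (\<lambda>x. (w x)\<^sup>2)"
proof -
  have int: "set_integrable lebesgue K (\<lambda>x. (local_poly K k w x)\<^sup>2)"
    by (intro set_integrable_lebesgue_continuous compact_K continuous_on_power continuous_local_poly)
  have ae: "AE x in lebesgue. indicator K x *\<^sub>R (local_poly K k w x)\<^sup>2 = indicator K x *\<^sub>R (w x)\<^sup>2"
    using AE_not_frontier
  proof eventually_elim
    case (elim x)
    then have "x \<notin> K \<or> x \<in> interior K" using closure_subset by (auto simp: frontier_def)
    then show ?case using local_poly_interior[OF w] by auto
  qed
  note int' = int[unfolded set_integrable_def]
  show ?thesis
    unfolding set_integrable_def
    by (rule integrable_cong_AE_imp[OF int' borel_measurable_AE[OF borel_measurable_integrable[OF int'] ae] ae])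
qed

lemma interior_subset_dom:
  assumes "polyhedral_domain (dom m)"
  shows "interior K \<subseteq> dom m"
proof -
  have "K \<subseteq> closure (dom m)" using mesh K by (auto simp: conforming_mesh_def)
  then have "interior K \<subseteq> interior (closure (dom m))" by (rule interior_mono)
  then show ?thesis using assms by (simp add: polyhedral_domain_def)
qed

end

lemma square_integrable_on_dom:
  assumes mesh: "conforming_mesh m" and D: "polyhedral_domain (dom m)" and w: "w \<in> dg_space m k"
  shows "set_integrable lebesgue (dom m) (\<lambda>x. (w x)\<^sup>2)"
proof (rule set_integrable_subset)
  have el: "dg_element m K" if "K \<in> elems m" for K by standard (rule mesh, rule that)
  show "set_integrable lebesgue (\<Union>K\<in>elems m. K) (\<lambda>x. (w x)\<^sup>2)"
  proof (rule set_integrable_UN)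
    show "finite (elems m)" using mesh by (simp add: conforming_mesh_def)
    show "set_integrable lebesgue K (\<lambda>x. (w x)\<^sup>2)" if "K \<in> elems m" for K
      by (rule dg_element.square_integrable_on_element[OF el[OF that] w])
    show "K \<in> sets lebesgue" if "K \<in> elems m" for K
      using compact_imp_closed[OF dg_element.compact_K[OF el[OF that]]] by auto
  qed
  have "dom m = interior (closure (dom m))" using D by (simp add: polyhedral_domain_def)
  then have "open (dom m)" by (metis open_interior)
  then show "dom m \<in> sets lebesgue" by auto
  show "dom m \<subseteq> (\<Union>K\<in>elems m. K)" using mesh closure_subset by (auto simp: conforming_mesh_def)
qed

lemma (in dg_element) L2_inner_le_dom:
  assumes D: "polyhedral_domain (dom m)" and w: "w \<in> dg_space m k"
  shows "L2_inner K w w \<le> (LINT x:dom m|lebesgue. (w x)\<^sup>2)"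
proof -
  have "(LINT x:K|lebesgue. (w x)\<^sup>2) \<le> (LINT x:dom m|lebesgue. (w x)\<^sup>2)"
    unfolding set_lebesgue_integral_def
  proof (rule integral_mono_AE)
    show "AE x in lebesgue. indicator K x *\<^sub>R (w x)\<^sup>2 \<le> indicator (dom m) x *\<^sub>R (w x)\<^sup>2"
      using AE_not_frontier
    proof eventually_elim
      case (elim x)
      then have "x \<notin> K \<or> x \<in> interior K" using closure_subset by (auto simp: frontier_def)
      then have "x \<notin> K \<or> x \<in> dom m" using interior_subset_dom[OF D] by blast
      then show ?case by (auto simp: indicator_def)
    qed
  qed (use square_integrable_on_element[OF w] square_integrable_on_dom[OF mesh D w] in \<open>simp_all add: set_integrable_def\<close>)
  then show ?thesis by (simp add: L2_inner_def power2_eq_square)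
qed

text \<open>By Parseval a coordinate difference is at most the L2 norm on \<open>K\<close>, which is
  at most the norm on the whole domain, since \<open>K\<close> lies in the domain up to a null
  set.\<close>

lemma dg_process_elementwise_continuous:
  assumes mesh: "conforming_mesh m" and D: "polyhedral_domain (dom m)" and v: "dg_process M T F \<tau> m k v"
  shows "AE \<omega> in M. elementwise_continuous m k {0..<\<tau> \<omega>} (\<lambda>s. v s \<omega>)"
proof -
  have dg: "\<And>\<omega> t. \<omega> \<in> space M \<Longrightarrow> t \<in> {0..<\<tau> \<omega>} \<Longrightarrow> v t \<omega> \<in> dg_space m k"
    and "AE \<omega> in M. \<forall>s\<in>{0..<\<tau> \<omega>}.
        ((\<lambda>t. LINT x:dom m|lebesgue. (v t \<omega> x - v s \<omega> x)\<^sup>2) \<longlongrightarrow> 0) (at s within {0..<\<tau> \<omega>})"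
    using v by (auto simp: dg_process_def)
  from this(2) show ?thesis
    using AE_space
  proof eventually_elim
    case (elim \<omega>)
    show ?case
      unfolding elementwise_continuous_def
    proof (intro conjI ballI allI impI)
      show "v s \<omega> \<in> dg_space m k" if "s \<in> {0..<\<tau> \<omega>}" for s using dg[OF elim(2) that] .
      fix K i assume K: "K \<in> elems m" and i: "i < basis_size K k"
      interpret dg_element m K k by standard (rule mesh, rule K)
      show "continuous_on {0..<\<tau> \<omega>} (\<lambda>s. coord K k i (v s \<omega>))"
        unfolding continuous_on_def
      proof
        fix s assume s: "s \<in> {0..<\<tau> \<omega>}"
        let ?n = "\<lambda>t. LINT x:dom m|lebesgue. (v t \<omega> x - v s \<omega> x)\<^sup>2"
        have le: "norm (coord K k i (v t \<omega>) - coord K k i (v s \<omega>)) \<le> sqrt (?n t)" if t: "t \<in> {0..<\<tau> \<omega>}" for t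
        proof -
          let ?w = "\<lambda>x. v t \<omega> x - v s \<omega> x"
          have w: "?w \<in> dg_space m k" by (rule dg_space_diff[OF dg[OF elim(2) t] dg[OF elim(2) s]])
          have "(coord K k i ?w)\<^sup>2 \<le> (\<Sum>j<basis_size K k. (coord K k j ?w)\<^sup>2)"
            using i by (intro member_le_sum) auto
          also have "\<dots> = L2_inner K ?w ?w" using L2_inner_dg[OF w w] by (simp add: power2_eq_square)
          also have "\<dots> \<le> ?n t" by (rule L2_inner_le_dom[OF D w])
          finally have "\<bar>coord K k i ?w\<bar> \<le> sqrt (?n t)" by (simp add: real_le_rsqrt)
          then show ?thesis using coord_diff[OF dg[OF elim(2) t] dg[OF elim(2) s] i] by simp
        qed
        have "((\<lambda>t. sqrt (?n t)) \<longlongrightarrow> sqrt 0) (at s within {0..<\<tau> \<omega>})"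
          using elim(1) s by (intro tendsto_real_sqrt) blast
        then have lim: "((\<lambda>t. sqrt (?n t)) \<longlongrightarrow> 0) (at s within {0..<\<tau> \<omega>})" by simp
        have "\<forall>\<^sub>F t in at s within {0..<\<tau> \<omega>}. norm (coord K k i (v t \<omega>) - coord K k i (v s \<omega>)) \<le> sqrt (?n t)"
          unfolding eventually_at_filter by (rule always_eventually) (use le in blast)
        then have "((\<lambda>t. coord K k i (v t \<omega>) - coord K k i (v s \<omega>)) \<longlongrightarrow> 0) (at s within {0..<\<tau> \<omega>})"
          by (rule Lim_null_comparison[OF _ lim])
        then show "((\<lambda>s. coord K k i (v s \<omega>)) \<longlongrightarrow> coord K k i (v s \<omega>)) (at s within {0..<\<tau> \<omega>})"
          by (rule LIM_zero_cancel)
      qed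
    qed
  qed
qed

text \<open>Measurability is known for pairings over the whole domain. The basis function extended
  by zero is an admissible test function because interiors of distinct elements are disjoint, and
  pairing with it gives the coordinate.\<close>

lemma (in dg_element) coord_measurable:
  assumes D: "polyhedral_domain (dom m)" and v: "dg_process M T F \<tau> m k v"
    and i: "i < basis_size K k" and t: "t \<in> {0..T}"
  shows "(\<lambda>\<omega>. if t < \<tau> \<omega> then coord K k i (v t \<omega>) else 0) \<in> borel_measurable (F t)"
proof -
  define \<phi> where "\<phi> x = (if x \<in> interior K then basis_fun K k i x else 0)" for x
  have "\<phi> \<in> dg_space m k"
    unfolding dg_space_def
  proof (intro CollectI ballI)
    fix K' assume K': "K' \<in> elems m"
    show "\<exists>p\<in>poly_space k. \<forall>x\<in>interior K'. \<phi> x = p x"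
    proof (cases "K' = K")
      case True
      then show ?thesis using basis_fun[OF i] by (intro bexI[of _ "basis_fun K k i"]) (auto simp: \<phi>_def)
    next
      case False
      then have "interior K \<inter> interior K' = {}" using mesh K K' by (auto simp: conforming_mesh_def)
      then show ?thesis using poly_space_0 by (intro bexI[of _ "\<lambda>_. 0"]) (auto simp: \<phi>_def)
    qed
  qed
  then have meas: "(\<lambda>\<omega>. if t < \<tau> \<omega> then LINT x:dom m|lebesgue. \<phi> x * v t \<omega> x else 0) \<in> borel_measurable (F t)"
    using v t by (auto simp: dg_process_def)
  have eq: "(LINT x:dom m|lebesgue. \<phi> x * w x) = coord K k i w" for w
  proof -
    have "indicator (dom m) x *\<^sub>R (\<phi> x * w x) = indicator K x *\<^sub>R (\<phi> x * w x)" for x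
      using interior_subset_dom[OF D] interior_subset[of K] by (auto simp: \<phi>_def indicator_def)
    then have "(LINT x:dom m|lebesgue. \<phi> x * w x) = (LINT x:K|lebesgue. \<phi> x * w x)"
      unfolding set_lebesgue_integral_def by (simp only:)
    also have "\<dots> = (LINT x:K|lebesgue. basis_fun K k i x * w x)"
      by (rule LINT_cong_interior[OF negligible_frontier_K]) (simp add: \<phi>_def)
    finally show ?thesis by (simp add: coord_def L2_inner_def)
  qed
  from meas show ?thesis unfolding eq .
qed

section \<open>Versions and uniqueness of the covariation\<close>

context filtered_prob_space
begin

text \<open>Convergence in probability includes measurability of the events; for the modified limit
  it comes from completeness.\<close>

lemma tendsto_in_prob_cong_AE:
  assumes XY: "tendsto_in_prob_on M E X Y" and E: "E \<in> events"
    and eq: "AE \<omega> in M. \<omega> \<in> E \<longrightarrow> Y \<omega> = Y' \<omega>"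
  shows "tendsto_in_prob_on M E X Y'"
  unfolding tendsto_in_prob_on_def
proof (intro allI impI)
  fix \<epsilon> :: real assume \<epsilon>: "\<epsilon> > 0"
  let ?A = "\<lambda>j. {\<omega>\<in>E. \<epsilon> < \<bar>X j \<omega> - Y \<omega>\<bar>}" and ?A' = "\<lambda>j. {\<omega>\<in>E. \<epsilon> < \<bar>X j \<omega> - Y' \<omega>\<bar>}"
  have A: "?A j \<in> events" "(\<lambda>j. prob (?A j)) \<longlonglongrightarrow> 0" for j
    using XY \<epsilon> by (auto simp: tendsto_in_prob_on_def)
  have ae: "AE \<omega> in M. \<omega> \<in> ?A j \<longleftrightarrow> \<omega> \<in> ?A' j" for j
    using eq by eventually_elim auto
  have A': "?A' j \<in> events" for j
    by (rule measurable_set_AE_eq[OF A(1)[of j] ae]) (use sets.sets_into_space[OF E] in auto)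
  moreover have "prob (?A' j) = prob (?A j)" for j
  proof (rule measure_eq_AE[OF _ A' A(1)])
    show "AE \<omega> in M. \<omega> \<in> ?A' j \<longleftrightarrow> \<omega> \<in> ?A j"
      using ae[of j] by eventually_elim blast
  qed
  ultimately show "(\<forall>j. ?A' j \<in> events) \<and> (\<lambda>j. prob (?A' j)) \<longlonglongrightarrow> 0" using A(2) by simp
qed

lemma has_covariation_cong_AE:
  assumes XY: "has_covariation M T \<tau> X Y A" and \<tau>: "stopping_time_upto M T F \<tau>"
    and eq: "AE \<omega> in M. \<forall>t\<in>{0..<\<tau> \<omega>}. A t \<omega> = A' t \<omega>"
  shows "has_covariation M T \<tau> X Y A'"
  unfolding has_covariation_def
proof (intro ballI allI impI)
  fix t N p assume t: "t \<in> {0..T}" and P: "partition_sequence t N p"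
  show "tendsto_in_prob_on M {\<omega>\<in>space M. t < \<tau> \<omega>}
      (\<lambda>j \<omega>. \<Sum>i<N j. (X (p j (Suc i)) \<omega> - X (p j i) \<omega>) * (Y (p j (Suc i)) \<omega> - Y (p j i) \<omega>)) (A' t)"
  proof (rule tendsto_in_prob_cong_AE[OF _ stopping_time_less_event[OF \<tau> t]])
    show "AE \<omega> in M. \<omega> \<in> {\<omega>\<in>space M. t < \<tau> \<omega>} \<longrightarrow> A t \<omega> = A' t \<omega>"
      using eq by eventually_elim (use t in auto)
  qed (use XY t P in \<open>auto simp: has_covariation_def\<close>)
qed

lemma has_covariation_unique:
  assumes "has_covariation M T \<tau> X Y A" "has_covariation M T \<tau> X Y A'" and t: "t \<in> {0..T}"
  shows "AE \<omega> in M. t < \<tau> \<omega> \<longrightarrow> A t \<omega> = A' t \<omega>"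
proof -
  have P: "partition_sequence t (\<lambda>j. Suc j) (\<lambda>j i. t * real i / real (Suc j))"
    by (rule uniform_partition_sequence) (use t in simp)
  have "AE \<omega> in M. \<omega> \<in> {\<omega>\<in>space M. t < \<tau> \<omega>} \<longrightarrow> A t \<omega> = A' t \<omega>"
    using assms P unfolding has_covariation_def by (intro tendsto_in_prob_unique) blast+
  then show ?thesis using AE_space by eventually_elim auto
qed

text \<open>Fubini for rational times, then continuity in time.\<close>

lemma covariation_field_unique:
  fixes A A' :: "real \<Rightarrow> 'w \<Rightarrow> 'b::euclidean_space \<Rightarrow> real"
  assumes A: "covariation_field M T \<tau> S X Y A" and A': "covariation_field M T \<tau> S X Y A'"
    and \<tau>: "stopping_time_upto M T F \<tau>" and S: "open S"
  shows "AE \<omega> in M. AE x in lborel. x \<in> S \<longrightarrow> (\<forall>t\<in>{0..<\<tau> \<omega>}. A t \<omega> x = A' t \<omega> x)"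
proof -
  define R where "R = restrict_space (lborel :: 'b measure) S"
  have spR: "space R = S" by (simp add: R_def space_restrict_space)
  have sf: "sigma_finite_measure R"
    unfolding R_def by (rule sigma_finite_measure_restrict_space) (use S in \<open>auto simp: lborel.sigma_finite_measure_axioms\<close>)
  interpret R: sigma_finite_measure R by (rule sf)
  interpret pair_sigma_finite M R ..
  \<comment> \<open>At each \<open>x\<close> the two versions agree outside a null set that depends
    on \<open>x\<close>. Joint measurability allows the two quantifiers to be exchanged.\<close>
  have one: "AE \<omega> in M. AE x in R. t < \<tau> \<omega> \<longrightarrow> A t \<omega> x = A' t \<omega> x" if t: "t \<in> {0..T}" for t
  proof (rule AE_commute[THEN iffD2])
    define f where "f = (\<lambda>(\<omega>, x). if t < \<tau> \<omega> then A t \<omega> x else 0)"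
    define g where "g = (\<lambda>(\<omega>, x). if t < \<tau> \<omega> then A' t \<omega> x else 0)"
    have f: "f \<in> borel_measurable (M \<Otimes>\<^sub>M R)" and g: "g \<in> borel_measurable (M \<Otimes>\<^sub>M R)"
      using A A' t by (simp_all add: covariation_field_def R_def f_def g_def)
    have "{p \<in> space (M \<Otimes>\<^sub>M R). f p = g p} \<in> sets (M \<Otimes>\<^sub>M R)"
      using f g by (rule borel_measurable_eq)
    moreover have "{p \<in> space (M \<Otimes>\<^sub>M R). f p = g p} =
        {p \<in> space (M \<Otimes>\<^sub>M R). t < \<tau> (fst p) \<longrightarrow> A t (fst p) (snd p) = A' t (fst p) (snd p)}"
      by (auto simp: f_def g_def)
    ultimately show "{p \<in> space (M \<Otimes>\<^sub>M R). t < \<tau> (fst p) \<longrightarrow> A t (fst p) (snd p) = A' t (fst p) (snd p)} \<in> sets (M \<Otimes>\<^sub>M R)"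
      by simp
    show "AE x in R. AE \<omega> in M. t < \<tau> \<omega> \<longrightarrow> A t \<omega> x = A' t \<omega> x"
    proof (rule AE_I2)
      fix x assume "x \<in> space R"
      then have x: "x \<in> S" by (simp add: spR)
      show "AE \<omega> in M. t < \<tau> \<omega> \<longrightarrow> A t \<omega> x = A' t \<omega> x"
        using A A' x
        by (intro has_covariation_unique[where X = "\<lambda>t \<omega>. X t \<omega> x" and Y = "\<lambda>t \<omega>. Y t \<omega> x", OF _ _ t])
          (auto simp: covariation_field_def)
    qed
  qed
  have "AE \<omega> in M. \<forall>t\<in>\<rat> \<inter> {0..T}. AE x in R. t < \<tau> \<omega> \<longrightarrow> A t \<omega> x = A' t \<omega> x"
    using one by (subst AE_ball_countable) (auto intro: countable_subset[OF _ countable_rat])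
  moreover have "AE \<omega> in M. \<forall>x\<in>S. continuous_on {0..<\<tau> \<omega>} (\<lambda>t. A t \<omega> x)"
    "AE \<omega> in M. \<forall>x\<in>S. continuous_on {0..<\<tau> \<omega>} (\<lambda>t. A' t \<omega> x)"
    using A A' by (auto simp: covariation_field_def)
  ultimately show ?thesis
    using AE_space
  proof eventually_elim
    case (elim \<omega>)
    have \<tau>T: "\<tau> \<omega> \<le> T" using \<tau> elim(4) by (auto simp: stopping_time_upto_def)
    have "AE x in R. \<forall>t\<in>\<rat> \<inter> {0..T}. t < \<tau> \<omega> \<longrightarrow> A t \<omega> x = A' t \<omega> x"
      using elim(1) by (subst AE_ball_countable) (auto intro: countable_subset[OF _ countable_rat])
    then have "AE x in lborel. x \<in> S \<longrightarrow> (\<forall>t\<in>\<rat> \<inter> {0..T}. t < \<tau> \<omega> \<longrightarrow> A t \<omega> x = A' t \<omega> x)"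
      unfolding R_def using S by (subst (asm) AE_restrict_space_iff) auto
    then show ?case
    proof eventually_elim
      case x: (elim x)
      show ?case
      proof (intro impI ballI)
        fix t assume xS: "x \<in> S" and t: "t \<in> {0..<\<tau> \<omega>}"
        \<comment> \<open>A right neighbourhood of \<open>t\<close> below \<open>\<tau>\<close>: its
          rational points have \<open>t\<close> in their closure, even for
          \<open>t = 0\<close>.\<close>
        obtain t1 where t1: "t < t1" "t1 < \<tau> \<omega>" using t dense[of t "\<tau> \<omega>"] by auto
        have sub: "{t..t1} \<subseteq> {0..<\<tau> \<omega>}" using t t1 by auto
        have "A t \<omega> x - A' t \<omega> x = 0"
        proof (rule continuous_constant_on_closure[where S = "{t<..<t1} \<inter> \<rat>" and f = "\<lambda>t. A t \<omega> x - A' t \<omega> x"])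
          show "continuous_on (closure ({t<..<t1} \<inter> \<rat>)) (\<lambda>t. A t \<omega> x - A' t \<omega> x)"
            unfolding closure_rationals_Ioo[OF t1(1)]
            using elim(2,3) xS sub by (intro continuous_on_diff continuous_on_subset[OF _ sub]) blast+
          show "A r \<omega> x - A' r \<omega> x = 0" if "r \<in> {t<..<t1} \<inter> \<rat>" for r
          proof -
            have "r \<in> \<rat> \<inter> {0..T}" "r < \<tau> \<omega>" using that t t1 \<tau>T by auto
            then show ?thesis using x xS by simp
          qed
        qed (use closure_rationals_Ioo[OF t1(1)] t1 in auto)
        then show "A t \<omega> x = A' t \<omega> x" by simp
      qed
    qed
  qed
qed

end

section \<open>The LDG solution on one element\<close>

locale ldg_element = filtered_prob_space M T F + dg_element m K k
  for M :: "'w measure" and T :: real and F :: "real \<Rightarrow> 'w measure"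
    and m :: "'a::euclidean_space dg_mesh" and K :: "'a set" and k :: nat +
  fixes L :: "'l set" and W :: "'l \<Rightarrow> real \<Rightarrow> 'w \<Rightarrow> real" and c :: "'l \<Rightarrow> 'a noise_coeff"
    and ubar :: "'a \<Rightarrow> real" and \<tau> :: "'w \<Rightarrow> real"
    and u :: "real \<Rightarrow> 'w \<Rightarrow> 'a \<Rightarrow> real" and q :: "'l \<Rightarrow> real \<Rightarrow> 'w \<Rightarrow> 'a \<Rightarrow> real"
  assumes finite_L: "finite L"
    and W: "\<And>l. l \<in> L \<Longrightarrow> wiener_process M T F (W l)" and ind: "independent_processes M T L W"
    and D: "polyhedral_domain (dom m)"
    and c: "\<And>l. l \<in> L \<Longrightarrow> structural_assumption m (c l)"
    and sol: "ldg_solution M T F L W m k c ubar \<tau> u q"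
begin

lemma \<tau>: "stopping_time_upto M T F \<tau>"
  using sol by (simp add: ldg_solution_def)

lemma u_process: "dg_process M T F \<tau> m k u" and q_process: "l \<in> L \<Longrightarrow> dg_process M T F \<tau> m k (q l)"
  using sol by (auto simp: ldg_solution_def)

lemma u_continuous: "AE \<omega> in M. elementwise_continuous m k {0..<\<tau> \<omega>} (\<lambda>s. u s \<omega>)"
  by (rule dg_process_elementwise_continuous[OF mesh D u_process])

lemma q_continuous: "AE \<omega> in M. \<forall>l\<in>L. elementwise_continuous m k {0..<\<tau> \<omega>} (\<lambda>s. q l s \<omega>)"
  by (intro AE_finite_allI finite_L dg_process_elementwise_continuous[OF mesh D q_process])

definition gram :: "'l \<Rightarrow> nat \<Rightarrow> nat \<Rightarrow> real \<Rightarrow> 'w \<Rightarrow> real" where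
  "gram l i j t \<omega> = (LINT s:{0..t}|lborel. coord K k i (q l s \<omega>) * coord K k j (q l s \<omega>))"

text \<open>An explicit version of the sum of the integrals of \<open>q l s x\<close> squared: space
  enters through basis functions, time and chance through finitely many scalars. Joint measurability
  is then immediate, and one null set serves for continuity at all \<open>x\<close>.\<close>

definition covar :: "real \<Rightarrow> 'w \<Rightarrow> 'a \<Rightarrow> real" where
  "covar t \<omega> x = (\<Sum>l\<in>L. \<Sum>i<basis_size K k. \<Sum>j<basis_size K k.
     (basis_fun K k i x * basis_fun K k j x) * gram l i j t \<omega>)"

lemma coord_q_continuous:
  assumes "elementwise_continuous m k I v" "J \<subseteq> I" "i < basis_size K k"
  shows "continuous_on J (\<lambda>s. coord K k i (v s))"
  by (rule continuous_on_subset[OF elementwise_continuousD(2)[OF assms(1) K assms(3)] assms(2)])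

lemma covar_eq:
  assumes q: "\<forall>l\<in>L. elementwise_continuous m k {0..<\<tau> \<omega>} (\<lambda>s. q l s \<omega>)"
    and t: "t \<in> {0..<\<tau> \<omega>}" and x: "x \<in> interior K"
  shows "(\<Sum>l\<in>L. LINT s:{0..t}|lborel. (LINT y:K|lebesgue. evaluation_poly x y * q l s \<omega> y)\<^sup>2) = covar t \<omega> x"
  unfolding covar_def
proof (rule sum.cong[OF refl])
  fix l assume l: "l \<in> L"
  let ?b = "\<lambda>i. basis_fun K k i x" and ?h = "\<lambda>i s. coord K k i (q l s \<omega>)" and ?n = "basis_size K k"
  have sub: "{0..t} \<subseteq> {0..<\<tau> \<omega>}" using t by auto
  have ql: "elementwise_continuous m k {0..<\<tau> \<omega>} (\<lambda>s. q l s \<omega>)" using q l by blast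
  have "(LINT y:K|lebesgue. evaluation_poly x y * q l s \<omega> y)\<^sup>2 =
      (\<Sum>p\<in>{..<?n} \<times> {..<?n}. (?b (fst p) * ?b (snd p)) * (?h (fst p) s * ?h (snd p) s))"
    if "s \<in> {0..t}" for s
  proof -
    have dg: "q l s \<omega> \<in> dg_space m k" using elementwise_continuousD(1)[OF ql] that sub by blast
    have "(LINT y:K|lebesgue. evaluation_poly x y * q l s \<omega> y) = (\<Sum>i<?n. ?h i s * ?b i)"
      unfolding L2_inner_evaluation_poly[OF dg x] local_poly_interior[OF dg x] by (simp add: local_poly_def)
    then have "(LINT y:K|lebesgue. evaluation_poly x y * q l s \<omega> y)\<^sup>2 =
        (\<Sum>i<?n. \<Sum>j<?n. (?h i s * ?b i) * (?h j s * ?b j))"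
      by (simp add: power2_eq_square sum_product)
    also have "\<dots> = (\<Sum>i<?n. \<Sum>j<?n. (?b i * ?b j) * (?h i s * ?h j s))"
      by (intro sum.cong refl) (simp only: mult_ac)
    finally show ?thesis by (simp add: sum.cartesian_product case_prod_beta)
  qed
  then have "(LINT s:{0..t}|lborel. (LINT y:K|lebesgue. evaluation_poly x y * q l s \<omega> y)\<^sup>2) =
      (LINT s:{0..t}|lborel. (\<Sum>p\<in>{..<?n} \<times> {..<?n}. (?b (fst p) * ?b (snd p)) * (?h (fst p) s * ?h (snd p) s)))"
    by (intro set_lebesgue_integral_cong) auto
  also have "\<dots> = (\<Sum>p\<in>{..<?n} \<times> {..<?n}. (?b (fst p) * ?b (snd p)) * (LINT s:{0..t}|lborel. ?h (fst p) s * ?h (snd p) s))"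
    by (rule LINT_Icc_sum) (auto intro!: continuous_on_mult coord_q_continuous[OF ql sub])
  also have "\<dots> = (\<Sum>i<?n. \<Sum>j<?n. (?b i * ?b j) * gram l i j t \<omega>)"
    by (simp add: gram_def sum.cartesian_product case_prod_beta)
  finally show "(LINT s:{0..t}|lborel. (LINT y:K|lebesgue. evaluation_poly x y * q l s \<omega> y)\<^sup>2) =
      (\<Sum>i<?n. \<Sum>j<?n. (?b i * ?b j) * gram l i j t \<omega>)" .
qed

lemma covariation_at:
  assumes x: "x \<in> interior K"
  shows "has_covariation M T \<tau> (\<lambda>t \<omega>. u t \<omega> x) (\<lambda>t \<omega>. u t \<omega> x) (\<lambda>t \<omega>. covar t \<omega> x)"
proof -
  let ?\<psi> = "evaluation_poly x"
  have \<psi>: "?\<psi> \<in> dg_space m k" by (rule poly_space_dg_space[OF evaluation_poly])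
  obtain I where ito: "\<And>l. l \<in> L \<Longrightarrow> ito_integral_on M T F \<tau> (W l) (\<lambda>s \<omega>. LINT y:K|lebesgue. ?\<psi> y * q l s \<omega> y) (I l)"
    and eq: "AE \<omega> in M. \<forall>t\<in>{0..<\<tau> \<omega>}.
           (LINT y:K|lebesgue. ?\<psi> y * u t \<omega> y) =
           (LINT y:K|lebesgue. ?\<psi> y * u 0 \<omega> y) +
           (LINT s:{0..t}|lborel. (\<Sum>l\<in>L. b_form m (c l) K (u s \<omega>) (q l s \<omega>) ?\<psi>)) -
           (\<Sum>l\<in>L. I l t \<omega>)"
  proof -
    have "\<forall>K\<in>elems m. \<forall>\<phi>\<in>dg_space m k. \<exists>I.
        (\<forall>l\<in>L. ito_integral_on M T F \<tau> (W l) (\<lambda>s \<omega>. LINT x:K|lebesgue. \<phi> x * q l s \<omega> x) (I l)) \<and>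
        (AE \<omega> in M. \<forall>t\<in>{0..<\<tau> \<omega>}.
           (LINT x:K|lebesgue. \<phi> x * u t \<omega> x) =
           (LINT x:K|lebesgue. \<phi> x * u 0 \<omega> x) +
           (LINT s:{0..t}|lborel. (\<Sum>l\<in>L. b_form m (c l) K (u s \<omega>) (q l s \<omega>) \<phi>)) -
           (\<Sum>l\<in>L. I l t \<omega>))"
      using sol unfolding ldg_solution_def by (elim conjE)
    from bspec[OF bspec[OF this K] \<psi>] show ?thesis using that by blast
  qed
  have "has_covariation M T \<tau> (\<lambda>t \<omega>. u t \<omega> x) (\<lambda>t \<omega>. u t \<omega> x)
    (\<lambda>t \<omega>. \<Sum>l\<in>L. LINT s:{0..t}|lborel. (LINT y:K|lebesgue. ?\<psi> y * q l s \<omega> y)\<^sup>2)"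
  proof (rule semimartingale_quadratic_variation[OF finite_L W ind \<tau> ito,
        where b = "\<lambda>s \<omega>. \<Sum>l\<in>L. b_form m (c l) K (u s \<omega>) (q l s \<omega>) ?\<psi>"])
    fix t assume t: "t \<in> {0..T}"
    have "(\<lambda>\<omega>. \<Sum>i<basis_size K k. (if t < \<tau> \<omega> then coord K k i (u t \<omega>) else 0) * basis_fun K k i x) \<in> borel_measurable M"
      using t by (intro borel_measurable_sum borel_measurable_times borel_measurable_const
          measurable_F_M[OF coord_measurable[OF D u_process]]) auto
    then show "(\<lambda>\<omega>. if t < \<tau> \<omega> then u t \<omega> x else 0) \<in> borel_measurable M"
    proof (rule measurable_cong[THEN iffD1, rotated])
      fix \<omega> assume \<omega>: "\<omega> \<in> space M"
      show "(\<Sum>i<basis_size K k. (if t < \<tau> \<omega> then coord K k i (u t \<omega>) else 0) * basis_fun K k i x) =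
          (if t < \<tau> \<omega> then u t \<omega> x else 0)"
      proof (cases "t < \<tau> \<omega>")
        case True
        then have "u t \<omega> \<in> dg_space m k" using u_process \<omega> t by (auto simp: dg_process_def)
        then show ?thesis using True local_poly_interior[OF _ x] by (simp add: local_poly_def)
      qed simp
    qed
  next
    show "AE \<omega> in M. continuous_on {0..<\<tau> \<omega>} (\<lambda>s. \<Sum>l\<in>L. b_form m (c l) K (u s \<omega>) (q l s \<omega>) ?\<psi>) \<and>
      (\<forall>t\<in>{0..<\<tau> \<omega>}. u t \<omega> x = u 0 \<omega> x +
        (LINT s:{0..t}|lborel. (\<Sum>l\<in>L. b_form m (c l) K (u s \<omega>) (q l s \<omega>) ?\<psi>)) - (\<Sum>l\<in>L. I l t \<omega>))"
      using u_continuous q_continuous eq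
    proof eventually_elim
      case (elim \<omega>)
      have "continuous_on {0..<\<tau> \<omega>} (\<lambda>s. b_form m (c l) K (u s \<omega>) (q l s \<omega>) ?\<psi>)" if "l \<in> L" for l
        using b_form_continuous[OF c[OF that] elim(1) _ evaluation_poly] elim(2) that by blast
      then have cont: "continuous_on {0..<\<tau> \<omega>} (\<lambda>s. \<Sum>l\<in>L. b_form m (c l) K (u s \<omega>) (q l s \<omega>) ?\<psi>)"
        by (rule continuous_on_sum)
      have ev: "(LINT y:K|lebesgue. ?\<psi> y * u t \<omega> y) = u t \<omega> x" if "t \<in> {0..<\<tau> \<omega>}" for t
        by (rule L2_inner_evaluation_poly[OF elementwise_continuousD(1)[OF elim(1) that] x])
      have "u t \<omega> x = u 0 \<omega> x +
        (LINT s:{0..t}|lborel. (\<Sum>l\<in>L. b_form m (c l) K (u s \<omega>) (q l s \<omega>) ?\<psi>)) - (\<Sum>l\<in>L. I l t \<omega>)"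
        if t: "t \<in> {0..<\<tau> \<omega>}" for t
      proof -
        have "0 \<in> {0..<\<tau> \<omega>}" using t by auto
        then show ?thesis using bspec[OF elim(3) t] ev[OF t] ev[of 0] by simp
      qed
      with cont show ?case by blast
    qed
  qed
  then show ?thesis
  proof (rule has_covariation_cong_AE[OF _ \<tau>])
    show "AE \<omega> in M. \<forall>t\<in>{0..<\<tau> \<omega>}.
        (\<Sum>l\<in>L. LINT s:{0..t}|lborel. (LINT y:K|lebesgue. ?\<psi> y * q l s \<omega> y)\<^sup>2) = covar t \<omega> x"
      using q_continuous
    proof eventually_elim
      case (elim \<omega>)
      show ?case using covar_eq[OF elim _ x] by blast
    qed
  qed
qed

lemma gram_measurable:
  assumes l: "l \<in> L" and ij: "i < basis_size K k" "j < basis_size K k" and t: "t \<in> {0..T}"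
  shows "(\<lambda>\<omega>. if t < \<tau> \<omega> then gram l i j t \<omega> else 0) \<in> borel_measurable M"
  unfolding gram_def
proof (rule measurable_time_integral[OF \<tau> t])
  fix s assume s: "s \<in> {0..T}"
  have "(\<lambda>\<omega>. (if s < \<tau> \<omega> then coord K k i (q l s \<omega>) else 0) * (if s < \<tau> \<omega> then coord K k j (q l s \<omega>) else 0)) \<in> borel_measurable M"
    using s ij by (intro borel_measurable_times measurable_F_M[OF coord_measurable[OF D q_process[OF l]]]) auto
  then show "(\<lambda>\<omega>. if s < \<tau> \<omega> then coord K k i (q l s \<omega>) * coord K k j (q l s \<omega>) else 0) \<in> borel_measurable M"
    by (rule measurable_cong[THEN iffD1, rotated]) auto
next
  show "AE \<omega> in M. continuous_on {0..<\<tau> \<omega>} (\<lambda>s. coord K k i (q l s \<omega>) * coord K k j (q l s \<omega>))"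
    using q_continuous
  proof eventually_elim
    case (elim \<omega>)
    then show ?case using l ij by (intro continuous_on_mult coord_q_continuous[OF _ subset_refl]) auto
  qed
qed

lemma covar_field: "covariation_field M T \<tau> (interior K) u u covar"
  unfolding covariation_field_def
proof (intro conjI ballI)
  fix t assume t: "t \<in> {0..T}"
  let ?R = "restrict_space lborel (interior K)"
  let ?g = "\<lambda>p. \<Sum>l\<in>L. \<Sum>i<basis_size K k. \<Sum>j<basis_size K k.
      (basis_fun K k i (snd p) * basis_fun K k j (snd p)) * (if t < \<tau> (fst p) then gram l i j t (fst p) else 0)"
  have b: "(\<lambda>p. basis_fun K k i (snd p)) \<in> borel_measurable (M \<Otimes>\<^sub>M ?R)" if "i < basis_size K k" for i
    using borel_measurable_continuous_onI[OF continuous_basis_fun[OF that]]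
    by (intro measurable_compose[OF measurable_snd] measurable_restrict_space1) simp
  have "?g \<in> borel_measurable (M \<Otimes>\<^sub>M ?R)"
    using b by (intro borel_measurable_sum borel_measurable_times
        measurable_compose[OF measurable_fst gram_measurable[OF _ _ _ t]]) auto
  moreover have "(\<lambda>(\<omega>, x). if t < \<tau> \<omega> then covar t \<omega> x else 0) = ?g"
    by (auto simp: covar_def fun_eq_iff)
  ultimately show "(\<lambda>(\<omega>, x). if t < \<tau> \<omega> then covar t \<omega> x else 0) \<in> borel_measurable (M \<Otimes>\<^sub>M ?R)" by simp
next
  show "AE \<omega> in M. \<forall>x\<in>interior K. continuous_on {0..<\<tau> \<omega>} (\<lambda>t. covar t \<omega> x)"
    using q_continuous
  proof eventually_elim
    case (elim \<omega>)
    show ?case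
      unfolding covar_def gram_def
      by (intro ballI continuous_on_sum continuous_on_mult continuous_on_const indefinite_LINT_continuous
          coord_q_continuous[OF _ subset_refl]) (use elim in auto)
  qed
qed (rule covariation_at)

text \<open>Orthonormality reduces the double sum to the trace of the Gram matrix, and Parseval
  reads the trace as the time integral of the squared norm.\<close>

lemma integral_covar:
  assumes q: "\<forall>l\<in>L. elementwise_continuous m k {0..<\<tau> \<omega>} (\<lambda>s. q l s \<omega>)"
    and t: "t \<in> {0..<\<tau> \<omega>}"
  shows "(LINT x:K|lebesgue. covar t \<omega> x) = (\<Sum>l\<in>L. LINT s:{0..t}|lborel. L2_inner K (q l s \<omega>) (q l s \<omega>))"
proof -
  let ?n = "basis_size K k"
  have sub: "{0..t} \<subseteq> {0..<\<tau> \<omega>}" using t by auto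
  have int: "integrable lebesgue (\<lambda>x. (indicator K x *\<^sub>R (basis_fun K k i x * basis_fun K k j x)) * g)"
    if "i < ?n" "j < ?n" for i j g
    using set_integrable_lebesgue_continuous[OF compact_K continuous_on_mult[OF continuous_basis_fun continuous_basis_fun], OF that]
    unfolding set_integrable_def by (rule integrable_mult_left)
  have "(LINT x:K|lebesgue. covar t \<omega> x) = (LINT x|lebesgue. (\<Sum>l\<in>L. \<Sum>i<?n. \<Sum>j<?n.
      (indicator K x *\<^sub>R (basis_fun K k i x * basis_fun K k j x)) * gram l i j t \<omega>))"
    unfolding set_lebesgue_integral_def covar_def
    by (intro Bochner_Integration.integral_cong refl) (simp add: sum_distrib_left mult.assoc)
  also have "\<dots> = (\<Sum>l\<in>L. LINT x|lebesgue. (\<Sum>i<?n. \<Sum>j<?n.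
      (indicator K x *\<^sub>R (basis_fun K k i x * basis_fun K k j x)) * gram l i j t \<omega>))"
    by (intro Bochner_Integration.integral_sum Bochner_Integration.integrable_sum int) auto
  also have "\<dots> = (\<Sum>l\<in>L. \<Sum>i<?n. LINT x|lebesgue. (\<Sum>j<?n.
      (indicator K x *\<^sub>R (basis_fun K k i x * basis_fun K k j x)) * gram l i j t \<omega>))"
    by (intro sum.cong refl Bochner_Integration.integral_sum Bochner_Integration.integrable_sum int) auto
  also have "\<dots> = (\<Sum>l\<in>L. \<Sum>i<?n. \<Sum>j<?n. LINT x|lebesgue.
      (indicator K x *\<^sub>R (basis_fun K k i x * basis_fun K k j x)) * gram l i j t \<omega>)"
    by (intro sum.cong refl Bochner_Integration.integral_sum int) auto
  also have "\<dots> = (\<Sum>l\<in>L. \<Sum>i<?n. \<Sum>j<?n. L2_inner K (basis_fun K k i) (basis_fun K k j) * gram l i j t \<omega>)"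
    unfolding L2_inner_def set_lebesgue_integral_def by simp
  also have "\<dots> = (\<Sum>l\<in>L. \<Sum>i<?n. gram l i i t \<omega>)"
  proof (intro sum.cong refl)
    fix l i assume "i \<in> {..<?n}"
    then have "(\<Sum>j<?n. L2_inner K (basis_fun K k i) (basis_fun K k j) * gram l i j t \<omega>) =
        (\<Sum>j<?n. if i = j then gram l i j t \<omega> else 0)"
      using basis_orthonormal by (intro sum.cong) auto
    then show "(\<Sum>j<?n. L2_inner K (basis_fun K k i) (basis_fun K k j) * gram l i j t \<omega>) = gram l i i t \<omega>"
      using \<open>i \<in> {..<?n}\<close> by simp
  qed
  also have "\<dots> = (\<Sum>l\<in>L. LINT s:{0..t}|lborel. L2_inner K (q l s \<omega>) (q l s \<omega>))"
  proof (rule sum.cong[OF refl])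
    fix l assume l: "l \<in> L"
    have ql: "elementwise_continuous m k {0..<\<tau> \<omega>} (\<lambda>s. q l s \<omega>)" using q l by blast
    have "(LINT s:{0..t}|lborel. L2_inner K (q l s \<omega>) (q l s \<omega>)) =
        (LINT s:{0..t}|lborel. (\<Sum>i<?n. 1 * (coord K k i (q l s \<omega>) * coord K k i (q l s \<omega>))))"
      using L2_inner_dg elementwise_continuousD(1)[OF ql] sub by (intro set_lebesgue_integral_cong) auto
    also have "\<dots> = (\<Sum>i<?n. 1 * gram l i i t \<omega>)"
      unfolding gram_def
      by (rule LINT_Icc_sum) (auto intro!: continuous_on_mult coord_q_continuous[OF ql sub])
    finally show "(\<Sum>i<?n. gram l i i t \<omega>) = (LINT s:{0..t}|lborel. L2_inner K (q l s \<omega>) (q l s \<omega>))" by simp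
  qed
  finally show ?thesis .
qed

definition face_energy :: "'l \<Rightarrow> 'a set \<Rightarrow> real \<Rightarrow> 'w \<Rightarrow> real" where
  "face_energy l e s \<omega> = (LINT x:e|surface_measure. ntrace (c l) (outward_normal K e) x *
     (inner_trace K (u s \<omega>) x * reduced_flux_dgq m (c l) K e (u s \<omega>) (q l s \<omega>) x +
      inner_trace K (q l s \<omega>) x * reduced_flux_g m (c l) K e (u s \<omega>) (q l s \<omega>) x -
      nonlin (c l) (inner_trace K (u s \<omega>) x) * inner_trace K (q l s \<omega>) x))"

lemma time_integrated_energy:
  assumes l: "l \<in> L" and u: "elementwise_continuous m k {0..<\<tau> \<omega>} (\<lambda>s. u s \<omega>)"
    and q: "elementwise_continuous m k {0..<\<tau> \<omega>} (\<lambda>s. q l s \<omega>)"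
    and scheme: "\<And>s \<psi>. s \<in> {0..<\<tau> \<omega>} \<Longrightarrow> \<psi> \<in> dg_space m k \<Longrightarrow> (LINT x:K|lebesgue. \<psi> x * q l s \<omega> x) =
        - (LINT x:K|lebesgue. (grad \<psi> x \<bullet> field (c l) x) * nonlin (c l) (u s \<omega> x)) +
        (\<Sum>e\<in>faces m K. LINT x:e|surface_measure. inner_trace K \<psi> x * flux_g m (c l) K e (u s \<omega>) (q l s \<omega>) x)"
    and t: "t \<in> {0..<\<tau> \<omega>}"
  shows "2 * (LINT s:{0..t}|lborel. b_form m (c l) K (u s \<omega>) (q l s \<omega>) (u s \<omega>)) +
      (LINT s:{0..t}|lborel. L2_inner K (q l s \<omega>) (q l s \<omega>)) =
    (\<Sum>e\<in>faces m K. LINT s:{0..t}|lborel. face_energy l e s \<omega>)"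
proof -
  have sub: "{0..t} \<subseteq> {0..<\<tau> \<omega>}" using t by auto
  let ?b = "\<lambda>s. b_form m (c l) K (u s \<omega>) (q l s \<omega>) (u s \<omega>)" and ?e = "\<lambda>s. L2_inner K (q l s \<omega>) (q l s \<omega>)"
  have id: "2 * ?b s + ?e s = (\<Sum>e\<in>faces m K. face_energy l e s \<omega>)" if "s \<in> {0..t}" for s
    unfolding face_energy_def
    using energy_identity[OF c[OF l] u q, of s] scheme[of s] that sub by blast
  have fc: "continuous_on {0..t} (\<lambda>s. face_energy l e s \<omega>)" if "e \<in> faces m K" for e
    unfolding face_energy_def
    by (rule continuous_on_subset[OF face_term(2)[OF c[OF l] u q that] sub])
  have ec: "continuous_on {0..t} ?e"
  proof -
    have c1: "continuous_on {0..t} (\<lambda>s. \<Sum>i<basis_size K k. coord K k i (q l s \<omega>) * coord K k i (q l s \<omega>))"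
      by (intro continuous_on_sum continuous_on_mult coord_q_continuous[OF q sub]) auto
    show ?thesis
    proof (rule continuous_on_eq[OF c1])
      fix s assume "s \<in> {0..t}"
      then have "q l s \<omega> \<in> dg_space m k" using elementwise_continuousD(1)[OF q] sub by blast
      then show "(\<Sum>i<basis_size K k. coord K k i (q l s \<omega>) * coord K k i (q l s \<omega>)) = ?e s"
        by (simp add: L2_inner_dg)
    qed
  qed
  \<comment> \<open>Here the test function varies with time, so continuity is read off from the
    energy identity: all other terms in it are continuous.\<close>
  have bc: "continuous_on {0..t} ?b"
  proof -
    have c1: "continuous_on {0..t} (\<lambda>s. ((\<Sum>e\<in>faces m K. face_energy l e s \<omega>) - ?e s) / 2)"
      by (intro continuous_on_divide continuous_on_diff continuous_on_sum fc ec continuous_on_const) auto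
    show ?thesis by (rule continuous_on_eq[OF c1]) (simp add: id[symmetric])
  qed
  have "set_integrable lborel {0..t} (\<lambda>s. 2 * ?b s)"
    by (rule borel_integrable_atLeastAtMost') (intro continuous_on_mult continuous_on_const bc)
  from set_integral_add(2)[OF this borel_integrable_atLeastAtMost'[OF ec]]
  have "2 * (LINT s:{0..t}|lborel. ?b s) + (LINT s:{0..t}|lborel. ?e s) = (LINT s:{0..t}|lborel. 2 * ?b s + ?e s)"
    by simp
  also have "\<dots> = (LINT s:{0..t}|lborel. (\<Sum>e\<in>faces m K. 1 * face_energy l e s \<omega>))"
    by (rule set_lebesgue_integral_cong) (use id in auto)
  also have "\<dots> = (\<Sum>e\<in>faces m K. 1 * (LINT s:{0..t}|lborel. face_energy l e s \<omega>))"
    by (rule LINT_Icc_sum[OF finite_faces fc])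
  finally show ?thesis by simp
qed

text \<open>Uniqueness of the covariation field replaces \<open>A\<close> by \<open>covar\<close>
  for almost every \<open>x\<close>, which leaves the integral over \<open>K\<close> unchanged; the
  rest is deterministic on each good path.\<close>

lemma energy_balance:
  assumes A: "covariation_field M T \<tau> (interior K) u u A"
  shows "AE \<omega> in M. \<forall>t\<in>{0..<\<tau> \<omega>}.
    2 * (\<Sum>l\<in>L. LINT s:{0..t}|lborel. b_form m (c l) K (u s \<omega>) (q l s \<omega>) (u s \<omega>)) +
    (LINT x:K|lebesgue. A t \<omega> x) = (\<Sum>l\<in>L. \<Sum>e\<in>faces m K. LINT s:{0..t}|lborel. face_energy l e s \<omega>)"
proof -
  have scheme: "AE \<omega> in M. \<forall>t\<in>{0..<\<tau> \<omega>}. \<forall>K\<in>elems m. \<forall>l\<in>L. \<forall>\<psi>\<in>dg_space m k.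
        (LINT x:K|lebesgue. \<psi> x * q l t \<omega> x) =
        - (LINT x:K|lebesgue. (grad \<psi> x \<bullet> field (c l) x) * nonlin (c l) (u t \<omega> x)) +
        (\<Sum>e\<in>faces m K. LINT x:e|surface_measure.
           inner_trace K \<psi> x * flux_g m (c l) K e (u t \<omega>) (q l t \<omega>) x)"
    using sol unfolding ldg_solution_def by (elim conjE)
  from covariation_field_unique[OF A covar_field \<tau> open_interior] scheme u_continuous q_continuous
  show ?thesis
  proof eventually_elim
    case (elim \<omega>)
    show ?case
    proof
      fix t assume t: "t \<in> {0..<\<tau> \<omega>}"
      have "AE x in lebesgue. x \<in> interior K \<longrightarrow> (\<forall>t\<in>{0..<\<tau> \<omega>}. A t \<omega> x = covar t \<omega> x)"
        by (rule AE_completion[OF elim(1)])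
      then have "AE x in lebesgue. indicator K x *\<^sub>R A t \<omega> x = indicator K x *\<^sub>R covar t \<omega> x"
        using AE_not_frontier
      proof eventually_elim
        case (elim x)
        then have "x \<notin> K \<or> x \<in> interior K" using closure_subset by (auto simp: frontier_def)
        then show ?case using elim(1) t by auto
      qed
      then have "(LINT x:K|lebesgue. A t \<omega> x) = (LINT x:K|lebesgue. covar t \<omega> x)"
        unfolding set_lebesgue_integral_def by (rule LINT_lebesgue_cong_AE)
      also have "\<dots> = (\<Sum>l\<in>L. LINT s:{0..t}|lborel. L2_inner K (q l s \<omega>) (q l s \<omega>))"
        by (rule integral_covar[OF elim(4) t])
      finally have "2 * (\<Sum>l\<in>L. LINT s:{0..t}|lborel. b_form m (c l) K (u s \<omega>) (q l s \<omega>) (u s \<omega>)) +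
          (LINT x:K|lebesgue. A t \<omega> x) =
          (\<Sum>l\<in>L. 2 * (LINT s:{0..t}|lborel. b_form m (c l) K (u s \<omega>) (q l s \<omega>) (u s \<omega>)) +
            (LINT s:{0..t}|lborel. L2_inner K (q l s \<omega>) (q l s \<omega>)))"
        by (simp add: sum.distrib sum_distrib_left)
      also have "\<dots> = (\<Sum>l\<in>L. \<Sum>e\<in>faces m K. LINT s:{0..t}|lborel. face_energy l e s \<omega>)"
      proof (rule sum.cong[OF refl])
        fix l assume l: "l \<in> L"
        show "2 * (LINT s:{0..t}|lborel. b_form m (c l) K (u s \<omega>) (q l s \<omega>) (u s \<omega>)) +
            (LINT s:{0..t}|lborel. L2_inner K (q l s \<omega>) (q l s \<omega>)) =
          (\<Sum>e\<in>faces m K. LINT s:{0..t}|lborel. face_energy l e s \<omega>)"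
        proof (rule time_integrated_energy[OF l elim(3) _ _ t])
          show "elementwise_continuous m k {0..<\<tau> \<omega>} (\<lambda>s. q l s \<omega>)" using elim(4) l by blast
          fix s \<psi> assume s: "s \<in> {0..<\<tau> \<omega>}" and \<psi>: "\<psi> \<in> dg_space m k"
          show "(LINT x:K|lebesgue. \<psi> x * q l s \<omega> x) =
              - (LINT x:K|lebesgue. (grad \<psi> x \<bullet> field (c l) x) * nonlin (c l) (u s \<omega> x)) +
              (\<Sum>e\<in>faces m K. LINT x:e|surface_measure. inner_trace K \<psi> x * flux_g m (c l) K e (u s \<omega>) (q l s \<omega>) x)"
            by (rule bspec[OF bspec[OF bspec[OF bspec[OF elim(2) s] K] l] \<psi>])
        qed
      qed
      finally show "2 * (\<Sum>l\<in>L. LINT s:{0..t}|lborel. b_form m (c l) K (u s \<omega>) (q l s \<omega>) (u s \<omega>)) +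
          (LINT x:K|lebesgue. A t \<omega> x) = (\<Sum>l\<in>L. \<Sum>e\<in>faces m K. LINT s:{0..t}|lborel. face_energy l e s \<omega>)" .
    qed
  qed
qed

end

text \<open>Pointwise covariation is determined only up to null sets that may vary with
  \<open>x\<close>. The identity is therefore stated for every admissible version, and the existence
  part keeps this from being vacuous.\<close>

theorem lemma4p2:
  fixes M :: "'w measure" and F :: "real \<Rightarrow> 'w measure" and T \<kappa> :: real
    and L :: "'l set" and W :: "'l \<Rightarrow> real \<Rightarrow> 'w \<Rightarrow> real"
    and m :: "'a::euclidean_space dg_mesh" and k :: nat
    and c :: "'l \<Rightarrow> 'a noise_coeff" and ubar :: "'a \<Rightarrow> real"
    and \<tau>max :: "'w \<Rightarrow> real"
    and u :: "real \<Rightarrow> 'w \<Rightarrow> 'a \<Rightarrow> real" and q :: "'l \<Rightarrow> real \<Rightarrow> 'w \<Rightarrow> 'a \<Rightarrow> real"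
    and K :: "'a set"
  assumes "T > 0"
    and "prob_space M" and "usual_filtration M T F"
    and "finite L"
    and "\<And>l. l \<in> L \<Longrightarrow> wiener_process M T F (W l)" and "independent_processes M T L W"
    and "polyhedral_domain (dom m)" and "conforming_mesh m" and "shape_regular \<kappa> m"
    and "square_integrable ubar"
    and "\<And>l. l \<in> L \<Longrightarrow> structural_assumption m (c l)"
    and "\<And>l e. l \<in> L \<Longrightarrow> e \<in> (\<Union>K'\<in>elems m. faces m K') \<Longrightarrow> eta_u (c l) e \<ge> 0 \<and> eta_q (c l) e \<ge> 0"
    and "maximal_ldg_solution M T F L W m k c ubar \<tau>max u q"
    and "K \<in> elems m"
  shows "(\<exists>A. covariation_field M T \<tau>max (interior K) u u A) \<and>
    (\<forall>A. covariation_field M T \<tau>max (interior K) u u A \<longrightarrow>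
      (AE \<omega> in M. \<forall>t\<in>{0..<\<tau>max \<omega>}.
        2 * (\<Sum>l\<in>L. LINT s:{0..t}|lborel. b_form m (c l) K (u s \<omega>) (q l s \<omega>) (u s \<omega>)) +
        (LINT x:K|lebesgue. A t \<omega> x) =
        (\<Sum>l\<in>L. \<Sum>e\<in>faces m K. LINT s:{0..t}|lborel. LINT x:e|surface_measure.
           ntrace (c l) (outward_normal K e) x *
           (inner_trace K (u s \<omega>) x * reduced_flux_dgq m (c l) K e (u s \<omega>) (q l s \<omega>) x +
            inner_trace K (q l s \<omega>) x * reduced_flux_g m (c l) K e (u s \<omega>) (q l s \<omega>) x -
            nonlin (c l) (inner_trace K (u s \<omega>) x) * inner_trace K (q l s \<omega>) x))))"
proof -
  interpret filtered_prob_space M T F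
    by (intro filtered_prob_space.intro filtered_prob_space_axioms.intro assms)
  interpret ldg_element M T F m K k L W c ubar \<tau>max u q
    by unfold_locales (use assms in \<open>simp_all add: maximal_ldg_solution_def\<close>)
  show ?thesis
    using covar_field energy_balance unfolding face_energy_def by blast
qed

end
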